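(* Let $U$ be the $\mathrm{mcG}(q)$ solution of $\dot u=f(u,t)$, $u(0)=u_0$, let $\pi u=\pi_{\mathrm{cG}}^{[q]}u$, let $\Phi$ be the corresponding $\mathrm{mcG}(q)^*$ solution of the dual problem with data $(\psi,g)$, and let $\bar e=U-\pi_{\mathrm{cG}}^{[q]}u$. Then there is a constant $C=C(q)>0$ such that $$|L_{\psi,g}(\bar e)|\le C\,S(T)\,\big\|k^{q+1}\bar u^{(q+1)}\big\|_{L_\infty([0,T],l_2)},$$ where $(k^{q+1}\bar u^{(q+1)})_i(t)=k_{ij}^{q_{ij}+1}\|u_i^{(q_{ij}+1)}\|_{L_\infty(I_{ij})}$ for $t\in I_{ij}$, and $S(T)=\int_0^T\|J^\top(\pi_{\mathrm{cG}}^{[q]}u,u,\cdot)\Phi\|_{l_2}\,dt$. Furthermore, suppose that there are $\alpha\in(0,1)$ and $c_k>0$ such that in every time slab: all degrees $q_{ij}$ equal a common value $\bar q$; $k_{ij}>\alpha k_{mn}$ for every pair $I_{ij},I_{mn}$ of local intervals in the slab; $f$ is autonomous ($\partial f_i/\partial t=0$ for all $i$); $\|f_i\|_{D^{\bar q+1}(\mathcal T)}<\infty$ for all $i$; and $k_{ij}C_f\le c_k$ for every local interval $I_{ij}$. Then there is a constant $C=C(q,c_k,\alpha)>0$ such that $$|L_{\psi,g}(\bar e)|\le C\,\bar S(T)\,\big\|k^{2q}\bar{\bar u}^{(2q)}\big\|_{L_\infty([0,T],l_1)},$$ where $(k^{2q}\bar{\bar u}^{(2q)})_i(t)=k_{ij}^{2q_{ij}}C_f^{q_{ij}-1}\|u_i^{(q_{ij}+1)}\|_{L_\infty(I_{ij})}$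 for $t\in I_{ij}$, and $$\bar S(T)=\int_0^T C_f\|\Phi\|_{L_\infty(\mathcal T,l_\infty)}\,dt=\sum_{n=1}^M K_nC_f\|\Phi\|_{L_\infty(\mathcal T_n,l_\infty)}.$$
   Context: Setting. Let $T>0$, $u_0\in\mathbb R^N$, $f:\mathbb R^N\times(0,T]\to\mathbb R^N$ bounded and Lipschitz-continuous in its first argument; $u:[0,T]\to\mathbb R^N$ solves $\dot u(t)=f(u(t),t)$, $t\in(0,T]$, $u(0)=u_0$. For each component $i=1,\dots,N$, $(0,T]$ is partitioned into subintervals $I_{ij}=(t_{i,j-1},t_{ij}]$, $j=1,\dots,M_i$, of length $k_{ij}=t_{ij}-t_{i,j-1}$, each with a polynomial degree $q_{ij}$. There are synchronized time levels $0=T_0<T_1<\dots<T_M=T$ (nodes common to all components); the time slab $\mathcal T_n$ is the set of $I_{ij}$ with $T_{n-1}\le t_{i,j-1}<t_{ij}\le T_n$, and $K_n=T_n-T_{n-1}$. $\mathcal P^q(I)$: polynomials of degree (at most) $q$ on $I$. $(\cdot,\cdot)$: inner product of $\mathbb R^N$. $\|v\|_{L_\infty(I,\|\cdot\|)}=\sup_{t\in I}\|v(t)\|$; $L_\infty(\mathcal T_n,\cdot)$ is the sup over the interval of the slab, $\mathcal T$ denoting the slab containing $t$. $\mathrm{mcG}(q)$ method ($q_{ij}\ge1$). $V$ is the space of continuous $v:[0,T]\to\mathbb R^N$ with $v_i|_{I_{ij}}\in\mathcal P^{q_{ij}}(I_{ij})$ for all $i,j$; $\hat V$ is the space of (possibly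 discontinuous) $v$ with $v_i|_{I_{ij}}\in\mathcal P^{q_{ij}-1}(I_{ij})$. $U\in V$ with $U(0)=u_0$ satisfies $\int_0^T(\dot U,v)\,dt=\int_0^T(f(U,\cdot),v)\,dt$ for all $v\in\hat V$. Dual problem. For functions $x,y$, $J(x,y,t)=\int_0^1\frac{\partial f}{\partial u}(s\,x(t)+(1-s)y(t),t)\,ds$. With $\psi\in\mathbb R^N$, $g:[0,T]\to\mathbb R^N$, the dual problem is $-\dot\phi=J^\top(\pi u,U,t)\phi+g$ on $[0,T)$, $\phi(T)=\psi$. $L_{\psi,g}(v)=(v(T),\psi)+\int_0^T(v,g)\,dt$. The $\mathrm{mcG}(q)^*$ solution is $\Phi\in\hat V$ with $\Phi(T^+)=\psi$ and $\int_0^T(\dot v,\Phi)\,dt=\int_0^T(J(\pi u,U,\cdot)v,\Phi)\,dt+L_{\psi,g}(v)$ for all $v\in V$ with $v(0)=0$. Interpolant. For $q\ge1$ and $v$ bounded and piecewise $\mathcal C^{q+1}$ on $[a,b]$, $\pi_{\mathrm{cG}}^{[q]}v\in\mathcal P^q([a,b])$ is defined by $\pi_{\mathrm{cG}}^{[q]}v(a)=v(a)$, $\pi_{\mathrm{cG}}^{[q]}v(b)=v(b)$, $\int_a^b(v-\pi_{\mathrm{cG}}^{[q]}v)w\,dx=0$ for all $w\in\mathcal P^{q-2}([a,b])$. For vector functions it is applied to component $i$ on each $I_{ij}$ with degree $q_{ij}$. Norm and constant $C_f$. For $v:\mathbb R^N\to\mathbb R$, $D^nv\,w^1\cdots w^n=\sum_{i_1,\dots,i_n}\frac{\partial^nv}{\partial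 x_{i_1}\cdots\partial x_{i_n}}w^1_{i_1}\cdots w^n_{i_n}$; $\|D^nv\|_{L_\infty(\mathcal T,l_\infty)}$ is the (smallest) constant with $\|D^nv\,w^1\cdots w^n\|_{L_\infty(\mathcal T)}\le\|D^nv\|_{L_\infty(\mathcal T,l_\infty)}\|w^1\|_{l_\infty}\cdots\|w^n\|_{l_\infty}$ for all $w^1,\dots,w^n\in\mathbb R^N$ (derivatives evaluated at the arguments occurring on the slab $\mathcal T$); $\|v\|_{D^p(\mathcal T)}=\max_{n=0,\dots,p}\|D^nv\|_{L_\infty(\mathcal T,l_\infty)}$. On each slab, $C_f$ is a constant with $C_f\ge\max_i\|f_i\|_{D^{\bar q+1}(\mathcal T)}$ and such that, for any $x:\mathbb R\to\mathbb R^N$ and $C_x>0$ with $\|x^{(n)}\|_{L_\infty(\mathcal T,l_\infty)}\le C_x^n$, $n=1,\dots,p$: $\|\frac{d^p}{dt^p}(\frac{\partial f}{\partial u})^\top(x(t))\|_{l_\infty}\le C_fC_x^p$ for $p=0,\dots,\bar q$, and the jump satisfies $\|[\frac{d^p}{dt^p}(\frac{\partial f}{\partial u})^\top(x(t))]_t\|_{l_\infty}\le C_f\sum_{n=0}^pC_x^{p-n}\|[x^{(n)}]_t\|_{l_\infty}$ for $p=0,\dots,\bar q-1$, where $[v]_t=v(t^+)-v(t^-)$. Thus $C_f=C_f(t)$ is piecewise constant on $0=T_0<\dots<T_M=T$.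
   Formalization: The second estimate fails for arbitrary g once q≥2, so it assumes that in each slab g is C^{q̄-2} with |g_i^{(p)}| ≤ c_g C_f^{p+1}‖Φ‖_{L∞(T_n,l∞)} for p ≤ q̄-2, and C may also depend on c_g (c_g=0 covers g=0). *)

theory Defs
  imports "HOL-Analysis.Analysis" "HOL-Computational_Algebra.Polynomial"
begin

text \<open>
  The dimension \<open>N\<close> is a number and not a type, because the constants of the error estimates must
  not depend on it. A vector of \<open>N\<close>-space is a function on the naturals of which only the
  coordinates below \<open>N\<close> matter; the right-hand side \<open>f\<close> depends on nothing else by its Lipschitz
  condition (see \<open>ivp\<close>), so that continuity of \<open>f\<close> and of its partial derivatives in the product
  topology is continuity on \<open>N\<close>-space.
\<close>

type_synonym rvec = "nat \<Rightarrow> real"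

definition linf :: "nat \<Rightarrow> rvec \<Rightarrow> real" where
  "linf N v = Max ((\<lambda>i. \<bar>v i\<bar>) ` {..<N})"

definition l1 :: "nat \<Rightarrow> rvec \<Rightarrow> real" where
  "l1 N v = (\<Sum>i<N. \<bar>v i\<bar>)"

text \<open>The operator norm induced by the maximum norm.\<close>

definition linf_op :: "nat \<Rightarrow> (nat \<Rightarrow> nat \<Rightarrow> real) \<Rightarrow> real" where
  "linf_op N A = (SUP w\<in>{w. linf N w \<le> 1}. linf N (\<lambda>i. \<Sum>l<N. A i l * w l))"


subsection \<open>Derivatives\<close>

definition Ck_on :: "nat \<Rightarrow> real set \<Rightarrow> (real \<Rightarrow> real) \<Rightarrow> bool" where
  "Ck_on p S h \<longleftrightarrow>
     (\<forall>n<p. \<forall>t\<in>S. ((deriv ^^ n) h) differentiable (at t)) \<and> continuous_on S ((deriv ^^ p) h)"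

definition jump :: "(real \<Rightarrow> real) \<Rightarrow> real \<Rightarrow> real" where
  "jump h t = Lim (at_right t) h - Lim (at_left t) h"

definition piecewise_Ck :: "nat \<Rightarrow> real \<Rightarrow> real \<Rightarrow> real set \<Rightarrow> (real \<Rightarrow> real) \<Rightarrow> bool" where
  "piecewise_Ck p a b S h \<longleftrightarrow> finite S \<and> Ck_on p ({a<..<b} - S) h \<and>
     (\<forall>t\<in>S \<inter> {a<..<b}. \<forall>n\<le>p.
        (\<exists>l. (((deriv ^^ n) h) \<longlongrightarrow> l) (at_right t)) \<and>
        (\<exists>l. (((deriv ^^ n) h) \<longlongrightarrow> l) (at_left t)))"

definition partial :: "nat \<Rightarrow> (rvec \<Rightarrow> real) \<Rightarrow> rvec \<Rightarrow> real" where
  "partial i v x = deriv (\<lambda>h. v (x(i := h))) (x i)"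

definition partials :: "nat list \<Rightarrow> (rvec \<Rightarrow> real) \<Rightarrow> rvec \<Rightarrow> real" where
  "partials ms v = foldr partial ms v"

definition Ck_space :: "nat \<Rightarrow> nat \<Rightarrow> (rvec \<Rightarrow> real) \<Rightarrow> bool" where
  "Ck_space N p v \<longleftrightarrow> (\<forall>ms. set ms \<subseteq> {..<N} \<and> length ms \<le> p \<longrightarrow>
     continuous_on UNIV (partials ms v) \<and>
     (length ms < p \<longrightarrow>
       (\<forall>i<N. \<forall>x. (\<lambda>h. partials ms v (x(i := h))) differentiable (at (x i)))))"

definition Dform :: "nat \<Rightarrow> nat \<Rightarrow> (rvec \<Rightarrow> real) \<Rightarrow> rvec \<Rightarrow> (nat \<Rightarrow> rvec) \<Rightarrow> real" where
  "Dform N n v x w =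
     (\<Sum>ms\<in>{ms. length ms = n \<and> set ms \<subseteq> {..<N}}. partials ms v x * (\<Prod>r<n. w r (ms ! r)))"

text \<open>
  \<open>A t\<close> is the set of arguments occurring at time \<open>t\<close>; the norms are infinite if there is no bound.
\<close>

definition Dnorm ::
  "nat \<Rightarrow> nat \<Rightarrow> (rvec \<Rightarrow> real \<Rightarrow> real) \<Rightarrow> real \<Rightarrow> real \<Rightarrow> (real \<Rightarrow> rvec set) \<Rightarrow> ereal" where
  "Dnorm N n F a b A = Inf (ereal ` {C. \<forall>t\<in>{a<..b}. \<forall>x\<in>A t. \<forall>w.
     \<bar>Dform N n (\<lambda>y. F y t) x w\<bar> \<le> C * (\<Prod>r<n. linf N (w r))})"

definition Dpnorm ::
  "nat \<Rightarrow> nat \<Rightarrow> (rvec \<Rightarrow> real \<Rightarrow> real) \<Rightarrow> real \<Rightarrow> real \<Rightarrow> (real \<Rightarrow> rvec set) \<Rightarrow> ereal" where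
  "Dpnorm N p F a b A = Max ((\<lambda>n. Dnorm N n F a b A) ` {..p})"


subsection \<open>Multi-adaptive partitions\<close>

text \<open>
  Components are numbered from \<open>0\<close>; cells and slabs are numbered from \<open>1\<close>, with end points
  \<open>node i (j - 1)\<close>, \<open>node i j\<close> and \<open>level (n - 1)\<close>, \<open>level n\<close>.
\<close>

record mesh =
  ncomp :: nat
  horizon :: real
  ncells :: "nat \<Rightarrow> nat"
  node :: "nat \<Rightarrow> nat \<Rightarrow> real"
  deg :: "nat \<Rightarrow> nat \<Rightarrow> nat"
  nslabs :: nat
  level :: "nat \<Rightarrow> real"

definition is_mesh :: "mesh \<Rightarrow> bool" where
  "is_mesh D \<longleftrightarrow> ncomp D \<ge> 1 \<and> horizon D > 0 \<and>
     (\<forall>i<ncomp D. ncells D i \<ge> 1 \<and> node D i 0 = 0 \<and> node D i (ncells D i) = horizon D \<and>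
        (\<forall>j\<in>{1..ncells D i}. node D i (j - 1) < node D i j \<and> deg D i j \<ge> 1)) \<and>
     nslabs D \<ge> 1 \<and> level D 0 = 0 \<and> level D (nslabs D) = horizon D \<and>
     (\<forall>n\<in>{1..nslabs D}. level D (n - 1) < level D n) \<and>
     (\<forall>n\<le>nslabs D. \<forall>i<ncomp D. \<exists>j\<le>ncells D i. node D i j = level D n)"

definition cell :: "mesh \<Rightarrow> nat \<Rightarrow> nat \<Rightarrow> real set" where
  "cell D i j = {node D i (j - 1)<..node D i j}"

definition step :: "mesh \<Rightarrow> nat \<Rightarrow> nat \<Rightarrow> real" where
  "step D i j = node D i j - node D i (j - 1)"

definition cell_at :: "mesh \<Rightarrow> nat \<Rightarrow> real \<Rightarrow> nat" where
  "cell_at D i t = (THE j. j \<in> {1..ncells D i} \<and> t \<in> cell D i j)"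

definition slab :: "mesh \<Rightarrow> nat \<Rightarrow> real set" where
  "slab D n = {level D (n - 1)<..level D n}"

definition slab_at :: "mesh \<Rightarrow> real \<Rightarrow> nat" where
  "slab_at D t = (THE n. n \<in> {1..nslabs D} \<and> t \<in> slab D n)"

definition slab_cells :: "mesh \<Rightarrow> nat \<Rightarrow> (nat \<times> nat) set" where
  "slab_cells D n = {(i, j). i < ncomp D \<and> j \<in> {1..ncells D i} \<and>
     level D (n - 1) \<le> node D i (j - 1) \<and> node D i j \<le> level D n}"

definition poly_on :: "nat \<Rightarrow> real set \<Rightarrow> (real \<Rightarrow> real) \<Rightarrow> bool" where
  "poly_on q I h \<longleftrightarrow> (\<exists>p :: real poly. degree p \<le> q \<and> (\<forall>t\<in>I. h t = poly p t))"

definition trial_space :: "mesh \<Rightarrow> (real \<Rightarrow> rvec) set" where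
  "trial_space D = {v. \<forall>i<ncomp D. continuous_on {0..horizon D} (\<lambda>t. v t i) \<and>
     (\<forall>j\<in>{1..ncells D i}. poly_on (deg D i j) (cell D i j) (\<lambda>t. v t i))}"

definition test_space :: "mesh \<Rightarrow> (real \<Rightarrow> rvec) set" where
  "test_space D = {v. \<forall>i<ncomp D.
     \<forall>j\<in>{1..ncells D i}. poly_on (deg D i j - 1) (cell D i j) (\<lambda>t. v t i)}"


subsection \<open>The initial value problem and its discretization\<close>

text \<open>
  Measurability in time gives a meaning to the integrals of the Galerkin formulation and
  differentiability in the first argument to the Jacobian of the dual problem.
\<close>

definition ivp :: "mesh \<Rightarrow> (rvec \<Rightarrow> real \<Rightarrow> rvec) \<Rightarrow> rvec \<Rightarrow> (real \<Rightarrow> rvec) \<Rightarrow> bool" where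
  "ivp D f u0 u \<longleftrightarrow> (let N = ncomp D; T = horizon D in
     (\<exists>B. \<forall>x. \<forall>t\<in>{0<..T}. L2_set (f x t) {..<N} \<le> B) \<and>
     (\<exists>L. \<forall>x y. \<forall>t\<in>{0<..T}.
        L2_set (\<lambda>i. f x t i - f y t i) {..<N} \<le> L * L2_set (\<lambda>i. x i - y i) {..<N}) \<and>
     (\<forall>i<N. \<forall>t\<in>{0<..T}. Ck_space N 1 (\<lambda>x. f x t i)) \<and>
     (\<forall>i<N. \<forall>x. (\<lambda>t. f x t i) \<in> borel_measurable (lebesgue_on {0<..T})) \<and>
     (\<forall>i<N. u 0 i = u0 i \<and> continuous_on {0..T} (\<lambda>t. u t i) \<and>
        (\<forall>t\<in>{0<..T}. ((\<lambda>t. u t i) has_real_derivative f (u t) t i) (at t within {0..T}))))"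

text \<open>
  The maximum norm over a cell or slab of a derivative is the supremum over the open interval:
  at the end points the derivative need not exist.
\<close>

definition deriv_sup :: "nat \<Rightarrow> real \<Rightarrow> real \<Rightarrow> (real \<Rightarrow> real) \<Rightarrow> real" where
  "deriv_sup n a b h = (SUP t\<in>{a<..<b}. \<bar>(deriv ^^ n) h t\<bar>)"

definition cellwise_smooth :: "mesh \<Rightarrow> (real \<Rightarrow> rvec) \<Rightarrow> bool" where
  "cellwise_smooth D u \<longleftrightarrow> (\<forall>i<ncomp D. \<forall>j\<in>{1..ncells D i}.
     (let I = {node D i (j - 1)<..<node D i j} in
        Ck_on (deg D i j + 1) I (\<lambda>t. u t i) \<and>
        bdd_above ((\<lambda>t. \<bar>(deriv ^^ (deg D i j + 1)) (\<lambda>t. u t i) t\<bar>) ` I)))"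

text \<open>
  The orthogonality is required against polynomials of degree at most \<open>q - 2\<close>; writing this as
  \<open>degree w + 2 \<le> q\<close> leaves no condition for \<open>q = 1\<close>.
\<close>

definition cG_interp :: "nat \<Rightarrow> real \<Rightarrow> real \<Rightarrow> (real \<Rightarrow> real) \<Rightarrow> (real \<Rightarrow> real) \<Rightarrow> bool" where
  "cG_interp q a b v h \<longleftrightarrow> poly_on q {a..b} h \<and> h a = v a \<and> h b = v b \<and>
     (\<forall>w :: real poly. degree w + 2 \<le> q \<longrightarrow> integral {a..b} (\<lambda>t. (v t - h t) * poly w t) = 0)"

definition cG_interpolant :: "mesh \<Rightarrow> (real \<Rightarrow> rvec) \<Rightarrow> (real \<Rightarrow> rvec) \<Rightarrow> bool" where
  "cG_interpolant D u piu \<longleftrightarrow> (\<forall>i<ncomp D. \<forall>j\<in>{1..ncells D i}.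
     cG_interp (deg D i j) (node D i (j - 1)) (node D i j) (\<lambda>t. u t i) (\<lambda>t. piu t i))"

definition mcG_solution ::
  "mesh \<Rightarrow> (rvec \<Rightarrow> real \<Rightarrow> rvec) \<Rightarrow> rvec \<Rightarrow> (real \<Rightarrow> rvec) \<Rightarrow> bool" where
  "mcG_solution D f u0 U \<longleftrightarrow> U \<in> trial_space D \<and> (\<forall>i<ncomp D. U 0 i = u0 i) \<and>
     (\<forall>v\<in>test_space D.
        integral {0..horizon D} (\<lambda>t. \<Sum>i<ncomp D. deriv (\<lambda>s. U s i) t * v t i) =
        integral {0..horizon D} (\<lambda>t. \<Sum>i<ncomp D. f (U t) t i * v t i))"


subsection \<open>The dual problem\<close>

definition Jac ::
  "(rvec \<Rightarrow> real \<Rightarrow> rvec) \<Rightarrow> (real \<Rightarrow> rvec) \<Rightarrow> (real \<Rightarrow> rvec) \<Rightarrow> real \<Rightarrow> nat \<Rightarrow> nat \<Rightarrow> real" where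
  "Jac f x y t i l =
     integral {0..1} (\<lambda>s. partial l (\<lambda>z. f z t i) (\<lambda>r. s * x t r + (1 - s) * y t r))"

definition Lfun :: "mesh \<Rightarrow> rvec \<Rightarrow> (real \<Rightarrow> rvec) \<Rightarrow> (real \<Rightarrow> rvec) \<Rightarrow> real" where
  "Lfun D \<psi> g v = (\<Sum>i<ncomp D. v (horizon D) i * \<psi> i) +
     integral {0..horizon D} (\<lambda>t. \<Sum>i<ncomp D. v t i * g t i)"

definition mcG_dual_solution ::
  "mesh \<Rightarrow> (rvec \<Rightarrow> real \<Rightarrow> rvec) \<Rightarrow> (real \<Rightarrow> rvec) \<Rightarrow> (real \<Rightarrow> rvec) \<Rightarrow> rvec \<Rightarrow> (real \<Rightarrow> rvec) \<Rightarrow>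
    (real \<Rightarrow> rvec) \<Rightarrow> bool" where
  "mcG_dual_solution D f piu U \<psi> g \<Phi> \<longleftrightarrow> \<Phi> \<in> test_space D \<and>
     (\<forall>i<ncomp D. ((\<lambda>t. \<Phi> t i) \<longlongrightarrow> \<psi> i) (at_right (horizon D))) \<and>
     (\<forall>v\<in>trial_space D. (\<forall>i<ncomp D. v 0 i = 0) \<longrightarrow>
        integral {0..horizon D} (\<lambda>t. \<Sum>i<ncomp D. deriv (\<lambda>s. v s i) t * \<Phi> t i) =
        integral {0..horizon D}
          (\<lambda>t. \<Sum>i<ncomp D. (\<Sum>l<ncomp D. Jac f piu U t i l * v t l) * \<Phi> t i) + Lfun D \<psi> g v)"

definition mcG_setup ::
  "mesh \<Rightarrow> (rvec \<Rightarrow> real \<Rightarrow> rvec) \<Rightarrow> rvec \<Rightarrow> (real \<Rightarrow> rvec) \<Rightarrow> (real \<Rightarrow> rvec) \<Rightarrow> (real \<Rightarrow> rvec) \<Rightarrow>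
    rvec \<Rightarrow> (real \<Rightarrow> rvec) \<Rightarrow> (real \<Rightarrow> rvec) \<Rightarrow> bool" where
  "mcG_setup D f u0 u U piu \<psi> g \<Phi> \<longleftrightarrow>
     is_mesh D \<and> ivp D f u0 u \<and> cellwise_smooth D u \<and>
     mcG_solution D f u0 U \<and> cG_interpolant D u piu \<and>
     (\<forall>i<ncomp D. (\<lambda>t. g t i) absolutely_integrable_on {0..horizon D}) \<and>
     mcG_dual_solution D f piu U \<psi> g \<Phi>"


subsection \<open>Quantities in the first estimate\<close>

definition stab_factor ::
  "mesh \<Rightarrow> (rvec \<Rightarrow> real \<Rightarrow> rvec) \<Rightarrow> (real \<Rightarrow> rvec) \<Rightarrow> (real \<Rightarrow> rvec) \<Rightarrow> (real \<Rightarrow> rvec) \<Rightarrow> real" where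
  "stab_factor D f piu u \<Phi> = integral {0..horizon D}
     (\<lambda>t. L2_set (\<lambda>i. \<Sum>l<ncomp D. Jac f piu u t l i * \<Phi> t l) {..<ncomp D})"

definition cell_deriv_sup :: "mesh \<Rightarrow> (real \<Rightarrow> rvec) \<Rightarrow> nat \<Rightarrow> nat \<Rightarrow> real" where
  "cell_deriv_sup D u i j =
     deriv_sup (deg D i j + 1) (node D i (j - 1)) (node D i j) (\<lambda>t. u t i)"

definition ubar :: "mesh \<Rightarrow> (real \<Rightarrow> rvec) \<Rightarrow> real \<Rightarrow> rvec" where
  "ubar D u t i = (let j = cell_at D i t in step D i j ^ (deg D i j + 1) * cell_deriv_sup D u i j)"


subsection \<open>Assumptions and quantities in the second estimate\<close>

text \<open>The arguments at which \<open>f\<close> and its derivatives are evaluated at time \<open>t\<close>.\<close>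

definition args :: "(real \<Rightarrow> rvec) \<Rightarrow> (real \<Rightarrow> rvec) \<Rightarrow> (real \<Rightarrow> rvec) \<Rightarrow> real \<Rightarrow> rvec set" where
  "args u U piu t = (\<Union>s\<in>{0..1}. {(\<lambda>i. s * piu t i + (1 - s) * U t i),
                                (\<lambda>i. s * piu t i + (1 - s) * u t i)})"

text \<open>The transposed Jacobian of \<open>f\<close> along a curve \<open>x\<close>: the entry in row \<open>i\<close>, column \<open>l\<close>.\<close>

definition DfT :: "(rvec \<Rightarrow> real \<Rightarrow> rvec) \<Rightarrow> (real \<Rightarrow> rvec) \<Rightarrow> nat \<Rightarrow> nat \<Rightarrow> real \<Rightarrow> real" where
  "DfT f x i l t = partial i (\<lambda>z. f z t l) (x t)"

text \<open>
  The curves \<open>x\<close> are piecewise smooth, with breakpoints in a finite set \<open>S\<close>: the bounds on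
  derivatives hold away from \<open>S\<close>, those on jumps in the interior of the slab.
\<close>

definition slab_constant ::
  "nat \<Rightarrow> (rvec \<Rightarrow> real \<Rightarrow> rvec) \<Rightarrow> nat \<Rightarrow> real \<Rightarrow> real \<Rightarrow> (real \<Rightarrow> rvec set) \<Rightarrow> real \<Rightarrow> bool" where
  "slab_constant N f q a b A Cf \<longleftrightarrow>
     (\<forall>i<N. Dpnorm N (q + 1) (\<lambda>x t. f x t i) a b A \<le> ereal Cf) \<and>
     (\<forall>x S Cx p. p \<le> q \<and> Cx > 0 \<and> (\<forall>i<N. piecewise_Ck p a b S (\<lambda>t. x t i)) \<and>
        (\<forall>n\<in>{1..p}. \<forall>t\<in>{a<..<b} - S. linf N (\<lambda>i. (deriv ^^ n) (\<lambda>s. x s i) t) \<le> Cx ^ n) \<longrightarrow>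
        (\<forall>t\<in>{a<..<b} - S. linf_op N (\<lambda>i l. (deriv ^^ p) (DfT f x i l) t) \<le> Cf * Cx ^ p) \<and>
        (p < q \<longrightarrow> (\<forall>t\<in>{a<..<b}.
           linf_op N (\<lambda>i l. jump ((deriv ^^ p) (DfT f x i l)) t) \<le>
           Cf * (\<Sum>n\<le>p. Cx ^ (p - n) * linf N (\<lambda>i. jump ((deriv ^^ n) (\<lambda>s. x s i)) t)))))"

definition slab_assumptions ::
  "mesh \<Rightarrow> (rvec \<Rightarrow> real \<Rightarrow> rvec) \<Rightarrow> (real \<Rightarrow> rvec) \<Rightarrow> (real \<Rightarrow> rvec) \<Rightarrow> (real \<Rightarrow> rvec) \<Rightarrow>
    (nat \<Rightarrow> nat) \<Rightarrow> (nat \<Rightarrow> real) \<Rightarrow> real \<Rightarrow> real \<Rightarrow> bool" where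
  "slab_assumptions D f u U piu qbar Cf \<alpha> ck \<longleftrightarrow> (\<forall>n\<in>{1..nslabs D}.
     (\<forall>(i, j)\<in>slab_cells D n. deg D i j = qbar n) \<and>
     (\<forall>(i, j)\<in>slab_cells D n. \<forall>(i', j')\<in>slab_cells D n. step D i j > \<alpha> * step D i' j') \<and>
     (\<forall>i<ncomp D. \<forall>x. \<forall>t\<in>slab D n.
        ((\<lambda>s. f x s i) has_real_derivative 0) (at t within slab D n)) \<and>
     (\<forall>i<ncomp D. (\<forall>t\<in>slab D n. Ck_space (ncomp D) (qbar n + 1) (\<lambda>x. f x t i)) \<and>
        Dpnorm (ncomp D) (qbar n + 1) (\<lambda>x t. f x t i) (level D (n - 1)) (level D n) (args u U piu)
          < \<infinity>) \<and>
     slab_constant (ncomp D) f (qbar n) (level D (n - 1)) (level D n) (args u U piu) (Cf n) \<and>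
     (\<forall>(i, j)\<in>slab_cells D n. step D i j * Cf n \<le> ck))"

definition slab_sup :: "mesh \<Rightarrow> (real \<Rightarrow> rvec) \<Rightarrow> nat \<Rightarrow> real" where
  "slab_sup D \<Phi> n = (SUP t\<in>slab D n. linf (ncomp D) (\<Phi> t))"

text \<open>
  The second estimate does not hold, with a constant independent of \<open>g\<close>, for an arbitrary source
  \<open>g\<close> of the dual problem: every \<open>\<Phi>\<close> in the test space is a dual solution for a suitable \<open>g\<close>, and
  a rapidly oscillating \<open>\<Phi>\<close> destroys the additional \<open>q - 1\<close> orders. The number \<open>cg\<close> measures the
  derivatives of \<open>g\<close> on the scale of \<open>\<Phi>\<close> and \<open>Cf\<close>. With \<open>cg = 0\<close> the condition says that \<open>g\<close>
  vanishes inside the slabs with \<open>q \<ge> 2\<close>; there is no condition on slabs with \<open>q = 1\<close>.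
\<close>

definition source_bound ::
  "mesh \<Rightarrow> (real \<Rightarrow> rvec) \<Rightarrow> (real \<Rightarrow> rvec) \<Rightarrow> (nat \<Rightarrow> nat) \<Rightarrow> (nat \<Rightarrow> real) \<Rightarrow> real \<Rightarrow> bool" where
  "source_bound D g \<Phi> qbar Cf cg \<longleftrightarrow> (\<forall>n\<in>{1..nslabs D}. \<forall>i<ncomp D. \<forall>p. p + 2 \<le> qbar n \<longrightarrow>
     Ck_on p {level D (n - 1)<..<level D n} (\<lambda>t. g t i) \<and>
     (\<forall>t\<in>{level D (n - 1)<..<level D n}.
        \<bar>(deriv ^^ p) (\<lambda>s. g s i) t\<bar> \<le> cg * Cf n ^ (p + 1) * slab_sup D \<Phi> n))"

definition stab_factor2 :: "mesh \<Rightarrow> (nat \<Rightarrow> real) \<Rightarrow> (real \<Rightarrow> rvec) \<Rightarrow> real" where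
  "stab_factor2 D Cf \<Phi> =
     integral {0..horizon D} (\<lambda>t. Cf (slab_at D t) * slab_sup D \<Phi> (slab_at D t))"

definition ubarbar :: "mesh \<Rightarrow> (nat \<Rightarrow> real) \<Rightarrow> (real \<Rightarrow> rvec) \<Rightarrow> real \<Rightarrow> rvec" where
  "ubarbar D Cf u t i = (let j = cell_at D i t in
     step D i j ^ (2 * deg D i j) * Cf (slab_at D t) ^ (deg D i j - 1) * cell_deriv_sup D u i j)"

end

theory Submission
  imports Defs
begin

text \<open>
  Testing the dual problem with the error \<open>U - piu\<close> and the method with \<open>\<Phi>\<close> gives
  \<open>L(U - piu) = \<integral> (f(piu) - piu', \<Phi>)\<close>. On each local interval \<open>u - piu\<close> vanishes at the ends and is
  orthogonal to the derivative of \<open>\<Phi>\<close>; hence \<open>piu'\<close> may be replaced by \<open>u' = f(u)\<close>, and the mean value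
  property of the averaged Jacobian yields \<open>L(U - piu) = \<integral> (piu - u, G)\<close> with \<open>G = J\<^sup>T(piu, u) \<Phi>\<close>
  (\<open>error_representation\<close>). The first estimate follows by Cauchy-Schwarz and the interpolation error
  bound \<open>cG_interp_error\<close>.

  For the second estimate, \<open>piu - u\<close> is orthogonal to polynomials of degree at most \<open>q - 2\<close> on each local
  interval. So it suffices to find a polynomial of that degree that differs from \<open>G\<close> by at most
  \<open>(k Cf) ^ (q - 1) * Cf * \<parallel>\<Phi>\<parallel>\<close> up to a constant. The functions involved are only piecewise smooth, and
  the number of their discontinuities within one local interval grows with the number of components;
  a bound by a sum over jumps would not be uniform in it. Instead all functions are compared with
  polynomials in \<open>t - t0\<close> whose \<open>n\<close>-th coefficient is of size \<open>Cf ^ n\<close>, with an error of size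
  \<open>(k Cf) ^ r\<close>, on windows of a few step sizes (\<open>near_poly\<close>). This property is preserved by averages and
  limits, by the action of time-dependent linear functionals that have it at constant vectors, and by
  \<open>L\<^sub>2\<close> projection and interpolation on the local intervals: these are quasi-optimal in the maximum norm,
  so that the same polynomial serves after the projection, and discontinuities need not be considered.
  Integration raises the order \<open>r\<close> by one.

  Now \<open>u' = f(u)\<close>, the derivative of \<open>U\<close> is the piecewise projection of \<open>f(U)\<close> (\<open>U_projection\<close>), and \<open>\<Phi>\<close> is
  the piecewise projection of a continuous function \<open>\<Theta>\<close> with \<open>- \<Theta>' = J\<^sup>T(piu, U) \<Phi> + g\<close>
  (\<open>dual_projection\<close>). With each use of these equations the order grows by one. The composition with
  \<open>f\<close> is controlled by the bounds on its higher derivatives along the curves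
  (\<open>Dform_along_near_poly\<close>), the Jacobian along the curves by the constant of the slab
  (\<open>dT_near_poly\<close>). All vectors are measured in the maximum norm and all matrices as operators, which
  keeps the constants independent of the number of components.
\<close>

section \<open>Polynomials on an interval\<close>

lemma has_integral_unit_interval:
  fixes h :: "real \<Rightarrow> real"
  assumes "(h has_integral I) {a..b}" "a < b"
  shows "((\<lambda>x. h (a + (b - a) * x)) has_integral I / (b - a)) {0..1}"
proof -
  have "((\<lambda>x. h ((b - a) *\<^sub>R x + a)) has_integral (1 / (\<bar>b - a\<bar> ^ DIM(real))) *\<^sub>R I)
      ((\<lambda>x. (1 / (b - a)) *\<^sub>R x + - ((1 / (b - a)) *\<^sub>R a)) ` cbox a b)"
    by (rule has_integral_affinity) (use assms in auto)
  moreover have "(\<lambda>x. (1 / (b - a)) *\<^sub>R x + - ((1 / (b - a)) *\<^sub>R a)) ` cbox a b = {0..1}"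
  proof -
    have "(\<lambda>x. (1 / (b - a)) * x + - ((1 / (b - a)) * a)) ` {a..b} = {0..1}"
      using assms(2) by (subst image_affinity_atLeastAtMost) (simp add: diff_divide_distrib[symmetric])
    thus ?thesis by simp
  qed
  ultimately show ?thesis
    using assms(2) by (simp add: algebra_simps)
qed

lemma continuous_on_poly_real [continuous_intros]:
  fixes p :: "real poly"
  shows "continuous_on S (poly p)"
  by (intro continuous_at_imp_continuous_on ballI poly_isCont)

text \<open>Induction on the degree: \<open>p(x) - 2 ^ (m + 1) * p(x / 2)\<close> has no term of degree \<open>m + 1\<close>, its other
  coefficients are not smaller than those of \<open>p\<close>, and its weighted integral exceeds that of \<open>p\<close> by
  a fixed factor at most. The weight \<open>x * (1 - x)\<close> is the one that appears when a polynomial with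
  zero end values is tested with its cofactor.\<close>

lemma coeffs_le_weighted_integral:
  "\<exists>C>0. \<forall>p :: real poly. degree p \<le> m \<longrightarrow>
     (\<Sum>k\<le>m. \<bar>coeff p k\<bar>) \<le> C * integral {0..1} (\<lambda>x. x * (1 - x) * \<bar>poly p x\<bar>)"
proof (induction m)
  case 0
  have I: "((\<lambda>x::real. x * (1 - x) * c) has_integral c / 6) {0..1}" for c
  proof -
    have "((\<lambda>x::real. x * (1 - x) * c) has_integral
        c * (1 ^ 2 / 2 - 1 ^ 3 / 3) - c * (0 ^ 2 / 2 - 0 ^ 3 / 3)) {0..1}"
      by (rule fundamental_theorem_of_calculus)
        (auto intro!: derivative_eq_intros
          simp: has_real_derivative_iff_has_vector_derivative[symmetric] power2_eq_square algebra_simps)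
    thus ?thesis by simp
  qed
  show ?case
  proof (intro exI[of _ 6] conjI allI impI)
    fix p :: "real poly" assume "degree p \<le> 0"
    then obtain a where p: "p = [:a:]" using degree_eq_zeroE by blast
    have "integral {0..1} (\<lambda>x. x * (1 - x) * \<bar>poly p x\<bar>) = \<bar>a\<bar> / 6"
      using integral_unique[OF I[of "\<bar>a\<bar>"]] unfolding p poly_pCons poly_0 by simp
    thus "(\<Sum>k\<le>0. \<bar>coeff p k\<bar>) \<le> 6 * integral {0..1} (\<lambda>x. x * (1 - x) * \<bar>poly p x\<bar>)"
      by (simp only:) (simp add: p)
  qed simp
next
  case (Suc m)
  then obtain C where C: "C > 0" and bound: "\<And>p :: real poly. degree p \<le> m \<Longrightarrow>
     (\<Sum>k\<le>m. \<bar>coeff p k\<bar>) \<le> C * integral {0..1} (\<lambda>x. x * (1 - x) * \<bar>poly p x\<bar>)"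
    by blast
  define w where "w = integral {0..1} (\<lambda>x::real. x * (1 - x) * x ^ Suc m)"
  have w: "((\<lambda>x::real. x * (1 - x) * x ^ Suc m) has_integral 1 / (real m + 3) - 1 / (real m + 4)) {0..1}"
  proof -
    have "((\<lambda>x::real. x * (1 - x) * x ^ Suc m) has_integral
        (1 ^ (m + 3) / (real m + 3) - 1 ^ (m + 4) / (real m + 4)) -
        (0 ^ (m + 3) / (real m + 3) - 0 ^ (m + 4) / (real m + 4))) {0..1}"
    proof (rule fundamental_theorem_of_calculus)
      fix x :: real assume "x \<in> {0..1}"
      have "((\<lambda>x. x ^ (m + 3) / (real m + 3) - x ^ (m + 4) / (real m + 4)) has_real_derivative
          real (m + 3) * x ^ (m + 2) / (real m + 3) - real (m + 4) * x ^ (m + 3) / (real m + 4)) (at x within {0..1})"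
        by (auto intro!: derivative_eq_intros simp: add.commute[of 3 m])
      also have "real (m + 3) * x ^ (m + 2) / (real m + 3) - real (m + 4) * x ^ (m + 3) / (real m + 4)
          = x ^ (m + 2) - x ^ (m + 3)"
      proof -
        have "real m + 3 \<noteq> 0" "real m + 4 \<noteq> 0" "real (m + 3) = real m + 3" "real (m + 4) = real m + 4"
          by auto
        thus ?thesis by (simp only: nonzero_mult_div_cancel_left simp_thms)
      qed
      also have "\<dots> = x * (1 - x) * x ^ Suc m"
        by (simp add: right_diff_distrib left_diff_distrib power_add power2_eq_square power3_eq_cube mult_ac add.commute[of m])
      finally show "((\<lambda>x. x ^ (m + 3) / (real m + 3) - x ^ (m + 4) / (real m + 4)) has_vector_derivative
          x * (1 - x) * x ^ Suc m) (at x within {0..1})"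
        by (simp add: has_real_derivative_iff_has_vector_derivative)
    qed simp
    thus ?thesis by (simp add: power_0_left)
  qed
  have wpos: "w > 0"
    unfolding w_def integral_unique[OF w] by (simp add: divide_strict_left_mono)
  define A where "A = C * (1 + 4 * 2 ^ Suc m)"
  have Apos: "A > 0" using C by (simp add: A_def add_pos_pos)
  show ?case
  proof (intro exI[of _ "A + (1 + A) / w"] conjI allI impI)
    show "0 < A + (1 + A) / w" using Apos wpos by (simp add: add_pos_pos)
    fix p :: "real poly" assume deg: "degree p \<le> Suc m"
    define \<nu> where "\<nu> p = integral {0..1} (\<lambda>x. x * (1 - x) * \<bar>poly p x\<bar>)" for p :: "real poly"
    \<comment> \<open>The substitution \<open>y = x / 2\<close> costs the factor 4: 2 from the measure, and 2 from the weight.\<close>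
    define r where "r = pcompose p [:0, 1/2:]"
    define q where "q = p - smult (2 ^ Suc m) r"
    have coeff_r: "coeff r k = (1/2) ^ k * coeff p k" for k
      by (simp add: r_def coeff_pcompose_linear)
    have coeff_q: "coeff q k = (1 - 2 ^ Suc m * (1/2) ^ k) * coeff p k" for k
      by (simp add: q_def coeff_r algebra_simps)
    have "coeff q k = 0" if "k > m" for k
    proof (cases "k = Suc m")
      case True
      have "(2::real) ^ Suc m * (1/2) ^ Suc m = 1" by (simp flip: power_mult_distrib del: power_Suc)
      thus ?thesis using True by (simp only: coeff_q) simp
    next
      case False
      thus ?thesis using that deg by (simp add: coeff_q coeff_eq_0)
    qed
    hence degq: "degree q \<le> m" by (intro degree_le) auto
    have "\<bar>coeff p k\<bar> \<le> \<bar>coeff q k\<bar>" if "k \<le> m" for k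
    proof -
      have "(2::real) ^ Suc m * (1/2) ^ k = 2 ^ (Suc m - k)"
        using that by (simp add: power_divide power_diff)
      moreover have "(2::real) ^ (Suc m - k) \<ge> 2 ^ 1"
        using that by (intro power_increasing) auto
      ultimately have "\<bar>1 - (2::real) ^ Suc m * (1/2) ^ k\<bar> \<ge> 1" by simp
      thus ?thesis unfolding coeff_q abs_mult by (metis abs_ge_zero mult_right_mono mult_1)
    qed
    hence "(\<Sum>k\<le>m. \<bar>coeff p k\<bar>) \<le> (\<Sum>k\<le>m. \<bar>coeff q k\<bar>)" by (intro sum_mono) auto
    also have "\<dots> \<le> C * \<nu> q" using bound[OF degq] by (simp add: \<nu>_def)
    also have "\<nu> q \<le> (1 + 4 * 2 ^ Suc m) * \<nu> p"
    proof -
      define h where "h y = (2 * y) * (1 - 2 * y) * \<bar>poly p y\<bar>" for y :: real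
      have int_h: "h integrable_on {0..1/2}"
        unfolding h_def by (intro integrable_continuous_real continuous_intros)
      have "((\<lambda>x. h (0 + (1/2 - 0) * x)) has_integral integral {0..1/2} h / (1/2 - 0)) {0..1}"
        by (rule has_integral_unit_interval) (use int_h in auto)
      hence hr: "((\<lambda>x. x * (1 - x) * \<bar>poly r x\<bar>) has_integral 2 * integral {0..1/2} h) {0..1}"
        by (simp add: h_def r_def poly_pcompose mult.commute)
      have "integral {0..1/2} h \<le> integral {0..1/2} (\<lambda>x. 2 * (x * (1 - x) * \<bar>poly p x\<bar>))"
      proof (rule integral_le[OF int_h])
        show "(\<lambda>x. 2 * (x * (1 - x) * \<bar>poly p x\<bar>)) integrable_on {0..1/2}"
          by (intro integrable_continuous_real continuous_intros)
        fix x :: real assume x: "x \<in> {0..1/2}"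
        have "(2 * x) * (1 - 2 * x) \<le> 2 * (x * (1 - x))" using x by (simp add: algebra_simps)
        from mult_right_mono[OF this, of "\<bar>poly p x\<bar>"]
        show "h x \<le> 2 * (x * (1 - x) * \<bar>poly p x\<bar>)" by (simp add: h_def mult.assoc)
      qed
      also have "\<dots> \<le> integral {0..1} (\<lambda>x. 2 * (x * (1 - x) * \<bar>poly p x\<bar>))"
        by (rule integral_subset_le) (auto intro!: integrable_continuous_real continuous_intros mult_nonneg_nonneg)
      also have "\<dots> = 2 * \<nu> p" by (simp add: \<nu>_def)
      finally have "2 * integral {0..1/2} h \<le> 4 * \<nu> p" by simp
      with integral_unique[OF hr] have r: "\<nu> r \<le> 4 * \<nu> p" by (simp add: \<nu>_def)
      have "\<nu> q \<le> integral {0..1} (\<lambda>x. x * (1 - x) * \<bar>poly p x\<bar> + 2 ^ Suc m * (x * (1 - x) * \<bar>poly r x\<bar>))"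
        unfolding \<nu>_def
      proof (rule integral_le)
        fix x :: real assume x: "x \<in> {0..1}"
        have "\<bar>poly q x\<bar> \<le> \<bar>poly p x\<bar> + 2 ^ Suc m * \<bar>poly r x\<bar>"
          unfolding q_def by (simp add: abs_mult order.trans[OF abs_triangle_ineq4])
        hence "x * (1 - x) * \<bar>poly q x\<bar> \<le> x * (1 - x) * (\<bar>poly p x\<bar> + 2 ^ Suc m * \<bar>poly r x\<bar>)"
          using x by (intro mult_left_mono) auto
        thus "x * (1 - x) * \<bar>poly q x\<bar> \<le> x * (1 - x) * \<bar>poly p x\<bar> + 2 ^ Suc m * (x * (1 - x) * \<bar>poly r x\<bar>)"
          by (simp add: algebra_simps)
      qed (auto intro!: integrable_continuous_real continuous_intros)
      also have "\<dots> = \<nu> p + 2 ^ Suc m * \<nu> r"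
        unfolding \<nu>_def by (subst integral_add) (auto intro!: integrable_continuous_real continuous_intros simp del: power_Suc)
      also have "\<dots> \<le> \<nu> p + 2 ^ Suc m * (4 * \<nu> p)" using r by (intro add_left_mono mult_left_mono) auto
      finally show ?thesis by (simp add: algebra_simps)
    qed
    finally have low: "(\<Sum>k\<le>m. \<bar>coeff p k\<bar>) \<le> A * \<nu> p"
      using C by (simp add: A_def mult.assoc)
    \<comment> \<open>The leading term is what remains of \<open>p\<close> when the other terms are subtracted.\<close>
    have "\<bar>coeff p (Suc m)\<bar> * w \<le> \<nu> p + (\<Sum>k\<le>m. \<bar>coeff p k\<bar>)"
    proof -
      have "\<bar>coeff p (Suc m)\<bar> * w = integral {0..1} (\<lambda>x. \<bar>coeff p (Suc m)\<bar> * (x * (1 - x) * x ^ Suc m))"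
        by (simp add: w_def)
      also have "\<dots> \<le> integral {0..1} (\<lambda>x. x * (1 - x) * \<bar>poly p x\<bar> + (\<Sum>k\<le>m. \<bar>coeff p k\<bar>))"
      proof (rule integral_le)
        fix x :: real assume x: "x \<in> {0..1}"
        have "poly p x = (\<Sum>k\<le>Suc m. coeff p k * x ^ k)"
          unfolding poly_altdef using deg
          by (intro sum.mono_neutral_left) (auto simp: coeff_eq_0)
        hence "coeff p (Suc m) * x ^ Suc m = poly p x - (\<Sum>k\<le>m. coeff p k * x ^ k)" by simp
        hence "\<bar>coeff p (Suc m)\<bar> * x ^ Suc m = \<bar>poly p x - (\<Sum>k\<le>m. coeff p k * x ^ k)\<bar>"
          using x by (metis abs_mult abs_of_nonneg atLeastAtMost_iff zero_le_power)
        also have "\<dots> \<le> \<bar>poly p x\<bar> + (\<Sum>k\<le>m. \<bar>coeff p k * x ^ k\<bar>)"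
          using abs_triangle_ineq4[of "poly p x" "\<Sum>k\<le>m. coeff p k * x ^ k"]
            sum_abs[of "\<lambda>k. coeff p k * x ^ k" "{..m}"] by linarith
        also have "(\<Sum>k\<le>m. \<bar>coeff p k * x ^ k\<bar>) \<le> (\<Sum>k\<le>m. \<bar>coeff p k\<bar>)"
        proof (rule sum_mono)
          fix k assume "k \<in> {..m}"
          have "x ^ k \<le> 1" "0 \<le> x ^ k" using x by (auto intro: power_le_one)
          thus "\<bar>coeff p k * x ^ k\<bar> \<le> \<bar>coeff p k\<bar>"
            by (simp add: abs_mult mult_left_le)
        qed
        finally have *: "\<bar>coeff p (Suc m)\<bar> * x ^ Suc m \<le> \<bar>poly p x\<bar> + (\<Sum>k\<le>m. \<bar>coeff p k\<bar>)" by simp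
        have x1: "0 \<le> x * (1 - x)" "x * (1 - x) \<le> 1" using x by (auto intro: mult_le_one)
        from mult_left_mono[OF * x1(1)]
        have "x * (1 - x) * (\<bar>coeff p (Suc m)\<bar> * x ^ Suc m) \<le>
           x * (1 - x) * \<bar>poly p x\<bar> + (x * (1 - x)) * (\<Sum>k\<le>m. \<bar>coeff p k\<bar>)" by (simp add: distrib_left)
        also have "(x * (1 - x)) * (\<Sum>k\<le>m. \<bar>coeff p k\<bar>) \<le> 1 * (\<Sum>k\<le>m. \<bar>coeff p k\<bar>)"
          using x1 by (intro mult_right_mono sum_nonneg) auto
        finally show "\<bar>coeff p (Suc m)\<bar> * (x * (1 - x) * x ^ Suc m) \<le>
           x * (1 - x) * \<bar>poly p x\<bar> + (\<Sum>k\<le>m. \<bar>coeff p k\<bar>)" by (simp add: mult_ac)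
      qed (auto intro!: integrable_continuous_real continuous_intros)
      also have "\<dots> = \<nu> p + (\<Sum>k\<le>m. \<bar>coeff p k\<bar>)"
        unfolding \<nu>_def by (subst integral_add) (auto intro!: integrable_continuous_real continuous_intros)
      finally show ?thesis .
    qed
    also have "\<dots> \<le> (1 + A) * \<nu> p" using low by (simp add: algebra_simps)
    finally have "\<bar>coeff p (Suc m)\<bar> \<le> (1 + A) / w * \<nu> p" using wpos by (simp add: field_simps)
    with low show "(\<Sum>k\<le>Suc m. \<bar>coeff p k\<bar>) \<le> (A + (1 + A) / w) * integral {0..1} (\<lambda>x. x * (1 - x) * \<bar>poly p x\<bar>)"
      by (simp add: distrib_right \<nu>_def)
  qed
qed

text \<open>For a square the modulus under the integral disappears, so that the right-hand side is an energy.\<close>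

lemma poly_square_le_weighted_integral:
  "\<exists>C>0. \<forall>(p :: real poly) a b t. degree p \<le> d \<longrightarrow> a < b \<longrightarrow> t \<in> {a..b} \<longrightarrow>
     (poly p t)\<^sup>2 * (b - a) ^ 3 \<le> C * integral {a..b} (\<lambda>s. (s - a) * (b - s) * (poly p s)\<^sup>2)"
proof -
  obtain C where C: "C > 0" and bound: "\<And>p :: real poly. degree p \<le> 2 * d \<Longrightarrow>
     (\<Sum>k\<le>2*d. \<bar>coeff p k\<bar>) \<le> C * integral {0..1} (\<lambda>x. x * (1 - x) * \<bar>poly p x\<bar>)"
    using coeffs_le_weighted_integral[of "2 * d"] by blast
  show ?thesis
  proof (intro exI[of _ C] conjI allI impI C)
    fix p :: "real poly" and a b t :: real
    assume deg: "degree p \<le> d" and ab: "a < b" and t: "t \<in> {a..b}"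
    define r where "r = pcompose (p ^ 2) [:a, b - a:]"
    have pr: "poly r x = (poly p (a + (b - a) * x))\<^sup>2" for x
      by (simp add: r_def poly_pcompose mult.commute)
    have "degree r \<le> degree (p ^ 2) * degree [:a, b - a:]" unfolding r_def by (rule degree_pcompose_le)
    also have "\<dots> \<le> degree (p^2)" by simp
    also have "\<dots> \<le> 2 * d" using degree_power_le[of p 2] deg by (simp add: mult.commute)
    finally have degr: "degree r \<le> 2 * d" .
    define x where "x = (t - a) / (b - a)"
    have x: "x \<in> {0..1}" "a + (b - a) * x = t" using ab t by (auto simp: x_def field_simps)
    have "poly r x = (\<Sum>k\<le>2*d. coeff r k * x ^ k)"
      unfolding poly_altdef using degr by (intro sum.mono_neutral_left) (auto simp: coeff_eq_0)
    also have "\<dots> \<le> (\<Sum>k\<le>2*d. \<bar>coeff r k\<bar>)"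
    proof (rule sum_mono)
      fix k
      have "x ^ k \<le> 1" "0 \<le> x ^ k" using x by (auto intro: power_le_one)
      thus "coeff r k * x ^ k \<le> \<bar>coeff r k\<bar>"
        by (smt (verit) mult_left_le mult_nonneg_nonneg mult_minus_left)
    qed
    also have "\<dots> \<le> C * integral {0..1} (\<lambda>x. x * (1 - x) * \<bar>poly r x\<bar>)" by (rule bound[OF degr])
    also have "integral {0..1} (\<lambda>x. x * (1 - x) * \<bar>poly r x\<bar>) =
        integral {a..b} (\<lambda>s. (s - a) * (b - s) * (poly p s)\<^sup>2) / (b - a) ^ 3"
    proof -
      define h where "h s = (s - a) * (b - s) * (poly p s)\<^sup>2 / (b - a)\<^sup>2" for s
      have "(h has_integral integral {a..b} h) {a..b}"
        unfolding h_def using ab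
        by (intro integrable_integral integrable_continuous_real continuous_intros) auto
      from has_integral_unit_interval[OF this ab]
      have "((\<lambda>x. h (a + (b - a) * x)) has_integral integral {a..b} h / (b - a)) {0..1}" .
      moreover have "h (a + (b - a) * x) = x * (1 - x) * \<bar>poly r x\<bar>" for x
      proof -
        have "(a + (b - a) * x - a) * (b - (a + (b - a) * x)) = (b - a)\<^sup>2 * (x * (1 - x))"
          by (simp add: power2_eq_square algebra_simps)
        hence "h (a + (b - a) * x) = (b - a)\<^sup>2 * (x * (1 - x)) * poly r x / (b - a)\<^sup>2"
          unfolding h_def pr by (rule arg_cong)
        thus ?thesis using ab by (simp add: pr)
      qed
      moreover have "integral {a..b} h = integral {a..b} (\<lambda>s. (s - a) * (b - s) * (poly p s)\<^sup>2) / (b - a)\<^sup>2"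
        unfolding h_def by simp
      ultimately show ?thesis
        by (simp add: integral_unique power2_eq_square power3_eq_cube mult.assoc)
    qed
    finally show "(poly p t)\<^sup>2 * (b - a) ^ 3 \<le> C * integral {a..b} (\<lambda>s. (s - a) * (b - s) * (poly p s)\<^sup>2)"
      using ab x by (simp add: pr field_simps)
  qed
qed

text \<open>The constant of the preceding lemma. All constants of the error estimates are built from it and
  from explicit functions of the degree, which makes them independent of the mesh.\<close>

definition polyC :: "nat \<Rightarrow> real" where
  "polyC d = (SOME C. C > 0 \<and> (\<forall>(p :: real poly) a b t. degree p \<le> d \<longrightarrow> a < b \<longrightarrow> t \<in> {a..b} \<longrightarrow>
     (poly p t)\<^sup>2 * (b - a) ^ 3 \<le> C * integral {a..b} (\<lambda>s. (s - a) * (b - s) * (poly p s)\<^sup>2)))"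

lemma polyC_pos: "polyC d > 0"
  and polyC_bound: "degree p \<le> d \<Longrightarrow> a < b \<Longrightarrow> t \<in> {a..b} \<Longrightarrow>
     (poly p t)\<^sup>2 * (b - a) ^ 3 \<le> polyC d * integral {a..b} (\<lambda>s. (s - a) * (b - s) * (poly p s)\<^sup>2)"
proof -
  have *: "polyC d > 0 \<and> (\<forall>(p :: real poly) a b t. degree p \<le> d \<longrightarrow> a < b \<longrightarrow> t \<in> {a..b} \<longrightarrow>
     (poly p t)\<^sup>2 * (b - a) ^ 3 \<le> polyC d * integral {a..b} (\<lambda>s. (s - a) * (b - s) * (poly p s)\<^sup>2))"
    unfolding polyC_def by (rule someI_ex) (use poly_square_le_weighted_integral[of d] in simp)
  from * show "polyC d > 0" by blast
  from * show "degree p \<le> d \<Longrightarrow> a < b \<Longrightarrow> t \<in> {a..b} \<Longrightarrow>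
     (poly p t)\<^sup>2 * (b - a) ^ 3 \<le> polyC d * integral {a..b} (\<lambda>s. (s - a) * (b - s) * (poly p s)\<^sup>2)" by blast
qed

lemma poly_max_on_interval:
  fixes p :: "real poly" assumes "a < b"
  obtains x where "x \<in> {a..b}" "\<And>s. s \<in> {a..b} \<Longrightarrow> \<bar>poly p s\<bar> \<le> \<bar>poly p x\<bar>"
proof -
  have "\<exists>x\<in>{a..b}. \<forall>s\<in>{a..b}. \<bar>poly p s\<bar> \<le> \<bar>poly p x\<bar>"
    by (rule continuous_attains_sup) (use assms in \<open>auto intro!: continuous_intros\<close>)
  thus ?thesis using that by blast
qed

text \<open>
  If \<open>p\<close> is the \<open>L\<^sub>2\<close> projection of \<open>h\<close>, testing with \<open>p\<close> itself bounds the energy of \<open>p\<close> by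
  \<open>E * (b - a) * max \<bar>p\<bar>\<close>, and the energy controls \<open>(max \<bar>p\<bar>)\<^sup>2\<close>. The set \<open>S\<close> leaves room for nodes of other
  components.
\<close>

lemma L2_projection_bounded:
  fixes p :: "real poly"
  assumes deg: "degree p \<le> d" and ab: "a < b"
    and h: "\<And>s. s \<in> {a<..<b} - S \<Longrightarrow> \<bar>h s\<bar> \<le> E" and S: "finite S"
    and orth: "((\<lambda>s. (poly p s - h s) * poly p s) has_integral 0) {a..b}"
    and t: "t \<in> {a..b}"
  shows "\<bar>poly p t\<bar> \<le> polyC d * E"
proof -
  define k where "k = b - a"
  have k: "k > 0" using ab by (simp add: k_def)
  obtain x where x: "x \<in> {a..b}" "\<And>s. s \<in> {a..b} \<Longrightarrow> \<bar>poly p s\<bar> \<le> \<bar>poly p x\<bar>"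
    using poly_max_on_interval[OF ab] by blast
  define Y where "Y = \<bar>poly p x\<bar>"
  have "infinite ({a<..<b} - S)" using S ab by (simp add: Diff_infinite_finite)
  hence "{a<..<b} - S \<noteq> {}" by (metis finite.emptyI)
  then obtain s0 where "s0 \<in> {a<..<b} - S" by blast
  hence E: "E \<ge> 0" using h[of s0] by linarith
  have sq: "((\<lambda>s. (poly p s)\<^sup>2) has_integral integral {a..b} (\<lambda>s. (poly p s)\<^sup>2)) {a..b}"
    by (intro integrable_integral integrable_continuous_real continuous_intros)
  from has_integral_diff[OF this orth]
  have hp: "((\<lambda>s. h s * poly p s) has_integral integral {a..b} (\<lambda>s. (poly p s)\<^sup>2)) {a..b}"
    by (simp add: power2_eq_square algebra_simps)
  have "((\<lambda>s. if s \<in> S \<union> {a, b} then 0 else h s * poly p s) has_integral integral {a..b} (\<lambda>s. (poly p s)\<^sup>2)) {a..b}"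
    by (rule has_integral_spike_finite[OF _ _ hp, of "S \<union> {a, b}"]) (use S in auto)
  moreover have "((\<lambda>s. E * Y) has_integral k * (E * Y)) {a..b}"
    using has_integral_const_real[of "E * Y" a b] ab by (simp add: k_def)
  ultimately have I: "integral {a..b} (\<lambda>s. (poly p s)\<^sup>2) \<le> k * (E * Y)"
  proof (rule has_integral_le)
    fix s assume s: "s \<in> {a..b}"
    show "(if s \<in> S \<union> {a, b} then 0 else h s * poly p s) \<le> E * Y"
    proof (cases "s \<in> S \<union> {a, b}")
      case True thus ?thesis using E by (simp add: Y_def)
    next
      case False
      hence "\<bar>h s\<bar> * \<bar>poly p s\<bar> \<le> E * Y"
        unfolding Y_def using s x(2)[OF s] h[of s] E by (intro mult_mono) auto
      thus ?thesis using False by (simp add: abs_mult[symmetric])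
    qed
  qed
  have "Y\<^sup>2 * k ^ 3 \<le> polyC d * integral {a..b} (\<lambda>s. (s - a) * (b - s) * (poly p s)\<^sup>2)"
    using polyC_bound[OF deg ab x(1)] by (simp add: Y_def k_def)
  also have "integral {a..b} (\<lambda>s. (s - a) * (b - s) * (poly p s)\<^sup>2) \<le> integral {a..b} (\<lambda>s. k\<^sup>2 * (poly p s)\<^sup>2)"
  proof (rule integral_le)
    fix s assume s: "s \<in> {a..b}"
    have "(s - a) * (b - s) \<le> k * k" unfolding k_def using s by (intro mult_mono) auto
    thus "(s - a) * (b - s) * (poly p s)\<^sup>2 \<le> k\<^sup>2 * (poly p s)\<^sup>2"
      by (intro mult_right_mono) (auto simp: power2_eq_square)
  qed (auto intro!: integrable_continuous_real continuous_intros)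
  also have "\<dots> = k\<^sup>2 * integral {a..b} (\<lambda>s. (poly p s)\<^sup>2)" by simp
  also have "\<dots> \<le> k\<^sup>2 * (k * (E * Y))" using I by (intro mult_left_mono) auto
  finally have "Y\<^sup>2 * k ^ 3 \<le> (polyC d * E * Y) * k ^ 3"
    using polyC_pos[of d] by (simp add: power2_eq_square power3_eq_cube mult_ac)
  hence "Y * Y \<le> (polyC d * E) * Y"
    using k mult_le_cancel_right_pos[of "k ^ 3" "Y * Y" "polyC d * E * Y"] by (simp add: power2_eq_square)
  hence "Y \<le> polyC d * E"
    using polyC_pos[of d] E mult_le_cancel_right_pos[of Y Y "polyC d * E"] by (cases "Y = 0") (auto simp: Y_def)
  thus ?thesis using x(2)[OF t] by (simp add: Y_def)
qed

text \<open>Polynomials are their own projections, so that stability may be applied to differences.\<close>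

lemma L2_projection_quasi_optimal:
  fixes p r :: "real poly"
  assumes "degree p \<le> d" "degree r \<le> d" and ab: "a < b" and S: "finite S"
    and E: "\<And>s. s \<in> {a<..<b} - S \<Longrightarrow> \<bar>h s - poly r s\<bar> \<le> E"
    and orth: "\<And>w :: real poly. degree w \<le> d \<Longrightarrow> ((\<lambda>s. (poly p s - h s) * poly w s) has_integral 0) {a..b}"
    and t: "t \<in> {a..b}"
  shows "\<bar>poly p t - poly r t\<bar> \<le> polyC d * E"
proof -
  have deg: "degree (p - r) \<le> d" using assms by (simp add: degree_diff_le)
  have "\<bar>poly (p - r) t\<bar> \<le> polyC d * E"
  proof (rule L2_projection_bounded[OF deg ab _ S _ t])
    show "\<bar>h s - poly r s\<bar> \<le> E" if "s \<in> {a<..<b} - S" for s using E[OF that] .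
    show "((\<lambda>s. (poly (p - r) s - (h s - poly r s)) * poly (p - r) s) has_integral 0) {a..b}"
      using orth[OF deg] by simp
  qed
  thus ?thesis by simp
qed

text \<open>After subtraction of the line through the end values the interpolant is \<open>(s - a) * (b - s) * r(s)\<close>
  up to sign, and the cofactor \<open>r\<close> is an admissible test polynomial.\<close>

lemma cG_interp_bounded:
  fixes p :: "real poly"
  assumes deg: "degree p \<le> q" and ab: "a < b"
    and w: "continuous_on {a..b} w" "\<And>s. s \<in> {a..b} \<Longrightarrow> \<bar>w s\<bar> \<le> E"
    and ends: "poly p a = w a" "poly p b = w b"
    and orth: "\<And>v :: real poly. degree v + 2 \<le> q \<Longrightarrow> integral {a..b} (\<lambda>s. (w s - poly p s) * poly v s) = 0"
    and t: "t \<in> {a..b}"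
  shows "\<bar>poly p t\<bar> \<le> (1 + 2 * polyC q) * E"
proof -
  define k where "k = b - a"
  have k: "k > 0" using ab by (simp add: k_def)
  have E: "E \<ge> 0" using w(2)[of a] ab by (smt (verit) atLeastAtMost_iff)
  \<comment> \<open>The line through the end values; as a convex combination of them it is bounded by \<open>E\<close>.\<close>
  define l where "l = [: w a - a * ((w b - w a) / k), (w b - w a) / k :]"
  have la: "poly l a = w a" by (simp add: l_def)
  have lb: "poly l b = w b"
  proof -
    have "poly l b = (w a - a * ((w b - w a) / k)) + b * ((w b - w a) / k)" by (simp add: l_def)
    also have "\<dots> = w a + (b - a) * ((w b - w a) / k)" unfolding left_diff_distrib by linarith
    finally have "poly l b = w a + (b - a) * ((w b - w a) / k)" .
    thus ?thesis using k by (simp add: k_def)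
  qed
  have labs: "\<bar>poly l s\<bar> \<le> E" if s: "s \<in> {a..b}" for s
  proof -
    have "poly l s = ((b - s) * w a + (s - a) * w b) / k"
    proof -
      have "poly l s = (w a - a * ((w b - w a) / k)) + s * ((w b - w a) / k)" by (simp add: l_def)
      also have "\<dots> = w a + (s - a) * ((w b - w a) / k)" unfolding left_diff_distrib by linarith
      also have "\<dots> = (k * w a + (s - a) * (w b - w a)) / k"
        using k by (simp add: add_divide_distrib)
      also have "k * w a + (s - a) * (w b - w a) = (b - s) * w a + (s - a) * w b"
        by (simp add: k_def algebra_simps)
      finally show ?thesis .
    qed
    moreover have "\<bar>(b - s) * w a + (s - a) * w b\<bar> \<le> (b - s) * E + (s - a) * E"
    proof -
      have "\<bar>(b - s) * w a\<bar> \<le> (b - s) * E" "\<bar>(s - a) * w b\<bar> \<le> (s - a) * E"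
        unfolding abs_mult using s w(2)[of a] w(2)[of b] ab by (auto intro!: mult_mono)
      thus ?thesis by linarith
    qed
    moreover have "(b - s) * E + (s - a) * E = E * k" by (simp add: k_def algebra_simps)
    ultimately show ?thesis using k by (simp add: pos_divide_le_eq)
  qed
  have "[:- a, 1:] dvd p - l" using la ends by (simp flip: poly_eq_0_iff_dvd)
  then obtain p1 where p1: "p - l = [:-a, 1:] * p1" by (auto elim: dvdE)
  have "poly (p - l) b = 0" using lb ends by simp
  hence "poly p1 b = 0" using ab unfolding p1 by simp
  then obtain r where r: "p1 = [:-b, 1:] * r" unfolding poly_eq_0_iff_dvd by (auto elim: dvdE)
  have plr: "p = l + [:-a, 1:] * ([:-b, 1:] * r)" using p1 r by (simp add: algebra_simps)
  have val: "poly p s = poly l s - (s - a) * (b - s) * poly r s" for s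
    by (simp add: plr algebra_simps)
  \<comment> \<open>The maximum covers \<open>q = 0\<close>, where the line may have a larger degree than \<open>p\<close>.\<close>
  have rdeg: "degree r + 2 \<le> max q 1" if "r \<noteq> 0"
  proof -
    have "degree (p - l) = degree r + 2"
      using that unfolding p1 r by (simp add: degree_mult_eq del: mult_pCons_left)
    moreover have "degree (p - l) \<le> max q 1"
      using deg by (intro degree_diff_le) (auto simp: l_def)
    ultimately show ?thesis by simp
  qed
  show ?thesis
  proof (cases "r = 0")
    case True
    hence "\<bar>poly p t\<bar> \<le> E" using labs[OF t] val by simp
    also have "E \<le> (1 + 2 * polyC q) * E" using E polyC_pos[of q] by (simp add: algebra_simps)
    finally show ?thesis .
  next
    case False
    hence rq: "degree r + 2 \<le> q" using rdeg by simp
    obtain x where x: "x \<in> {a..b}" "\<And>s. s \<in> {a..b} \<Longrightarrow> \<bar>poly r s\<bar> \<le> \<bar>poly r x\<bar>"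
      using poly_max_on_interval[OF ab] by blast
    define R where "R = \<bar>poly r x\<bar>"
    have R: "R \<ge> 0" by (simp add: R_def)
    have "integral {a..b} (\<lambda>s. (s - a) * (b - s) * (poly r s)\<^sup>2) =
        integral {a..b} (\<lambda>s. (w s - poly p s) * poly r s - (w s - poly l s) * poly r s)"
      by (rule integral_cong) (simp add: val power2_eq_square algebra_simps)
    also have "\<dots> = - integral {a..b} (\<lambda>s. (w s - poly l s) * poly r s)"
      by (subst integral_diff) (auto simp: orth[OF rq] intro!: integrable_continuous_real continuous_intros w(1))
    also have "\<dots> \<le> norm (integral {a..b} (\<lambda>s. (w s - poly l s) * poly r s))" by simp
    also have "\<dots> \<le> 2 * E * R * (b - a)"
    proof (rule integral_bound)
      fix s assume s: "s \<in> {a..b}"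
      have "\<bar>w s - poly l s\<bar> \<le> 2 * E" using w(2)[OF s] labs[OF s] by linarith
      thus "norm ((w s - poly l s) * poly r s) \<le> 2 * E * R"
        unfolding R_def real_norm_def abs_mult using x(2)[OF s] E by (intro mult_mono) auto
    qed (use ab in \<open>auto intro!: continuous_intros w(1)\<close>)
    finally have I: "integral {a..b} (\<lambda>s. (s - a) * (b - s) * (poly r s)\<^sup>2) \<le> 2 * E * R * k"
      by (simp add: k_def)
    have "R\<^sup>2 * k ^ 3 \<le> polyC q * integral {a..b} (\<lambda>s. (s - a) * (b - s) * (poly r s)\<^sup>2)"
      using polyC_bound[of r q a b x] rq ab x(1) by (simp add: R_def k_def)
    also have "\<dots> \<le> polyC q * (2 * E * R * k)" using I polyC_pos[of q] by (intro mult_left_mono) auto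
    finally have "(R * k\<^sup>2) * (R * k) \<le> (2 * polyC q * E) * (R * k)"
      by (simp add: power2_eq_square power3_eq_cube mult_ac)
    hence Rk: "R * k\<^sup>2 \<le> 2 * polyC q * E"
      using R k polyC_pos[of q] E by (cases "R = 0") (auto simp: mult_le_cancel_right)
    have "\<bar>poly p t\<bar> \<le> \<bar>poly l t\<bar> + \<bar>(t - a) * (b - t) * poly r t\<bar>" unfolding val by linarith
    also have "\<dots> \<le> E + k * k * R"
      unfolding abs_mult k_def R_def
      by (intro add_mono labs mult_mono) (use t x(2)[OF t] in auto)
    also have "\<dots> \<le> E + 2 * polyC q * E" using Rk by (simp add: power2_eq_square mult_ac)
    finally show ?thesis by (simp add: algebra_simps)
  qed
qed

definition interpC :: "nat \<Rightarrow> real" where "interpC q = 2 + 2 * polyC q"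

lemma interpC_pos: "interpC q > 0"
  using polyC_pos[of q] by (simp add: interpC_def)

text \<open>Interpolation reproduces polynomials, hence the error is at most a multiple of the best
  approximation. The exceptional set is removed by continuity.\<close>

lemma cG_interp_quasi_optimal:
  fixes r :: "real poly"
  assumes int: "cG_interp q a b v h" and ab: "a < b" and v: "continuous_on {a..b} v"
    and deg: "degree r \<le> q" and E: "\<And>s. s \<in> {a<..<b} - S \<Longrightarrow> \<bar>v s - poly r s\<bar> \<le> E"
    and S: "finite S" and t: "t \<in> {a..b}"
  shows "\<bar>h t - poly r t\<bar> \<le> interpC q * E" "\<bar>h t - v t\<bar> \<le> interpC q * E"
proof -
  obtain p where p: "degree p \<le> q" "\<And>s. s \<in> {a..b} \<Longrightarrow> h s = poly p s"
    using int by (auto simp: cG_interp_def poly_on_def)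
  have E': "\<bar>v s - poly r s\<bar> \<le> E" if "s \<in> {a..b}" for s
  proof -
    have "s islimpt {a<..<b}"
    proof (cases "s = a \<or> s = b")
      case True
      thus ?thesis using ab islimpt_greaterThanLessThan1[of a b] islimpt_greaterThanLessThan2[of a b] by auto
    next
      case False
      thus ?thesis using that by (intro interior_limit_point) (auto simp: interior_open)
    qed
    also have "{a<..<b} = (S \<inter> {a<..<b}) \<union> ({a<..<b} - S)" by blast
    finally have "s \<in> closure ({a<..<b} - S)"
      using S islimpt_Un_finite[of "S \<inter> {a<..<b}" s "{a<..<b} - S"] unfolding closure_def by blast
    moreover have "closure ({a<..<b} - S) \<subseteq> {a..b}"
      by (rule closure_minimal) auto
    ultimately have "continuous_on (closure ({a<..<b} - S)) (\<lambda>s. \<bar>v s - poly r s\<bar>)"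
      by (intro continuous_intros continuous_on_subset[OF v])
    from continuous_le_on_closure[OF this \<open>s \<in> closure ({a<..<b} - S)\<close> E]
    show ?thesis by simp
  qed
  have "\<bar>poly (p - r) t\<bar> \<le> (1 + 2 * polyC q) * E"
  proof (rule cG_interp_bounded[OF _ ab, where w = "\<lambda>s. v s - poly r s"])
    show "degree (p - r) \<le> q" using p deg by (simp add: degree_diff_le)
    show "continuous_on {a..b} (\<lambda>s. v s - poly r s)" by (intro continuous_intros v)
    show "poly (p - r) a = v a - poly r a" "poly (p - r) b = v b - poly r b"
      using int p(2)[of a] p(2)[of b] ab by (auto simp: cG_interp_def)
    fix w :: "real poly" assume "degree w + 2 \<le> q"
    hence "integral {a..b} (\<lambda>s. (v s - h s) * poly w s) = 0"
      using int by (simp add: cG_interp_def)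
    moreover have "integral {a..b} (\<lambda>s. (v s - h s) * poly w s) =
        integral {a..b} (\<lambda>s. (v s - poly r s - poly (p - r) s) * poly w s)"
      by (rule integral_cong) (simp add: p)
    ultimately show "integral {a..b} (\<lambda>s. (v s - poly r s - poly (p - r) s) * poly w s) = 0" by simp
  qed (use t E' in auto)
  hence *: "\<bar>h t - poly r t\<bar> \<le> (1 + 2 * polyC q) * E" using p(2)[OF t] by simp
  have "E \<ge> 0" using E'[OF t] by linarith
  hence "(1 + 2 * polyC q) * E + E = interpC q * E" by (simp add: interpC_def algebra_simps)
  with * E'[OF t] \<open>E \<ge> 0\<close> show "\<bar>h t - poly r t\<bar> \<le> interpC q * E" "\<bar>h t - v t\<bar> \<le> interpC q * E"
    by linarith+
qed

definition taylor_poly :: "nat \<Rightarrow> (real \<Rightarrow> real) \<Rightarrow> real \<Rightarrow> real poly" where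
  "taylor_poly n v c = (\<Sum>m<n. monom ((deriv ^^ m) v c / fact m) m)"

lemma coeff_taylor_poly: "coeff (taylor_poly n v c) m = (if m < n then (deriv ^^ m) v c / fact m else 0)"
  by (auto simp: taylor_poly_def coeff_sum)

lemma poly_taylor_poly: "poly (taylor_poly n v c) z = (\<Sum>m<n. (deriv ^^ m) v c / fact m * z ^ m)"
  by (simp add: taylor_poly_def poly_sum poly_monom)

lemma taylor_poly_error:
  assumes diff: "\<And>m s. m < n \<Longrightarrow> s \<in> {a<..<b} \<Longrightarrow> ((deriv ^^ m) v) differentiable (at s)"
    and c: "c \<in> {a<..<b}" and s: "s \<in> {a<..<b}"
    and M: "\<And>s. s \<in> {a<..<b} \<Longrightarrow> \<bar>(deriv ^^ n) v s\<bar> \<le> M"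
  shows "\<bar>v s - poly (taylor_poly n v c) (s - c)\<bar> \<le> M * \<bar>s - c\<bar> ^ n"
proof (cases "n = 0")
  case True
  thus ?thesis using M[OF s] by (simp add: poly_taylor_poly)
next
  case False
  have M0: "M \<ge> 0" using M[OF s] by linarith
  show ?thesis
  proof (cases "s = c")
    case True
    have "poly (taylor_poly n v c) 0 = v c"
      using False by (simp add: poly_0_coeff_0 coeff_taylor_poly)
    thus ?thesis using True M0 by simp
  next
    case neq: False
    have "\<exists>t. (if s < c then s < t \<and> t < c else c < t \<and> t < s) \<and>
        v s = (\<Sum>m<n. ((deriv ^^ m) v c / fact m) * (s - c)^m) + ((deriv ^^ n) v t / fact n) * (s - c)^n"
    proof (rule Taylor[where a = "min s c" and b = "max s c"])
      show "\<forall>m t. m < n \<and> min s c \<le> t \<and> t \<le> max s c \<longrightarrow>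
          DERIV ((deriv ^^ m) v) t :> (deriv ^^ Suc m) v t"
      proof (intro allI impI)
        fix m t assume mt: "m < n \<and> min s c \<le> t \<and> t \<le> max s c"
        hence "t \<in> {a<..<b}" using c s by auto
        with mt have "((deriv ^^ m) v) differentiable (at t)" using diff by blast
        thus "DERIV ((deriv ^^ m) v) t :> (deriv ^^ Suc m) v t"
          by (simp add: DERIV_deriv_iff_real_differentiable)
      qed
    qed (use False neq in auto)
    then obtain t where t: "if s < c then s < t \<and> t < c else c < t \<and> t < s"
      and eq: "v s = (\<Sum>m<n. ((deriv ^^ m) v c / fact m) * (s - c)^m) + ((deriv ^^ n) v t / fact n) * (s - c)^n"
      by blast
    have "t \<in> {a<..<b}" using t c s by (auto split: if_splits)
    hence Mt: "\<bar>(deriv ^^ n) v t\<bar> \<le> M" by (rule M)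
    have "\<bar>v s - poly (taylor_poly n v c) (s - c)\<bar> = \<bar>(deriv ^^ n) v t\<bar> / fact n * \<bar>s - c\<bar> ^ n"
      unfolding poly_taylor_poly by (subst eq) (simp add: abs_mult power_abs)
    also have "\<dots> \<le> M * \<bar>s - c\<bar> ^ n"
    proof (rule mult_right_mono)
      have "\<bar>(deriv ^^ n) v t\<bar> / fact n \<le> \<bar>(deriv ^^ n) v t\<bar> / 1"
        by (intro divide_left_mono) auto
      thus "\<bar>(deriv ^^ n) v t\<bar> / fact n \<le> M" using Mt by simp
    qed simp
    finally show ?thesis .
  qed
qed

lemma cG_interp_error:
  assumes int: "cG_interp q a b v h" and ab: "a < b" and v: "continuous_on {a..b} v"
    and smooth: "Ck_on (q + 1) {a<..<b} v"
    and M: "\<And>s. s \<in> {a<..<b} \<Longrightarrow> \<bar>(deriv ^^ (q + 1)) v s\<bar> \<le> M"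
    and t: "t \<in> {a..b}"
  shows "\<bar>h t - v t\<bar> \<le> interpC q * ((b - a) ^ (q + 1) * M)"
proof -
  define c where "c = (a + b) / 2"
  have c: "c \<in> {a<..<b}" using ab by (simp add: c_def)
  have M0: "M \<ge> 0" using M[OF c] by linarith
  define r where "r = pcompose (taylor_poly (q + 1) v c) [:- c, 1:]"
  have r: "poly r s = poly (taylor_poly (q + 1) v c) (s - c)" for s
    by (simp add: r_def poly_pcompose)
  have "degree (taylor_poly (q + 1) v c) \<le> q"
    by (rule degree_le) (auto simp: coeff_taylor_poly)
  hence "degree r \<le> q" unfolding r_def
    using degree_pcompose_le[of "taylor_poly (q + 1) v c" "[:- c, 1:]"] by simp
  moreover have "\<bar>v s - poly r s\<bar> \<le> (b - a) ^ (q + 1) * M" if s: "s \<in> {a<..<b} - {}" for s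
  proof -
    have "\<bar>v s - poly r s\<bar> \<le> M * \<bar>s - c\<bar> ^ (q + 1)"
      unfolding r by (rule taylor_poly_error[where a = a and b = b])
        (use smooth c s M in \<open>auto simp: Ck_on_def\<close>)
    also have "\<dots> \<le> M * (b - a) ^ (q + 1)"
      using s c M0 by (intro mult_left_mono power_mono) auto
    finally show ?thesis by (simp add: mult.commute)
  qed
  ultimately show ?thesis
    by (intro cG_interp_quasi_optimal(2)[OF int ab v, where S = "{}"]) (use t in auto)
qed

section \<open>Functions with continuous partial derivatives\<close>

text \<open>A vector is a function on all naturals; the functions on \<open>N\<close>-space are those that ignore the
  coordinates from \<open>N\<close> on.\<close>

definition depends_on_first :: "nat \<Rightarrow> (rvec \<Rightarrow> real) \<Rightarrow> bool" where
  "depends_on_first N v \<longleftrightarrow> (\<forall>x y. (\<forall>i<N. x i = y i) \<longrightarrow> v x = v y)"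

lemma depends_partial:
  assumes "depends_on_first N v" "i < N"
  shows "depends_on_first N (partial i v)"
  unfolding depends_on_first_def
proof (intro allI impI)
  fix x y :: rvec assume xy: "\<forall>l<N. x l = y l"
  have "(\<lambda>h. v (x(i := h))) = (\<lambda>h. v (y(i := h)))"
    using assms(1) xy unfolding depends_on_first_def by (intro ext) auto
  thus "partial i v x = partial i v y" using xy assms(2) by (simp add: partial_def)
qed

lemma partials_Nil [simp]: "partials [] v = v"
  and partials_Cons [simp]: "partials (i # ms) v = partial i (partials ms v)"
  by (simp_all add: partials_def)

lemma partials_append: "partials (ms @ ms') v = partials ms (partials ms' v)"
  by (induction ms) auto

lemma depends_partials:
  assumes "depends_on_first N v" "set ms \<subseteq> {..<N}"
  shows "depends_on_first N (partials ms v)"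
  using assms(2) by (induction ms) (auto simp: assms(1) intro!: depends_partial)

lemma Ck_space_partials:
  assumes "Ck_space N p v" "set ms \<subseteq> {..<N}" "length ms \<le> p"
  shows "Ck_space N (p - length ms) (partials ms v)"
  unfolding Ck_space_def
proof (intro allI impI conjI)
  fix ms' assume ms': "set ms' \<subseteq> {..<N} \<and> length ms' \<le> p - length ms"
  hence s: "set (ms' @ ms) \<subseteq> {..<N} \<and> length (ms' @ ms) \<le> p" using assms by auto
  show "continuous_on UNIV (partials ms' (partials ms v))"
    using assms(1) s unfolding Ck_space_def partials_append[symmetric] by blast
  fix i x assume "length ms' < p - length ms" "i < N"
  hence "length (ms' @ ms) < p" by simp
  thus "(\<lambda>h. partials ms' (partials ms v) (x(i := h))) differentiable (at (x i))"
    using assms(1) s \<open>i < N\<close> unfolding Ck_space_def partials_append[symmetric] by blast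
qed

lemma Ck_space_mono: "Ck_space N p v \<Longrightarrow> p' \<le> p \<Longrightarrow> Ck_space N p' v"
  unfolding Ck_space_def by (meson le_trans less_le_trans)

lemma Ck_space_continuous: "Ck_space N p v \<Longrightarrow> continuous_on UNIV v"
  unfolding Ck_space_def by (drule spec[of _ "[]"]) auto

lemma Ck_space_partial:
  assumes "Ck_space N (Suc p) v" "i < N" shows "Ck_space N p (partial i v)"
  using Ck_space_partials[OF assms(1), of "[i]"] assms(2) by simp

lemma Ck_space_has_partial:
  assumes "Ck_space N (Suc p) v" "i < N"
  shows "((\<lambda>h. v (x(i := h))) has_real_derivative partial i v (x(i := h))) (at h)"
proof -
  have "(\<lambda>h'. v ((x(i := h))(i := h'))) differentiable (at ((x(i := h)) i))"
    using assms unfolding Ck_space_def by (metis bot.extremum length_0_conv list.set(1) partials_Nil zero_le zero_less_Suc)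
  hence "(\<lambda>h'. v (x(i := h'))) differentiable (at h)" by simp
  hence "((\<lambda>h. v (x(i := h))) has_real_derivative deriv (\<lambda>h. v (x(i := h))) h) (at h)"
    by (simp add: DERIV_deriv_iff_real_differentiable)
  thus ?thesis by (simp add: partial_def)
qed

lemma tendsto_fun_iff:
  fixes f :: "'a \<Rightarrow> nat \<Rightarrow> real"
  shows "(f \<longlongrightarrow> l) F \<longleftrightarrow> (\<forall>i. ((\<lambda>x. f x i) \<longlongrightarrow> l i) F)"
proof -
  have "(f \<longlongrightarrow> l) F \<longleftrightarrow> limitin (product_topology (\<lambda>i::nat. euclidean::real topology) UNIV) f l F"
    by (simp add: euclidean_product_topology limitin_canonical_iff)
  also have "\<dots> \<longleftrightarrow> (\<forall>i. ((\<lambda>x. f x i) \<longlongrightarrow> l i) F)"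
    by (simp add: limitin_componentwise limitin_canonical_iff)
  finally show ?thesis .
qed

text \<open>Changing the coordinates one at a time, the mean value theorem applies in each of them.\<close>

lemma mean_value_coordinatewise:
  assumes dep: "depends_on_first N v" and C1: "Ck_space N 1 v"
  obtains p :: "nat \<Rightarrow> rvec" where
    "\<And>l i. l < N \<Longrightarrow> i < N \<Longrightarrow> \<bar>p l i - x i\<bar> \<le> \<bar>y i - x i\<bar>"
    "\<And>l i. l < N \<Longrightarrow> \<not> i < N \<Longrightarrow> p l i = x i"
    "v y - v x = (\<Sum>l<N. partial l v (p l) * (y l - x l))"
proof -
  define z where "z l i = (if i < l then y i else x i)" for l i :: nat
  have z: "z (Suc l) = (z l)(l := y l)" "(z l)(l := x l) = z l" for l
    by (auto simp: z_def fun_eq_iff less_Suc_eq)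
  have "\<exists>\<xi>. \<bar>\<xi> - x l\<bar> \<le> \<bar>y l - x l\<bar> \<and> v (z (Suc l)) - v (z l) = partial l v ((z l)(l := \<xi>)) * (y l - x l)"
    if l: "l < N" for l
  proof -
    have D: "((\<lambda>h. v ((z l)(l := h))) has_real_derivative partial l v ((z l)(l := h))) (at h)" for h
      using Ck_space_has_partial[of N 0 v l "z l" h] C1 l by simp
    consider "x l < y l" | "y l < x l" | "x l = y l" by linarith
    thus ?thesis
    proof cases
      case 1
      from MVT2[OF 1 D] obtain \<xi> where "x l < \<xi>" "\<xi> < y l"
        "v ((z l)(l := y l)) - v ((z l)(l := x l)) = (y l - x l) * partial l v ((z l)(l := \<xi>))" by blast
      thus ?thesis using z[of l] by (intro exI[of _ \<xi>]) (auto simp: mult.commute)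
    next
      case 2
      from MVT2[OF 2 D] obtain \<xi> where "y l < \<xi>" "\<xi> < x l"
        "v ((z l)(l := x l)) - v ((z l)(l := y l)) = (x l - y l) * partial l v ((z l)(l := \<xi>))" by blast
      thus ?thesis using z[of l] by (intro exI[of _ \<xi>]) (auto simp: algebra_simps)
    next
      case 3
      thus ?thesis using z[of l] by (intro exI[of _ "x l"]) auto
    qed
  qed
  then obtain \<xi> where \<xi>: "\<And>l. l < N \<Longrightarrow> \<bar>\<xi> l - x l\<bar> \<le> \<bar>y l - x l\<bar>"
    "\<And>l. l < N \<Longrightarrow> v (z (Suc l)) - v (z l) = partial l v ((z l)(l := \<xi> l)) * (y l - x l)"
    by metis
  have "v y = v (z N)" "v x = v (z 0)"
    using dep unfolding depends_on_first_def by (auto simp: z_def)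
  hence "v y - v x = (\<Sum>l<N. v (z (Suc l)) - v (z l))"
    using sum_lessThan_telescope[of "\<lambda>l. v (z l)" N] by simp
  also have "\<dots> = (\<Sum>l<N. partial l v ((z l)(l := \<xi> l)) * (y l - x l))"
    by (intro sum.cong) (auto simp: \<xi>(2))
  finally show ?thesis
    by (intro that[of "\<lambda>l. (z l)(l := \<xi> l)"]) (auto simp: z_def \<xi>(1))
qed

text \<open>The intermediate points of the mean value theorem tend to \<open>x t\<close>, so that continuity of the partial
  derivatives suffices.\<close>

lemma chain_rule:
  assumes dep: "depends_on_first N v" and C1: "Ck_space N 1 v"
    and x: "\<And>l. l < N \<Longrightarrow> ((\<lambda>s. x s l) has_real_derivative d l) (at t within A)"
  shows "((\<lambda>s. v (x s)) has_real_derivative (\<Sum>l<N. partial l v (x t) * d l)) (at t within A)"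
proof -
  define Q where "Q s p \<longleftrightarrow> (\<forall>l i. l < N \<longrightarrow> i < N \<longrightarrow> \<bar>p l i - x t i\<bar> \<le> \<bar>x s i - x t i\<bar>) \<and>
      (\<forall>l i. l < N \<longrightarrow> \<not> i < N \<longrightarrow> p l i = x t i) \<and>
      v (x s) - v (x t) = (\<Sum>l<N. partial l v (p l) * (x s l - x t l))" for s and p :: "nat \<Rightarrow> rvec"
  have "\<exists>p. Q s p" for s
  proof -
    obtain p :: "nat \<Rightarrow> rvec" where
      "\<And>l i. l < N \<Longrightarrow> i < N \<Longrightarrow> \<bar>p l i - x t i\<bar> \<le> \<bar>x s i - x t i\<bar>"
      "\<And>l i. l < N \<Longrightarrow> \<not> i < N \<Longrightarrow> p l i = x t i"
      "v (x s) - v (x t) = (\<Sum>l<N. partial l v (p l) * (x s l - x t l))"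
      using mean_value_coordinatewise[OF dep C1, where x = "x t" and y = "x s"] by blast
    thus ?thesis unfolding Q_def by (intro exI[of _ p]) blast
  qed
  then obtain p where p: "\<And>s. Q s (p s)" by meson
  have p1: "l < N \<Longrightarrow> i < N \<Longrightarrow> \<bar>p s l i - x t i\<bar> \<le> \<bar>x s i - x t i\<bar>"
    and p2: "l < N \<Longrightarrow> \<not> i < N \<Longrightarrow> p s l i = x t i"
    and p3: "v (x s) - v (x t) = (\<Sum>l<N. partial l v (p s l) * (x s l - x t l))" for s l i
    using p[of s] unfolding Q_def by blast+
  have lim: "((\<lambda>s. p s l) \<longlongrightarrow> x t) (at t within A)" if l: "l < N" for l
    unfolding tendsto_fun_iff
  proof
    fix i
    show "((\<lambda>s. p s l i) \<longlongrightarrow> x t i) (at t within A)"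
    proof (cases "i < N")
      case True
      have "continuous (at t within A) (\<lambda>s. x s i)"
        using DERIV_continuous[OF x[OF True]] .
      hence "((\<lambda>s. x s i - x t i) \<longlongrightarrow> 0) (at t within A)"
        by (simp add: continuous_within LIM_zero)
      hence "((\<lambda>s. p s l i - x t i) \<longlongrightarrow> 0) (at t within A)"
        by (rule Lim_null_comparison[rotated, OF tendsto_rabs_zero]) (simp add: p1 l True)
      thus ?thesis by (simp add: LIM_zero_iff)
    next
      case False
      thus ?thesis by (simp add: p2 l)
    qed
  qed
  have "((\<lambda>s. \<Sum>l<N. partial l v (p s l) * ((x s l - x t l) / (s - t))) \<longlongrightarrow>
      (\<Sum>l<N. partial l v (x t) * d l)) (at t within A)"
  proof (intro tendsto_sum tendsto_mult)
    fix l assume "l \<in> {..<N}"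
    hence l: "l < N" by simp
    have "isCont (partial l v) (x t)"
      using Ck_space_continuous[OF Ck_space_partial[of N 0 v l]] C1 l
      by (simp add: continuous_on_eq_continuous_at)
    thus "((\<lambda>s. partial l v (p s l)) \<longlongrightarrow> partial l v (x t)) (at t within A)"
      using lim[OF l] isCont_tendsto_compose by blast
    show "((\<lambda>s. (x s l - x t l) / (s - t)) \<longlongrightarrow> d l) (at t within A)"
      using x[OF l] by (simp add: has_field_derivative_iff)
  qed
  also have "(\<lambda>s. \<Sum>l<N. partial l v (p s l) * ((x s l - x t l) / (s - t))) =
      (\<lambda>s. (v (x s) - v (x t)) / (s - t))"
    unfolding p3 by (simp add: sum_divide_distrib)
  finally show ?thesis by (simp add: has_field_derivative_iff)
qed

text \<open>
  Naming the derivative in each step makes closure under products and composition a simple induction;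
  the iterated \<open>deriv\<close> is recovered afterwards.
\<close>

fun smooth :: "nat \<Rightarrow> (real \<Rightarrow> real) \<Rightarrow> bool" where
  "smooth 0 h \<longleftrightarrow> continuous_on UNIV h"
| "smooth (Suc n) h \<longleftrightarrow> (\<exists>h'. (\<forall>t. (h has_real_derivative h' t) (at t)) \<and> smooth n h')"

lemma smooth_imp_continuous: "smooth n h \<Longrightarrow> continuous_on UNIV h"
  by (cases n) (auto intro!: continuous_at_imp_continuous_on intro: DERIV_isCont)

lemma smooth_Suc_D: "smooth (Suc n) h \<Longrightarrow> smooth n h"
proof (induction n arbitrary: h)
  case 0
  then show ?case using smooth_imp_continuous by (simp only: smooth.simps(1))
next
  case (Suc n)
  then show ?case by (metis smooth.simps(2))
qed

lemma smooth_const: "smooth n (\<lambda>_. c)"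
  by (induction n arbitrary: c) (auto intro!: derivative_eq_intros exI[of _ "\<lambda>_. 0"])

lemma smooth_add: "smooth n h \<Longrightarrow> smooth n k \<Longrightarrow> smooth n (\<lambda>t. h t + k t)"
proof (induction n arbitrary: h k)
  case (Suc n)
  then obtain h' k' where "\<forall>t. (h has_real_derivative h' t) (at t)" "smooth n h'"
    "\<forall>t. (k has_real_derivative k' t) (at t)" "smooth n k'" by auto
  thus ?case using Suc.IH[of h' k'] by (auto intro!: derivative_eq_intros exI[of _ "\<lambda>t. h' t + k' t"])
qed (auto intro: continuous_intros)

lemma smooth_sum: "(\<And>l. l \<in> A \<Longrightarrow> smooth n (h l)) \<Longrightarrow> smooth n (\<lambda>t. \<Sum>l\<in>A. h l t)"
  by (induction A rule: infinite_finite_induct) (auto intro: smooth_const smooth_add)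

lemma smooth_mult: "smooth n h \<Longrightarrow> smooth n k \<Longrightarrow> smooth n (\<lambda>t. h t * k t)"
proof (induction n arbitrary: h k)
  case (Suc n)
  then obtain h' k' where d: "\<forall>t. (h has_real_derivative h' t) (at t)" "smooth n h'"
    "\<forall>t. (k has_real_derivative k' t) (at t)" "smooth n k'" by auto
  have "smooth n (\<lambda>t. h' t * k t + h t * k' t)"
    using d Suc.prems Suc.IH smooth_Suc_D by (intro smooth_add) blast+
  thus ?case using d
    by (auto intro!: derivative_eq_intros exI[of _ "\<lambda>t. h' t * k t + h t * k' t"])
qed (auto intro: continuous_intros)

lemma smooth_poly: "smooth n (poly p)"
proof (induction n arbitrary: p)
  case (Suc n)
  thus ?case by (auto intro!: exI[of _ "poly (pderiv p)"] poly_DERIV)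
qed (auto intro: continuous_intros)

lemma smooth_higher_deriv:
  assumes "smooth n h" "m \<le> n" shows "smooth (n - m) ((deriv ^^ m) h)"
  using assms(2)
proof (induction m)
  case 0
  then show ?case using assms(1) by simp
next
  case (Suc m)
  hence "smooth (Suc (n - Suc m)) ((deriv ^^ m) h)" by (simp add: Suc_diff_Suc del: smooth.simps)
  then obtain h' where h': "\<forall>t. ((deriv ^^ m) h has_real_derivative h' t) (at t)" "smooth (n - Suc m) h'" by auto
  hence "h' = (deriv ^^ Suc m) h" using DERIV_imp_deriv[OF h'(1)[rule_format]] by (intro ext) simp
  thus ?case using h' by simp
qed

lemma smooth_has_deriv:
  assumes "smooth n h" "m < n"
  shows "((deriv ^^ m) h has_real_derivative (deriv ^^ Suc m) h t) (at t)"
proof -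
  have "smooth (Suc (n - Suc m)) ((deriv ^^ m) h)"
    using smooth_higher_deriv[OF assms(1), of m] assms(2) by (simp add: Suc_diff_Suc del: smooth.simps)
  then obtain h' where "\<And>t. ((deriv ^^ m) h has_real_derivative h' t) (at t)" by auto
  from this[of t] DERIV_imp_deriv[OF this[of t]] show ?thesis by simp
qed

lemma higher_deriv_sum:
  assumes "\<And>l. l \<in> A \<Longrightarrow> smooth n (h l)" "m \<le> n"
  shows "(deriv ^^ m) (\<lambda>t. \<Sum>l\<in>A. h l t * c l) = (\<lambda>t. \<Sum>l\<in>A. (deriv ^^ m) (h l) t * c l)"
  using assms(2)
proof (induction m)
  case (Suc m)
  have "deriv (\<lambda>t. \<Sum>l\<in>A. (deriv ^^ m) (h l) t * c l) t = (\<Sum>l\<in>A. (deriv ^^ Suc m) (h l) t * c l)" for t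
    using Suc.prems assms(1)
    by (intro DERIV_imp_deriv DERIV_sum DERIV_cmult_right smooth_has_deriv[of n]) auto
  thus ?case using Suc by auto
qed simp

lemma higher_deriv_cong_open:
  assumes "open S" "\<And>t. t \<in> S \<Longrightarrow> h t = k t" "t \<in> S"
  shows "(deriv ^^ n) h t = (deriv ^^ n) k t"
  using assms(3)
proof (induction n arbitrary: t)
  case (Suc n)
  have "eventually (\<lambda>s. (deriv ^^ n) h s = (deriv ^^ n) k s) (nhds t)"
    using Suc assms(1) eventually_nhds by blast
  thus ?case by (simp add: deriv_cong_ev)
qed (use assms in auto)

lemma deriv_shift: "deriv (\<lambda>t. h (t + c)) t = deriv h (t + c)"
  for h :: "real \<Rightarrow> real"
proof -
  have "((\<lambda>t. h (t + c)) has_field_derivative D) (at t) = (h has_field_derivative D) (at (t + c))" for D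
    by (metis DERIV_shift)
  thus ?thesis unfolding deriv_def by simp
qed

lemma higher_deriv_shift:
  fixes h :: "real \<Rightarrow> real"
  shows "(deriv ^^ n) (\<lambda>t. h (t + c)) = (\<lambda>t. (deriv ^^ n) h (t + c))"
  by (induction n) (auto simp: deriv_shift)

lemma higher_deriv_poly: "(deriv ^^ n) (poly p) = poly ((pderiv ^^ n) (p :: real poly))"
proof -
  have "deriv (poly r) = poly (pderiv r)" for r :: "real poly"
    by (intro ext DERIV_imp_deriv poly_DERIV)
  thus ?thesis by (induction n) simp_all
qed

lemma smooth_along_polynomials:
  assumes "depends_on_first N v" "Ck_space N n v"
  shows "smooth n (\<lambda>t. v (\<lambda>l. poly (X l) t))"
  using assms
proof (induction n arbitrary: v)
  case 0
  have "continuous_on UNIV (\<lambda>t. v (\<lambda>l. poly (X l) t))"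
    by (rule continuous_on_compose2[OF Ck_space_continuous[OF 0(2)]])
      (auto intro!: continuous_on_coordinatewise_then_product continuous_intros)
  thus ?case by simp
next
  case (Suc n)
  define h' where "h' t = (\<Sum>l<N. partial l v (\<lambda>l. poly (X l) t) * poly (pderiv (X l)) t)" for t
  have "((\<lambda>t. v (\<lambda>l. poly (X l) t)) has_real_derivative h' t) (at t)" for t
    unfolding h'_def using Suc.prems
    by (intro chain_rule[of N v]) (auto intro: Ck_space_mono poly_DERIV)
  moreover have "smooth n h'"
    unfolding h'_def using Suc.prems
    by (intro smooth_sum smooth_mult smooth_poly Suc.IH) (auto intro: Ck_space_partial depends_partial)
  ultimately show ?case by auto
qed

subsection \<open>The forms given by the higher derivatives\<close>

lemma Dform_0: "Dform N 0 v x w = v x"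
proof -
  have "{ms. length ms = 0 \<and> set ms \<subseteq> {..<N}} = {[]}" by auto
  thus ?thesis unfolding Dform_def by (simp del: length_0_conv)
qed

text \<open>The form of order \<open>n + 1\<close> as a linear functional of its first argument, the others being \<open>w\<close>.\<close>

definition Dform_coeff :: "nat \<Rightarrow> nat \<Rightarrow> (rvec \<Rightarrow> real) \<Rightarrow> rvec \<Rightarrow> (nat \<Rightarrow> rvec) \<Rightarrow> nat \<Rightarrow> real" where
  "Dform_coeff N n v x w l =
     (\<Sum>ms\<in>{ms. length ms = n \<and> set ms \<subseteq> {..<N}}. partial l (partials ms v) x * (\<Prod>r<n. w r (ms ! r)))"

lemma Dform_Suc:
  "Dform N (Suc n) v x (case_nat y w) = (\<Sum>l<N. Dform_coeff N n v x w l * y l)"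
proof -
  let ?A = "{ms. length ms = n \<and> set ms \<subseteq> {..<N}}"
  have "Dform N (Suc n) v x (case_nat y w) =
      (\<Sum>ms\<in>(\<lambda>(l, ms). l # ms) ` ({..<N} \<times> ?A). partials ms v x * (\<Prod>r<Suc n. case_nat y w r (ms ! r)))"
    unfolding Dform_def
  proof (rule sum.cong)
    show "{ms. length ms = Suc n \<and> set ms \<subseteq> {..<N}} = (\<lambda>(l, ms). l # ms) ` ({..<N} \<times> ?A)"
    proof (intro equalityI subsetI)
      fix ms assume "ms \<in> {ms. length ms = Suc n \<and> set ms \<subseteq> {..<N}}"
      thus "ms \<in> (\<lambda>(l, ms). l # ms) ` ({..<N} \<times> ?A)" by (cases ms) (auto simp: image_iff)
    qed auto
  qed auto
  also have "\<dots> = (\<Sum>(l, ms)\<in>{..<N} \<times> ?A. partials (l # ms) v x * (y l * (\<Prod>r<n. w r (ms ! r))))"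
    by (subst sum.reindex) (auto simp: inj_on_def prod.lessThan_Suc_shift split_def simp del: prod.lessThan_Suc intro!: sum.cong)
  also have "\<dots> = (\<Sum>l<N. \<Sum>ms\<in>?A. partials (l # ms) v x * (y l * (\<Prod>r<n. w r (ms ! r))))"
    by (simp add: sum.cartesian_product)
  also have "\<dots> = (\<Sum>l<N. Dform_coeff N n v x w l * y l)"
    unfolding Dform_coeff_def by (simp add: sum_distrib_left sum_distrib_right mult_ac)
  finally show ?thesis .
qed

text \<open>Differentiation along a curve inserts the velocity as a further argument of the form.\<close>

lemma Dform_has_derivative:
  assumes dep: "depends_on_first N v" and C: "Ck_space N (Suc n) v"
    and x: "\<And>l. l < N \<Longrightarrow> ((\<lambda>s. x s l) has_real_derivative d l) (at t within A)"
  shows "((\<lambda>s. Dform N n v (x s) w) has_real_derivative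
     (\<Sum>l<N. Dform_coeff N n v (x t) w l * d l)) (at t within A)"
proof -
  let ?A = "{ms. length ms = n \<and> set ms \<subseteq> {..<N}}"
  have "((\<lambda>s. Dform N n v (x s) w) has_real_derivative
     (\<Sum>ms\<in>?A. (\<Sum>l<N. partial l (partials ms v) (x t) * d l) * (\<Prod>r<n. w r (ms ! r)))) (at t within A)"
    unfolding Dform_def
  proof (intro DERIV_sum DERIV_cmult_right chain_rule x)
    fix ms assume ms: "ms \<in> ?A"
    show "depends_on_first N (partials ms v)" using ms by (intro depends_partials dep) auto
    show "Ck_space N 1 (partials ms v)" using Ck_space_partials[OF C, of ms] ms by simp
  qed
  also have "(\<Sum>ms\<in>?A. (\<Sum>l<N. partial l (partials ms v) (x t) * d l) * (\<Prod>r<n. w r (ms ! r))) =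
      (\<Sum>l<N. Dform_coeff N n v (x t) w l * d l)"
    unfolding Dform_coeff_def sum_distrib_right
    by (subst sum.swap) (simp add: mult_ac)
  finally show ?thesis .
qed

lemma Dform_continuous:
  assumes dep: "depends_on_first N v" and C: "Ck_space N n v" and x: "\<And>l. l < N \<Longrightarrow> continuous_on A (\<lambda>s. x s l)"
  shows "continuous_on A (\<lambda>s. Dform N n v (x s) w)"
  unfolding Dform_def
proof (intro continuous_on_sum continuous_on_mult continuous_on_const)
  fix ms assume ms: "ms \<in> {ms. length ms = n \<and> set ms \<subseteq> {..<N}}"
  define x' where "x' s l = (if l < N then x s l else 0)" for s l
  have cx: "continuous_on A x'"
  proof (rule continuous_on_coordinatewise_then_product)
    fix l show "continuous_on A (\<lambda>s. x' s l)"
      using x by (cases "l < N") (simp_all add: x'_def)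
  qed
  have "continuous_on UNIV (partials ms v)"
    using Ck_space_continuous[OF Ck_space_partials[OF C, of ms]] ms by simp
  hence "continuous_on A (\<lambda>s. partials ms v (x' s))"
    by (rule continuous_on_compose2[OF _ cx]) auto
  moreover have "partials ms v (x' s) = partials ms v (x s)" for s
    using depends_partials[OF dep, of ms] ms unfolding depends_on_first_def by (auto simp: x'_def)
  ultimately show "continuous_on A (\<lambda>s. partials ms v (x s))" by simp
qed

section \<open>Integrals and measurability in time\<close>

lemma has_integral_partition:
  fixes h :: "real \<Rightarrow> real" and x :: "nat \<Rightarrow> real"
  assumes "\<And>j. j < n \<Longrightarrow> x j \<le> x (Suc j)"
    and "\<And>j. j < n \<Longrightarrow> (h has_integral I j) {x j..x (Suc j)}"
  shows "x 0 \<le> x n \<and> (h has_integral (\<Sum>j<n. I j)) {x 0..x n}"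
  using assms
proof (induction n)
  case 0
  show ?case using has_integral_refl(2)[of h "x 0"] by simp
next
  case (Suc n)
  hence IH: "x 0 \<le> x n" "(h has_integral (\<Sum>j<n. I j)) {x 0..x n}" by auto
  have "x n \<le> x (Suc n)" "(h has_integral I n) {x n..x (Suc n)}" using Suc.prems by auto
  with IH show ?case using has_integral_combine[of "x 0" "x n" "x (Suc n)" h] by auto
qed

text \<open>Averages over the unit interval, such as the averaged Jacobian, inherit from finite averages both
  measurability in time and closeness to polynomials.\<close>

lemma riemann_sums:
  fixes h :: "real \<Rightarrow> real"
  assumes h: "continuous_on {0..1} h"
  shows "(\<lambda>m. (\<Sum>j<Suc m. h (real j / real (Suc m))) / real (Suc m)) \<longlonglongrightarrow> integral {0..1} h"
proof (rule LIMSEQ_I)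
  fix e :: real assume e: "e > 0"
  have "uniformly_continuous_on {0..1} h" using h by (intro compact_uniformly_continuous) auto
  then obtain d where d: "d > 0"
    "\<And>s t. s \<in> {0..1} \<Longrightarrow> t \<in> {0..1} \<Longrightarrow> dist t s < d \<Longrightarrow> dist (h t) (h s) < e / 2"
    unfolding uniformly_continuous_on_def using e by (metis half_gt_zero)
  obtain m0 where m0: "inverse (real (Suc m0)) < d" using d(1) reals_Archimedean by blast
  show "\<exists>no. \<forall>m\<ge>no. norm ((\<Sum>j<Suc m. h (real j / real (Suc m))) / real (Suc m) - integral {0..1} h) < e"
  proof (intro exI allI impI)
    fix m assume m: "m \<ge> m0"
    define n where "n = real (Suc m)"
    have n: "n > 0" by (simp add: n_def)
    have nd: "1 / n < d"
    proof -
      have "1 / n \<le> 1 / real (Suc m0)" unfolding n_def using m by (intro divide_left_mono) auto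
      also have "\<dots> < d" using m0 by (simp only: inverse_eq_divide)
      finally show ?thesis .
    qed
    define x where "x j = real j / n" for j
    have x01: "{x j..x (Suc j)} \<subseteq> {0..1}" if "j < Suc m" for j
    proof -
      have "real (Suc j) \<le> n" using that by (simp add: n_def)
      hence "x (Suc j) \<le> 1" using n by (simp add: x_def)
      moreover have "x j \<ge> 0" using n by (simp add: x_def)
      ultimately show ?thesis by auto
    qed
    have step: "x (Suc j) - x j = 1 / n" for j by (simp add: x_def diff_divide_distrib[symmetric])
    have le: "x j \<le> x (Suc j)" for j using step[of j] n by (smt (verit) divide_pos_pos)
    have cont: "continuous_on {x j..x (Suc j)} h" if "j < Suc m" for j
      using continuous_on_subset[OF h x01[OF that]] .
    have "(h has_integral (\<Sum>j<Suc m. integral {x j..x (Suc j)} h)) {x 0..x (Suc m)}"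
      by (rule conjunct2[OF has_integral_partition])
        (auto intro!: le integrable_integral integrable_continuous_real cont)
    moreover have "x 0 = 0" "x (Suc m) = 1" by (auto simp: x_def n_def)
    ultimately have I: "integral {0..1} h = (\<Sum>j<Suc m. integral {x j..x (Suc j)} h)"
      by (simp add: integral_unique)
    have piece: "\<bar>h (x j) / n - integral {x j..x (Suc j)} h\<bar> \<le> e / 2 * (1 / n)" if j: "j < Suc m" for j
    proof -
      have "norm (integral {x j..x (Suc j)} (\<lambda>s. h (x j) - h s)) \<le> e / 2 * (x (Suc j) - x j)"
      proof (rule integral_bound[OF le])
        show "continuous_on {x j..x (Suc j)} (\<lambda>s. h (x j) - h s)"
          by (intro continuous_intros cont j)
        fix s assume s: "s \<in> {x j..x (Suc j)}"
        have "dist s (x j) < d" using s step[of j] nd by (auto simp: dist_real_def)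
        hence "dist (h s) (h (x j)) < e / 2" using d(2)[of "x j" s] s x01[OF j] le[of j] by fastforce
        thus "norm (h (x j) - h s) \<le> e / 2" by (simp add: dist_real_def abs_minus_commute)
      qed
      moreover have "integral {x j..x (Suc j)} (\<lambda>s. h (x j) - h s) = h (x j) / n - integral {x j..x (Suc j)} h"
        using le[of j] step[of j]
        by (subst integral_diff) (auto intro!: integrable_continuous_real cont j)
      ultimately show ?thesis using step[of j] by simp
    qed
    have "\<bar>(\<Sum>j<Suc m. h (x j)) / n - integral {0..1} h\<bar> =
        \<bar>\<Sum>j<Suc m. h (x j) / n - integral {x j..x (Suc j)} h\<bar>"
      by (simp only: I sum_subtractf sum_divide_distrib)
    also have "\<dots> \<le> (\<Sum>j<Suc m. e / 2 * (1 / n))"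
      by (rule order.trans[OF sum_abs sum_mono]) (use piece in auto)
    also have "\<dots> = e / 2" using n by (simp add: n_def field_simps)
    also have "\<dots> < e" using e by simp
    finally show "norm ((\<Sum>j<Suc m. h (real j / real (Suc m))) / real (Suc m) - integral {0..1} h) < e"
      by (simp only: x_def n_def real_norm_def)
  qed
qed

text \<open>A continuous curve is the limit of its values on the grid of mesh size \<open>1 / (m + 1)\<close>; these involve
  countably many arguments \<open>x\<close> only, and for each of them measurability in \<open>t\<close> is known.\<close>

lemma caratheodory_measurable:
  fixes h :: "rvec \<Rightarrow> real \<Rightarrow> real"
  assumes T: "T > 0"
    and meas: "\<And>x. (\<lambda>t. h x t) \<in> borel_measurable (lebesgue_on {0<..T})"
    and cont: "\<And>t. t \<in> {0<..T} \<Longrightarrow> continuous_on UNIV (\<lambda>x. h x t)"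
    and dep: "\<And>t. t \<in> {0<..T} \<Longrightarrow> depends_on_first N (\<lambda>x. h x t)"
    and x: "\<And>i. i < N \<Longrightarrow> continuous_on {0..T} (\<lambda>t. x t i)"
  shows "(\<lambda>t. h (x t) t) \<in> borel_measurable (lebesgue_on {0<..T})"
proof -
  define x' where "x' t i = (if i < N then x t i else 0)" for t i
  define g where "g m t = real_of_int \<lfloor>real (Suc m) * t\<rfloor> / real (Suc m)" for m t
  show ?thesis
  proof (rule borel_measurable_LIMSEQ_real[where u = "\<lambda>m t. h (x' (g m t)) t"])
  show "(\<lambda>t. h (x' (g m t)) t) \<in> borel_measurable (lebesgue_on {0<..T})" for m
  proof -
    have "(\<lambda>t. (\<lambda>k t. h (x' (real_of_int k / real (Suc m))) t) \<lfloor>real (Suc m) * t\<rfloor> t)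
        \<in> borel_measurable (lebesgue_on {0<..T})"
    proof (rule measurable_compose_countable[where g = "\<lambda>t. \<lfloor>real (Suc m) * t\<rfloor>"
        and f = "\<lambda>k t. h (x' (real_of_int k / real (Suc m))) t"])
      show "(\<lambda>t. h (x' (real_of_int k / real (Suc m))) t) \<in> borel_measurable (lebesgue_on {0<..T})" for k
        by (rule meas)
      have "(\<lambda>t::real. \<lfloor>real (Suc m) * t\<rfloor>) \<in> measurable borel (count_space UNIV)" by measurable
      thus "(\<lambda>t. \<lfloor>real (Suc m) * t\<rfloor>) \<in> measurable (lebesgue_on {0<..T}) (count_space UNIV)"
        by (simp add: measurable_completion measurable_restrict_space1)
    qed
    thus ?thesis by (simp add: g_def)
  qed
  fix t assume "t \<in> space (lebesgue_on {0<..T})"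
  hence t: "t \<in> {0<..T}" by (simp add: space_restrict_space)
  have g: "g m t \<in> {0..T}" "\<bar>g m t - t\<bar> \<le> inverse (real (Suc m))" for m
  proof -
    let ?n = "real (Suc m)"
    have "real_of_int \<lfloor>?n * t\<rfloor> \<le> ?n * t" "?n * t - 1 \<le> real_of_int \<lfloor>?n * t\<rfloor>" "0 \<le> \<lfloor>?n * t\<rfloor>"
      using t by (linarith, linarith, simp)
    note fl = this
    have "g m t \<le> ?n * t / ?n" unfolding g_def by (rule divide_right_mono[OF fl(1)]) simp
    moreover have "(?n * t - 1) / ?n \<le> g m t" unfolding g_def by (rule divide_right_mono[OF fl(2)]) simp
    moreover have "0 \<le> g m t" unfolding g_def using fl(3) by (intro divide_nonneg_nonneg) auto
    moreover have "(?n * t - 1) / ?n = t - inverse ?n" by (simp add: diff_divide_distrib inverse_eq_divide)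
    ultimately show "g m t \<in> {0..T}" "\<bar>g m t - t\<bar> \<le> inverse (real (Suc m))" using t by auto
  qed
  have "(\<lambda>m. g m t - t) \<longlonglongrightarrow> 0"
    by (rule Lim_null_comparison[OF _ LIMSEQ_inverse_real_of_nat]) (use g(2) in \<open>auto intro: always_eventually\<close>)
  hence gl: "(\<lambda>m. g m t) \<longlonglongrightarrow> t" by (simp add: LIM_zero_iff)
  have "(\<lambda>m. x' (g m t)) \<longlonglongrightarrow> x' t"
    unfolding tendsto_fun_iff
  proof
    fix i
    show "(\<lambda>m. x' (g m t) i) \<longlonglongrightarrow> x' t i"
    proof (cases "i < N")
      case True
      have "(\<lambda>m. x (g m t) i) \<longlonglongrightarrow> x t i"
        using continuous_on_tendsto_compose[OF x[OF True] gl] g(1) t by simp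
      thus ?thesis using True by (simp add: x'_def)
    qed (simp add: x'_def)
  qed
  moreover have "isCont (\<lambda>y. h y t) (x' t)" using cont[OF t] by (simp add: continuous_on_eq_continuous_at)
  ultimately have "(\<lambda>m. h (x' (g m t)) t) \<longlonglongrightarrow> h (x' t) t" using isCont_tendsto_compose by blast
  moreover have "h (x' t) t = h (x t) t" using dep[OF t] unfolding depends_on_first_def by (auto simp: x'_def)
  ultimately show "(\<lambda>m. h (x' (g m t)) t) \<longlonglongrightarrow> h (x t) t" by simp
  qed
qed

lemma bounded_measurable_integrable:
  fixes h :: "real \<Rightarrow> real"
  assumes "T > 0" "h \<in> borel_measurable (lebesgue_on {0<..T})" "\<And>t. t \<in> {0<..T} \<Longrightarrow> \<bar>h t\<bar> \<le> B"
  shows "h integrable_on {0..T}"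
proof -
  have eq: "insert 0 {0<..T} = {0..T}" using assms(1) by auto
  have "(\<lambda>_. B) integrable_on insert 0 {0<..T}" unfolding eq by (rule integrable_const_ivl)
  hence B: "(\<lambda>_. B) integrable_on {0<..T}" by (simp add: integrable_on_insert_iff)
  have "h absolutely_integrable_on {0<..T}"
    by (rule measurable_bounded_by_integrable_imp_absolutely_integrable[OF assms(2) _ B])
      (use assms(3) in auto)
  hence "h integrable_on {0<..T}" by (rule set_lebesgue_integral_eq_integral(1))
  hence "h integrable_on insert 0 {0<..T}" by (simp add: integrable_on_insert_iff)
  thus ?thesis unfolding eq .
qed

lemma continuous_times_bounded_measurable_integrable:
  fixes h k :: "real \<Rightarrow> real"
  assumes T: "T > 0" and h: "continuous_on {0..T} h"
    and k: "k \<in> borel_measurable (lebesgue_on {0<..T})" "\<And>t. t \<in> {0<..T} \<Longrightarrow> \<bar>k t\<bar> \<le> B"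
  shows "(\<lambda>t. h t * k t) integrable_on {0..T}"
proof -
  have "compact (h ` {0..T})" by (rule compact_continuous_image[OF h]) simp
  hence "bounded (h ` {0..T})" by (rule compact_imp_bounded)
  then obtain A where A: "\<And>t. t \<in> {0..T} \<Longrightarrow> \<bar>h t\<bar> \<le> A" by (metis bounded_iff image_eqI real_norm_def)
  show ?thesis
  proof (rule bounded_measurable_integrable[OF T, where B = "\<bar>A\<bar> * \<bar>B\<bar>"])
    have "h \<in> borel_measurable (lebesgue_on {0<..T})"
      by (rule continuous_imp_measurable_on_sets_lebesgue) (auto intro: continuous_on_subset[OF h])
    thus "(\<lambda>t. h t * k t) \<in> borel_measurable (lebesgue_on {0<..T})"
      by (intro borel_measurable_times k)
    fix t assume t: "t \<in> {0<..T}"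
    show "\<bar>h t * k t\<bar> \<le> \<bar>A\<bar> * \<bar>B\<bar>"
      unfolding abs_mult using k(2)[OF t] A[of t] t by (intro mult_mono) auto
  qed
qed

subsection \<open>The right-hand side and the averaged Jacobian\<close>

context
  fixes D :: mesh and f :: "rvec \<Rightarrow> real \<Rightarrow> rvec" and u0 :: rvec and u :: "real \<Rightarrow> rvec"
    and N :: nat and T :: real
  assumes mesh: "is_mesh D" and ivp: "ivp D f u0 u"
    and N_def: "N = ncomp D" and T_def: "T = horizon D"
begin

lemma T_pos: "T > 0" using mesh by (simp add: is_mesh_def T_def)

lemma f_C1: "i < N \<Longrightarrow> t \<in> {0<..T} \<Longrightarrow> Ck_space N 1 (\<lambda>x. f x t i)"
  using ivp by (simp add: ivp_def Let_def N_def T_def)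

lemma f_bounded: "\<exists>B. \<forall>i<N. \<forall>x. \<forall>t\<in>{0<..T}. \<bar>f x t i\<bar> \<le> B"
proof -
  have "\<exists>B. \<forall>x. \<forall>t\<in>{0<..T}. L2_set (f x t) {..<N} \<le> B"
    using ivp by (simp only: ivp_def Let_def N_def T_def)
  then obtain B where B: "\<And>x t. t \<in> {0<..T} \<Longrightarrow> L2_set (f x t) {..<N} \<le> B" by blast
  show ?thesis
  proof (intro exI allI ballI impI)
    fix i x t assume i: "i < N" and t: "t \<in> {0<..T}"
    have "\<bar>f x t i\<bar> \<le> L2_set (\<lambda>i. \<bar>f x t i\<bar>) {..<N}" using i by (intro member_le_L2_set) auto
    also have "\<dots> = L2_set (f x t) {..<N}" by (simp add: L2_set_def)
    finally show "\<bar>f x t i\<bar> \<le> B" using B[OF t] by (rule order.trans)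
  qed
qed

lemma f_lipschitz:
  "\<exists>L\<ge>0. \<forall>i<N. \<forall>x y. \<forall>t\<in>{0<..T}. \<bar>f x t i - f y t i\<bar> \<le> L * (\<Sum>l<N. \<bar>x l - y l\<bar>)"
proof -
  have "\<exists>L. \<forall>x y. \<forall>t\<in>{0<..T}.
      L2_set (\<lambda>i. f x t i - f y t i) {..<N} \<le> L * L2_set (\<lambda>i. x i - y i) {..<N}"
    using ivp by (simp only: ivp_def Let_def N_def T_def)
  then obtain L where L: "\<And>x y t. t \<in> {0<..T} \<Longrightarrow>
      L2_set (\<lambda>i. f x t i - f y t i) {..<N} \<le> L * L2_set (\<lambda>i. x i - y i) {..<N}" by blast
  show ?thesis
  proof (intro exI[of _ "\<bar>L\<bar>"] conjI allI ballI impI)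
    fix i x y t assume i: "i < N" and t: "t \<in> {0<..T}"
    have "\<bar>f x t i - f y t i\<bar> \<le> L2_set (\<lambda>i. \<bar>f x t i - f y t i\<bar>) {..<N}"
      using i by (intro member_le_L2_set) auto
    also have "\<dots> = L2_set (\<lambda>i. f x t i - f y t i) {..<N}" by (simp add: L2_set_def)
    also have "\<dots> \<le> L * L2_set (\<lambda>i. x i - y i) {..<N}" using L[OF t] .
    also have "\<dots> \<le> \<bar>L\<bar> * (\<Sum>l<N. \<bar>x l - y l\<bar>)"
      by (intro mult_mono L2_set_le_sum_abs) auto
    finally show "\<bar>f x t i - f y t i\<bar> \<le> \<bar>L\<bar> * (\<Sum>l<N. \<bar>x l - y l\<bar>)" .
  qed simp
qed

lemma f_depends:
  assumes i: "i < N" and t: "t \<in> {0<..T}"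
  shows "depends_on_first N (\<lambda>x. f x t i)"
  unfolding depends_on_first_def
proof (intro allI impI)
  fix x y :: rvec assume xy: "\<forall>i<N. x i = y i"
  obtain L where L: "\<And>i x y t. i < N \<Longrightarrow> t \<in> {0<..T} \<Longrightarrow>
      \<bar>f x t i - f y t i\<bar> \<le> L * (\<Sum>l<N. \<bar>x l - y l\<bar>)" using f_lipschitz by blast
  have "(\<Sum>l<N. \<bar>x l - y l\<bar>) = 0" using xy by simp
  with L[OF i t, of x y] show "f x t i = f y t i" by simp
qed

lemma partial_f_bounded:
  "\<exists>L\<ge>0. \<forall>i<N. \<forall>l<N. \<forall>x. \<forall>t\<in>{0<..T}. \<bar>partial l (\<lambda>z. f z t i) x\<bar> \<le> L"
proof -
  obtain L where L: "L \<ge> 0" "\<And>i x y t. i < N \<Longrightarrow> t \<in> {0<..T} \<Longrightarrow>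
      \<bar>f x t i - f y t i\<bar> \<le> L * (\<Sum>l<N. \<bar>x l - y l\<bar>)" using f_lipschitz by blast
  show ?thesis
  proof (intro exI[of _ L] conjI allI ballI impI L(1))
    fix i l x t assume i: "i < N" and l: "l < N" and t: "t \<in> {0<..T}"
    have "((\<lambda>h. f (x(l := h)) t i) has_real_derivative partial l (\<lambda>z. f z t i) x) (at (x l))"
      using Ck_space_has_partial[of N 0 "\<lambda>z. f z t i" l x "x l"] f_C1[OF i t] l by simp
    hence "((\<lambda>h. \<bar>(f (x(l := h)) t i - f x t i) / (h - x l)\<bar>) \<longlongrightarrow> \<bar>partial l (\<lambda>z. f z t i) x\<bar>) (at (x l))"
      unfolding has_field_derivative_iff by (intro tendsto_rabs) simp
    moreover have "eventually (\<lambda>h. \<bar>(f (x(l := h)) t i - f x t i) / (h - x l)\<bar> \<le> L) (at (x l))"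
      unfolding eventually_at_filter
    proof (intro always_eventually allI impI)
      fix h assume h: "h \<noteq> x l"
      have "(\<Sum>m<N. \<bar>(x(l := h)) m - x m\<bar>) = (\<Sum>m<N. if m = l then \<bar>h - x l\<bar> else 0)"
        by (intro sum.cong) auto
      also have "\<dots> = \<bar>h - x l\<bar>" using l by simp
      finally have "\<bar>f (x(l := h)) t i - f x t i\<bar> \<le> L * \<bar>h - x l\<bar>"
        using L(2)[OF i t, of "x(l := h)" x] by simp
      thus "\<bar>(f (x(l := h)) t i - f x t i) / (h - x l)\<bar> \<le> L"
        using h by (simp add: pos_divide_le_eq)
    qed
    ultimately show "\<bar>partial l (\<lambda>z. f z t i) x\<bar> \<le> L"
      using tendsto_upperbound trivial_limit_at by blast
  qed
qed

lemma f_along_measurable: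
  assumes i: "i < N" and x: "\<And>i. i < N \<Longrightarrow> continuous_on {0..T} (\<lambda>t. x t i)"
  shows "(\<lambda>t. f (x t) t i) \<in> borel_measurable (lebesgue_on {0<..T})"
proof (rule caratheodory_measurable[OF T_pos, where N = N and h = "\<lambda>x t. f x t i"])
  show "(\<lambda>t. f x t i) \<in> borel_measurable (lebesgue_on {0<..T})" for x
    using ivp i by (simp add: ivp_def Let_def N_def T_def)
qed (use f_depends i x Ck_space_continuous[OF f_C1[OF i]] in auto)

lemma partial_f_along_measurable:
  assumes i: "i < N" and l: "l < N" and x: "\<And>i. i < N \<Longrightarrow> continuous_on {0..T} (\<lambda>t. x t i)"
  shows "(\<lambda>t. partial l (\<lambda>z. f z t i) (x t)) \<in> borel_measurable (lebesgue_on {0<..T})"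
proof (rule caratheodory_measurable[OF T_pos, where N = N and h = "\<lambda>x t. partial l (\<lambda>z. f z t i) x"])
  fix x
  show "(\<lambda>t. partial l (\<lambda>z. f z t i) x) \<in> borel_measurable (lebesgue_on {0<..T})"
  proof (rule borel_measurable_LIMSEQ_real[where
      u = "\<lambda>m t. (f (x(l := x l + inverse (real (Suc m)))) t i - f x t i) / inverse (real (Suc m))"])
    let ?d = "\<lambda>m. inverse (real (Suc m))"
    show "(\<lambda>t. (f (x(l := x l + ?d m)) t i - f x t i) / ?d m) \<in> borel_measurable (lebesgue_on {0<..T})" for m
    proof -
      have "(\<lambda>t. f x t i) \<in> borel_measurable (lebesgue_on {0<..T})" for x
        using ivp i by (simp add: ivp_def Let_def N_def T_def)
      thus ?thesis by (intro borel_measurable_divide borel_measurable_diff borel_measurable_const)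
    qed
    fix t assume "t \<in> space (lebesgue_on {0<..T})"
    hence t: "t \<in> {0<..T}" by (simp add: space_restrict_space)
    have "((\<lambda>h. f (x(l := h)) t i) has_real_derivative partial l (\<lambda>z. f z t i) x) (at (x l))"
      using Ck_space_has_partial[of N 0 "\<lambda>z. f z t i" l x "x l"] f_C1[OF i t] l by simp
    hence "((\<lambda>h. (f (x(l := x l + h)) t i - f x t i) / h) \<longlongrightarrow> partial l (\<lambda>z. f z t i) x) (at 0)"
      by (simp add: DERIV_def)
    moreover have "filterlim (\<lambda>m. ?d m) (at 0) sequentially"
      unfolding filterlim_at using LIMSEQ_inverse_real_of_nat by auto
    ultimately show "(\<lambda>m. (f (x(l := x l + ?d m)) t i - f x t i) / ?d m) \<longlonglongrightarrow> partial l (\<lambda>z. f z t i) x"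
      by (rule filterlim_compose)
  qed
next
  fix t assume t: "t \<in> {0<..T}"
  show "continuous_on UNIV (\<lambda>x. partial l (\<lambda>z. f z t i) x)"
    using Ck_space_continuous[OF Ck_space_partial[of N 0 "\<lambda>z. f z t i" l]] f_C1[OF i t] l by simp
  show "depends_on_first N (\<lambda>x. partial l (\<lambda>z. f z t i) x)"
    using depends_partial[OF f_depends[OF i t] l] .
qed (use x in auto)

lemma partial_f_segment_continuous:
  assumes i: "i < N" and l: "l < N" and t: "t \<in> {0<..T}"
  shows "continuous_on A (\<lambda>s. partial l (\<lambda>z. f z t i) (\<lambda>r. s * a r + (1 - s) * b r))"
proof (rule continuous_on_compose2[where g = "\<lambda>x. partial l (\<lambda>z. f z t i) x"])
  show "continuous_on UNIV (\<lambda>x. partial l (\<lambda>z. f z t i) x)"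
    using Ck_space_continuous[OF Ck_space_partial[of N 0 "\<lambda>z. f z t i" l]] f_C1[OF i t] l by simp
qed (auto intro!: continuous_intros continuous_on_coordinatewise_then_product)

lemma Jac_measurable:
  assumes i: "i < N" and l: "l < N" and x: "\<And>i. i < N \<Longrightarrow> continuous_on {0..T} (\<lambda>t. x t i)"
    and y: "\<And>i. i < N \<Longrightarrow> continuous_on {0..T} (\<lambda>t. y t i)"
  shows "(\<lambda>t. Jac f x y t i l) \<in> borel_measurable (lebesgue_on {0<..T})"
  unfolding Jac_def
proof (rule borel_measurable_LIMSEQ_real[where u = "\<lambda>m t. (\<Sum>j<Suc m. partial l (\<lambda>z. f z t i)
    (\<lambda>r. real j / real (Suc m) * x t r + (1 - real j / real (Suc m)) * y t r)) / real (Suc m)"])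
  let ?h = "\<lambda>s t. partial l (\<lambda>z. f z t i) (\<lambda>r. s * x t r + (1 - s) * y t r)"
  fix t assume "t \<in> space (lebesgue_on {0<..T})"
  hence t: "t \<in> {0<..T}" by (simp add: space_restrict_space)
  show "(\<lambda>m. (\<Sum>j<Suc m. ?h (real j / real (Suc m)) t) / real (Suc m)) \<longlonglongrightarrow> integral {0..1} (\<lambda>s. ?h s t)"
    by (rule riemann_sums) (rule partial_f_segment_continuous[OF i l t])
next
  fix m
  show "(\<lambda>t. (\<Sum>j<Suc m. partial l (\<lambda>z. f z t i) (\<lambda>r. real j / real (Suc m) * x t r + (1 - real j / real (Suc m)) * y t r)) / real (Suc m))
      \<in> borel_measurable (lebesgue_on {0<..T})"
    by (intro borel_measurable_divide borel_measurable_sum borel_measurable_const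
        partial_f_along_measurable i l continuous_intros x y)
qed

lemma Jac_bounded:
  "\<exists>L\<ge>0. \<forall>i<N. \<forall>l<N. \<forall>x y. \<forall>t\<in>{0<..T}. \<bar>Jac f x y t i l\<bar> \<le> L"
proof -
  obtain L where L: "L \<ge> 0" "\<And>i l x t. i < N \<Longrightarrow> l < N \<Longrightarrow> t \<in> {0<..T} \<Longrightarrow>
      \<bar>partial l (\<lambda>z. f z t i) x\<bar> \<le> L" using partial_f_bounded by blast
  show ?thesis
  proof (intro exI[of _ L] conjI allI ballI impI L(1))
    fix i l x y t assume i: "i < N" and l: "l < N" and t: "t \<in> {0<..T}"
    have "norm (Jac f x y t i l) \<le> L * (1 - 0)"
      unfolding Jac_def by (rule integral_bound) (auto intro!: partial_f_segment_continuous i l t L(2))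
    thus "\<bar>Jac f x y t i l\<bar> \<le> L" by simp
  qed
qed

lemma Jac_mean_value:
  assumes i: "i < N" and t: "t \<in> {0<..T}"
  shows "f (x t) t i - f (y t) t i = (\<Sum>l<N. Jac f x y t i l * (x t l - y t l))"
proof -
  let ?p = "\<lambda>s r. s * x t r + (1 - s) * y t r"
  have "((\<lambda>s. \<Sum>l<N. partial l (\<lambda>z. f z t i) (?p s) * (x t l - y t l)) has_integral
      (f (?p 1) t i - f (?p 0) t i)) {0..1}"
  proof (rule fundamental_theorem_of_calculus)
    fix s :: real
    show "((\<lambda>s. f (?p s) t i) has_vector_derivative
        (\<Sum>l<N. partial l (\<lambda>z. f z t i) (?p s) * (x t l - y t l))) (at s within {0..1})"
      unfolding has_real_derivative_iff_has_vector_derivative[symmetric]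
      by (rule chain_rule[OF f_depends[OF i t] f_C1[OF i t]]) (auto intro!: derivative_eq_intros)
  qed simp
  moreover have "((\<lambda>s. \<Sum>l<N. partial l (\<lambda>z. f z t i) (?p s) * (x t l - y t l)) has_integral
      (\<Sum>l<N. Jac f x y t i l * (x t l - y t l))) {0..1}"
    unfolding Jac_def
    by (intro has_integral_sum has_integral_mult_left integrable_integral integrable_continuous_real
        partial_f_segment_continuous i t) auto
  ultimately have "f (?p 1) t i - f (?p 0) t i = (\<Sum>l<N. Jac f x y t i l * (x t l - y t l))"
    by (rule has_integral_unique)
  thus ?thesis by simp
qed

end

section \<open>Partitions\<close>

lemma increasing_sequence_le:
  fixes x :: "nat \<Rightarrow> real"
  assumes "\<And>j. j \<in> {1..n} \<Longrightarrow> x (j - 1) < x j" "i \<le> j" "j \<le> n"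
  shows "x i \<le> x j"
  using assms(2,3)
proof (induction rule: dec_induct)
  case (step m)
  thus ?case using assms(1)[of "Suc m"] by force
qed simp

lemma partition_index:
  fixes x :: "nat \<Rightarrow> real"
  assumes inc: "\<And>j. j \<in> {1..n} \<Longrightarrow> x (j - 1) < x j" and t: "t \<in> {x 0<..x n}"
  shows "\<exists>!j. j \<in> {1..n} \<and> t \<in> {x (j - 1)<..x j}"
proof -
  define j where "j = (LEAST j. t \<le> x j)"
  have "t \<le> x n" using t by simp
  hence j: "t \<le> x j" "j \<le> n" unfolding j_def by (auto intro: LeastI Least_le)
  have j1: "j \<noteq> 0" using j(1) t by (cases "j = 0") auto
  have "\<not> t \<le> x (j - 1)" using j1 not_less_Least[of "j - 1" "\<lambda>j. t \<le> x j"] by (simp add: j_def)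
  hence "j \<in> {1..n} \<and> t \<in> {x (j - 1)<..x j}" using j j1 by auto
  moreover have "i = j'" if i: "i \<in> {1..n} \<and> t \<in> {x (i - 1)<..x i}"
    and j': "j' \<in> {1..n} \<and> t \<in> {x (j' - 1)<..x j'}" for i j'
  proof (rule ccontr)
    assume "i \<noteq> j'"
    then consider "i \<le> j' - 1" | "j' \<le> i - 1" by linarith
    thus False
    proof cases
      case 1
      hence "x i \<le> x (j' - 1)" using j' inc by (intro increasing_sequence_le[of n x]) auto
      thus False using i j' by auto
    next
      case 2
      hence "x j' \<le> x (i - 1)" using i inc by (intro increasing_sequence_le[of n x]) auto
      thus False using i j' by auto
    qed
  qed
  ultimately show ?thesis by blast
qed

lemma has_integral_partition':
  fixes h :: "real \<Rightarrow> real" and x :: "nat \<Rightarrow> real"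
  assumes inc: "\<And>j. j \<in> {1..n} \<Longrightarrow> x (j - 1) < x j"
    and I: "\<And>j. j \<in> {1..n} \<Longrightarrow> (h has_integral I j) {x (j - 1)..x j}"
  shows "(h has_integral (\<Sum>j=1..n. I j)) {x 0..x n}"
proof -
  have "(h has_integral (\<Sum>j<n. I (Suc j))) {x 0..x n}"
  proof (rule conjunct2[OF has_integral_partition])
    fix j assume "j < n"
    thus "x j \<le> x (Suc j)" "(h has_integral I (Suc j)) {x j..x (Suc j)}"
      using inc[of "Suc j"] I[of "Suc j"] by auto
  qed
  also have "(\<Sum>j<n. I (Suc j)) = (\<Sum>j=1..n. I j)"
    by (rule sum.reindex_bij_witness[of _ "\<lambda>j. j - 1" Suc]) auto
  finally show ?thesis .
qed

lemma continuous_on_partition: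
  fixes h :: "real \<Rightarrow> real" and x :: "nat \<Rightarrow> real"
  assumes inc: "\<And>j. j \<in> {1..n} \<Longrightarrow> x (j - 1) < x j"
    and c: "\<And>j. j \<in> {1..n} \<Longrightarrow> continuous_on {x (j - 1)..x j} h"
  shows "continuous_on {x 0..x n} h"
  using assms
proof (induction n)
  case (Suc n)
  hence "continuous_on {x 0..x n} h" by auto
  moreover have "continuous_on {x n..x (Suc n)} h" using Suc.prems(2)[of "Suc n"] by auto
  moreover have "x 0 \<le> x n" using Suc.prems(1) by (intro increasing_sequence_le[of "Suc n" x]) auto
  moreover have "x n \<le> x (Suc n)" using Suc.prems(1)[of "Suc n"] by auto
  ultimately show ?case
    using continuous_on_closed_Un[of "{x 0..x n}" "{x n..x (Suc n)}" h] by (simp add: ivl_disj_un_two_touch)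
qed auto

lemma eq_on_closure_interval:
  fixes h k :: "real \<Rightarrow> real"
  assumes "a < b" "continuous_on {a..b} h" "continuous_on {a..b} k" "\<And>t. t \<in> {a<..b} \<Longrightarrow> h t = k t" "t \<in> {a..b}"
  shows "h t = k t"
proof -
  have cl: "closure {a<..b} = {a..b}" using assms(1) by simp
  have "continuous_on {a..b} (\<lambda>t. h t - k t)" by (intro continuous_intros assms)
  hence "h t - k t = 0"
    by (intro continuous_constant_on_closure[of "{a<..b}" "\<lambda>t. h t - k t" 0 t])
      (simp_all only: cl assms(4,5) diff_self)
  thus ?thesis by simp
qed

lemma integral_sum_diff:
  fixes A B :: "nat \<Rightarrow> real \<Rightarrow> real"
  assumes "\<And>i. i < n \<Longrightarrow> A i integrable_on S" "\<And>i. i < n \<Longrightarrow> B i integrable_on S"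
  shows "integral S (\<lambda>t. \<Sum>i<n. A i t - B i t) = (\<Sum>i<n. integral S (A i)) - (\<Sum>i<n. integral S (B i))"
proof -
  have "integral S (\<lambda>t. \<Sum>i<n. A i t - B i t) = (\<Sum>i<n. integral S (\<lambda>t. A i t - B i t))"
    by (rule integral_sum) (auto intro!: integrable_diff assms)
  also have "\<dots> = (\<Sum>i<n. integral S (A i) - integral S (B i))"
    by (intro sum.cong refl integral_diff) (auto intro!: assms)
  finally show ?thesis by (simp add: sum_subtractf)
qed

locale galerkin =
  fixes D :: mesh and f :: "rvec \<Rightarrow> real \<Rightarrow> rvec" and u0 \<psi> :: rvec and u U piu g \<Phi> :: "real \<Rightarrow> rvec"
  assumes galerkin: "mcG_setup D f u0 u U piu \<psi> g \<Phi>"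
begin

abbreviation "N \<equiv> ncomp D"
abbreviation "T \<equiv> horizon D"

lemma mesh: "is_mesh D" and ivp: "ivp D f u0 u" and smooth_u: "cellwise_smooth D u"
  and mcG: "mcG_solution D f u0 U" and interp: "cG_interpolant D u piu"
  and dual: "mcG_dual_solution D f piu U \<psi> g \<Phi>"
  and g_integrable: "i < N \<Longrightarrow> (\<lambda>t. g t i) absolutely_integrable_on {0..T}"
  using galerkin by (auto simp: mcG_setup_def)

lemma N_pos: "N \<ge> 1" and T_pos: "T > 0" using mesh by (auto simp: is_mesh_def)

lemma integral_0T:
  fixes h :: "real \<Rightarrow> real"
  shows "integral {0<..T} h = integral {0..T} h"
proof -
  have "{0..T} = insert 0 {0<..T}" using T_pos by auto
  thus ?thesis by (intro integral_spike_set) (auto intro: negligible_subset[of "{0}"])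
qed

lemma node_less: "i < N \<Longrightarrow> j \<in> {1..ncells D i} \<Longrightarrow> node D i (j - 1) < node D i j"
  and deg_ge1: "i < N \<Longrightarrow> j \<in> {1..ncells D i} \<Longrightarrow> deg D i j \<ge> 1"
  and node_0: "i < N \<Longrightarrow> node D i 0 = 0"
  and node_T: "i < N \<Longrightarrow> node D i (ncells D i) = T"
  using mesh by (auto simp: is_mesh_def)

lemma node_le: "i < N \<Longrightarrow> j \<le> j' \<Longrightarrow> j' \<le> ncells D i \<Longrightarrow> node D i j \<le> node D i j'"
  by (rule increasing_sequence_le[of "ncells D i"]) (blast intro: node_less)+

lemma node_bounds: "i < N \<Longrightarrow> j \<le> ncells D i \<Longrightarrow> node D i j \<in> {0..T}"
  using node_le[of i 0 j] node_le[of i j "ncells D i"] node_0 node_T by auto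

lemma cell_closed_subset: "i < N \<Longrightarrow> j \<in> {1..ncells D i} \<Longrightarrow> {node D i (j - 1)..node D i j} \<subseteq> {0..T}"
  using node_bounds[of i j] node_bounds[of i "j - 1"] by (auto simp: le_diff_conv)

lemma cell_subset: "i < N \<Longrightarrow> j \<in> {1..ncells D i} \<Longrightarrow> cell D i j \<subseteq> {0<..T}"
  using node_bounds[of i j] node_bounds[of i "j - 1"] by (fastforce simp: cell_def le_diff_conv)

lemma cell_at_unique:
  assumes "i < N" "t \<in> {0<..T}"
  shows "\<exists>!j. j \<in> {1..ncells D i} \<and> t \<in> cell D i j"
  unfolding cell_def
  using partition_index[of "ncells D i" "node D i" t] node_less node_0 node_T assms by simp

lemma cell_at:
  assumes "i < N" "t \<in> {0<..T}"
  shows "cell_at D i t \<in> {1..ncells D i}" "t \<in> cell D i (cell_at D i t)"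
  using theI'[OF cell_at_unique[OF assms]] unfolding cell_at_def by auto

lemma cell_at_eq:
  assumes "i < N" "j \<in> {1..ncells D i}" "t \<in> cell D i j"
  shows "cell_at D i t = j"
proof -
  have "t \<in> {0<..T}" using cell_subset assms by blast
  thus ?thesis unfolding cell_at_def by (intro the1_equality cell_at_unique) (use assms in auto)
qed

lemma has_integral_cells:
  fixes h :: "real \<Rightarrow> real"
  assumes "i < N" "\<And>j. j \<in> {1..ncells D i} \<Longrightarrow> (h has_integral I j) {node D i (j - 1)..node D i j}"
  shows "(h has_integral (\<Sum>j=1..ncells D i. I j)) {0..T}"
  using has_integral_partition'[of "ncells D i" "node D i" h I] node_less node_0 node_T assms by simp

lemma integrable_cells:
  fixes h :: "real \<Rightarrow> real"
  assumes "i < N" "\<And>j. j \<in> {1..ncells D i} \<Longrightarrow> h integrable_on {node D i (j - 1)..node D i j}"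
  shows "h integrable_on {0..T}"
    "integral {0..T} h = (\<Sum>j=1..ncells D i. integral {node D i (j - 1)..node D i j} h)"
  using has_integral_cells[of i h "\<lambda>j. integral {node D i (j - 1)..node D i j} h"] assms
  by (auto intro: integrable_integral simp: integral_unique has_integral_integrable)

definition nodes :: "real set" where "nodes = (\<Union>i<N. node D i ` {..ncells D i})"

lemma finite_nodes: "finite nodes" by (simp add: nodes_def)

lemma node_in_nodes: "i < N \<Longrightarrow> j \<le> ncells D i \<Longrightarrow> node D i j \<in> nodes" by (auto simp: nodes_def)

lemma cell_interior:
  assumes "i < N" "t \<in> {0<..<T} - nodes" "j = cell_at D i t"
  shows "j \<in> {1..ncells D i}" "t \<in> {node D i (j - 1)<..<node D i j}"
proof -
  have t: "t \<in> {0<..T}" using assms by auto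
  show j: "j \<in> {1..ncells D i}" using cell_at(1)[OF assms(1) t] assms by simp
  have "t \<noteq> node D i j" using node_in_nodes[of i j] assms j by auto
  thus "t \<in> {node D i (j - 1)<..<node D i j}"
    using cell_at(2)[OF assms(1) t] assms(3) by (auto simp: cell_def)
qed

lemma trial_space_poly:
  assumes "v \<in> trial_space D" "i < N" "j \<in> {1..ncells D i}"
  obtains p :: "real poly" where "degree p \<le> deg D i j"
    "\<And>t. t \<in> {node D i (j - 1)..node D i j} \<Longrightarrow> v t i = poly p t"
proof -
  obtain p :: "real poly" where p: "degree p \<le> deg D i j" "\<And>t. t \<in> cell D i j \<Longrightarrow> v t i = poly p t"
    using assms unfolding trial_space_def poly_on_def by blast
  have "continuous_on {0..T} (\<lambda>t. v t i)" using assms by (simp add: trial_space_def)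
  hence c: "continuous_on {node D i (j - 1)..node D i j} (\<lambda>t. v t i)"
    by (rule continuous_on_subset) (rule cell_closed_subset[OF assms(2,3)])
  show ?thesis
  proof (rule that[OF p(1)])
    fix t assume t: "t \<in> {node D i (j - 1)..node D i j}"
    show "v t i = poly p t"
      by (rule eq_on_closure_interval[OF node_less[OF assms(2,3)] c continuous_on_poly_real p(2) t])
        (simp add: cell_def)
  qed
qed

lemma U_trial: "U \<in> trial_space D" using mcG by (simp add: mcG_solution_def)

lemma U_cont: "i < N \<Longrightarrow> continuous_on {0..T} (\<lambda>t. U t i)"
  using U_trial by (simp add: trial_space_def)

lemma u_cont: "i < N \<Longrightarrow> continuous_on {0..T} (\<lambda>t. u t i)"
  using ivp by (simp add: ivp_def Let_def)

lemma piu_interp: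
  "i < N \<Longrightarrow> j \<in> {1..ncells D i} \<Longrightarrow>
     cG_interp (deg D i j) (node D i (j - 1)) (node D i j) (\<lambda>t. u t i) (\<lambda>t. piu t i)"
  using interp by (simp add: cG_interpolant_def)

lemma piu_cont: "i < N \<Longrightarrow> continuous_on {0..T} (\<lambda>t. piu t i)"
proof -
  assume i: "i < N"
  have "continuous_on {node D i 0..node D i (ncells D i)} (\<lambda>t. piu t i)"
  proof (rule continuous_on_partition)
    fix j assume j: "j \<in> {1..ncells D i}"
    obtain p :: "real poly" where p: "\<And>t. t \<in> {node D i (j - 1)..node D i j} \<Longrightarrow> poly p t = piu t i"
      using piu_interp[OF i j] unfolding cG_interp_def poly_on_def by metis
    show "continuous_on {node D i (j - 1)..node D i j} (\<lambda>t. piu t i)"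
      by (rule continuous_on_eq[OF continuous_on_poly_real p])
  qed (use i node_less in auto)
  thus ?thesis using node_0 node_T i by simp
qed

lemma piu_trial: "piu \<in> trial_space D"
  unfolding trial_space_def
proof (intro CollectI allI impI conjI ballI piu_cont)
  fix i j assume i: "i < N" and j: "j \<in> {1..ncells D i}"
  have "poly_on (deg D i j) {node D i (j - 1)..node D i j} (\<lambda>t. piu t i)"
    using piu_interp[OF i j] by (simp add: cG_interp_def)
  then obtain p :: "real poly" where p: "degree p \<le> deg D i j"
    "\<forall>t\<in>{node D i (j - 1)..node D i j}. piu t i = poly p t" unfolding poly_on_def by blast
  show "poly_on (deg D i j) (cell D i j) (\<lambda>t. piu t i)"
    unfolding poly_on_def
  proof (intro exI[of _ p] conjI ballI p(1))
    fix t assume "t \<in> cell D i j"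
    hence "t \<in> {node D i (j - 1)..node D i j}" by (simp add: cell_def)
    thus "piu t i = poly p t" using p(2) by blast
  qed
qed

definition err :: "real \<Rightarrow> rvec" where "err t i = U t i - piu t i"

lemma err_trial: "err \<in> trial_space D"
  unfolding trial_space_def
proof (intro CollectI allI impI conjI ballI)
  fix i assume i: "i < N"
  show "continuous_on {0..T} (\<lambda>t. err t i)"
    unfolding err_def by (intro continuous_intros U_cont piu_cont i)
  fix j assume j: "j \<in> {1..ncells D i}"
  obtain p where p: "degree p \<le> deg D i j" "\<And>t. t \<in> {node D i (j - 1)..node D i j} \<Longrightarrow> U t i = poly p t"
    using trial_space_poly[OF U_trial i j] by blast
  obtain r where r: "degree r \<le> deg D i j" "\<And>t. t \<in> {node D i (j - 1)..node D i j} \<Longrightarrow> piu t i = poly r t"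
    using trial_space_poly[OF piu_trial i j] by blast
  show "poly_on (deg D i j) (cell D i j) (\<lambda>t. err t i)"
    unfolding poly_on_def err_def
  proof (intro exI[of _ "p - r"] conjI ballI)
    show "degree (p - r) \<le> deg D i j" using p r by (simp add: degree_diff_le)
    fix t assume "t \<in> cell D i j"
    hence "t \<in> {node D i (j - 1)..node D i j}" by (simp add: cell_def)
    thus "U t i - piu t i = poly (p - r) t" using p(2) r(2) by simp
  qed
qed

lemma err_0: "i < N \<Longrightarrow> err 0 i = 0"
proof -
  assume i: "i < N"
  have 1: "1 \<in> {1..ncells D i}" using i mesh by (auto simp: is_mesh_def)
  have "piu 0 i = u 0 i" using piu_interp[OF i 1] node_0[OF i] by (simp add: cG_interp_def)
  moreover have "u 0 i = u0 i" using ivp i by (simp add: ivp_def Let_def)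
  moreover have "U 0 i = u0 i" using mcG i by (simp add: mcG_solution_def)
  ultimately show ?thesis by (simp add: err_def)
qed

lemma \<Phi>_poly:
  assumes "i < N" "j \<in> {1..ncells D i}"
  obtains p :: "real poly" where "degree p \<le> deg D i j - 1" "\<And>t. t \<in> cell D i j \<Longrightarrow> \<Phi> t i = poly p t"
proof -
  have "\<Phi> \<in> test_space D" using dual by (simp add: mcG_dual_solution_def)
  thus ?thesis using assms that unfolding test_space_def poly_on_def by blast
qed

lemma \<Phi>_bounded: "\<exists>B\<ge>0. \<forall>i<N. \<forall>t\<in>{0<..T}. \<bar>\<Phi> t i\<bar> \<le> B"
proof -
  have "\<exists>B\<ge>0. \<forall>t\<in>cell D i j. \<bar>\<Phi> t i\<bar> \<le> B" if ij: "i < N" "j \<in> {1..ncells D i}" for i j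
  proof -
    obtain p where p: "\<And>t. t \<in> cell D i j \<Longrightarrow> \<Phi> t i = poly p t" using \<Phi>_poly[OF ij] by blast
    obtain x where "\<And>s. s \<in> {node D i (j - 1)..node D i j} \<Longrightarrow> \<bar>poly p s\<bar> \<le> \<bar>poly p x\<bar>"
      using poly_max_on_interval[OF node_less[OF ij]] by blast
    thus ?thesis using p by (intro exI[of _ "\<bar>poly p x\<bar>"]) (auto simp: cell_def)
  qed
  then obtain B where B: "\<And>i j. i < N \<Longrightarrow> j \<in> {1..ncells D i} \<Longrightarrow> B i j \<ge> 0"
    "\<And>i j t. i < N \<Longrightarrow> j \<in> {1..ncells D i} \<Longrightarrow> t \<in> cell D i j \<Longrightarrow> \<bar>\<Phi> t i\<bar> \<le> B i j" by metis
  show ?thesis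
  proof (intro exI[of _ "\<Sum>i<N. \<Sum>j=1..ncells D i. B i j"] conjI allI impI ballI)
    show "0 \<le> (\<Sum>i<N. \<Sum>j=1..ncells D i. B i j)" by (intro sum_nonneg B) auto
    fix i t assume i: "i < N" and t: "t \<in> {0<..T}"
    have "\<bar>\<Phi> t i\<bar> \<le> B i (cell_at D i t)" using B(2)[OF i] cell_at[OF i t] by blast
    also have "\<dots> \<le> (\<Sum>j=1..ncells D i. B i j)"
      using cell_at(1)[OF i t] i by (intro member_le_sum B(1)) auto
    also have "\<dots> \<le> (\<Sum>i<N. \<Sum>j=1..ncells D i. B i j)"
      using i by (intro member_le_sum[of i "{..<N}" "\<lambda>i. \<Sum>j=1..ncells D i. B i j"] sum_nonneg B(1)) auto
    finally show "\<bar>\<Phi> t i\<bar> \<le> (\<Sum>i<N. \<Sum>j=1..ncells D i. B i j)" .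
  qed
qed

lemma \<Phi>_measurable:
  assumes i: "i < N" shows "(\<lambda>t. \<Phi> t i) \<in> borel_measurable (lebesgue_on {0<..T})"
proof -
  have "(\<lambda>t. \<Phi> t i) integrable_on {0..T}"
  proof (rule integrable_cells(1)[OF i])
    fix j assume j: "j \<in> {1..ncells D i}"
    obtain p where p: "\<And>t. t \<in> cell D i j \<Longrightarrow> \<Phi> t i = poly p t" using \<Phi>_poly[OF i j] by blast
    have "poly p integrable_on {node D i (j - 1)..node D i j}"
      by (intro integrable_continuous_real continuous_intros)
    thus "(\<lambda>t. \<Phi> t i) integrable_on {node D i (j - 1)..node D i j}"
      by (rule integrable_spike_finite[where S = "{node D i (j - 1)}", rotated 2])
        (auto simp: cell_def intro!: p)
  qed
  hence "(\<lambda>t. \<Phi> t i) \<in> borel_measurable (lebesgue_on {0..T})"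
    by (rule integrable_imp_measurable)
  thus ?thesis by (rule measurable_restrict_mono) auto
qed

lemma f_\<Phi>_integrable:
  assumes i: "i < N" and x: "\<And>i. i < N \<Longrightarrow> continuous_on {0..T} (\<lambda>t. x t i)"
  shows "(\<lambda>t. f (x t) t i * \<Phi> t i) integrable_on {0..T}"
proof -
  obtain B where B: "B \<ge> 0" "\<And>i t. i < N \<Longrightarrow> t \<in> {0<..T} \<Longrightarrow> \<bar>\<Phi> t i\<bar> \<le> B" using \<Phi>_bounded by blast
  obtain A where A: "\<And>i x t. i < N \<Longrightarrow> t \<in> {0<..T} \<Longrightarrow> \<bar>f x t i\<bar> \<le> A"
    using f_bounded[OF mesh ivp refl refl] by blast
  show ?thesis
  proof (rule bounded_measurable_integrable[OF T_pos, where B = "\<bar>A\<bar> * B"])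
    show "(\<lambda>t. f (x t) t i * \<Phi> t i) \<in> borel_measurable (lebesgue_on {0<..T})"
      by (intro borel_measurable_times \<Phi>_measurable f_along_measurable[OF mesh ivp refl refl] i x)
    fix t assume t: "t \<in> {0<..T}"
    show "\<bar>f (x t) t i * \<Phi> t i\<bar> \<le> \<bar>A\<bar> * B"
      unfolding abs_mult using A[OF i t, of "x t"] B(2)[OF i t] by (intro mult_mono) auto
  qed
qed

lemma deriv_trial:
  assumes "v \<in> trial_space D" "i < N" "j \<in> {1..ncells D i}"
  shows "\<exists>p :: real poly. degree p \<le> deg D i j \<and>
    (\<forall>t\<in>{node D i (j - 1)..node D i j}. v t i = poly p t) \<and>
    (\<forall>t\<in>{node D i (j - 1)<..<node D i j}. ((\<lambda>s. v s i) has_real_derivative poly (pderiv p) t) (at t)) \<and>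
    (\<forall>t\<in>{node D i (j - 1)<..<node D i j}. deriv (\<lambda>s. v s i) t = poly (pderiv p) t)"
proof -
  obtain p where p: "degree p \<le> deg D i j" "\<And>t. t \<in> {node D i (j - 1)..node D i j} \<Longrightarrow> v t i = poly p t"
    using trial_space_poly[OF assms] by blast
  have d: "((\<lambda>s. v s i) has_real_derivative poly (pderiv p) t) (at t)"
    if "t \<in> {node D i (j - 1)<..<node D i j}" for t
    by (rule has_field_derivative_transform_within_open[OF poly_DERIV, where S = "{node D i (j - 1)<..<node D i j}"])
      (use that p(2) in auto)
  show ?thesis
    by (intro exI[of _ p] conjI ballI p d DERIV_imp_deriv)
qed

lemma deriv_trial_\<Phi>_integrable:
  assumes v: "v \<in> trial_space D" and i: "i < N"
  shows "(\<lambda>t. deriv (\<lambda>s. v s i) t * \<Phi> t i) integrable_on {0..T}"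
proof (rule integrable_cells(1)[OF i])
  fix j assume j: "j \<in> {1..ncells D i}"
  obtain r where r: "\<And>t. t \<in> cell D i j \<Longrightarrow> \<Phi> t i = poly r t" using \<Phi>_poly[OF i j] by blast
    obtain p where p: "degree p \<le> deg D i j"
      "\<forall>t\<in>{node D i (j - 1)..node D i j}. v t i = poly p t"
      "\<forall>t\<in>{node D i (j - 1)<..<node D i j}. ((\<lambda>s. v s i) has_real_derivative poly (pderiv p) t) (at t)"
      "\<forall>t\<in>{node D i (j - 1)<..<node D i j}. deriv (\<lambda>s. v s i) t = poly (pderiv p) t"
      using deriv_trial[OF v i j] by blast
  have "(\<lambda>t. poly (pderiv p) t * poly r t) integrable_on {node D i (j - 1)..node D i j}"
    by (intro integrable_continuous_real continuous_intros)
  thus "(\<lambda>t. deriv (\<lambda>s. v s i) t * \<Phi> t i) integrable_on {node D i (j - 1)..node D i j}"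
    by (rule integrable_spike_finite[where S = "{node D i (j - 1), node D i j}", rotated 2])
      (auto simp: cell_def p(4)[rule_format] r)
qed

lemma u_deriv:
  assumes i: "i < N" and t: "t \<in> {0<..<T}"
  shows "((\<lambda>t. u t i) has_real_derivative f (u t) t i) (at t)"
proof -
  have "((\<lambda>t. u t i) has_real_derivative f (u t) t i) (at t within {0..T})"
    using ivp i t by (simp add: ivp_def Let_def)
  moreover have "at t within {0..T} = at t" using t by (intro at_within_interior) simp
  ultimately show ?thesis by (simp only:)
qed

text \<open>
  Integration by parts: \<open>u - piu\<close> vanishes at the ends of every local interval and is orthogonal to
  the derivative of \<open>\<Phi>\<close>, whose degree is at most \<open>q - 2\<close> there.
\<close>

lemma interp_galerkin_orthogonality:
  assumes i: "i < N"
  shows "integral {0..T} (\<lambda>t. deriv (\<lambda>s. piu s i) t * \<Phi> t i) = integral {0..T} (\<lambda>t. f (u t) t i * \<Phi> t i)"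
proof -
  have "((\<lambda>t. f (u t) t i * \<Phi> t i - deriv (\<lambda>s. piu s i) t * \<Phi> t i) has_integral (\<Sum>j=1..ncells D i. 0)) {0..T}"
  proof (rule has_integral_cells[OF i])
    fix j assume j: "j \<in> {1..ncells D i}"
    define a b where "a = node D i (j - 1)" and "b = node D i j"
    have ab: "a < b" using node_less[OF i j] by (simp add: a_def b_def)
    obtain r where r: "degree r \<le> deg D i j - 1" "\<And>t. t \<in> cell D i j \<Longrightarrow> \<Phi> t i = poly r t"
      using \<Phi>_poly[OF i j] by blast
    obtain p where p0: "degree p \<le> deg D i j"
      "\<forall>t\<in>{node D i (j - 1)..node D i j}. piu t i = poly p t"
      "\<forall>t\<in>{node D i (j - 1)<..<node D i j}. ((\<lambda>s. piu s i) has_real_derivative poly (pderiv p) t) (at t)"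
      "\<forall>t\<in>{node D i (j - 1)<..<node D i j}. deriv (\<lambda>s. piu s i) t = poly (pderiv p) t"
      using deriv_trial[OF piu_trial i j] by blast
    note p = p0(2,4)[folded a_def b_def, rule_format]
    have int: "cG_interp (deg D i j) a b (\<lambda>t. u t i) (\<lambda>t. piu t i)" using piu_interp[OF i j] by (simp add: a_def b_def)
    have sub: "{a..b} \<subseteq> {0..T}" using cell_closed_subset[OF i j] by (simp add: a_def b_def)
    have uc: "continuous_on {a..b} (\<lambda>t. u t i)" using continuous_on_subset[OF u_cont[OF i] sub] .
    let ?e = "\<lambda>t. u t i - poly p t"
    have parts: "((\<lambda>t. (f (u t) t i - poly (pderiv p) t) * poly r t + ?e t * poly (pderiv r) t) has_integral
        ?e b * poly r b - ?e a * poly r a) {a..b}"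
    proof (rule fundamental_theorem_of_calculus_interior)
      show "continuous_on {a..b} (\<lambda>t. ?e t * poly r t)" by (intro continuous_intros uc)
      fix t assume t: "t \<in> {a<..<b}"
      have "0 \<le> a" "b \<le> T" using sub ab by auto
      hence "t \<in> {0<..<T}" using t by simp
      hence "((\<lambda>t. u t i) has_real_derivative f (u t) t i) (at t)" by (rule u_deriv[OF i])
      hence "((\<lambda>t. ?e t * poly r t) has_real_derivative
          (f (u t) t i - poly (pderiv p) t) * poly r t + ?e t * poly (pderiv r) t) (at t)"
        by (auto intro!: derivative_eq_intros)
      thus "((\<lambda>t. ?e t * poly r t) has_vector_derivative
          (f (u t) t i - poly (pderiv p) t) * poly r t + ?e t * poly (pderiv r) t) (at t)"
        by (simp add: has_real_derivative_iff_has_vector_derivative)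
    qed (use ab in simp)
    have ends: "?e a = 0" "?e b = 0"
      using int p(1)[of a] p(1)[of b] ab by (auto simp: cG_interp_def)
    have orth: "((\<lambda>t. ?e t * poly (pderiv r) t) has_integral 0) {a..b}"
    proof -
      have "integral {a..b} (\<lambda>t. ?e t * poly (pderiv r) t) = integral {a..b} (\<lambda>t. (u t i - piu t i) * poly (pderiv r) t)"
        by (rule integral_cong) (simp add: p)
      also have "\<dots> = 0"
      proof (cases "pderiv r = 0")
        case False
        hence "degree r \<noteq> 0" by (simp add: pderiv_eq_0_iff)
        hence "degree (pderiv r) + 2 \<le> deg D i j" using r(1) by (simp add: degree_pderiv)
        thus ?thesis using int by (simp add: cG_interp_def)
      qed simp
      finally show ?thesis
        using integrable_integral[of "\<lambda>t. ?e t * poly (pderiv r) t" "{a..b}"]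
        by (simp add: integrable_continuous_real continuous_intros uc)
    qed
    have "((\<lambda>t. (f (u t) t i - poly (pderiv p) t) * poly r t) has_integral 0) {a..b}"
      using has_integral_diff[OF parts orth] unfolding ends by (simp only: add_diff_cancel_right' mult_zero_left diff_zero)
    hence "((\<lambda>t. f (u t) t i * \<Phi> t i - deriv (\<lambda>s. piu s i) t * \<Phi> t i) has_integral 0) {a..b}"
      by (rule has_integral_spike_finite[where S = "{a, b}", rotated 2])
        (auto simp: cell_def a_def b_def p(2)[unfolded a_def b_def] r(2) algebra_simps)
    thus "((\<lambda>t. f (u t) t i * \<Phi> t i - deriv (\<lambda>s. piu s i) t * \<Phi> t i) has_integral 0) {node D i (j - 1)..node D i j}"
      by (simp add: a_def b_def)
  qed
  hence "integral {0..T} (\<lambda>t. f (u t) t i * \<Phi> t i - deriv (\<lambda>s. piu s i) t * \<Phi> t i) = 0"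
    by (simp add: integral_unique)
  thus ?thesis
    using integral_diff[OF f_\<Phi>_integrable[OF i u_cont] deriv_trial_\<Phi>_integrable[OF piu_trial i]] by simp
qed

text \<open>The transposed averaged Jacobian applied to \<open>\<Phi>\<close>: the quantity under the integral of the stability
  factor.\<close>

definition G :: "real \<Rightarrow> rvec" where "G t l = (\<Sum>i<N. Jac f piu u t i l * \<Phi> t i)"

lemma integrand_eq:
  assumes t: "t \<in> {0<..T}"
  shows "(\<Sum>i<N. (f (piu t) t i - f (u t) t i) * \<Phi> t i) = (\<Sum>l<N. (piu t l - u t l) * G t l)"
proof -
  have "(\<Sum>i<N. (f (piu t) t i - f (u t) t i) * \<Phi> t i) =
      (\<Sum>i<N. \<Sum>l<N. Jac f piu u t i l * (piu t l - u t l) * \<Phi> t i)"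
    by (intro sum.cong refl)
      (simp only: Jac_mean_value[OF mesh ivp refl refl _ t, of _ piu u] sum_distrib_right lessThan_iff)
  also have "\<dots> = (\<Sum>l<N. (piu t l - u t l) * G t l)"
    unfolding G_def sum_distrib_left by (subst sum.swap) (simp add: mult_ac)
  finally show ?thesis .
qed

text \<open>The dual problem is tested with the error and the method with \<open>\<Phi>\<close>. By the mean value property of
  the averaged Jacobian \<open>f(U)\<close> cancels, and \<open>f(piu) - f(u)\<close> remains.\<close>

lemma error_representation:
  "(\<lambda>t. \<Sum>l<N. (piu t l - u t l) * G t l) integrable_on {0..T}"
  "Lfun D \<psi> g err = integral {0..T} (\<lambda>t. \<Sum>l<N. (piu t l - u t l) * G t l)"
proof -
  have TT: "\<And>h k. (\<And>t. t \<in> {0<..T} \<Longrightarrow> h t = k t) \<Longrightarrow> integral {0..T} h = integral {0..T} (k :: real \<Rightarrow> real)"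
    by (rule integral_spike[of "{0}"]) auto
  note fI = f_\<Phi>_integrable
  have "integral {0..T} (\<lambda>t. \<Sum>i<N. deriv (\<lambda>s. err s i) t * \<Phi> t i) =
      integral {0..T} (\<lambda>t. \<Sum>i<N. deriv (\<lambda>s. U s i) t * \<Phi> t i - deriv (\<lambda>s. piu s i) t * \<Phi> t i)"
  proof (rule integral_spike[of "nodes \<union> {0, T}"])
    fix t assume "t \<in> {0..T} - (nodes \<union> {0, T})"
    hence t: "t \<in> {0<..<T} - nodes" by auto
    show "(\<Sum>i<N. deriv (\<lambda>s. U s i) t * \<Phi> t i - deriv (\<lambda>s. piu s i) t * \<Phi> t i) = (\<Sum>i<N. deriv (\<lambda>s. err s i) t * \<Phi> t i)"
    proof (intro sum.cong refl)
      fix i assume "i \<in> {..<N}"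
      hence i: "i < N" by simp
      define j where "j = cell_at D i t"
      note j = cell_interior[OF i t j_def]
    obtain p where p0: "degree p \<le> deg D i j"
      "\<forall>t\<in>{node D i (j - 1)..node D i j}. U t i = poly p t"
      "\<forall>t\<in>{node D i (j - 1)<..<node D i j}. ((\<lambda>s. U s i) has_real_derivative poly (pderiv p) t) (at t)"
      "\<forall>t\<in>{node D i (j - 1)<..<node D i j}. deriv (\<lambda>s. U s i) t = poly (pderiv p) t"
      using deriv_trial[OF U_trial i j(1)] by blast
    obtain r where r0: "degree r \<le> deg D i j"
      "\<forall>t\<in>{node D i (j - 1)..node D i j}. piu t i = poly r t"
      "\<forall>t\<in>{node D i (j - 1)<..<node D i j}. ((\<lambda>s. piu s i) has_real_derivative poly (pderiv r) t) (at t)"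
      "\<forall>t\<in>{node D i (j - 1)<..<node D i j}. deriv (\<lambda>s. piu s i) t = poly (pderiv r) t"
      using deriv_trial[OF piu_trial i j(1)] by blast
      note p = p0(3)[rule_format, OF j(2)] and r = r0(3)[rule_format, OF j(2)]
      have "deriv (\<lambda>s. err s i) t = poly (pderiv p) t - poly (pderiv r) t"
        unfolding err_def by (intro DERIV_imp_deriv derivative_intros p r)
      thus "deriv (\<lambda>s. U s i) t * \<Phi> t i - deriv (\<lambda>s. piu s i) t * \<Phi> t i = deriv (\<lambda>s. err s i) t * \<Phi> t i"
        by (simp add: DERIV_imp_deriv[OF p] DERIV_imp_deriv[OF r] left_diff_distrib)
    qed
  qed (simp add: finite_nodes negligible_finite)
  also have "\<dots> = (\<Sum>i<N. integral {0..T} (\<lambda>t. deriv (\<lambda>s. U s i) t * \<Phi> t i)) - (\<Sum>i<N. integral {0..T} (\<lambda>t. deriv (\<lambda>s. piu s i) t * \<Phi> t i))"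
    by (intro integral_sum_diff deriv_trial_\<Phi>_integrable U_trial piu_trial)
  also have "(\<Sum>i<N. integral {0..T} (\<lambda>t. deriv (\<lambda>s. U s i) t * \<Phi> t i)) = integral {0..T} (\<lambda>t. \<Sum>i<N. deriv (\<lambda>s. U s i) t * \<Phi> t i)"
    by (rule integral_sum[symmetric]) (auto intro!: deriv_trial_\<Phi>_integrable U_trial)
  also have "integral {0..T} (\<lambda>t. \<Sum>i<N. deriv (\<lambda>s. U s i) t * \<Phi> t i) = integral {0..T} (\<lambda>t. \<Sum>i<N. f (U t) t i * \<Phi> t i)"
    using mcG dual by (simp add: mcG_solution_def mcG_dual_solution_def)
  also have "\<dots> = (\<Sum>i<N. integral {0..T} (\<lambda>t. f (U t) t i * \<Phi> t i))"
    by (subst integral_sum) (auto intro!: fI U_cont)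
  finally have A: "integral {0..T} (\<lambda>t. \<Sum>i<N. deriv (\<lambda>s. err s i) t * \<Phi> t i) =
      (\<Sum>i<N. integral {0..T} (\<lambda>t. f (U t) t i * \<Phi> t i)) - (\<Sum>i<N. integral {0..T} (\<lambda>t. f (u t) t i * \<Phi> t i))"
    by (simp add: interp_galerkin_orthogonality)
  have "integral {0..T} (\<lambda>t. \<Sum>i<N. (\<Sum>l<N. Jac f piu U t i l * err t l) * \<Phi> t i) =
      integral {0..T} (\<lambda>t. \<Sum>i<N. f (U t) t i * \<Phi> t i - f (piu t) t i * \<Phi> t i)"
  proof (rule TT)
    fix t assume t: "t \<in> {0<..T}"
    have "(\<Sum>l<N. Jac f piu U t i l * err t l) = f (U t) t i - f (piu t) t i" if i: "i < N" for i
    proof -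
      have "(\<Sum>l<N. Jac f piu U t i l * err t l) = - (\<Sum>l<N. Jac f piu U t i l * (piu t l - U t l))"
        unfolding err_def sum_negf[symmetric] by (simp add: algebra_simps)
      also have "\<dots> = - (f (piu t) t i - f (U t) t i)"
        by (simp only: Jac_mean_value[OF mesh ivp refl refl i t, of piu U])
      finally show ?thesis by simp
    qed
    thus "(\<Sum>i<N. (\<Sum>l<N. Jac f piu U t i l * err t l) * \<Phi> t i) = (\<Sum>i<N. f (U t) t i * \<Phi> t i - f (piu t) t i * \<Phi> t i)"
      by (intro sum.cong refl) (simp only: left_diff_distrib lessThan_iff)
  qed
  also have "\<dots> = (\<Sum>i<N. integral {0..T} (\<lambda>t. f (U t) t i * \<Phi> t i)) - (\<Sum>i<N. integral {0..T} (\<lambda>t. f (piu t) t i * \<Phi> t i))"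
    by (intro integral_sum_diff fI U_cont piu_cont)
  finally have B: "integral {0..T} (\<lambda>t. \<Sum>i<N. (\<Sum>l<N. Jac f piu U t i l * err t l) * \<Phi> t i) =
      (\<Sum>i<N. integral {0..T} (\<lambda>t. f (U t) t i * \<Phi> t i)) - (\<Sum>i<N. integral {0..T} (\<lambda>t. f (piu t) t i * \<Phi> t i))" .
  have "integral {0..T} (\<lambda>t. \<Sum>i<N. deriv (\<lambda>s. err s i) t * \<Phi> t i) =
      integral {0..T} (\<lambda>t. \<Sum>i<N. (\<Sum>l<N. Jac f piu U t i l * err t l) * \<Phi> t i) + Lfun D \<psi> g err"
    using dual err_trial err_0 by (simp add: mcG_dual_solution_def)
  with A B have "Lfun D \<psi> g err =
      (\<Sum>i<N. integral {0..T} (\<lambda>t. f (piu t) t i * \<Phi> t i)) - (\<Sum>i<N. integral {0..T} (\<lambda>t. f (u t) t i * \<Phi> t i))"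
    by linarith
  also have "\<dots> = integral {0..T} (\<lambda>t. \<Sum>i<N. (f (piu t) t i - f (u t) t i) * \<Phi> t i)"
    unfolding left_diff_distrib by (rule integral_sum_diff[symmetric]; intro fI u_cont piu_cont)
  also have "\<dots> = integral {0..T} (\<lambda>t. \<Sum>l<N. (piu t l - u t l) * G t l)"
    by (rule TT) (rule integrand_eq)
  finally show "Lfun D \<psi> g err = integral {0..T} (\<lambda>t. \<Sum>l<N. (piu t l - u t l) * G t l)" .
  have "(\<lambda>t. \<Sum>i<N. (f (piu t) t i - f (u t) t i) * \<Phi> t i) integrable_on {0..T}"
    unfolding left_diff_distrib by (intro integrable_sum integrable_diff fI u_cont piu_cont) auto
  thus "(\<lambda>t. \<Sum>l<N. (piu t l - u t l) * G t l) integrable_on {0..T}"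
    by (rule integrable_spike[of _ _ "{0}"]) (auto simp: integrand_eq)
qed

subsection \<open>The first estimate\<close>

lemma cell_interp_error:
  assumes i: "i < N" and j: "j \<in> {1..ncells D i}" and t: "t \<in> {node D i (j - 1)..node D i j}"
  shows "\<bar>piu t i - u t i\<bar> \<le> interpC (deg D i j) * (step D i j ^ (deg D i j + 1) * cell_deriv_sup D u i j)"
  unfolding step_def
proof (rule cG_interp_error[OF piu_interp[OF i j] node_less[OF i j]])
  let ?I = "{node D i (j - 1)<..<node D i j}"
  show "continuous_on {node D i (j - 1)..node D i j} (\<lambda>t. u t i)"
    using continuous_on_subset[OF u_cont[OF i] cell_closed_subset[OF i j]] .
  have s: "Ck_on (deg D i j + 1) ?I (\<lambda>t. u t i)"
    "bdd_above ((\<lambda>t. \<bar>(deriv ^^ (deg D i j + 1)) (\<lambda>t. u t i) t\<bar>) ` ?I)"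
    using smooth_u[unfolded cellwise_smooth_def Let_def, rule_format, OF i j] by simp_all
  show "Ck_on (deg D i j + 1) ?I (\<lambda>t. u t i)" by (rule s)
  fix s assume "s \<in> ?I"
  thus "\<bar>(deriv ^^ (deg D i j + 1)) (\<lambda>t. u t i) s\<bar> \<le> cell_deriv_sup D u i j"
    unfolding cell_deriv_sup_def deriv_sup_def using s(2) by (intro cSUP_upper) auto
qed (use t in auto)

lemma cell_deriv_sup_nonneg: "i < N \<Longrightarrow> j \<in> {1..ncells D i} \<Longrightarrow> cell_deriv_sup D u i j \<ge> 0"
proof -
  assume ij: "i < N" "j \<in> {1..ncells D i}"
  let ?I = "{node D i (j - 1)<..<node D i j}"
  have b: "bdd_above ((\<lambda>t. \<bar>(deriv ^^ (deg D i j + 1)) (\<lambda>t. u t i) t\<bar>) ` ?I)"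
    using smooth_u[unfolded cellwise_smooth_def Let_def, rule_format, OF ij] by simp
  obtain s where s: "s \<in> ?I" using dense[OF node_less[OF ij]] by auto
  have "0 \<le> \<bar>(deriv ^^ (deg D i j + 1)) (\<lambda>t. u t i) s\<bar>" by simp
  also have "\<dots> \<le> cell_deriv_sup D u i j"
    unfolding cell_deriv_sup_def deriv_sup_def by (rule cSUP_upper[OF s b])
  finally show ?thesis .
qed

lemma step_pos: "i < N \<Longrightarrow> j \<in> {1..ncells D i} \<Longrightarrow> step D i j > 0"
  using node_less by (simp add: step_def)

lemma G_measurable: "l < N \<Longrightarrow> (\<lambda>t. G t l) \<in> borel_measurable (lebesgue_on {0<..T})"
  unfolding G_def
  by (intro borel_measurable_sum borel_measurable_times \<Phi>_measurable Jac_measurable[OF mesh ivp refl refl]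
      piu_cont u_cont) auto

lemma G_bounded: "\<exists>B\<ge>0. \<forall>l<N. \<forall>t\<in>{0<..T}. \<bar>G t l\<bar> \<le> B"
proof -
  obtain B where B: "B \<ge> 0" "\<And>i t. i < N \<Longrightarrow> t \<in> {0<..T} \<Longrightarrow> \<bar>\<Phi> t i\<bar> \<le> B" using \<Phi>_bounded by blast
  obtain L where L: "L \<ge> 0" "\<And>i l x y t. i < N \<Longrightarrow> l < N \<Longrightarrow> t \<in> {0<..T} \<Longrightarrow> \<bar>Jac f x y t i l\<bar> \<le> L"
    using Jac_bounded[OF mesh ivp refl refl] by blast
  show ?thesis
  proof (intro exI[of _ "\<Sum>i<N. L * B"] conjI allI impI ballI)
    show "0 \<le> (\<Sum>i<N. L * B)" using L B by (intro sum_nonneg) auto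
    fix l t assume l: "l < N" and t: "t \<in> {0<..T}"
    show "\<bar>G t l\<bar> \<le> (\<Sum>i<N. L * B)"
      unfolding G_def
      by (rule order.trans[OF sum_abs sum_mono]) (auto simp: abs_mult intro!: mult_mono L B t l)
  qed
qed

lemma stab_integrable: "(\<lambda>t. L2_set (G t) {..<N}) integrable_on {0..T}"
proof -
  obtain B where B: "B \<ge> 0" "\<And>l t. l < N \<Longrightarrow> t \<in> {0<..T} \<Longrightarrow> \<bar>G t l\<bar> \<le> B" using G_bounded by blast
  show ?thesis
  proof (rule bounded_measurable_integrable[OF T_pos, where B = "\<Sum>i<N. B"])
    show "(\<lambda>t. L2_set (G t) {..<N}) \<in> borel_measurable (lebesgue_on {0<..T})"
      unfolding L2_set_def using G_measurable by measurable
    fix t assume t: "t \<in> {0<..T}"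
    have "L2_set (G t) {..<N} \<le> (\<Sum>i<N. \<bar>G t i\<bar>)" by (rule L2_set_le_sum_abs)
    also have "\<dots> \<le> (\<Sum>i<N. B)" by (intro sum_mono B t) auto
    finally show "\<bar>L2_set (G t) {..<N}\<bar> \<le> (\<Sum>i<N. B)" by simp
  qed
qed

lemma stab_factor_eq: "stab_factor D f piu u \<Phi> = integral {0..T} (\<lambda>t. L2_set (G t) {..<N})"
  unfolding stab_factor_def G_def ..

text \<open>A quantity that depends on \<open>t\<close> only through the cells containing \<open>t\<close> takes finitely many values.\<close>

lemma cellwise_bdd_above:
  fixes H :: "nat \<Rightarrow> nat \<Rightarrow> 'a \<Rightarrow> real"
  assumes F: "\<And>t. t \<in> {0<..T} \<Longrightarrow> F t \<le> (\<Sum>i<N. \<bar>H i (cell_at D i t) (K t)\<bar>)"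
    and K: "\<And>t. t \<in> {0<..T} \<Longrightarrow> K t \<in> A" "finite A"
  shows "bdd_above (F ` {0<..T})"
proof (rule bdd_aboveI2)
  fix t assume t: "t \<in> {0<..T}"
  have "\<bar>H i (cell_at D i t) (K t)\<bar> \<le> (\<Sum>j=1..ncells D i. \<Sum>k\<in>A. \<bar>H i j k\<bar>)" if i: "i < N" for i
  proof -
    have "\<bar>H i (cell_at D i t) (K t)\<bar> \<le> (\<Sum>k\<in>A. \<bar>H i (cell_at D i t) k\<bar>)"
      using K t by (intro member_le_sum[of "K t" A "\<lambda>k. \<bar>H i (cell_at D i t) k\<bar>"]) auto
    also have "\<dots> \<le> (\<Sum>j=1..ncells D i. \<Sum>k\<in>A. \<bar>H i j k\<bar>)"
      using cell_at(1)[OF i t]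
      by (intro member_le_sum[of _ _ "\<lambda>j. \<Sum>k\<in>A. \<bar>H i j k\<bar>"]) (auto intro: sum_nonneg)
    finally show ?thesis .
  qed
  hence "(\<Sum>i<N. \<bar>H i (cell_at D i t) (K t)\<bar>) \<le> (\<Sum>i<N. \<Sum>j=1..ncells D i. \<Sum>k\<in>A. \<bar>H i j k\<bar>)"
    by (intro sum_mono) auto
  with F[OF t] show "F t \<le> (\<Sum>i<N. \<Sum>j=1..ncells D i. \<Sum>k\<in>A. \<bar>H i j k\<bar>)" by linarith
qed

theorem first_estimate:
  assumes deg: "\<And>i j. i < N \<Longrightarrow> j \<in> {1..ncells D i} \<Longrightarrow> deg D i j \<le> qmax"
  shows "\<bar>Lfun D \<psi> g err\<bar> \<le> (\<Sum>q\<le>qmax. interpC q) * stab_factor D f piu u \<Phi> *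
         (SUP t\<in>{0<..T}. L2_set (ubar D u t) {..<N})"
proof -
  define C where "C = (\<Sum>q\<le>qmax. interpC q)"
  have C0: "C \<ge> 0" unfolding C_def by (intro sum_nonneg less_imp_le interpC_pos)
  have Cq: "interpC q \<le> C" if "q \<le> qmax" for q
    unfolding C_def using that by (intro member_le_sum) (auto intro: less_imp_le interpC_pos)
  define M where "M = (SUP t\<in>{0<..T}. L2_set (ubar D u t) {..<N})"
  have bdd: "bdd_above ((\<lambda>t. L2_set (ubar D u t) {..<N}) ` {0<..T})"
  proof (rule cellwise_bdd_above[where A = "{()}" and K = "\<lambda>_. ()"])
    fix t
    show "L2_set (ubar D u t) {..<N} \<le> (\<Sum>i<N. \<bar>(\<lambda>i j _. step D i j ^ (deg D i j + 1) * cell_deriv_sup D u i j) i (cell_at D i t) ()\<bar>)"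
      using L2_set_le_sum_abs[of "ubar D u t" "{..<N}"] by (simp add: ubar_def Let_def)
  qed auto
  have le: "L2_set (\<lambda>i. piu t i - u t i) {..<N} \<le> C * M" if t: "t \<in> {0<..T}" for t
  proof -
    have "L2_set (\<lambda>i. piu t i - u t i) {..<N} = L2_set (\<lambda>i. \<bar>piu t i - u t i\<bar>) {..<N}"
      by (simp add: L2_set_def)
    also have "\<dots> \<le> L2_set (\<lambda>i. C * ubar D u t i) {..<N}"
    proof (rule L2_set_mono)
      fix i assume "i \<in> {..<N}"
      hence i: "i < N" by simp
      define j where "j = cell_at D i t"
      have j: "j \<in> {1..ncells D i}" "t \<in> cell D i j" using cell_at[OF i t] by (auto simp: j_def)
      have "\<bar>piu t i - u t i\<bar> \<le> interpC (deg D i j) * (step D i j ^ (deg D i j + 1) * cell_deriv_sup D u i j)"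
        using j by (intro cell_interp_error i) (auto simp: cell_def)
      also have "\<dots> \<le> C * (step D i j ^ (deg D i j + 1) * cell_deriv_sup D u i j)"
        using step_pos[OF i j(1)] cell_deriv_sup_nonneg[OF i j(1)]
        by (intro mult_right_mono Cq deg i j) auto
      finally show "\<bar>piu t i - u t i\<bar> \<le> C * ubar D u t i" by (simp add: ubar_def Let_def j_def)
    qed auto
    also have "\<dots> = C * L2_set (ubar D u t) {..<N}" using L2_set_right_distrib[OF C0] by metis
    also have "\<dots> \<le> C * M"
      unfolding M_def using t by (intro mult_left_mono C0 cSUP_upper bdd)
    finally show ?thesis .
  qed
  have CM0: "C * M \<ge> 0" using le[of T] T_pos L2_set_nonneg by (meson greaterThanAtMost_iff order.refl order.trans)
  have "norm (integral {0<..T} (\<lambda>t. \<Sum>l<N. (piu t l - u t l) * G t l)) \<le> integral {0<..T} (\<lambda>t. C * M * L2_set (G t) {..<N})"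
  proof (rule Henstock_Kurzweil_Integration.integral_norm_bound_integral)
    have eq: "insert 0 {0<..T} = {0..T}" using T_pos by auto
    show "(\<lambda>t. \<Sum>l<N. (piu t l - u t l) * G t l) integrable_on {0<..T}"
      using error_representation(1) unfolding eq[symmetric] integrable_on_insert_iff .
    show "(\<lambda>t. C * M * L2_set (G t) {..<N}) integrable_on {0<..T}"
      using integrable_cmul[OF stab_integrable, of "C * M"]
      unfolding eq[symmetric] integrable_on_insert_iff real_scaleR_def .
    fix t assume t: "t \<in> {0<..T}"
    have "\<bar>\<Sum>l<N. (piu t l - u t l) * G t l\<bar> \<le> (\<Sum>l<N. \<bar>piu t l - u t l\<bar> * \<bar>G t l\<bar>)"
      using sum_abs[of "\<lambda>l. (piu t l - u t l) * G t l" "{..<N}"] by (simp add: abs_mult)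
    also have "\<dots> \<le> L2_set (\<lambda>i. piu t i - u t i) {..<N} * L2_set (G t) {..<N}" by (rule L2_set_mult_ineq)
    also have "\<dots> \<le> C * M * L2_set (G t) {..<N}" by (intro mult_right_mono le t L2_set_nonneg)
    finally show "norm (\<Sum>l<N. (piu t l - u t l) * G t l) \<le> C * M * L2_set (G t) {..<N}" by simp
  qed
  also have "integral {0<..T} (\<lambda>t. C * M * L2_set (G t) {..<N}) = C * M * stab_factor D f piu u \<Phi>"
    unfolding stab_factor_eq integral_0T by simp
  also have "integral {0<..T} (\<lambda>t. \<Sum>l<N. (piu t l - u t l) * G t l) = Lfun D \<psi> g err"
    unfolding error_representation(2) integral_0T ..
  finally show ?thesis by (simp add: C_def M_def mult_ac)
qed

end

section \<open>Functions close to polynomials with scaled coefficients\<close>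

lemma bounded_derivative_increment:
  fixes e e' :: "real \<Rightarrow> real"
  assumes "x \<le> y" "finite S" "continuous_on {x..y} e" "M \<ge> 0"
    and d: "\<And>t. t \<in> {x<..<y} - S \<Longrightarrow> (e has_real_derivative e' t) (at t)"
    and M: "\<And>t. t \<in> {x<..<y} - S \<Longrightarrow> \<bar>e' t\<bar> \<le> M"
  shows "\<bar>e y - e x\<bar> \<le> M * (y - x)"
proof -
  have "(e' has_integral (e y - e x)) {x..y}"
    by (rule fundamental_theorem_of_calculus_interior_strong[OF assms(2,1)])
      (use d assms(3) in \<open>auto simp: has_real_derivative_iff_has_vector_derivative\<close>)
  hence "norm (e y - e x) \<le> M * measure lborel {x..y}"
    by (rule has_integral_bound_real[where S = "S \<union> {x, y}", rotated 2]) (use assms M in auto)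
  thus ?thesis using assms(1) by simp
qed

lemma bounded_sequences_convergent_subsequence:
  fixes c :: "nat \<Rightarrow> nat \<Rightarrow> real"
  assumes "\<And>m n. n < r \<Longrightarrow> \<bar>c m n\<bar> \<le> B n"
  shows "\<exists>\<sigma>. strict_mono (\<sigma> :: nat \<Rightarrow> nat) \<and> (\<forall>n<r. \<exists>l. (\<lambda>m. c (\<sigma> m) n) \<longlonglongrightarrow> l)"
  using assms
proof (induction r)
  case 0
  show ?case by (rule exI[of _ id]) (auto simp: strict_mono_def)
next
  case (Suc r)
  then obtain \<sigma> :: "nat \<Rightarrow> nat" where \<sigma>: "strict_mono \<sigma>" "\<forall>n<r. \<exists>l. (\<lambda>m. c (\<sigma> m) n) \<longlonglongrightarrow> l" by auto
  have "seq_compact {- B r..B r}" using compact_Icc compact_eq_seq_compact_metric by blast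
  moreover have "\<forall>m. c (\<sigma> m) r \<in> {- B r..B r}" using Suc.prems[of r] by (auto simp: abs_le_iff minus_le_iff)
  ultimately obtain l \<tau> where \<tau>: "strict_mono (\<tau> :: nat \<Rightarrow> nat)" "((\<lambda>m. c (\<sigma> m) r) \<circ> \<tau>) \<longlonglongrightarrow> l"
    unfolding seq_compact_def by meson
  show ?case
  proof (intro exI[of _ "\<sigma> \<circ> \<tau>"] conjI allI impI)
    show "strict_mono (\<sigma> \<circ> \<tau>)" using \<sigma>(1) \<tau>(1) by (rule strict_mono_o)
    fix n assume "n < Suc r"
    show "\<exists>l. (\<lambda>m. c ((\<sigma> \<circ> \<tau>) m) n) \<longlonglongrightarrow> l"
    proof (cases "n = r")
      case True
      thus ?thesis using \<tau>(2) by (auto simp: o_def)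
    next
      case False
      hence "n < r" using \<open>n < Suc r\<close> by simp
      then obtain l where "(\<lambda>m. c (\<sigma> m) n) \<longlonglongrightarrow> l" using \<sigma>(2) by blast
      from LIMSEQ_subseq_LIMSEQ[OF this \<tau>(1)] show ?thesis by (auto simp: o_def)
    qed
  qed
qed

lemma poly_sum_below:
  fixes P :: "real poly"
  assumes "\<And>n. n \<ge> r \<Longrightarrow> coeff P n = 0"
  shows "poly P z = (\<Sum>n<r. coeff P n * z ^ n)"
proof -
  have "poly P z = (\<Sum>n\<le>degree P. coeff P n * z ^ n)" by (rule poly_altdef)
  also have "\<dots> = (\<Sum>n\<in>{..degree P} \<inter> {..<r}. coeff P n * z ^ n)"
    by (rule sum.mono_neutral_right) (auto simp: assms)
  also have "\<dots> = (\<Sum>n<r. coeff P n * z ^ n)"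
    by (rule sum.mono_neutral_left) (auto simp: coeff_eq_0)
  finally show ?thesis .
qed

text \<open>A window is the part of the slab \<open>(a, b)\<close> within a multiple of \<open>\<kappa>\<close> from \<open>t0\<close>, without the points
  of \<open>S\<close>. The length \<open>\<kappa>\<close> stands for the local step size and \<open>1 / Cf\<close> for the time scale of the problem.\<close>

locale window =
  fixes a b t0 \<kappa> Cf c R :: real and S :: "real set"
  assumes t0: "a < t0" "t0 < b" and \<kappa>: "\<kappa> > 0" and Cf: "Cf > 0" and c: "\<kappa> * Cf \<le> c"
    and R: "R \<ge> 1" and S: "finite S"
begin

definition W :: "real \<Rightarrow> real set" where "W \<rho> = {t. a < t \<and> t < b \<and> \<bar>t - t0\<bar> \<le> \<rho> * \<kappa>} - S"

text \<open>In powers of \<open>t - t0\<close> the coefficients are of the size of Taylor coefficients of a function that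
  varies on the time scale \<open>1 / Cf\<close>, and the error is that of a Taylor polynomial of degree \<open>r - 1\<close>.
  Unlike conditions on derivatives and jumps this does not count the discontinuities in the window,
  whose number grows with the number of components.\<close>

definition near_poly :: "nat \<Rightarrow> real \<Rightarrow> real \<Rightarrow> (real \<Rightarrow> real) \<Rightarrow> bool" where
  "near_poly r \<rho> B h \<longleftrightarrow> (\<exists>P. (\<forall>n. \<bar>coeff P n\<bar> \<le> B * Cf ^ n) \<and> (\<forall>n\<ge>r. coeff P n = 0) \<and>
     (\<forall>t\<in>W \<rho>. \<bar>h t - poly P (t - t0)\<bar> \<le> B * (\<kappa> * Cf) ^ r))"

definition H :: real where "H = 1 + c + R"

lemma c_pos: "c > 0" using c mult_pos_pos[OF \<kappa> Cf] by linarith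

lemma H_ge: "H \<ge> 1" "R \<le> H" "c \<le> H" "\<kappa> * Cf \<le> H" "R \<ge> 0"
  using c_pos R c by (auto simp: H_def)

lemma \<kappa>Cf_pos: "\<kappa> * Cf > 0" using \<kappa> Cf by simp

lemma near_polyI:
  assumes "\<And>n. \<bar>coeff P n\<bar> \<le> B * Cf ^ n" "\<And>n. n \<ge> r \<Longrightarrow> coeff P n = 0"
    "\<And>t. t \<in> W \<rho> \<Longrightarrow> \<bar>h t - poly P (t - t0)\<bar> \<le> B * (\<kappa> * Cf) ^ r"
  shows "near_poly r \<rho> B h"
  using assms unfolding near_poly_def by blast

lemma near_polyE:
  assumes "near_poly r \<rho> B h"
  obtains P where "\<And>n. \<bar>coeff P n\<bar> \<le> B * Cf ^ n" "\<And>n. n \<ge> r \<Longrightarrow> coeff P n = 0"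
    "\<And>t. t \<in> W \<rho> \<Longrightarrow> \<bar>h t - poly P (t - t0)\<bar> \<le> B * (\<kappa> * Cf) ^ r"
  using assms unfolding near_poly_def by blast

lemma near_poly_nonneg: "near_poly r \<rho> B h \<Longrightarrow> B \<ge> 0"
proof -
  assume "near_poly r \<rho> B h"
  then obtain P where "\<bar>coeff P 0\<bar> \<le> B * Cf ^ 0" by (rule near_polyE) blast
  thus ?thesis by simp
qed

lemma W_mono: "\<rho>' \<le> \<rho> \<Longrightarrow> W \<rho>' \<subseteq> W \<rho>"
proof -
  assume "\<rho>' \<le> \<rho>"
  hence "\<rho>' * \<kappa> \<le> \<rho> * \<kappa>" using \<kappa> by simp
  thus ?thesis by (auto simp: W_def)
qed

lemma near_poly_mono:
  assumes "near_poly r \<rho> B h" "B \<le> B'" "\<rho>' \<le> \<rho>"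
  shows "near_poly r \<rho>' B' h"
proof -
  obtain P where P: "\<And>n. \<bar>coeff P n\<bar> \<le> B * Cf ^ n" "\<And>n. n \<ge> r \<Longrightarrow> coeff P n = 0"
    "\<And>t. t \<in> W \<rho> \<Longrightarrow> \<bar>h t - poly P (t - t0)\<bar> \<le> B * (\<kappa> * Cf) ^ r" by (rule near_polyE[OF assms(1)]) blast
  show ?thesis
  proof (rule near_polyI[OF _ P(2)])
    show "\<bar>coeff P n\<bar> \<le> B' * Cf ^ n" for n
      using P(1)[of n] assms(2) Cf by (meson mult_right_mono order.trans zero_le_power less_imp_le)
    show "\<bar>h t - poly P (t - t0)\<bar> \<le> B' * (\<kappa> * Cf) ^ r" if "t \<in> W \<rho>'" for t
      using P(3)[of t] that W_mono[OF assms(3)] assms(2) \<kappa>Cf_pos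
      by (meson mult_right_mono order.trans zero_le_power less_imp_le subsetD)
  qed
qed

lemma near_poly_cong:
  assumes "near_poly r \<rho> B h" "\<And>t. t \<in> W \<rho> \<Longrightarrow> h t = k t" shows "near_poly r \<rho> B k"
  using assms unfolding near_poly_def by auto

lemma near_poly_0_iff: "near_poly 0 \<rho> B h \<longleftrightarrow> B \<ge> 0 \<and> (\<forall>t\<in>W \<rho>. \<bar>h t\<bar> \<le> B)"
proof
  assume g: "near_poly 0 \<rho> B h"
  then obtain P where P: "\<And>n. coeff P n = 0" "\<And>t. t \<in> W \<rho> \<Longrightarrow> \<bar>h t - poly P (t - t0)\<bar> \<le> B * (\<kappa> * Cf) ^ 0"
    by (rule near_polyE) auto
  have "P = 0" using P(1) by (simp add: poly_eq_iff)
  thus "B \<ge> 0 \<and> (\<forall>t\<in>W \<rho>. \<bar>h t\<bar> \<le> B)" using near_poly_nonneg[OF g] P(2) by simp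
next
  assume "B \<ge> 0 \<and> (\<forall>t\<in>W \<rho>. \<bar>h t\<bar> \<le> B)"
  thus "near_poly 0 \<rho> B h" using Cf by (intro near_polyI[of 0]) auto
qed

lemma near_poly_zero: "(\<And>t. t \<in> W \<rho> \<Longrightarrow> h t = 0) \<Longrightarrow> B \<ge> 0 \<Longrightarrow> near_poly r \<rho> B h"
  using Cf \<kappa>Cf_pos by (intro near_polyI[of 0]) auto

lemma near_poly_const: "\<bar>x\<bar> \<le> B \<Longrightarrow> near_poly r \<rho> B (\<lambda>_. x)"
proof (cases "r = 0")
  case False
  assume x: "\<bar>x\<bar> \<le> B"
  hence "B \<ge> 0" by linarith
  thus ?thesis using x Cf \<kappa>Cf_pos False by (intro near_polyI[of "[:x:]"]) (auto simp: coeff_pCons split: nat.splits)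
qed (simp add: near_poly_0_iff)

lemma near_poly_add:
  assumes "near_poly r \<rho> B h" "near_poly r \<rho> B' k" shows "near_poly r \<rho> (B + B') (\<lambda>t. h t + k t)"
proof -
  obtain P where P: "\<And>n. \<bar>coeff P n\<bar> \<le> B * Cf ^ n" "\<And>n. n \<ge> r \<Longrightarrow> coeff P n = 0"
    "\<And>t. t \<in> W \<rho> \<Longrightarrow> \<bar>h t - poly P (t - t0)\<bar> \<le> B * (\<kappa> * Cf) ^ r" by (rule near_polyE[OF assms(1)]) blast
  obtain Q where Q: "\<And>n. \<bar>coeff Q n\<bar> \<le> B' * Cf ^ n" "\<And>n. n \<ge> r \<Longrightarrow> coeff Q n = 0"
    "\<And>t. t \<in> W \<rho> \<Longrightarrow> \<bar>k t - poly Q (t - t0)\<bar> \<le> B' * (\<kappa> * Cf) ^ r" by (rule near_polyE[OF assms(2)]) blast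
  show ?thesis
  proof (rule near_polyI[of "P + Q"])
    show "\<bar>coeff (P + Q) n\<bar> \<le> (B + B') * Cf ^ n" for n
      using P(1)[of n] Q(1)[of n] by (simp add: distrib_right abs_triangle_ineq[THEN order.trans] add_mono)
    show "coeff (P + Q) n = 0" if "n \<ge> r" for n using P(2) Q(2) that by simp
    show "\<bar>h t + k t - poly (P + Q) (t - t0)\<bar> \<le> (B + B') * (\<kappa> * Cf) ^ r" if "t \<in> W \<rho>" for t
      using P(3)[OF that] Q(3)[OF that] unfolding poly_add distrib_right by linarith
  qed
qed

lemma near_poly_cmult:
  assumes "near_poly r \<rho> B h" shows "near_poly r \<rho> (\<bar>x\<bar> * B) (\<lambda>t. x * h t)"
proof -
  obtain P where P: "\<And>n. \<bar>coeff P n\<bar> \<le> B * Cf ^ n" "\<And>n. n \<ge> r \<Longrightarrow> coeff P n = 0"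
    "\<And>t. t \<in> W \<rho> \<Longrightarrow> \<bar>h t - poly P (t - t0)\<bar> \<le> B * (\<kappa> * Cf) ^ r" by (rule near_polyE[OF assms(1)]) blast
  show ?thesis
  proof (rule near_polyI[of "smult x P"])
    show "\<bar>coeff (smult x P) n\<bar> \<le> \<bar>x\<bar> * B * Cf ^ n" for n
      using mult_left_mono[OF P(1)[of n], of "\<bar>x\<bar>"] by (simp add: abs_mult mult.assoc)
    show "coeff (smult x P) n = 0" if "n \<ge> r" for n using P(2) that by simp
    show "\<bar>x * h t - poly (smult x P) (t - t0)\<bar> \<le> \<bar>x\<bar> * B * (\<kappa> * Cf) ^ r" if "t \<in> W \<rho>" for t
      using mult_left_mono[OF P(3)[OF that], of "\<bar>x\<bar>"]
      by (simp add: abs_mult[symmetric] right_diff_distrib mult.assoc)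
  qed
qed

lemma near_poly_convex:
  assumes "near_poly r \<rho> B h" "near_poly r \<rho> B k" "s \<in> {0..1}"
  shows "near_poly r \<rho> B (\<lambda>t. s * h t + (1 - s) * k t)"
  using near_poly_add[OF near_poly_cmult[OF assms(1), of s] near_poly_cmult[OF assms(2), of "1 - s"]] assms(3)
  by (simp add: algebra_simps)

lemma near_poly_average:
  assumes "\<And>j. j < n \<Longrightarrow> near_poly r \<rho> B (h j)" "n > 0"
  shows "near_poly r \<rho> B (\<lambda>t. (\<Sum>j<n. h j t) / real n)"
proof -
  have B: "B \<ge> 0" using near_poly_nonneg[OF assms(1)[of 0]] assms(2) by simp
  have "near_poly r \<rho> (real m * B) (\<lambda>t. \<Sum>j<m. h j t)" if "m \<le> n" for m
    using that
  proof (induction m)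
    case 0
    show ?case by (rule near_poly_zero) auto
  next
    case (Suc m)
    have "near_poly r \<rho> (real m * B + B) (\<lambda>t. (\<Sum>j<m. h j t) + h m t)"
      using Suc assms(1) by (intro near_poly_add) auto
    thus ?case by (simp add: algebra_simps)
  qed
  from near_poly_cmult[OF this[OF order.refl], of "1 / real n"]
  have "near_poly r \<rho> (\<bar>1 / real n\<bar> * (real n * B)) (\<lambda>t. (\<Sum>j<n. h j t) / real n)" by simp
  moreover have "\<bar>1 / real n\<bar> * (real n * B) = B" using assms(2) by simp
  ultimately show ?thesis by (simp only:)
qed

text \<open>The coefficients lie in a compact set, so that a subsequence of the polynomials converges.\<close>

lemma near_poly_limit:
  assumes g: "\<And>m. near_poly r \<rho> B (h m)" and lim: "\<And>t. t \<in> W \<rho> \<Longrightarrow> (\<lambda>m. h m t) \<longlonglongrightarrow> k t"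
  shows "near_poly r \<rho> B k"
proof -
  have "\<exists>P. \<forall>m. (\<forall>n. \<bar>coeff (P m) n\<bar> \<le> B * Cf ^ n) \<and> (\<forall>n\<ge>r. coeff (P m) n = 0) \<and>
     (\<forall>t\<in>W \<rho>. \<bar>h m t - poly (P m) (t - t0)\<bar> \<le> B * (\<kappa> * Cf) ^ r)"
    using g unfolding near_poly_def by (intro choice allI)
  then obtain P where P: "\<And>m n. \<bar>coeff (P m) n\<bar> \<le> B * Cf ^ n" "\<And>m n. n \<ge> r \<Longrightarrow> coeff (P m) n = 0"
     "\<And>m t. t \<in> W \<rho> \<Longrightarrow> \<bar>h m t - poly (P m) (t - t0)\<bar> \<le> B * (\<kappa> * Cf) ^ r" by blast
  obtain \<sigma> :: "nat \<Rightarrow> nat" where \<sigma>: "strict_mono \<sigma>" "\<And>n. n < r \<Longrightarrow> \<exists>l. (\<lambda>m. coeff (P (\<sigma> m)) n) \<longlonglongrightarrow> l"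
    using bounded_sequences_convergent_subsequence[of r "\<lambda>m n. coeff (P m) n" "\<lambda>n. B * Cf ^ n"] P(1) by blast
  then obtain l where l: "\<And>n. n < r \<Longrightarrow> (\<lambda>m. coeff (P (\<sigma> m)) n) \<longlonglongrightarrow> l n" by metis
  define L where "L = (\<Sum>n<r. monom (l n) n)"
  have coeff_L: "coeff L n = (if n < r then l n else 0)" for n
    by (auto simp: L_def coeff_sum)
  have polyL: "poly L z = (\<Sum>n<r. l n * z ^ n)" for z
    by (simp add: L_def poly_sum poly_monom)
  show ?thesis
  proof (rule near_polyI[of L])
    show "\<bar>coeff L n\<bar> \<le> B * Cf ^ n" for n
    proof (cases "n < r")
      case True
      have "(\<lambda>m. \<bar>coeff (P (\<sigma> m)) n\<bar>) \<longlonglongrightarrow> \<bar>l n\<bar>" by (intro tendsto_rabs l True)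
      hence "\<bar>l n\<bar> \<le> B * Cf ^ n" by (rule LIMSEQ_le_const2) (use P(1) in blast)
      thus ?thesis using True by (simp add: coeff_L)
    next
      case False
      thus ?thesis using near_poly_nonneg[OF g] Cf by (simp add: coeff_L)
    qed
    show "coeff L n = 0" if "n \<ge> r" for n using that by (simp add: coeff_L)
    fix t assume t: "t \<in> W \<rho>"
    have "(\<lambda>m. \<Sum>n<r. coeff (P (\<sigma> m)) n * (t - t0) ^ n) \<longlonglongrightarrow> (\<Sum>n<r. l n * (t - t0) ^ n)"
      by (intro tendsto_intros l) auto
    hence "(\<lambda>m. poly (P (\<sigma> m)) (t - t0)) \<longlonglongrightarrow> poly L (t - t0)"
      by (simp add: polyL poly_sum_below[OF P(2)])
    moreover have "(\<lambda>m. h (\<sigma> m) t) \<longlonglongrightarrow> k t"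
      using LIMSEQ_subseq_LIMSEQ[OF lim[OF t] \<sigma>(1)] by (simp add: o_def)
    ultimately have "(\<lambda>m. \<bar>h (\<sigma> m) t - poly (P (\<sigma> m)) (t - t0)\<bar>) \<longlonglongrightarrow> \<bar>k t - poly L (t - t0)\<bar>"
      by (intro tendsto_intros)
    thus "\<bar>k t - poly L (t - t0)\<bar> \<le> B * (\<kappa> * Cf) ^ r"
      by (rule LIMSEQ_le_const2) (use P(3)[OF t] in blast)
  qed
qed

lemma W_power:
  assumes "t \<in> W \<rho>" "\<rho> \<le> R" shows "\<bar>t - t0\<bar> ^ n \<le> R ^ n * \<kappa> ^ n"
proof -
  have "\<bar>t - t0\<bar> \<le> \<rho> * \<kappa>" using assms by (simp add: W_def)
  also have "\<dots> \<le> R * \<kappa>" using assms \<kappa> by simp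
  finally have "\<bar>t - t0\<bar> ^ n \<le> (R * \<kappa>) ^ n" by (intro power_mono) auto
  thus ?thesis by (simp add: power_mult_distrib)
qed

definition lowerC :: "nat \<Rightarrow> real" where "lowerC r = (1 + real r) * H ^ (2 * r)"

lemma lowerC_ge1: "lowerC r \<ge> 1"
  unfolding lowerC_def using mult_mono[of 1 "1 + real r" 1 "H ^ (2 * r)"] H_ge(1) by (simp add: one_le_power)

text \<open>The terms of degree at least \<open>r'\<close> are moved to the error; \<open>\<kappa> * Cf\<close> and the radius being bounded,
  this costs a factor.\<close>

lemma near_poly_lower:
  assumes g: "near_poly r \<rho> B h" and r': "r' \<le> r" and \<rho>: "\<rho> \<le> R"
  shows "near_poly r' \<rho> (lowerC r * B) h"
proof -
  obtain P where P: "\<And>n. \<bar>coeff P n\<bar> \<le> B * Cf ^ n" "\<And>n. n \<ge> r \<Longrightarrow> coeff P n = 0"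
    "\<And>t. t \<in> W \<rho> \<Longrightarrow> \<bar>h t - poly P (t - t0)\<bar> \<le> B * (\<kappa> * Cf) ^ r" by (rule near_polyE[OF g]) blast
  have B: "B \<ge> 0" using near_poly_nonneg[OF g] .
  define Q where "Q = (\<Sum>n<r'. monom (coeff P n) n)"
  have coeff_Q: "coeff Q n = (if n < r' then coeff P n else 0)" for n
    by (auto simp: Q_def coeff_sum)
  have pow: "(\<kappa> * Cf) ^ m * H ^ m' \<le> (\<kappa> * Cf) ^ r' * H ^ (2 * r)" if "r' \<le> m" "m \<le> r" "m' \<le> r" for m m'
  proof -
    have "(\<kappa> * Cf) ^ m = (\<kappa> * Cf) ^ r' * (\<kappa> * Cf) ^ (m - r')" using that by (simp flip: power_add)
    also have "\<dots> \<le> (\<kappa> * Cf) ^ r' * H ^ (m - r')"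
      using \<kappa>Cf_pos H_ge by (intro mult_left_mono power_mono) auto
    finally have "(\<kappa> * Cf) ^ m * H ^ m' \<le> (\<kappa> * Cf) ^ r' * H ^ (m - r') * H ^ m'"
      using H_ge by (intro mult_right_mono) auto
    also have "\<dots> = (\<kappa> * Cf) ^ r' * H ^ (m - r' + m')" by (simp add: power_add)
    also have "\<dots> \<le> (\<kappa> * Cf) ^ r' * H ^ (2 * r)"
      using that \<kappa>Cf_pos H_ge by (intro mult_left_mono power_increasing) auto
    finally show ?thesis .
  qed
  show ?thesis
  proof (rule near_polyI[of Q])
    show "\<bar>coeff Q n\<bar> \<le> lowerC r * B * Cf ^ n" for n
    proof -
      have "\<bar>coeff Q n\<bar> \<le> \<bar>coeff P n\<bar>" by (simp add: coeff_Q)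
      also have "\<dots> \<le> 1 * (B * Cf ^ n)" using P(1) by simp
      also have "\<dots> \<le> lowerC r * (B * Cf ^ n)" using lowerC_ge1 B Cf by (intro mult_right_mono) auto
      finally show ?thesis by (simp add: mult.assoc)
    qed
    show "coeff Q n = 0" if "n \<ge> r'" for n using that by (simp add: coeff_Q)
    fix t assume t: "t \<in> W \<rho>"
    define z where "z = t - t0"
    have "poly P z = (\<Sum>n<r. coeff P n * z ^ n)" by (rule poly_sum_below) (rule P(2))
    also have "\<dots> = (\<Sum>n<r'. coeff P n * z ^ n) + (\<Sum>n\<in>{r'..<r}. coeff P n * z ^ n)"
      using r' by (subst sum.union_disjoint[symmetric]) (auto simp: ivl_disj_un)
    also have "(\<Sum>n<r'. coeff P n * z ^ n) = poly Q z" by (simp add: Q_def poly_sum poly_monom)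
    finally have PQ: "poly P z - poly Q z = (\<Sum>n\<in>{r'..<r}. coeff P n * z ^ n)" by simp
    have "\<bar>coeff P n * z ^ n\<bar> \<le> B * ((\<kappa> * Cf) ^ r' * H ^ (2 * r))" if n: "n \<in> {r'..<r}" for n
    proof -
      have "\<bar>coeff P n * z ^ n\<bar> \<le> (B * Cf ^ n) * (R ^ n * \<kappa> ^ n)"
        unfolding abs_mult power_abs z_def using B Cf
        by (intro mult_mono P(1) W_power[OF t \<rho>]) auto
      also have "\<dots> = B * ((\<kappa> * Cf) ^ n * R ^ n)" by (simp add: power_mult_distrib mult_ac)
      also have "\<dots> \<le> B * ((\<kappa> * Cf) ^ n * H ^ n)"
        using B \<kappa>Cf_pos H_ge R by (intro mult_left_mono power_mono) auto
      also have "\<dots> \<le> B * ((\<kappa> * Cf) ^ r' * H ^ (2 * r))" using n B by (intro mult_left_mono pow) auto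
      finally show ?thesis .
    qed
    hence "\<bar>poly P z - poly Q z\<bar> \<le> (\<Sum>n\<in>{r'..<r}. B * ((\<kappa> * Cf) ^ r' * H ^ (2 * r)))"
      unfolding PQ by (intro order.trans[OF sum_abs sum_mono])
    also have "\<dots> \<le> real r * (B * ((\<kappa> * Cf) ^ r' * H ^ (2 * r)))"
      using B \<kappa>Cf_pos H_ge by (simp add: mult_right_mono)
    finally have 1: "\<bar>poly P z - poly Q z\<bar> \<le> real r * (B * ((\<kappa> * Cf) ^ r' * H ^ (2 * r)))" .
    have "\<bar>h t - poly P z\<bar> \<le> B * ((\<kappa> * Cf) ^ r * H ^ 0)" using P(3)[OF t] by (simp add: z_def)
    also have "\<dots> \<le> B * ((\<kappa> * Cf) ^ r' * H ^ (2 * r))" using B r' by (intro mult_left_mono pow) auto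
    finally have "\<bar>h t - poly Q z\<bar> \<le> (1 + real r) * (B * ((\<kappa> * Cf) ^ r' * H ^ (2 * r)))"
      using 1 by (simp add: distrib_right)
    thus "\<bar>h t - poly Q (t - t0)\<bar> \<le> lowerC r * B * (\<kappa> * Cf) ^ r'"
      by (simp add: z_def lowerC_def mult_ac)
  qed
qed

text \<open>Integration gains one order, since it multiplies the error by a length of order \<open>\<kappa>\<close>.\<close>

lemma near_poly_integrate:
  assumes g: "near_poly r \<rho> (B * Cf) h'" and \<rho>: "\<rho> \<le> R"
    and cont: "continuous_on {a<..<b} h"
    and d: "\<And>t. t \<in> {a<..<b} - S \<Longrightarrow> (h has_real_derivative h' t) (at t)"
  shows "near_poly (Suc r) \<rho> (B * H) (\<lambda>t. h t - h t0)"
proof -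
  obtain P where P: "\<And>n. \<bar>coeff P n\<bar> \<le> B * Cf * Cf ^ n" "\<And>n. n \<ge> r \<Longrightarrow> coeff P n = 0"
    "\<And>t. t \<in> W \<rho> \<Longrightarrow> \<bar>h' t - poly P (t - t0)\<bar> \<le> B * Cf * (\<kappa> * Cf) ^ r" by (rule near_polyE[OF g]) blast
  have B: "B \<ge> 0" using near_poly_nonneg[OF g] Cf by (simp add: zero_le_mult_iff)
  define Q where "Q = (\<Sum>n<r. monom (coeff P n / real (Suc n)) (Suc n))"
  have coeff_Q: "coeff Q m = (if m = 0 \<or> m > r then 0 else coeff P (m - 1) / real m)" for m
  proof (cases m)
    case 0 thus ?thesis by (simp add: Q_def coeff_sum)
  next
    case (Suc k)
    thus ?thesis by (auto simp: Q_def coeff_sum)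
  qed
  have dQ: "pderiv Q = P"
  proof (rule poly_eqI)
    fix n
    show "coeff (pderiv Q) n = coeff P n"
      using P(2)[of n] by (auto simp: coeff_pderiv coeff_Q)
  qed
  have BH: "B \<le> B * H" using B H_ge(1) by (simp add: mult_le_cancel_left1)
  show ?thesis
  proof (rule near_polyI[of Q])
    show "\<bar>coeff Q n\<bar> \<le> B * H * Cf ^ n" for n
    proof (cases "n = 0 \<or> n > r")
      case True
      thus ?thesis using B H_ge Cf by (simp add: coeff_Q)
    next
      case False
      hence "\<bar>coeff Q n\<bar> = \<bar>coeff P (n - 1)\<bar> / real n" by (simp add: coeff_Q)
      also have "\<dots> \<le> \<bar>coeff P (n - 1)\<bar> / 1" using False by (intro divide_left_mono) auto
      also have "\<dots> \<le> B * (Cf * Cf ^ (n - 1))" using P(1)[of "n - 1"] by (simp add: mult.assoc)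
      also have "Cf * Cf ^ (n - 1) = Cf ^ n" using False by (cases n) auto
      also have "B * Cf ^ n \<le> B * H * Cf ^ n" using BH Cf by (intro mult_right_mono) auto
      finally show ?thesis .
    qed
    show "coeff Q n = 0" if "n \<ge> Suc r" for n using that by (simp add: coeff_Q)
    fix t assume t: "t \<in> W \<rho>"
    define e where "e s = h s - h t0 - poly Q (s - t0)" for s
    define M where "M = B * Cf * (\<kappa> * Cf) ^ r"
    have M0: "M \<ge> 0" using B Cf \<kappa>Cf_pos by (simp add: M_def)
    have tab: "a < t" "t < b" "\<bar>t - t0\<bar> \<le> \<rho> * \<kappa>" using t by (auto simp: W_def)
    have de: "(e has_real_derivative (h' s - poly P (s - t0))) (at s)" if "s \<in> {a<..<b} - S" for s
      unfolding e_def
      by (auto intro!: derivative_eq_intros d[OF that] simp: dQ)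
    have ce: "continuous_on {a<..<b} e" unfolding e_def by (intro continuous_intros cont)
    have be: "\<bar>h' s - poly P (s - t0)\<bar> \<le> M" if "s \<in> {a<..<b} - S" "\<bar>s - t0\<bar> \<le> \<bar>t - t0\<bar>" for s
      unfolding M_def using that tab by (intro P(3)) (auto simp: W_def)
    have "e t0 = 0" by (simp add: e_def poly_0_coeff_0 coeff_Q)
    have "\<bar>e t - e t0\<bar> \<le> M * \<bar>t - t0\<bar>"
    proof (cases "t0 \<le> t")
      case True
      have "\<bar>e t - e t0\<bar> \<le> M * (t - t0)"
        by (rule bounded_derivative_increment[OF True S _ M0 de be])
          (use tab t0 True in \<open>auto intro: continuous_on_subset[OF ce]\<close>)
      thus ?thesis using True by simp
    next
      case False
      have "\<bar>e t0 - e t\<bar> \<le> M * (t0 - t)"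
        by (rule bounded_derivative_increment[OF _ S _ M0 de be])
          (use tab t0 False in \<open>auto intro: continuous_on_subset[OF ce]\<close>)
      thus ?thesis using False by (simp add: abs_minus_commute)
    qed
    also have "\<dots> \<le> M * (R ^ 1 * \<kappa> ^ 1)" using W_power[OF t \<rho>, of 1] M0 by (intro mult_left_mono) auto
    also have "\<dots> \<le> M * (H * \<kappa>)" using H_ge M0 \<kappa> by (intro mult_left_mono mult_right_mono) auto
    also have "\<dots> = B * H * (\<kappa> * Cf) ^ Suc r" by (simp add: M_def mult_ac)
    finally show "\<bar>h t - h t0 - poly Q (t - t0)\<bar> \<le> B * H * (\<kappa> * Cf) ^ Suc r"
      using \<open>e t0 = 0\<close> by (simp add: e_def)
  qed
qed

lemma near_poly_taylor:
  assumes diff: "\<And>m s. m < r \<Longrightarrow> s \<in> {a<..<b} \<Longrightarrow> ((deriv ^^ m) h) differentiable (at s)"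
    and B: "\<And>m s. m \<le> r \<Longrightarrow> s \<in> {a<..<b} \<Longrightarrow> \<bar>(deriv ^^ m) h s\<bar> \<le> B * Cf ^ m"
    and \<rho>: "\<rho> \<le> R"
  shows "near_poly r \<rho> (B * H ^ r) h"
proof (rule near_polyI[of "taylor_poly r h t0"])
  have "\<bar>(deriv ^^ 0) h t0\<bar> \<le> B * Cf ^ 0" using t0 by (intro B) auto
  hence B0: "B \<ge> 0" by simp
  have BH: "B * 1 \<le> B * H ^ r" using B0 H_ge(1) by (intro mult_left_mono one_le_power) auto
  show "\<bar>coeff (taylor_poly r h t0) n\<bar> \<le> B * H ^ r * Cf ^ n" for n
  proof (cases "n < r")
    case True
    have "\<bar>(deriv ^^ n) h t0\<bar> / fact n \<le> \<bar>(deriv ^^ n) h t0\<bar> / 1" by (intro divide_left_mono) auto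
    also have "\<dots> \<le> B * Cf ^ n" using True t0 B[of n t0] by simp
    also have "\<dots> \<le> B * H ^ r * Cf ^ n" using BH Cf by (intro mult_right_mono) auto
    finally show ?thesis using True by (simp add: coeff_taylor_poly)
  next
    case False
    thus ?thesis using B0 H_ge Cf by (simp add: coeff_taylor_poly)
  qed
  show "coeff (taylor_poly r h t0) n = 0" if "n \<ge> r" for n using that by (simp add: coeff_taylor_poly)
  fix t assume t: "t \<in> W \<rho>"
  have "\<bar>h t - poly (taylor_poly r h t0) (t - t0)\<bar> \<le> (B * Cf ^ r) * \<bar>t - t0\<bar> ^ r"
    by (rule taylor_poly_error[where a = a and b = b]) (use diff B t t0 in \<open>auto simp: W_def\<close>)
  also have "\<dots> \<le> (B * Cf ^ r) * (R ^ r * \<kappa> ^ r)"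
    using B0 Cf by (intro mult_left_mono W_power[OF t \<rho>]) auto
  also have "\<dots> \<le> (B * Cf ^ r) * (H ^ r * \<kappa> ^ r)"
    using B0 Cf H_ge R \<kappa> by (intro mult_left_mono mult_right_mono power_mono) auto
  finally show "\<bar>h t - poly (taylor_poly r h t0) (t - t0)\<bar> \<le> B * H ^ r * (\<kappa> * Cf) ^ r"
    by (simp add: power_mult_distrib mult_ac)
qed

text \<open>
  The same polynomial serves for a function and for its piecewise \<open>L\<^sub>2\<close> projection, because the
  projection on each piece is quasi-optimal. The pieces must lie in the window of the function, which
  shrinks the window by one unit.
\<close>

lemma near_poly_projection:
  assumes g: "near_poly r (\<rho> + 1) B h" and r: "r \<le> d + 1"
    and cells: "\<And>t. t \<in> W \<rho> \<Longrightarrow> \<exists>\<alpha> \<beta> (Y :: real poly). \<alpha> < t \<and> t < \<beta> \<and> a \<le> \<alpha> \<and> \<beta> \<le> b \<and> \<beta> - \<alpha> \<le> \<kappa> \<and>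
      degree Y \<le> d \<and> y t = poly Y t \<and>
      (\<forall>w. degree w \<le> d \<longrightarrow> ((\<lambda>s. (poly Y s - h s) * poly w s) has_integral 0) {\<alpha>..\<beta>})"
  shows "near_poly r \<rho> ((1 + polyC d) * B) y"
proof -
  obtain P where P: "\<And>n. \<bar>coeff P n\<bar> \<le> B * Cf ^ n" "\<And>n. n \<ge> r \<Longrightarrow> coeff P n = 0"
    "\<And>t. t \<in> W (\<rho> + 1) \<Longrightarrow> \<bar>h t - poly P (t - t0)\<bar> \<le> B * (\<kappa> * Cf) ^ r" by (rule near_polyE[OF g]) blast
  have B: "B \<ge> 0" using near_poly_nonneg[OF g] .
  have pc: "1 \<le> 1 + polyC d" "polyC d \<le> 1 + polyC d" using polyC_pos[of d] by auto
  show ?thesis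
  proof (rule near_polyI[OF _ P(2)])
    show "\<bar>coeff P n\<bar> \<le> (1 + polyC d) * B * Cf ^ n" for n
      using P(1)[of n] mult_right_mono[OF pc(1), of "B * Cf ^ n"] B Cf by (simp add: mult.assoc)
    fix t assume t: "t \<in> W \<rho>"
    from cells[OF t] obtain \<alpha> \<beta> and Y :: "real poly" where Y: "\<alpha> < t" "t < \<beta>" "a \<le> \<alpha>" "\<beta> \<le> b" "\<beta> - \<alpha> \<le> \<kappa>"
      "degree Y \<le> d" "y t = poly Y t"
      "\<And>w. degree w \<le> d \<Longrightarrow> ((\<lambda>s. (poly Y s - h s) * poly w s) has_integral 0) {\<alpha>..\<beta>}" by blast
    define p where "p = pcompose P [:- t0, 1:]"
    have p: "poly p s = poly P (s - t0)" for s by (simp add: p_def poly_pcompose)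
    have "degree P \<le> d"
    proof (cases "P = 0")
      case False
      hence "coeff P (degree P) \<noteq> 0" by simp
      hence "degree P < r" using P(2) by (meson not_le)
      thus ?thesis using r by simp
    qed simp
    hence degp: "degree p \<le> d" unfolding p_def using degree_pcompose_le[of P "[:- t0, 1:]"] by simp
    have "\<bar>poly Y t - poly p t\<bar> \<le> polyC d * (B * (\<kappa> * Cf) ^ r)"
    proof (rule L2_projection_quasi_optimal[OF Y(6) degp _ S _ Y(8)])
      show "\<alpha> < \<beta>" using Y by simp
      fix s assume s: "s \<in> {\<alpha><..<\<beta>} - S"
      have "\<bar>s - t0\<bar> \<le> \<bar>s - t\<bar> + \<bar>t - t0\<bar>" by linarith
      also have "\<dots> \<le> \<kappa> + \<rho> * \<kappa>" using s Y t by (intro add_mono) (auto simp: W_def)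
      finally have "s \<in> W (\<rho> + 1)" using s Y by (auto simp: W_def algebra_simps)
      thus "\<bar>h s - poly p s\<bar> \<le> B * (\<kappa> * Cf) ^ r" unfolding p by (rule P(3))
    qed (use Y in auto)
    also have "\<dots> \<le> (1 + polyC d) * (B * (\<kappa> * Cf) ^ r)"
      using pc B \<kappa>Cf_pos by (intro mult_right_mono) auto
    finally show "\<bar>y t - poly P (t - t0)\<bar> \<le> (1 + polyC d) * B * (\<kappa> * Cf) ^ r"
      by (simp add: Y p mult.assoc)
  qed
qed

text \<open>The interpolant is quasi-optimal, hence close to the same polynomial as the function itself.\<close>

lemma near_poly_interp:
  assumes g: "near_poly r (\<rho> + 1) B (\<lambda>t. v t - x0)" and r: "r \<le> d + 1"
    and cells: "\<And>t. t \<in> W \<rho> \<Longrightarrow> \<exists>\<alpha> \<beta>. \<alpha> < t \<and> t < \<beta> \<and> a \<le> \<alpha> \<and> \<beta> \<le> b \<and> \<beta> - \<alpha> \<le> \<kappa> \<and>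
      cG_interp d \<alpha> \<beta> v h \<and> continuous_on {\<alpha>..\<beta>} v"
  shows "near_poly r \<rho> (interpC d * B) (\<lambda>t. h t - x0)"
proof -
  obtain P where P: "\<And>n. \<bar>coeff P n\<bar> \<le> B * Cf ^ n" "\<And>n. n \<ge> r \<Longrightarrow> coeff P n = 0"
    "\<And>t. t \<in> W (\<rho> + 1) \<Longrightarrow> \<bar>v t - x0 - poly P (t - t0)\<bar> \<le> B * (\<kappa> * Cf) ^ r" by (rule near_polyE[OF g]) blast
  have B: "B \<ge> 0" using near_poly_nonneg[OF g] .
  have pc: "1 \<le> interpC d" using polyC_pos[of d] by (simp add: interpC_def)
  show ?thesis
  proof (rule near_polyI[OF _ P(2)])
    show "\<bar>coeff P n\<bar> \<le> interpC d * B * Cf ^ n" for n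
      using P(1)[of n] mult_right_mono[OF pc, of "B * Cf ^ n"] B Cf by (simp add: mult.assoc)
    fix t assume t: "t \<in> W \<rho>"
    from cells[OF t] obtain \<alpha> \<beta> where Y: "\<alpha> < t" "t < \<beta>" "a \<le> \<alpha>" "\<beta> \<le> b" "\<beta> - \<alpha> \<le> \<kappa>"
      "cG_interp d \<alpha> \<beta> v h" "continuous_on {\<alpha>..\<beta>} v" by blast
    define p where "p = pcompose P [:- t0, 1:] + [:x0:]"
    have p: "poly p s = poly P (s - t0) + x0" for s by (simp add: p_def poly_pcompose)
    have "degree P \<le> d"
    proof (cases "P = 0")
      case False
      hence "coeff P (degree P) \<noteq> 0" by simp
      hence "degree P < r" using P(2) by (meson not_le)
      thus ?thesis using r by simp
    qed simp
    hence "degree (pcompose P [:- t0, 1:]) \<le> d" using degree_pcompose_le[of P "[:- t0, 1:]"] by simp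
    hence degp: "degree p \<le> d" unfolding p_def by (intro degree_add_le) auto
    have "\<bar>h t - poly p t\<bar> \<le> interpC d * (B * (\<kappa> * Cf) ^ r)"
    proof (rule cG_interp_quasi_optimal(1)[OF Y(6) _ Y(7) degp _ S])
      show "\<alpha> < \<beta>" using Y by simp
      fix s assume s: "s \<in> {\<alpha><..<\<beta>} - S"
      have "\<bar>s - t0\<bar> \<le> \<bar>s - t\<bar> + \<bar>t - t0\<bar>" by linarith
      also have "\<dots> \<le> \<kappa> + \<rho> * \<kappa>" using s Y t by (intro add_mono) (auto simp: W_def)
      finally have "s \<in> W (\<rho> + 1)" using s Y by (auto simp: W_def algebra_simps)
      from P(3)[OF this] show "\<bar>v s - poly p s\<bar> \<le> B * (\<kappa> * Cf) ^ r" by (simp add: p algebra_simps)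
    qed (use Y in auto)
    thus "\<bar>h t - x0 - poly P (t - t0)\<bar> \<le> interpC d * B * (\<kappa> * Cf) ^ r"
      by (simp add: p algebra_simps)
  qed
qed

definition prodC :: "nat \<Rightarrow> real" where "prodC r = (1 + real r) * lowerC r * H ^ r"

lemma prodC_ge1: "prodC r \<ge> 1"
proof -
  have "1 * 1 * 1 \<le> (1 + real r) * lowerC r * H ^ r"
    using lowerC_ge1[of r] H_ge(1) by (intro mult_mono one_le_power) auto
  thus ?thesis by (simp add: prodC_def)
qed

text \<open>
  The curve is expanded in powers of \<open>t - t0\<close>; the functional is then evaluated at constant vectors
  and at the error, all measured in the maximum norm. Thus the constant does not depend on the
  dimension.
\<close>

lemma near_poly_linear:
  assumes M: "\<And>y. (\<And>l. l < N \<Longrightarrow> \<bar>y l\<bar> \<le> 1) \<Longrightarrow> near_poly r \<rho> K (\<lambda>t. \<Sum>l<N. M t l * y l)"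
    and v: "\<And>l. l < N \<Longrightarrow> near_poly r \<rho> B (\<lambda>t. v t l)" and \<rho>: "\<rho> \<le> R" and B: "B \<ge> 0"
  shows "near_poly r \<rho> (K * B * prodC r) (\<lambda>t. \<Sum>l<N. M t l * v t l)"
proof (cases "B = 0")
  case True
  have "v t l = 0" if l: "l < N" and t: "t \<in> W \<rho>" for t l
  proof -
    obtain P where P: "\<And>n. \<bar>coeff P n\<bar> \<le> 0 * Cf ^ n" "\<And>t. t \<in> W \<rho> \<Longrightarrow> \<bar>v t l - poly P (t - t0)\<bar> \<le> 0 * (\<kappa> * Cf) ^ r"
      using v[OF l] True unfolding near_poly_def by blast
    have "P = 0" using P(1) by (simp add: poly_eq_iff)
    thus ?thesis using P(2)[OF t] by simp
  qed
  thus ?thesis using True by (intro near_poly_zero) auto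
next
  case False
  hence B: "B > 0" using assms(4) by simp
  have K: "K \<ge> 0" using near_poly_nonneg[OF M[of "\<lambda>_. 0"]] by simp
  have "\<exists>P. (\<forall>n. \<bar>coeff P n\<bar> \<le> B * Cf ^ n) \<and> (\<forall>n\<ge>r. coeff P n = 0) \<and>
     (\<forall>t\<in>W \<rho>. \<bar>v t l - poly P (t - t0)\<bar> \<le> B * (\<kappa> * Cf) ^ r)" if "l < N" for l
    using v[OF that] unfolding near_poly_def .
  then obtain V where V: "\<And>l n. l < N \<Longrightarrow> \<bar>coeff (V l) n\<bar> \<le> B * Cf ^ n"
    "\<And>l n. l < N \<Longrightarrow> n \<ge> r \<Longrightarrow> coeff (V l) n = 0"
    "\<And>l t. l < N \<Longrightarrow> t \<in> W \<rho> \<Longrightarrow> \<bar>v t l - poly (V l) (t - t0)\<bar> \<le> B * (\<kappa> * Cf) ^ r"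
    by metis
  \<comment> \<open>The constant vectors: the \<open>n\<close>-th coefficients of all components, scaled to maximum norm at most 1.\<close>
  define y where "y n l = coeff (V l) n / (B * Cf ^ n)" for n l
  have BCf: "B * Cf ^ n > 0" for n using B Cf by simp
  have y1: "\<bar>y n l\<bar> \<le> 1" if "l < N" for n l
    using V(1)[OF that, of n] BCf[of n] unfolding y_def abs_divide by (simp add: divide_le_eq)
  have Vy: "coeff (V l) n = B * Cf ^ n * y n l" for n l
    using B Cf by (simp add: y_def)
  have "\<exists>Q. (\<forall>m. \<bar>coeff Q m\<bar> \<le> lowerC r * K * Cf ^ m) \<and> (\<forall>m\<ge>r - n. coeff Q m = 0) \<and>
     (\<forall>t\<in>W \<rho>. \<bar>(\<Sum>l<N. M t l * y n l) - poly Q (t - t0)\<bar> \<le> lowerC r * K * (\<kappa> * Cf) ^ (r - n))" for n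
  proof -
    have "near_poly (r - n) \<rho> (lowerC r * K) (\<lambda>t. \<Sum>l<N. M t l * y n l)"
      by (intro near_poly_lower[OF M] y1 \<rho>) auto
    thus ?thesis unfolding near_poly_def .
  qed
  hence "\<exists>Q. \<forall>n. (\<forall>m. \<bar>coeff (Q n) m\<bar> \<le> lowerC r * K * Cf ^ m) \<and> (\<forall>m\<ge>r - n. coeff (Q n) m = 0) \<and>
     (\<forall>t\<in>W \<rho>. \<bar>(\<Sum>l<N. M t l * y n l) - poly (Q n) (t - t0)\<bar> \<le> lowerC r * K * (\<kappa> * Cf) ^ (r - n))"
    by (intro choice allI)
  then obtain Q where Q: "\<And>n m. \<bar>coeff (Q n) m\<bar> \<le> lowerC r * K * Cf ^ m" "\<And>n m. m \<ge> r - n \<Longrightarrow> coeff (Q n) m = 0"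
     "\<And>n t. t \<in> W \<rho> \<Longrightarrow> \<bar>(\<Sum>l<N. M t l * y n l) - poly (Q n) (t - t0)\<bar> \<le> lowerC r * K * (\<kappa> * Cf) ^ (r - n)"
    by blast
  \<comment> \<open>At the \<open>n\<close>-th vector the functional is expanded to order \<open>r - n\<close> only, so that the degree of the
    product stays below \<open>r\<close>; the missing power of \<open>\<kappa> * Cf\<close> is supplied by \<open>(t - t0) ^ n * Cf ^ n\<close>.\<close>
  define P where "P = (\<Sum>n<r. monom (B * Cf ^ n) n * Q n)"
  have LK: "lowerC r * K \<ge> 0" using lowerC_ge1[of r] K by simp
  define X where "X = lowerC r * K * B * H ^ r"
  have Hr: "1 \<le> H ^ r" using H_ge(1) by (intro one_le_power)
  have X0: "X \<ge> 0" unfolding X_def using LK B Hr by simp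
  have KMX: "K * B * prodC r = (1 + real r) * X" by (simp add: prodC_def X_def mult_ac)
  have X1: "lowerC r * K * B \<le> X"
    unfolding X_def using mult_left_mono[OF Hr, of "lowerC r * K * B"] LK B by simp
  show ?thesis
    unfolding KMX
  proof (rule near_polyI[of P])
    have cP: "coeff P m = (\<Sum>n<r. if n \<le> m then B * Cf ^ n * coeff (Q n) (m - n) else 0)" for m
      unfolding P_def coeff_sum by (intro sum.cong) (auto simp: coeff_monom_mult)
    show "\<bar>coeff P m\<bar> \<le> (1 + real r) * X * Cf ^ m" for m
    proof -
      have "\<bar>coeff P m\<bar> \<le> (\<Sum>n<r. X * Cf ^ m)"
        unfolding cP
      proof (rule order.trans[OF sum_abs sum_mono])
        fix n
        show "\<bar>if n \<le> m then B * Cf ^ n * coeff (Q n) (m - n) else 0\<bar> \<le> X * Cf ^ m"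
        proof (cases "n \<le> m")
          case True
          have "B * Cf ^ n * \<bar>coeff (Q n) (m - n)\<bar> \<le> B * Cf ^ n * (lowerC r * K * Cf ^ (m - n))"
            using BCf[of n] by (intro mult_left_mono Q(1)) auto
          also have "\<dots> = lowerC r * K * B * Cf ^ (n + (m - n))" by (simp add: power_add mult_ac)
          also have "\<dots> \<le> X * Cf ^ m" using True X1 Cf by (simp add: mult_right_mono)
          finally show ?thesis using True B Cf by (simp add: abs_mult)
        qed (use X0 Cf in simp)
      qed
      also have "\<dots> = real r * (X * Cf ^ m)" by simp
      also have "\<dots> \<le> (1 + real r) * (X * Cf ^ m)" using X0 Cf by (intro mult_right_mono) auto
      finally show ?thesis by (simp add: mult.assoc)
    qed
    show "coeff P m = 0" if "m \<ge> r" for m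
      unfolding cP using that by (intro sum.neutral) (auto simp: Q(2))
    fix t assume t: "t \<in> W \<rho>"
    define z where "z = t - t0"
    define E where "E = B * (\<kappa> * Cf) ^ r"
    have E: "E > 0" using B \<kappa>Cf_pos by (simp add: E_def)
    \<comment> \<open>For fixed \<open>t\<close> the scaled error is another admissible constant vector.\<close>
    define e where "e l = (v t l - poly (V l) z) / E" for l
    have e1: "\<bar>e l\<bar> \<le> 1" if "l < N" for l
      using V(3)[OF that t] E unfolding e_def abs_divide by (simp add: z_def E_def divide_le_eq)
    have vt: "v t l = (\<Sum>n<r. B * Cf ^ n * y n l * z ^ n) + E * e l" if "l < N" for l
    proof -
      have "poly (V l) z = (\<Sum>n<r. B * Cf ^ n * y n l * z ^ n)"
        unfolding Vy[symmetric] by (rule poly_sum_below) (rule V(2)[OF that])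
      thus ?thesis using E by (simp add: e_def)
    qed
    have "(\<Sum>l<N. M t l * v t l) = (\<Sum>l<N. (\<Sum>n<r. B * Cf ^ n * z ^ n * (M t l * y n l)) + E * (M t l * e l))"
      by (intro sum.cong refl) (simp add: vt distrib_left sum_distrib_left mult_ac)
    also have "\<dots> = (\<Sum>n<r. B * Cf ^ n * z ^ n * (\<Sum>l<N. M t l * y n l)) + E * (\<Sum>l<N. M t l * e l)"
      unfolding sum.distrib sum_distrib_left by (subst sum.swap) simp
    finally have main: "(\<Sum>l<N. M t l * v t l) - poly P z =
        (\<Sum>n<r. B * Cf ^ n * z ^ n * ((\<Sum>l<N. M t l * y n l) - poly (Q n) z)) + E * (\<Sum>l<N. M t l * e l)"
      by (simp add: P_def poly_sum poly_monom right_diff_distrib sum_subtractf)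
    have 1: "\<bar>B * Cf ^ n * z ^ n * ((\<Sum>l<N. M t l * y n l) - poly (Q n) z)\<bar> \<le> X * (\<kappa> * Cf) ^ r" if n: "n < r" for n
    proof -
      have "\<bar>B * Cf ^ n * z ^ n * ((\<Sum>l<N. M t l * y n l) - poly (Q n) z)\<bar> =
          (B * Cf ^ n) * (\<bar>z\<bar> ^ n * \<bar>(\<Sum>l<N. M t l * y n l) - poly (Q n) z\<bar>)"
        using B Cf by (simp add: abs_mult power_abs mult.assoc)
      also have "\<dots> \<le> (B * Cf ^ n) * ((R ^ n * \<kappa> ^ n) * (lowerC r * K * (\<kappa> * Cf) ^ (r - n)))"
        using BCf[of n] Q(3)[OF t, of n] W_power[OF t \<rho>, of n] R \<kappa>
        by (intro mult_left_mono mult_mono) (auto simp: z_def)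
      also have "\<dots> = lowerC r * K * B * R ^ n * (\<kappa> * Cf) ^ (n + (r - n))"
        by (simp add: power_add power_mult_distrib mult_ac)
      also have "\<dots> = lowerC r * K * B * R ^ n * (\<kappa> * Cf) ^ r" using n by simp
      also have "\<dots> \<le> lowerC r * K * B * H ^ r * (\<kappa> * Cf) ^ r"
      proof -
        have "R ^ n \<le> H ^ n" using R H_ge by (intro power_mono) auto
        also have "\<dots> \<le> H ^ r" using n H_ge by (intro power_increasing) auto
        finally show ?thesis using LK B \<kappa>Cf_pos by (intro mult_right_mono mult_left_mono) auto
      qed
      finally show ?thesis by (simp add: X_def)
    qed
    have 2: "\<bar>E * (\<Sum>l<N. M t l * e l)\<bar> \<le> X * (\<kappa> * Cf) ^ r"
    proof -
      have "near_poly 0 \<rho> (lowerC r * K) (\<lambda>t. \<Sum>l<N. M t l * e l)" by (intro near_poly_lower[OF M] e1 \<rho>) auto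
      hence "\<bar>\<Sum>l<N. M t l * e l\<bar> \<le> lowerC r * K" using t by (simp add: near_poly_0_iff)
      hence "E * \<bar>\<Sum>l<N. M t l * e l\<bar> \<le> E * (lowerC r * K)" using E by (intro mult_left_mono) auto
      also have "\<dots> = (lowerC r * K * B) * (\<kappa> * Cf) ^ r" by (simp add: E_def mult_ac)
      also have "\<dots> \<le> X * (\<kappa> * Cf) ^ r" using X1 \<kappa>Cf_pos by (intro mult_right_mono) auto
      finally show ?thesis using E by (simp add: abs_mult)
    qed
    have "\<bar>(\<Sum>l<N. M t l * v t l) - poly P z\<bar> \<le> (\<Sum>n<r. X * (\<kappa> * Cf) ^ r) + X * (\<kappa> * Cf) ^ r"
      unfolding main
      by (rule order.trans[OF abs_triangle_ineq add_mono[OF order.trans[OF sum_abs sum_mono] 2]]) (simp add: 1)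
    thus "\<bar>(\<Sum>l<N. M t l * v t l) - poly P (t - t0)\<bar> \<le> (1 + real r) * X * (\<kappa> * Cf) ^ r"
      by (simp add: z_def algebra_simps)
  qed
qed

end

section \<open>One time slab\<close>

lemma linf_upper: "i < N \<Longrightarrow> \<bar>v i\<bar> \<le> linf N v"
  unfolding linf_def by (intro Max_ge) auto

lemma linf_le_iff:
  assumes "N \<ge> 1" shows "linf N v \<le> C \<longleftrightarrow> (\<forall>i<N. \<bar>v i\<bar> \<le> C)"
proof -
  have "(\<lambda>i. \<bar>v i\<bar>) ` {..<N} \<noteq> {}" using assms by (auto simp: lessThan_empty_iff)
  thus ?thesis unfolding linf_def by (subst Max_le_iff) auto
qed

lemma linf_op_upper:
  assumes N: "N \<ge> 1" and i: "i < N" and y: "\<And>l. l < N \<Longrightarrow> \<bar>y l\<bar> \<le> 1"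
  shows "\<bar>\<Sum>l<N. B i l * y l\<bar> \<le> linf_op N B"
proof -
  have "bdd_above ((\<lambda>w. linf N (\<lambda>i. \<Sum>l<N. B i l * w l)) ` {w. linf N w \<le> 1})"
  proof (rule bdd_aboveI2)
    fix w assume "w \<in> {w. linf N w \<le> 1}"
    hence w: "\<And>l. l < N \<Longrightarrow> \<bar>w l\<bar> \<le> 1" using N by (auto simp: linf_le_iff)
    have "\<bar>\<Sum>l<N. B k l * w l\<bar> \<le> (\<Sum>k<N. \<Sum>l<N. \<bar>B k l\<bar>)" if k: "k < N" for k
    proof -
      have "\<bar>\<Sum>l<N. B k l * w l\<bar> \<le> (\<Sum>l<N. \<bar>B k l\<bar>)"
      proof (rule order.trans[OF sum_abs sum_mono])
        fix l assume "l \<in> {..<N}"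
        thus "\<bar>B k l * w l\<bar> \<le> \<bar>B k l\<bar>" using w[of l] by (simp add: abs_mult mult_left_le)
      qed
      also have "\<dots> \<le> (\<Sum>k<N. \<Sum>l<N. \<bar>B k l\<bar>)"
        using k by (intro member_le_sum[of k "{..<N}" "\<lambda>k. \<Sum>l<N. \<bar>B k l\<bar>"]) (auto intro: sum_nonneg)
      finally show ?thesis .
    qed
    thus "linf N (\<lambda>i. \<Sum>l<N. B i l * w l) \<le> (\<Sum>k<N. \<Sum>l<N. \<bar>B k l\<bar>)" using N by (simp add: linf_le_iff)
  qed
  moreover have "y \<in> {w. linf N w \<le> 1}" using y N by (simp add: linf_le_iff)
  ultimately have "linf N (\<lambda>i. \<Sum>l<N. B i l * y l) \<le> linf_op N B"
    unfolding linf_op_def by (intro cSUP_upper)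
  thus ?thesis using linf_upper[OF i, of "\<lambda>i. \<Sum>l<N. B i l * y l"] by simp
qed

lemma Dpnorm_bound:
  assumes "Dpnorm N p F a b A \<le> ereal Cf" "n \<le> p" "t \<in> {a<..b}" "x \<in> A t" "N \<ge> 1"
  shows "\<bar>Dform N n (\<lambda>y. F y t) x w\<bar> \<le> Cf * (\<Prod>r<n. linf N (w r))"
proof (rule field_le_epsilon)
  fix e :: real assume e: "e > 0"
  define P where "P = (\<Prod>r<n. linf N (w r))"
  define d where "d = e / (1 + \<bar>P\<bar>)"
  have d: "d > 0" using e by (simp add: d_def)
  have "Dnorm N n F a b A \<le> Dpnorm N p F a b A"
    unfolding Dpnorm_def using assms(2) by (intro Max_ge) auto
  hence "Dnorm N n F a b A \<le> ereal Cf" using assms(1) by (rule order.trans)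
  also have "\<dots> < ereal (Cf + d)" using d by simp
  finally have "Dnorm N n F a b A < ereal (Cf + d)" .
  then obtain C where C: "C < Cf + d"
    "\<And>t x w. t \<in> {a<..b} \<Longrightarrow> x \<in> A t \<Longrightarrow> \<bar>Dform N n (\<lambda>y. F y t) x w\<bar> \<le> C * (\<Prod>r<n. linf N (w r))"
    unfolding Dnorm_def Inf_less_iff by auto
  have 1: "\<bar>Dform N n (\<lambda>y. F y t) x w\<bar> \<le> C * P" unfolding P_def by (rule C(2)[OF assms(3,4)])
  have "\<bar>w r i\<bar> \<le> linf N (w r)" if "i < N" for r i using linf_upper[OF that] .
  hence P0: "P \<ge> 0" unfolding P_def using assms(5) by (intro prod_nonneg ballI) (meson abs_ge_zero order.trans less_le_trans zero_less_one)
  hence "C * P \<le> (Cf + d) * P" using C(1) by (intro mult_right_mono) auto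
  moreover have "d * P \<le> e" using P0 e by (simp add: d_def field_simps)
  ultimately show "\<bar>Dform N n (\<lambda>y. F y t) x w\<bar> \<le> Cf * (\<Prod>r<n. linf N (w r)) + e"
    using 1 unfolding P_def by (simp add: distrib_right)
qed

lemma right_limit_exists:
  fixes F G :: "real \<Rightarrow> real"
  assumes "e > 0" "\<And>s. s \<in> {t<..<t + e} \<Longrightarrow> F s = G s" "isCont G t"
  shows "\<exists>l. (F \<longlongrightarrow> l) (at_right t)"
proof
  have "(G \<longlongrightarrow> G t) (at_right t)" using assms(3) by (simp add: continuous_at filterlim_at_split)
  moreover have "eventually (\<lambda>s. G s = F s) (at_right t)"
    unfolding eventually_at_right_field using assms(1,2) by (intro exI[of _ "t + e"]) auto
  ultimately show "(F \<longlongrightarrow> G t) (at_right t)" by (rule Lim_transform_eventually)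
qed

lemma left_limit_exists:
  fixes F G :: "real \<Rightarrow> real"
  assumes "e > 0" "\<And>s. s \<in> {t - e<..<t} \<Longrightarrow> F s = G s" "isCont G t"
  shows "\<exists>l. (F \<longlongrightarrow> l) (at_left t)"
proof
  have "(G \<longlongrightarrow> G t) (at_left t)" using assms(3) by (simp add: continuous_at filterlim_at_split)
  moreover have "eventually (\<lambda>s. G s = F s) (at_left t)"
    unfolding eventually_at_left_field using assms(1,2) by (intro exI[of _ "t - e"]) auto
  ultimately show "(F \<longlongrightarrow> G t) (at_left t)" by (rule Lim_transform_eventually)
qed

lemma higher_deriv_zero: "(deriv ^^ n) (\<lambda>_. 0 :: real) = (\<lambda>_. 0)"
  by (induction n) auto

text \<open>Within the slab \<open>f\<close> does not depend on time, and its value at the end point \<open>b\<close> represents it.\<close>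

locale smooth_slab = window +
  fixes N q :: nat and f :: "rvec \<Rightarrow> real \<Rightarrow> rvec" and A :: "real \<Rightarrow> rvec set"
  assumes N: "N \<ge> 1"
    and dep: "\<And>i. i < N \<Longrightarrow> depends_on_first N (\<lambda>x. f x b i)"
    and Ck: "\<And>i. i < N \<Longrightarrow> Ck_space N (q + 1) (\<lambda>x. f x b i)"
    and autonomous: "\<And>i x t. i < N \<Longrightarrow> t \<in> {a<..b} \<Longrightarrow> f x t i = f x b i"
    and slab_const: "slab_constant N f q a b A Cf"
begin

definition dT :: "nat \<Rightarrow> nat \<Rightarrow> rvec \<Rightarrow> real" where "dT i l x = partial i (\<lambda>z. f z b l) x"

lemma ab: "a < b" using t0 by simp

lemma partial_f_eq: "l < N \<Longrightarrow> t \<in> {a<..b} \<Longrightarrow> partial i (\<lambda>z. f z t l) x = dT i l x"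
  unfolding dT_def by (subst autonomous) auto

lemma dT_depends: "i < N \<Longrightarrow> l < N \<Longrightarrow> depends_on_first N (dT i l)"
  using depends_partial[OF dep[of l], of i] by (simp add: dT_def[abs_def])

lemma dT_Ck: "i < N \<Longrightarrow> l < N \<Longrightarrow> Ck_space N q (dT i l)"
  using Ck_space_partial[of N q "\<lambda>x. f x b l" i] Ck[of l] by (simp add: dT_def[abs_def])

lemma dT_smooth: "i < N \<Longrightarrow> l < N \<Longrightarrow> smooth q (\<lambda>z. dT i l (\<lambda>m. poly (X m) z))"
  by (rule smooth_along_polynomials[OF dT_depends dT_Ck])

text \<open>
  The defining property of the constant of the slab speaks of curves whose derivatives are bounded
  on the whole slab. It can be used at a single point nevertheless: the curve is shifted to the middle
  of the slab and replaced by \<open>0\<close> outside a small neighbourhood, where by continuity the strict bounds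
  persist.
\<close>

lemma dT_along_polynomials_bound:
  assumes p: "p \<le> q" and Cx: "Cx > 0"
    and X: "\<And>n i. n \<in> {1..p} \<Longrightarrow> i < N \<Longrightarrow> \<bar>poly ((pderiv ^^ n) (X i)) \<tau>\<bar> < Cx ^ n"
    and i: "i < N" and y: "\<And>l. l < N \<Longrightarrow> \<bar>y l\<bar> \<le> 1"
  shows "\<bar>(deriv ^^ p) (\<lambda>z. \<Sum>l<N. dT i l (\<lambda>m. poly (X m) z) * y l) \<tau>\<bar> \<le> Cf * Cx ^ p"
proof -
  have "eventually (\<lambda>z. \<forall>n\<in>{1..p}. \<forall>i\<in>{..<N}. \<bar>poly ((pderiv ^^ n) (X i)) z\<bar> < Cx ^ n) (nhds \<tau>)"
  proof (intro eventually_ball_finite ballI)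
    fix n i assume "n \<in> {1..p}" "i \<in> {..<N}"
    hence "\<bar>poly ((pderiv ^^ n) (X i)) \<tau>\<bar> < Cx ^ n" by (intro X) auto
    moreover have "((\<lambda>z. \<bar>poly ((pderiv ^^ n) (X i)) z\<bar>) \<longlongrightarrow> \<bar>poly ((pderiv ^^ n) (X i)) \<tau>\<bar>) (nhds \<tau>)"
      using poly_isCont[where p = "(pderiv ^^ n) (X i)" and x = \<tau>] by (intro tendsto_rabs) (simp add: continuous_at tendsto_nhds_iff)
    ultimately show "eventually (\<lambda>z. \<bar>poly ((pderiv ^^ n) (X i)) z\<bar> < Cx ^ n) (nhds \<tau>)"
      by (rule order_tendstoD(2)[rotated])
  qed auto
  then obtain d where d: "d > 0" "\<And>z n i. dist z \<tau> < d \<Longrightarrow> n \<in> {1..p} \<Longrightarrow> i < N \<Longrightarrow>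
      \<bar>poly ((pderiv ^^ n) (X i)) z\<bar> < Cx ^ n"
    unfolding eventually_nhds_metric by auto
  define \<delta> where "\<delta> = min d ((b - a) / 4)"
  have "\<delta> > 0" using d(1) ab by (simp add: \<delta>_def)
  moreover have "\<delta> \<le> d" unfolding \<delta>_def by (rule min.cobounded1)
  moreover have "\<delta> \<le> (b - a) / 4" unfolding \<delta>_def by (rule min.cobounded2)
  ultimately have \<delta>: "\<delta> > 0" "\<delta> \<le> d" "\<delta> \<le> (b - a) / 4" by blast+
  define m where "m = (a + b) / 2"
  define I where "I = {m - \<delta><..<m + \<delta>}"
  define E where "E = - {m - \<delta>..m + \<delta>}"
  define S0 where "S0 = {m - \<delta>, m + \<delta>}"
  \<comment> \<open>A quarter of the slab on either side of its middle \<open>m\<close> is enough to place the neighbourhood,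
    wherever \<open>\<tau>\<close> lies.\<close>
  define x where "x t i = (if t \<in> I then poly (X i) (t + (\<tau> - m)) else 0)" for t i
  have op: "open I" "open E" by (auto simp: I_def E_def)
  have Iab: "I \<subseteq> {a<..<b}" using \<delta> ab by (auto simp: I_def m_def field_simps)
  have mI: "m \<in> I" using \<delta> by (simp add: I_def)
  have cover: "t \<in> I \<or> t \<in> E" if "t \<notin> S0" for t using that by (auto simp: I_def E_def S0_def)
  define G where "G n i t = poly ((pderiv ^^ n) (X i)) (t + (\<tau> - m))" for n i t
  have onI: "(deriv ^^ n) (\<lambda>s. x s i) t = G n i t" if "t \<in> I" for n i t
  proof -
    have "(deriv ^^ n) (\<lambda>s. x s i) t = (deriv ^^ n) (\<lambda>s. poly (X i) (s + (\<tau> - m))) t"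
      by (rule higher_deriv_cong_open[OF op(1)]) (use that in \<open>auto simp: x_def\<close>)
    thus ?thesis by (simp add: higher_deriv_shift higher_deriv_poly G_def)
  qed
  have onE: "(deriv ^^ n) (\<lambda>s. x s i) t = 0" if "t \<in> E" for n i t
  proof -
    have "(deriv ^^ n) (\<lambda>s. x s i) t = (deriv ^^ n) (\<lambda>s. 0) t"
      by (rule higher_deriv_cong_open[OF op(2)]) (use that in \<open>auto simp: x_def I_def E_def\<close>)
    thus ?thesis by (simp add: higher_deriv_zero)
  qed
  have Gd: "(G n i has_real_derivative poly (pderiv ((pderiv ^^ n) (X i))) (t + (\<tau> - m)) * (1 + 0)) (at t)" for n i t
    unfolding G_def by (rule DERIV_chain2[OF poly_DERIV]) (auto intro!: derivative_eq_intros)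
  have Gcont: "isCont (G n i) t" for n i t by (rule DERIV_isCont[OF Gd])
  have diff: "((deriv ^^ n) (\<lambda>s. x s i)) differentiable (at t)" if "t \<notin> S0" for n i t
  proof -
    have "t \<in> I \<or> t \<in> E" by (rule cover[OF that])
    thus ?thesis
    proof
      assume t: "t \<in> I"
      have "((deriv ^^ n) (\<lambda>s. x s i) has_real_derivative poly (pderiv ((pderiv ^^ n) (X i))) (t + (\<tau> - m)) * (1 + 0)) (at t)"
        by (rule has_field_derivative_transform_within_open[OF Gd op(1) t]) (simp add: onI)
      thus ?thesis using real_differentiable_def by blast
    next
      assume t: "t \<in> E"
      have "((deriv ^^ n) (\<lambda>s. x s i) has_real_derivative 0) (at t)"
        by (rule has_field_derivative_transform_within_open[OF DERIV_const op(2) t]) (simp add: onE)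
      thus ?thesis using real_differentiable_def by blast
    qed
  qed
  have pw: "piecewise_Ck p a b S0 (\<lambda>t. x t i)" for i
    unfolding piecewise_Ck_def Ck_on_def
  proof (intro conjI allI impI ballI)
    show "finite S0" by (simp add: S0_def)
    show "((deriv ^^ n) (\<lambda>t. x t i)) differentiable (at t)" if "t \<in> {a<..<b} - S0" for n t
      using diff that by blast
    show "continuous_on ({a<..<b} - S0) ((deriv ^^ p) (\<lambda>t. x t i))"
      by (intro continuous_at_imp_continuous_on ballI differentiable_imp_continuous_within diff) auto
    fix t n assume t: "t \<in> S0 \<inter> {a<..<b}"
    hence "t = m - \<delta> \<or> t = m + \<delta>" by (simp add: S0_def)
    thus "\<exists>l. ((deriv ^^ n) (\<lambda>t. x t i) \<longlongrightarrow> l) (at_right t)"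
    proof
      assume "t = m - \<delta>"
      thus ?thesis using \<delta> Gcont
        by (intro right_limit_exists[where e = \<delta> and G = "G n i"]) (auto intro!: onI simp: I_def)
    next
      assume "t = m + \<delta>"
      thus ?thesis using \<delta>
        by (intro right_limit_exists[where e = \<delta> and G = "\<lambda>_. 0"]) (auto intro!: onE simp: E_def)
    qed
    from \<open>t = m - \<delta> \<or> t = m + \<delta>\<close> show "\<exists>l. ((deriv ^^ n) (\<lambda>t. x t i) \<longlongrightarrow> l) (at_left t)"
    proof
      assume "t = m - \<delta>"
      thus ?thesis using \<delta>
        by (intro left_limit_exists[where e = \<delta> and G = "\<lambda>_. 0"]) (auto intro!: onE simp: E_def)
    next
      assume "t = m + \<delta>"
      thus ?thesis using \<delta> Gcont
        by (intro left_limit_exists[where e = \<delta> and G = "G n i"]) (auto intro!: onI simp: I_def)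
    qed
  qed
  have bound: "linf N (\<lambda>i. (deriv ^^ n) (\<lambda>s. x s i) t) \<le> Cx ^ n" if n: "n \<in> {1..p}" and t: "t \<in> {a<..<b} - S0" for n t
    unfolding linf_le_iff[OF N]
  proof (intro allI impI)
    fix i assume i: "i < N"
    show "\<bar>(deriv ^^ n) (\<lambda>s. x s i) t\<bar> \<le> Cx ^ n"
    proof (cases "t \<in> I")
      case True
      hence "dist (t + (\<tau> - m)) \<tau> < d" using \<delta> by (auto simp: I_def dist_real_def)
      from d(2)[OF this n i] show ?thesis using onI[OF True] by (simp add: G_def)
    next
      case False
      hence "t \<in> E" using cover t by blast
      thus ?thesis using onE Cx by simp
    qed
  qed
  have mab: "m \<in> {a<..<b} - S0" using Iab mI \<delta>(1) by (auto simp: S0_def)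
  have "linf_op N (\<lambda>i l. (deriv ^^ p) (DfT f x i l) m) \<le> Cf * Cx ^ p"
    using slab_const p Cx pw bound mab unfolding slab_constant_def by blast
  moreover have "\<bar>\<Sum>l<N. (deriv ^^ p) (DfT f x i l) m * y l\<bar> \<le> linf_op N (\<lambda>i l. (deriv ^^ p) (DfT f x i l) m)"
    by (rule linf_op_upper[OF N i y])
  moreover have "(\<Sum>l<N. (deriv ^^ p) (DfT f x i l) m * y l) =
      (deriv ^^ p) (\<lambda>z. \<Sum>l<N. dT i l (\<lambda>m. poly (X m) z) * y l) \<tau>"
  proof -
    have "(deriv ^^ p) (DfT f x i l) m = (deriv ^^ p) (\<lambda>z. dT i l (\<lambda>m. poly (X m) z)) \<tau>" if l: "l < N" for l
    proof -
      have "(deriv ^^ p) (DfT f x i l) m = (deriv ^^ p) (\<lambda>t. dT i l (\<lambda>k. poly (X k) (t + (\<tau> - m)))) m"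
      proof (rule higher_deriv_cong_open[OF op(1) _ mI])
        fix t assume t: "t \<in> I"
        hence "t \<in> {a<..b}" using Iab by auto
        moreover have "x t = (\<lambda>k. poly (X k) (t + (\<tau> - m)))" using t by (simp add: x_def fun_eq_iff)
        ultimately show "DfT f x i l t = dT i l (\<lambda>k. poly (X k) (t + (\<tau> - m)))"
          unfolding DfT_def by (simp only: partial_f_eq[OF l])
      qed
      thus ?thesis using higher_deriv_shift[of p "\<lambda>z. dT i l (\<lambda>k. poly (X k) z)" "\<tau> - m"] by simp
    qed
    thus ?thesis using higher_deriv_sum[of "{..<N}" q "\<lambda>l z. dT i l (\<lambda>m. poly (X m) z)" p y] dT_smooth[OF i] p by simp
  qed
  ultimately show ?thesis by linarith
qed

text \<open>The case \<open>p = 1\<close> of the preceding lemma along the straight line from \<open>x'\<close> to \<open>x\<close>.\<close>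

lemma dT_lipschitz:
  assumes i: "i < N" and y: "\<And>l. l < N \<Longrightarrow> \<bar>y l\<bar> \<le> 1" and q: "q \<ge> 1"
    and x: "\<And>m. m < N \<Longrightarrow> \<bar>x m - x' m\<bar> \<le> \<delta>"
  shows "\<bar>(\<Sum>l<N. dT i l x * y l) - (\<Sum>l<N. dT i l x' * y l)\<bar> \<le> Cf * \<delta>"
proof (rule field_le_epsilon)
  fix e :: real assume e: "e > 0"
  have \<delta>: "\<delta> \<ge> 0" using x[of 0] N by fastforce
  \<comment> \<open>The velocity of the line has to be strictly below the rate, hence the summand with \<open>e\<close>.\<close>
  define Cx where "Cx = \<delta> + e / Cf"
  have Cx: "Cx > \<delta>" "Cx > 0" using e Cf \<delta> by (auto simp: Cx_def add_nonneg_pos)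
  define X where "X m = [: x' m, x m - x' m :]" for m
  define h where "h z = (\<Sum>l<N. dT i l (\<lambda>m. poly (X m) z) * y l)" for z
  have sm: "smooth q h" unfolding h_def
    by (intro smooth_sum smooth_mult smooth_const dT_smooth i) auto
  have d: "(h has_real_derivative deriv h z) (at z)" for z
    using smooth_has_deriv[OF sm, of 0] q by simp
  have "\<bar>deriv h z\<bar> \<le> Cf * Cx" for z
  proof -
    have "\<bar>(deriv ^^ 1) (\<lambda>z. \<Sum>l<N. dT i l (\<lambda>m. poly (X m) z) * y l) z\<bar> \<le> Cf * Cx ^ 1"
    proof (rule dT_along_polynomials_bound[OF q Cx(2) _ i y])
      fix n k assume n: "n \<in> {1..1::nat}" and k: "k < N"
      hence "n = 1" by simp
      thus "\<bar>poly ((pderiv ^^ n) (X k)) z\<bar> < Cx ^ n" using x[OF k] Cx by (simp add: X_def pderiv_pCons)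
    qed
    thus ?thesis unfolding h_def by simp
  qed
  hence "\<bar>h 1 - h 0\<bar> \<le> Cf * Cx * (1 - 0)"
    using Cf Cx smooth_imp_continuous[OF sm]
    by (intro bounded_derivative_increment[where S = "{}" and e' = "deriv h"])
      (auto intro: continuous_on_subset d)
  also have "Cf * Cx * (1 - 0) = Cf * \<delta> + e" using Cf by (simp add: Cx_def distrib_left)
  finally show "\<bar>(\<Sum>l<N. dT i l x * y l) - (\<Sum>l<N. dT i l x' * y l)\<bar> \<le> Cf * \<delta> + e"
    by (simp add: h_def X_def)
qed

text \<open>\<open>curveC r B * Cf\<close> is the rate of a geometric bound on the derivatives of a curve near a polynomial
  of order \<open>r\<close> with constant \<open>B\<close>; \<open>jacC\<close> is the resulting constant of the Jacobian along the curve.\<close>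

definition curveC :: "nat \<Rightarrow> real \<Rightarrow> real" where
  "curveC r B = 1 + real r * fact r * B * (2 * H * H) ^ r"

definition jacC :: "nat \<Rightarrow> real \<Rightarrow> real" where "jacC r B = curveC r B ^ r * H ^ r + B"

lemma higher_pderiv_bound:
  assumes V: "\<And>n. \<bar>coeff V n\<bar> \<le> B * Cf ^ n" "\<And>n. n \<ge> r \<Longrightarrow> coeff V n = 0"
    and n: "n \<ge> 1" and z: "\<bar>z\<bar> \<le> 2 * R * \<kappa>"
  shows "\<bar>poly ((pderiv ^^ n) (V + [:cx:])) z\<bar> < (curveC r B * Cf) ^ n"
proof -
  have B: "B \<ge> 0" using V(1)[of 0] by simp
  let ?P = "(pderiv ^^ n) (V + [:cx:])"
  define X where "X = fact r * B * (2 * H * H) ^ r"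
  have HH: "1 \<le> 2 * H * H" using mult_mono[of 1 "2 * H" 1 H] H_ge by simp
  have X0: "X \<ge> 0" unfolding X_def using B HH by simp
  have c0: "coeff ?P k = pochhammer (of_nat (Suc k)) n * coeff V (n + k)" for k
    using n by (simp add: coeff_higher_pderiv coeff_pCons add.commute split: nat.splits)
  have "poly ?P z = (\<Sum>k<r. coeff ?P k * z ^ k)"
    by (rule poly_sum_below) (simp add: c0 V(2))
  also have "\<bar>\<dots>\<bar> \<le> (\<Sum>k<r. X * Cf ^ n)"
  proof (rule order.trans[OF sum_abs sum_mono])
    fix k assume k: "k \<in> {..<r}"
    show "\<bar>coeff ?P k * z ^ k\<bar> \<le> X * Cf ^ n"
    proof (cases "n + k < r")
      case False
      thus ?thesis using X0 Cf by (simp add: c0 V(2))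
    next
      case True
      have "pochhammer (1::real) (k + n) = pochhammer 1 k * pochhammer (1 + of_nat k) n"
        by (subst pochhammer_product[of k]) auto
      hence "fact (k + n) = fact k * pochhammer (of_nat (Suc k) :: real) n"
        by (simp add: pochhammer_fact[symmetric] add.commute)
      moreover have "(1::real) \<le> fact k" by (rule fact_ge_1)
      moreover have p0: "pochhammer (of_nat (Suc k) :: real) n \<ge> 0" by (rule pochhammer_nonneg) simp
      ultimately have "pochhammer (of_nat (Suc k) :: real) n \<le> fact (k + n)"
        using mult_right_mono[of 1 "fact k" "pochhammer (of_nat (Suc k) :: real) n"] by simp
      also have "\<dots> \<le> fact r" using True by (intro fact_mono) auto
      finally have p1: "pochhammer (of_nat (Suc k) :: real) n \<le> fact r" .
      have "\<bar>coeff ?P k * z ^ k\<bar> = pochhammer (of_nat (Suc k)) n * \<bar>coeff V (n + k)\<bar> * \<bar>z\<bar> ^ k"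
        using p0 by (simp add: c0 abs_mult power_abs)
      also have "\<dots> \<le> fact r * (B * Cf ^ (n + k)) * (2 * R * \<kappa>) ^ k"
        using p0 p1 B Cf z by (intro mult_mono V(1) power_mono) auto
      also have "\<dots> = fact r * B * (2 * R * (\<kappa> * Cf)) ^ k * Cf ^ n"
        by (simp add: power_mult_distrib power_add mult_ac)
      also have "\<dots> \<le> fact r * B * (2 * H * H) ^ r * Cf ^ n"
      proof -
        have "(2 * R * (\<kappa> * Cf)) ^ k \<le> (2 * H * H) ^ k"
          using H_ge \<kappa>Cf_pos by (intro power_mono mult_mono) auto
        also have "\<dots> \<le> (2 * H * H) ^ r" using HH k by (intro power_increasing) auto
        finally show ?thesis using B Cf by (intro mult_right_mono mult_left_mono) auto
      qed
      finally show ?thesis by (simp add: X_def)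
    qed
  qed
  also have "\<dots> = (curveC r B - 1) * Cf ^ n" by (simp add: curveC_def X_def)
  also have "\<dots> < curveC r B * Cf ^ n" using Cf by simp
  also have "\<dots> \<le> curveC r B ^ n * Cf ^ n"
  proof -
    have "curveC r B \<ge> 1" using X0 by (simp add: curveC_def X_def mult.assoc)
    hence "curveC r B ^ 1 \<le> curveC r B ^ n" using n by (intro power_increasing) auto
    thus ?thesis using Cf by (intro mult_right_mono) auto
  qed
  finally show ?thesis by (simp add: power_mult_distrib)
qed

text \<open>The curve is replaced by its polynomial, at the expense of the Lipschitz bound, and Taylor's formula
  is applied to the Jacobian along the polynomial. Constant vectors \<open>y\<close> reduce the matrix to scalar
  functions without a sum over its entries.\<close>

lemma dT_near_poly:
  assumes x: "\<And>m. m < N \<Longrightarrow> near_poly r \<rho> B (\<lambda>t. x t m - cx m)" and r: "r \<le> q" and q: "q \<ge> 1" and \<rho>: "\<rho> \<le> R"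
    and i: "i < N" and y: "\<And>l. l < N \<Longrightarrow> \<bar>y l\<bar> \<le> 1"
  shows "near_poly r \<rho> (Cf * jacC r B) (\<lambda>t. \<Sum>l<N. dT i l (x t) * y l)"
proof -
  have B: "B \<ge> 0" using near_poly_nonneg[OF x[of 0]] N by simp
  have "\<exists>V. m < N \<longrightarrow> (\<forall>n. \<bar>coeff V n\<bar> \<le> B * Cf ^ n) \<and> (\<forall>n\<ge>r. coeff V n = 0) \<and>
     (\<forall>t\<in>W \<rho>. \<bar>x t m - cx m - poly V (t - t0)\<bar> \<le> B * (\<kappa> * Cf) ^ r)" for m
    using x[of m] unfolding near_poly_def by blast
  hence "\<exists>V. \<forall>m. m < N \<longrightarrow> (\<forall>n. \<bar>coeff (V m) n\<bar> \<le> B * Cf ^ n) \<and> (\<forall>n\<ge>r. coeff (V m) n = 0) \<and>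
     (\<forall>t\<in>W \<rho>. \<bar>x t m - cx m - poly (V m) (t - t0)\<bar> \<le> B * (\<kappa> * Cf) ^ r)"
    by (intro choice allI)
  then obtain V where V: "\<And>m n. m < N \<Longrightarrow> \<bar>coeff (V m) n\<bar> \<le> B * Cf ^ n"
     "\<And>m n. m < N \<Longrightarrow> n \<ge> r \<Longrightarrow> coeff (V m) n = 0"
     "\<And>m t. m < N \<Longrightarrow> t \<in> W \<rho> \<Longrightarrow> \<bar>x t m - cx m - poly (V m) (t - t0)\<bar> \<le> B * (\<kappa> * Cf) ^ r"
    by blast
  define X where "X m = V m + [:cx m:]" for m
  \<comment> \<open>The Jacobian along the polynomials, with the time \<open>t0\<close> moved to \<open>0\<close>.\<close>
  define h where "h z = (\<Sum>l<N. dT i l (\<lambda>m. poly (X m) z) * y l)" for z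
  define D where "D = curveC r B"
  have D1: "D \<ge> 1" using B H_ge by (simp add: D_def curveC_def)
  have sm: "smooth q h" unfolding h_def
    by (intro smooth_sum smooth_mult smooth_const dT_smooth i) auto
  have hb: "\<bar>(deriv ^^ p) h z\<bar> \<le> Cf * D ^ r * Cf ^ p" if p: "p \<le> r" and z: "\<bar>z\<bar> \<le> 2 * R * \<kappa>" for p z
  proof -
    have "\<bar>(deriv ^^ p) h z\<bar> \<le> Cf * (D * Cf) ^ p"
      unfolding h_def
    proof (rule dT_along_polynomials_bound[OF _ _ _ i y])
      show "p \<le> q" using p r by simp
      show "D * Cf > 0" using D1 Cf by simp
      fix n k assume "n \<in> {1..p}" "k < N"
      thus "\<bar>poly ((pderiv ^^ n) (X k)) z\<bar> < (D * Cf) ^ n"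
        unfolding X_def D_def using V z by (intro higher_pderiv_bound) auto
    qed
    also have "\<dots> = Cf * D ^ p * Cf ^ p" by (simp add: power_mult_distrib)
    also have "\<dots> \<le> Cf * D ^ r * Cf ^ p"
      using D1 Cf p by (intro mult_right_mono mult_left_mono power_increasing) auto
    finally show ?thesis .
  qed
  define C where "C = Cf * D ^ r * H ^ r"
  have Hr: "1 \<le> H ^ r" using H_ge(1) by (intro one_le_power)
  have CD: "Cf * D ^ r \<le> C" "0 \<le> C"
    using mult_left_mono[OF Hr, of "Cf * D ^ r"] D1 Cf Hr by (auto simp: C_def)
  have KAC: "Cf * jacC r B = C + Cf * B" by (simp add: jacC_def C_def D_def distrib_left)
  define P where "P = taylor_poly r h 0"
  show ?thesis
    unfolding KAC
  proof (rule near_polyI[of P])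
    show "\<bar>coeff P n\<bar> \<le> (C + Cf * B) * Cf ^ n" for n
    proof (cases "n < r")
      case True
      have "\<bar>(deriv ^^ n) h 0\<bar> / fact n \<le> \<bar>(deriv ^^ n) h 0\<bar> / 1" by (intro divide_left_mono) auto
      also have "\<dots> \<le> Cf * D ^ r * Cf ^ n" using hb[of n 0] True H_ge \<kappa> by simp
      also have "\<dots> \<le> (C + Cf * B) * Cf ^ n" using CD Cf B by (intro mult_right_mono) (auto intro: add_increasing2)
      finally show ?thesis using True by (simp add: P_def coeff_taylor_poly)
    next
      case False
      thus ?thesis using CD Cf B by (simp add: P_def coeff_taylor_poly)
    qed
    show "coeff P n = 0" if "n \<ge> r" for n using that by (simp add: P_def coeff_taylor_poly)
    fix t assume t: "t \<in> W \<rho>"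
    define z where "z = t - t0"
    have "\<bar>z\<bar> \<le> R * \<kappa>" using W_power[OF t \<rho>, of 1] by (simp add: z_def)
    moreover have "R * \<kappa> > 0" using R \<kappa> by simp
    ultimately have z2: "z \<in> {- (2 * R * \<kappa>)<..<2 * R * \<kappa>}" "0 \<in> {- (2 * R * \<kappa>)<..<2 * R * \<kappa>}" by auto
    have "\<bar>h z - poly (taylor_poly r h 0) (z - 0)\<bar> \<le> Cf * D ^ r * Cf ^ r * \<bar>z - 0\<bar> ^ r"
    proof (rule taylor_poly_error[OF _ z2(2,1)])
      fix m s assume "m < r"
      hence "((deriv ^^ m) h has_real_derivative (deriv ^^ Suc m) h s) (at s)"
        using r by (intro smooth_has_deriv[OF sm]) auto
      thus "((deriv ^^ m) h) differentiable (at s)" using real_differentiable_def by blast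
    qed (auto intro!: hb)
    also have "\<dots> \<le> Cf * D ^ r * Cf ^ r * (R ^ r * \<kappa> ^ r)"
      using W_power[OF t \<rho>, of r] Cf D1 by (intro mult_left_mono) (auto simp: z_def)
    also have "\<dots> \<le> Cf * D ^ r * Cf ^ r * (H ^ r * \<kappa> ^ r)"
      using Cf D1 H_ge \<kappa> by (intro mult_left_mono mult_right_mono power_mono) auto
    also have "\<dots> = C * (\<kappa> * Cf) ^ r" by (simp add: C_def power_mult_distrib mult_ac)
    finally have 1: "\<bar>h z - poly P z\<bar> \<le> C * (\<kappa> * Cf) ^ r" by (simp add: P_def)
    have 2: "\<bar>(\<Sum>l<N. dT i l (x t) * y l) - h z\<bar> \<le> Cf * (B * (\<kappa> * Cf) ^ r)"
      unfolding h_def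
    proof (rule dT_lipschitz[OF i y q])
      fix m assume "m < N"
      from V(3)[OF this t] show "\<bar>x t m - poly (X m) z\<bar> \<le> B * (\<kappa> * Cf) ^ r"
        by (simp add: X_def z_def algebra_simps)
    qed auto
    show "\<bar>(\<Sum>l<N. dT i l (x t) * y l) - poly P (t - t0)\<bar> \<le> (C + Cf * B) * (\<kappa> * Cf) ^ r"
      using 1 2 by (simp add: z_def algebra_simps)
  qed
qed

text \<open>The averaged Jacobian is a limit of finite averages of Jacobians along convex combinations of the
  two curves; all of them are near polynomials with the same constant.\<close>

lemma Jac_near_poly:
  assumes x: "\<And>m. m < N \<Longrightarrow> near_poly r \<rho> B (\<lambda>t. x t m - cx m)"
    and y: "\<And>m. m < N \<Longrightarrow> near_poly r \<rho> B (\<lambda>t. y t m - cy m)"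
    and \<Phi>: "\<And>l. l < N \<Longrightarrow> near_poly r \<rho> C (\<lambda>t. \<Phi> t l)" and C: "C \<ge> 0"
    and r: "r \<le> q" and q: "q \<ge> 1" and \<rho>: "\<rho> \<le> R" and i: "i < N"
  shows "near_poly r \<rho> (Cf * jacC r B * C * prodC r) (\<lambda>t. \<Sum>l<N. Jac f x y t l i * \<Phi> t l)"
proof (rule near_poly_limit)
  let ?x = "\<lambda>s t m. s * x t m + (1 - s) * y t m"
  fix n
  show "near_poly r \<rho> (Cf * jacC r B * C * prodC r)
      (\<lambda>t. (\<Sum>j<Suc n. \<Sum>l<N. dT i l (?x (real j / real (Suc n)) t) * \<Phi> t l) / real (Suc n))"
  proof (rule near_poly_average)
    fix j assume j: "j < Suc n"
    define s where "s = real j / real (Suc n)"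
    have s: "s \<in> {0..1}" using j by (auto simp: s_def divide_le_eq)
    show "near_poly r \<rho> (Cf * jacC r B * C * prodC r) (\<lambda>t. \<Sum>l<N. dT i l (?x (real j / real (Suc n)) t) * \<Phi> t l)"
      unfolding s_def[symmetric]
    proof (rule near_poly_linear[OF _ \<Phi> \<rho> C])
      fix v :: "nat \<Rightarrow> real" assume v: "\<And>l. l < N \<Longrightarrow> \<bar>v l\<bar> \<le> 1"
      show "near_poly r \<rho> (Cf * jacC r B) (\<lambda>t. \<Sum>l<N. dT i l (?x s t) * v l)"
      proof (rule dT_near_poly[OF _ r q \<rho> i v, where cx = "\<lambda>m. s * cx m + (1 - s) * cy m"])
        fix m assume m: "m < N"
        show "near_poly r \<rho> B (\<lambda>t. ?x s t m - (s * cx m + (1 - s) * cy m))"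
          using near_poly_convex[OF x[OF m] y[OF m] s] by (rule near_poly_cong) (simp add: algebra_simps)
      qed
    qed
  qed simp
next
  let ?x = "\<lambda>s t m. s * x t m + (1 - s) * y t m"
  fix t assume "t \<in> W \<rho>"
  hence t: "t \<in> {a<..b}" by (auto simp: W_def)
  have cont: "continuous_on {0..1} (\<lambda>s. dT i l (?x s t))" if l: "l < N" for l
    by (rule continuous_on_compose2[OF Ck_space_continuous[OF dT_Ck[OF i l]]])
      (auto intro!: continuous_intros continuous_on_coordinatewise_then_product)
  have "(\<lambda>m. (\<Sum>j<Suc m. (\<lambda>s. \<Sum>l<N. dT i l (?x s t) * \<Phi> t l) (real j / real (Suc m))) / real (Suc m))
      \<longlonglongrightarrow> integral {0..1} (\<lambda>s. \<Sum>l<N. dT i l (?x s t) * \<Phi> t l)"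
    by (rule riemann_sums) (intro continuous_on_sum continuous_on_mult continuous_on_const cont, simp)
  also have "integral {0..1} (\<lambda>s. \<Sum>l<N. dT i l (?x s t) * \<Phi> t l) = (\<Sum>l<N. Jac f x y t l i * \<Phi> t l)"
  proof -
    have "integral {0..1} (\<lambda>s. \<Sum>l<N. dT i l (?x s t) * \<Phi> t l) =
        (\<Sum>l<N. integral {0..1} (\<lambda>s. dT i l (?x s t) * \<Phi> t l))"
      by (rule integral_sum) (auto intro!: integrable_continuous_real continuous_on_mult continuous_on_const cont)
    also have "\<dots> = (\<Sum>l<N. Jac f x y t l i * \<Phi> t l)"
    proof (intro sum.cong refl)
      fix l assume "l \<in> {..<N}"
      hence "Jac f x y t l i = integral {0..1} (\<lambda>s. dT i l (?x s t))"
        unfolding Jac_def by (subst partial_f_eq[OF _ t]) auto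
      thus "integral {0..1} (\<lambda>s. dT i l (?x s t) * \<Phi> t l) = Jac f x y t l i * \<Phi> t l" by simp
    qed
    finally show ?thesis .
  qed
  finally show "(\<lambda>n. (\<Sum>j<Suc n. \<Sum>l<N. dT i l (?x (real j / real (Suc n)) t) * \<Phi> t l) / real (Suc n))
      \<longlonglongrightarrow> (\<Sum>l<N. Jac f x y t l i * \<Phi> t l)" .
qed

lemma Jac_continuous:
  assumes x: "\<And>m. m < N \<Longrightarrow> continuous_on {a<..<b} (\<lambda>t. x t m)" and y: "\<And>m. m < N \<Longrightarrow> continuous_on {a<..<b} (\<lambda>t. y t m)"
    and i: "i < N" and l: "l < N"
  shows "continuous_on {a<..<b} (\<lambda>t. Jac f x y t l i)"
proof -
  define h where "h t s m = (if m < N then s * x t m + (1 - s) * y t m else 0)" for t s m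
  have "continuous_on ({a<..<b} \<times> cbox 0 1) (\<lambda>p. h (fst p) (snd p))"
  proof (rule continuous_on_coordinatewise_then_product)
    fix m
    show "continuous_on ({a<..<b} \<times> cbox 0 1) (\<lambda>p. h (fst p) (snd p) m)"
    proof (cases "m < N")
      case True
      have "continuous_on ({a<..<b} \<times> cbox 0 (1::real)) (\<lambda>p. x (fst p) m)" "continuous_on ({a<..<b} \<times> cbox 0 (1::real)) (\<lambda>p. y (fst p) m)"
        by (rule continuous_on_compose2[OF x[OF True] continuous_on_fst[OF continuous_on_id]]; auto)
          (rule continuous_on_compose2[OF y[OF True] continuous_on_fst[OF continuous_on_id]]; auto)
      thus ?thesis using True by (simp add: h_def continuous_intros)
    qed (simp add: h_def)
  qed
  hence "continuous_on ({a<..<b} \<times> cbox 0 1) (\<lambda>p. dT i l (h (fst p) (snd p)))"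
    by (rule continuous_on_compose2[OF Ck_space_continuous[OF dT_Ck[OF i l]]]) auto
  hence "continuous_on {a<..<b} (\<lambda>t. integral (cbox 0 1) (\<lambda>s. dT i l (h t s)))"
    by (intro integral_continuous_on_param) (simp add: split_beta)
  moreover have "integral (cbox 0 1) (\<lambda>s. dT i l (h t s)) = Jac f x y t l i" if t: "t \<in> {a<..<b}" for t
  proof -
    have t': "t \<in> {a<..b}" using t by auto
    have "dT i l (h t s) = dT i l (\<lambda>m. s * x t m + (1 - s) * y t m)" for s
      using dT_depends[OF i l] unfolding depends_on_first_def by (auto simp: h_def)
    thus ?thesis unfolding Jac_def by (subst partial_f_eq[OF l t']) simp
  qed
  ultimately show ?thesis by (rule continuous_on_eq)
qed

text \<open>
  For a curve whose velocity is near a polynomial with constant \<open>B * Cf\<close>, this is the constant of the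
  right-hand side along the curve at order \<open>s\<close>, in units of \<open>Cf\<close>.
\<close>

fun rhsC :: "real \<Rightarrow> nat \<Rightarrow> real" where
  "rhsC B 0 = 1"
| "rhsC B (Suc s) = 1 + rhsC B s * B * prodC s * H"

lemma Dform_bounded:
  assumes "i < N" "t \<in> {a<..<b}" "x \<in> A t" "n \<le> q + 1" "\<And>j l. j < n \<Longrightarrow> l < N \<Longrightarrow> \<bar>w j l\<bar> \<le> 1"
  shows "\<bar>Dform N n (\<lambda>x. f x b i) x w\<bar> \<le> Cf"
proof -
  have t: "t \<in> {a<..b}" using assms(2) by auto
  have "Dpnorm N (q + 1) (\<lambda>x t. f x t i) a b A \<le> ereal Cf"
    using slab_const assms(1) by (simp add: slab_constant_def)
  from Dpnorm_bound[OF this assms(4) t assms(3) N, of w]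
  have "\<bar>Dform N n (\<lambda>x. f x b i) x w\<bar> \<le> Cf * (\<Prod>r<n. linf N (w r))"
    by (simp add: autonomous[OF assms(1) t])
  also have "(\<Prod>r<n. linf N (w r)) \<le> (\<Prod>r<n. 1)"
  proof (rule prod_mono)
    fix r assume "r \<in> {..<n}"
    hence "linf N (w r) \<le> 1" using assms(5) N by (simp add: linf_le_iff)
    moreover have "0 \<le> linf N (w r)" using linf_upper[of 0 N "w r"] N by (smt (verit) less_le_trans zero_less_one)
    ultimately show "0 \<le> linf N (w r) \<and> linf N (w r) \<le> 1" by simp
  qed
  finally show ?thesis using Cf by simp
qed

text \<open>Induction on the order: the time derivative of \<open>D\<^sup>n f(y)[w]\<close> is \<open>D\<^sup>n\<^sup>+\<^sup>1 f(y)[y', w]\<close>, to which the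
  induction hypothesis applies for constant arguments, and integration raises the order. In contrast
  to Taylor's formula in the state, only points on the curve itself occur, and the higher derivatives
  of \<open>f\<close> are bounded nowhere else.\<close>

lemma Dform_along_near_poly:
  assumes yA: "\<And>t. t \<in> {a<..<b} \<Longrightarrow> y t \<in> A t"
    and yc: "\<And>l. l < N \<Longrightarrow> continuous_on {a<..<b} (\<lambda>t. y t l)"
    and y': "\<And>l t. l < N \<Longrightarrow> t \<in> {a<..<b} - S \<Longrightarrow> ((\<lambda>t. y t l) has_real_derivative y' t l) (at t)"
    and g: "\<And>s l. s < r \<Longrightarrow> l < N \<Longrightarrow> near_poly s \<rho> (B * Cf) (\<lambda>t. y' t l)" and B: "B \<ge> 0"
    and \<rho>: "\<rho> \<le> R" and i: "i < N"
    and nr: "n + r \<le> q + 1" and w: "\<And>j l. j < n \<Longrightarrow> l < N \<Longrightarrow> \<bar>w j l\<bar> \<le> 1"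
  shows "near_poly r \<rho> (Cf * rhsC B r) (\<lambda>t. Dform N n (\<lambda>x. f x b i) (y t) w)"
  using g nr w
proof (induction r arbitrary: n w)
  case 0
  have "\<bar>Dform N n (\<lambda>x. f x b i) (y t) w\<bar> \<le> Cf" if "t \<in> W \<rho>" for t
  proof -
    have t: "t \<in> {a<..<b}" using that by (auto simp: W_def)
    show ?thesis using 0 by (intro Dform_bounded[OF i t yA[OF t]]) auto
  qed
  thus ?case using Cf by (simp add: near_poly_0_iff)
next
  case (Suc s)
  define h where "h t = Dform N n (\<lambda>x. f x b i) (y t) w" for t
  \<comment> \<open>The velocity inserted into the first argument of the form of order \<open>n + 1\<close>: to the functional
    with coefficients \<open>M t\<close> the induction hypothesis applies at constant vectors.\<close>
  define M where "M t = Dform_coeff N n (\<lambda>x. f x b i) (y t) w" for t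
  define h' where "h' t = (\<Sum>l<N. M t l * y' t l)" for t
  have "near_poly s \<rho> (Cf * rhsC B s) (\<lambda>t. \<Sum>l<N. M t l * v l)" if v: "\<And>l. l < N \<Longrightarrow> \<bar>v l\<bar> \<le> 1" for v
  proof -
    have "near_poly s \<rho> (Cf * rhsC B s) (\<lambda>t. Dform N (Suc n) (\<lambda>x. f x b i) (y t) (case_nat v w))"
    proof (rule Suc.IH)
      show "\<bar>(case j of 0 \<Rightarrow> v | Suc x \<Rightarrow> w x) l\<bar> \<le> 1" if "j < Suc n" "l < N" for j l
        using that v Suc.prems(3) by (cases j) auto
    qed (use Suc.prems in auto)
    thus ?thesis by (simp add: Dform_Suc M_def)
  qed
  hence "near_poly s \<rho> (Cf * rhsC B s * (B * Cf) * prodC s) h'"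
    unfolding h'_def using Suc.prems(1) B Cf \<rho> by (intro near_poly_linear) auto
  hence "near_poly s \<rho> ((Cf * rhsC B s * B * prodC s) * Cf) h'" by (simp add: mult_ac)
  hence 1: "near_poly (Suc s) \<rho> ((Cf * rhsC B s * B * prodC s) * H) (\<lambda>t. h t - h t0)"
  proof (rule near_poly_integrate[OF _ \<rho>])
    show "continuous_on {a<..<b} h"
      unfolding h_def using Suc.prems(2) by (intro Dform_continuous[OF dep[OF i] Ck_space_mono[OF Ck[OF i]]] yc) auto
    fix t assume t: "t \<in> {a<..<b} - S"
    show "(h has_real_derivative h' t) (at t)"
      unfolding h_def h'_def M_def using Suc.prems(2) t
      by (intro Dform_has_derivative[OF dep[OF i] Ck_space_mono[OF Ck[OF i]]] y') auto
  qed
  have "\<bar>h t0\<bar> \<le> Cf"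
    unfolding h_def using Suc.prems t0 by (intro Dform_bounded[OF i, of t0] yA[of t0]) auto
  hence "near_poly (Suc s) \<rho> Cf (\<lambda>_. h t0)" by (rule near_poly_const)
  from near_poly_add[OF 1 this] show ?case by (simp add: h_def algebra_simps)
qed

lemma f_along_near_poly:
  assumes "\<And>t. t \<in> {a<..<b} \<Longrightarrow> y t \<in> A t"
    and "\<And>l. l < N \<Longrightarrow> continuous_on {a<..<b} (\<lambda>t. y t l)"
    and "\<And>l t. l < N \<Longrightarrow> t \<in> {a<..<b} - S \<Longrightarrow> ((\<lambda>t. y t l) has_real_derivative y' t l) (at t)"
    and "\<And>s l. s < r \<Longrightarrow> l < N \<Longrightarrow> near_poly s \<rho> (B * Cf) (\<lambda>t. y' t l)" and "B \<ge> 0"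
    and "\<rho> \<le> R" and i: "i < N" and "r \<le> q + 1"
  shows "near_poly r \<rho> (Cf * rhsC B r) (\<lambda>t. f (y t) t i)"
proof -
  have "near_poly r \<rho> (Cf * rhsC B r) (\<lambda>t. Dform N 0 (\<lambda>x. f x b i) (y t) (\<lambda>_ _. 0))"
    by (rule Dform_along_near_poly[OF assms(1-7)]) (use assms(8) in auto)
  thus ?thesis
  proof (rule near_poly_cong)
    fix t assume "t \<in> W \<rho>"
    hence "t \<in> {a<..b}" by (auto simp: W_def)
    thus "Dform N 0 (\<lambda>x. f x b i) (y t) (\<lambda>_ _. 0) = f (y t) t i"
      using autonomous[OF i] by (simp only: Dform_0)
  qed
qed

end

section \<open>The discrete solutions as projections\<close>

lemma poly_antiderivative:
  fixes w :: "real poly"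
  obtains p where "pderiv p = w" "degree p \<le> Suc (degree w)" "poly p c = 0"
proof -
  define p0 where "p0 = (\<Sum>n\<le>degree w. monom (coeff w n / real (Suc n)) (Suc n))"
  have c: "coeff p0 (Suc n) = coeff w n / real (Suc n)" for n
    unfolding p0_def coeff_sum by (cases "n \<le> degree w") (auto simp: coeff_eq_0)
  have "pderiv p0 = w" by (rule poly_eqI) (simp add: coeff_pderiv c del: of_nat_Suc)
  moreover have "degree p0 \<le> Suc (degree w)"
  proof (rule degree_le, intro allI impI)
    fix i assume i: "Suc (degree w) < i"
    then obtain n where "i = Suc n" by (cases i) auto
    thus "coeff p0 i = 0" using i by (simp add: c coeff_eq_0)
  qed
  moreover have "degree (p0 - [:poly p0 c:]) \<le> Suc (degree w)" using calculation(2) by (intro degree_diff_le) auto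
  ultimately show ?thesis by (intro that[of "p0 - [:poly p0 c:]"]) (auto simp: pderiv_diff pderiv_pCons)
qed

context galerkin
begin

lemma f_times_integrable:
  assumes i: "i < N" and x: "\<And>i. i < N \<Longrightarrow> continuous_on {0..T} (\<lambda>t. x t i)" and h: "continuous_on {0..T} h"
  shows "(\<lambda>t. f (x t) t i * h t) integrable_on {0..T}"
proof -
  obtain A where A: "\<And>i x t. i < N \<Longrightarrow> t \<in> {0<..T} \<Longrightarrow> \<bar>f x t i\<bar> \<le> A"
    using f_bounded[OF mesh ivp refl refl] by blast
  have "(\<lambda>t. h t * f (x t) t i) integrable_on {0..T}"
    by (rule continuous_times_bounded_measurable_integrable[OF T_pos h])
      (use f_along_measurable[OF mesh ivp refl refl i x] A[OF i] in auto)
  thus ?thesis by (simp add: mult.commute)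
qed

lemma integral_cell:
  fixes h :: "real \<Rightarrow> real"
  assumes i: "i < N" and j: "j \<in> {1..ncells D i}"
  shows "integral {0..T} (\<lambda>t. if t \<in> cell D i j then h t else 0) = integral {node D i (j - 1)..node D i j} h"
proof -
  have "cell D i j \<subseteq> {0..T}" using cell_subset[OF i j] by auto
  hence "integral {0..T} (\<lambda>t. if t \<in> cell D i j then h t else 0) = integral (cell D i j) h"
    by (simp only: integral_restrict_Int Int_absorb2)
  also have "\<dots> = integral {node D i (j - 1)..node D i j} h"
    by (rule integral_subset_negligible) (auto simp: cell_def intro: negligible_subset[of "{node D i (j - 1)}"])
  finally show ?thesis .
qed

text \<open>
  Test functions may be discontinuous, so the method can be tested with polynomials on one cell of
  one component: there the derivative of \<open>U\<close> is the \<open>L\<^sub>2\<close> projection of \<open>f(U)\<close>.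
\<close>

lemma U_projection:
  assumes i: "i < N" and j: "j \<in> {1..ncells D i}"
    and p: "\<And>t. t \<in> {node D i (j - 1)<..<node D i j} \<Longrightarrow> deriv (\<lambda>s. U s i) t = poly (pderiv p) t"
    and w: "degree w \<le> deg D i j - 1"
  shows "((\<lambda>s. (poly (pderiv p) s - f (U s) s i) * poly w s) has_integral 0) {node D i (j - 1)..node D i j}"
proof -
  let ?I = "{node D i (j - 1)..node D i j}"
  define v where "v t k = (if k = i \<and> t \<in> cell D i j then poly w t else 0)" for t k
  have "v \<in> test_space D"
    unfolding test_space_def poly_on_def
  proof (intro CollectI allI impI ballI)
    fix k j' assume k: "k < N" and j': "j' \<in> {1..ncells D k}"
    show "\<exists>p. degree p \<le> deg D k j' - 1 \<and> (\<forall>t\<in>cell D k j'. v t k = poly p t)"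
    proof (cases "k = i \<and> j' = j")
      case True
      thus ?thesis using w by (intro exI[of _ w]) (auto simp: v_def)
    next
      case False
      have "v t k = 0" if "t \<in> cell D k j'" for t
        using False that cell_at_eq[OF k j' that] cell_at_eq[OF i j, of t] by (auto simp: v_def)
      thus ?thesis by (intro exI[of _ 0]) auto
    qed
  qed
  hence "integral {0..T} (\<lambda>t. \<Sum>k<N. deriv (\<lambda>s. U s k) t * v t k) = integral {0..T} (\<lambda>t. \<Sum>k<N. f (U t) t k * v t k)"
    using mcG by (simp add: mcG_solution_def)
  moreover have "(\<Sum>k<N. h k * v t k) = (if t \<in> cell D i j then h i * poly w t else 0)" for h t
  proof -
    have "(\<Sum>k<N. h k * v t k) = (\<Sum>k<N. if k = i then (if t \<in> cell D i j then h i * poly w t else 0) else 0)"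
      by (intro sum.cong) (auto simp: v_def)
    thus ?thesis using i by simp
  qed
  ultimately have eq: "integral ?I (\<lambda>t. deriv (\<lambda>s. U s i) t * poly w t) = integral ?I (\<lambda>t. f (U t) t i * poly w t)"
    by (simp add: integral_cell[OF i j])
  have "integral ?I (\<lambda>t. deriv (\<lambda>s. U s i) t * poly w t) = integral ?I (\<lambda>t. poly (pderiv p) t * poly w t)"
    by (rule integral_spike[of "{node D i (j - 1), node D i j}"]) (auto simp: p)
  with eq have "integral ?I (\<lambda>t. poly (pderiv p) t * poly w t) = integral ?I (\<lambda>t. f (U t) t i * poly w t)" by simp
  moreover have ip: "(\<lambda>t. poly (pderiv p) t * poly w t) integrable_on ?I"
    by (intro integrable_continuous_real continuous_on_mult continuous_on_poly_real)
  moreover have iF: "(\<lambda>t. f (U t) t i * poly w t) integrable_on ?I"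
    by (rule integrable_on_subinterval[OF f_times_integrable[OF i U_cont continuous_on_poly_real] cell_closed_subset[OF i j]])
  ultimately have "((\<lambda>t. poly (pderiv p) t * poly w t - f (U t) t i * poly w t) has_integral 0) ?I"
    using has_integral_diff[OF integrable_integral[OF ip] integrable_integral[OF iF]] by simp
  thus ?thesis by (simp add: left_diff_distrib)
qed

definition F :: "real \<Rightarrow> rvec" where "F t l = (\<Sum>i<N. Jac f piu U t i l * \<Phi> t i) + g t l"

text \<open>The exact solution of the dual equation with the discrete solution \<open>\<Phi>\<close> inserted on the right-hand
  side: \<open>\<Theta>' = - F\<close> and \<open>\<Theta>(T) = \<psi>\<close>.\<close>

definition \<Theta> :: "real \<Rightarrow> rvec" where "\<Theta> t l = \<psi> l + integral {t..T} (\<lambda>s. F s l)"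

lemma J\<Phi>_measurable: "l < N \<Longrightarrow> (\<lambda>t. \<Sum>i<N. Jac f piu U t i l * \<Phi> t i) \<in> borel_measurable (lebesgue_on {0<..T})"
  by (intro borel_measurable_sum borel_measurable_times \<Phi>_measurable Jac_measurable[OF mesh ivp refl refl]
      piu_cont U_cont) auto

lemma J\<Phi>_bounded: "\<exists>B\<ge>0. \<forall>l<N. \<forall>t\<in>{0<..T}. \<bar>\<Sum>i<N. Jac f piu U t i l * \<Phi> t i\<bar> \<le> B"
proof -
  obtain B where B: "B \<ge> 0" "\<And>i t. i < N \<Longrightarrow> t \<in> {0<..T} \<Longrightarrow> \<bar>\<Phi> t i\<bar> \<le> B" using \<Phi>_bounded by blast
  obtain L where L: "L \<ge> 0" "\<And>i l x y t. i < N \<Longrightarrow> l < N \<Longrightarrow> t \<in> {0<..T} \<Longrightarrow> \<bar>Jac f x y t i l\<bar> \<le> L"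
    using Jac_bounded[OF mesh ivp refl refl] by blast
  show ?thesis
  proof (intro exI[of _ "\<Sum>i<N. L * B"] conjI allI impI ballI)
    show "0 \<le> (\<Sum>i<N. L * B)" using L B by (intro sum_nonneg) auto
    fix l t assume l: "l < N" and t: "t \<in> {0<..T}"
    show "\<bar>\<Sum>i<N. Jac f piu U t i l * \<Phi> t i\<bar> \<le> (\<Sum>i<N. L * B)"
      by (rule order.trans[OF sum_abs sum_mono]) (auto simp: abs_mult intro!: mult_mono L B t l)
  qed
qed

lemma times_F_integrable:
  assumes l: "l < N" and h: "continuous_on {0..T} h"
  shows "(\<lambda>t. h t * (\<Sum>i<N. Jac f piu U t i l * \<Phi> t i)) integrable_on {0..T}"
    "(\<lambda>t. h t * g t l) integrable_on {0..T}"
    "(\<lambda>t. h t * F t l) integrable_on {0..T}"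
proof -
  have "compact (h ` {0..T})" by (rule compact_continuous_image[OF h]) simp
  hence bh: "bounded (h ` {0..T})" by (rule compact_imp_bounded)
  obtain L where L: "\<And>l t. l < N \<Longrightarrow> t \<in> {0<..T} \<Longrightarrow> \<bar>\<Sum>i<N. Jac f piu U t i l * \<Phi> t i\<bar> \<le> L"
    using J\<Phi>_bounded by blast
  show 1: "(\<lambda>t. h t * (\<Sum>i<N. Jac f piu U t i l * \<Phi> t i)) integrable_on {0..T}"
    by (rule continuous_times_bounded_measurable_integrable[OF T_pos h J\<Phi>_measurable[OF l] L[OF l]])
  have "h \<in> borel_measurable (lebesgue_on {0..T})"
    by (rule continuous_imp_measurable_on_sets_lebesgue[OF h]) auto
  hence "(\<lambda>t. h t * g t l) absolutely_integrable_on {0..T}"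
    by (intro absolutely_integrable_bounded_measurable_product_real g_integrable l bh) auto
  thus 2: "(\<lambda>t. h t * g t l) integrable_on {0..T}" by (rule set_lebesgue_integral_eq_integral(1))
  show "(\<lambda>t. h t * F t l) integrable_on {0..T}"
    using integrable_add[OF 1 2] by (simp add: F_def distrib_left)
qed

lemma F_integrable: "l < N \<Longrightarrow> (\<lambda>t. F t l) integrable_on {0..T}"
  using times_F_integrable(3)[of l "\<lambda>_. 1"] by simp

lemma \<Theta>_eq:
  assumes "l < N" "t \<in> {0..T}"
  shows "\<Theta> t l = \<psi> l + integral {0..T} (\<lambda>s. F s l) - integral {0..t} (\<lambda>s. F s l)"
  using Henstock_Kurzweil_Integration.integral_combine[OF _ _ F_integrable[OF assms(1)], of t] assms(2) by (simp add: \<Theta>_def)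

lemma \<Theta>_cont: "l < N \<Longrightarrow> continuous_on {0..T} (\<lambda>t. \<Theta> t l)"
proof -
  assume l: "l < N"
  have "continuous_on {0..T} (\<lambda>t. \<psi> l + integral {0..T} (\<lambda>s. F s l) - integral {0..t} (\<lambda>s. F s l))"
    by (intro continuous_on_diff continuous_on_const indefinite_integral_continuous_1 F_integrable l)
  thus ?thesis by (rule continuous_on_eq) (simp add: \<Theta>_eq l)
qed

lemma \<Theta>_deriv:
  assumes l: "l < N" and t: "t \<in> {0<..<T}" and c: "isCont (\<lambda>t. F t l) t"
  shows "((\<lambda>t. \<Theta> t l) has_real_derivative - F t l) (at t)"
proof -
  have "((\<lambda>u. integral {0..u} (\<lambda>s. F s l)) has_vector_derivative F t l) (at t within ({0..T} - {}))"
    using t c by (intro integral_has_vector_derivative_continuous_at F_integrable l)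
      (auto intro: continuous_at_imp_continuous_at_within)
  moreover have "at t within {0..T} = at t" using t by (intro at_within_interior) simp
  ultimately have "((\<lambda>u. integral {0..u} (\<lambda>s. F s l)) has_real_derivative F t l) (at t)"
    by (simp add: has_real_derivative_iff_has_vector_derivative)
  hence "((\<lambda>u. \<psi> l + integral {0..T} (\<lambda>s. F s l) - integral {0..u} (\<lambda>s. F s l)) has_real_derivative - F t l) (at t)"
    by (auto intro!: derivative_eq_intros)
  thus ?thesis
    by (rule has_field_derivative_transform_within_open[where S = "{0<..<T}"]) (use t in \<open>auto simp: \<Theta>_eq l\<close>)
qed

text \<open>Integration by parts in the dual problem shows that \<open>\<Phi> - \<Theta>\<close> is orthogonal to the derivatives of
  all trial functions vanishing at \<open>0\<close>. A primitive of \<open>w\<close>, continued by constants outside one cell, is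
  such a function; hence \<open>\<Phi>\<close> is the \<open>L\<^sub>2\<close> projection of the continuous function \<open>\<Theta>\<close> on the cell.\<close>

lemma dual_projection:
  assumes l: "l < N" and j: "j \<in> {1..ncells D l}" and S: "finite S"
    and c: "\<And>t. t \<in> {node D l (j - 1)<..<node D l j} - S \<Longrightarrow> isCont (\<lambda>t. F t l) t"
    and r: "\<And>t. t \<in> cell D l j \<Longrightarrow> \<Phi> t l = poly r t"
    and w: "degree w \<le> deg D l j - 1"
  shows "((\<lambda>s. (poly r s - \<Theta> s l) * poly w s) has_integral 0) {node D l (j - 1)..node D l j}"
proof -
  define \<alpha> \<beta> where "\<alpha> = node D l (j - 1)" and "\<beta> = node D l j"
  have ab: "\<alpha> < \<beta>" using node_less[OF l j] by (simp add: \<alpha>_def \<beta>_def)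
  have sub: "0 \<le> \<alpha>" "\<beta> \<le> T" using cell_closed_subset[OF l j] ab by (auto simp: \<alpha>_def \<beta>_def)
  have cell_eq: "cell D l j = {\<alpha><..\<beta>}" by (simp add: cell_def \<alpha>_def \<beta>_def)
  obtain p where p: "pderiv p = w" "degree p \<le> Suc (degree w)" "poly p \<alpha> = 0"
    using poly_antiderivative[of w \<alpha>] by blast
  have degp: "degree p \<le> deg D l j" using p(2) w deg_ge1[OF l j] by linarith
  \<comment> \<open>Clamping the argument to the cell continues \<open>p\<close> by constants.\<close>
  define V where "V t = poly p (max \<alpha> (min t \<beta>))" for t
  have Vc: "continuous_on A V" for A
    unfolding V_def by (intro continuous_on_compose2[OF continuous_on_poly_real[of UNIV p]] continuous_intros) auto
  have Vlow: "V t = 0" if "t \<le> \<alpha>" for t using that ab p(3) by (simp add: V_def max_def min_def)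
  have Vmid: "V t = poly p t" if "t \<in> {\<alpha>..\<beta>}" for t using that by (simp add: V_def)
  have Vhigh: "V t = poly p \<beta>" if "t \<ge> \<beta>" for t using that ab by (simp add: V_def max_def min_def)
  define v where "v t i = (if i = l then V t else 0)" for t i
  have v: "v \<in> trial_space D"
    unfolding trial_space_def poly_on_def
  proof (intro CollectI allI impI conjI ballI)
    fix i assume i: "i < N"
    show "continuous_on {0..T} (\<lambda>t. v t i)" using Vc by (cases "i = l") (auto simp: v_def)
    fix j' assume j': "j' \<in> {1..ncells D i}"
    show "\<exists>p. degree p \<le> deg D i j' \<and> (\<forall>t\<in>cell D i j'. v t i = poly p t)"
    proof (cases "i = l")
      case False
      thus ?thesis by (intro exI[of _ 0]) (simp add: v_def)
    next
      case True
      consider "j' = j" | "j' \<le> j - 1" | "j \<le> j' - 1" by linarith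
      thus ?thesis
      proof cases
        case 1
        thus ?thesis using degp True Vmid by (intro exI[of _ p]) (auto simp: v_def cell_def \<alpha>_def \<beta>_def)
      next
        case 2
        have "node D l j' \<le> \<alpha>" unfolding \<alpha>_def using 2 j by (intro node_le l) auto
        hence "V t = 0" if "t \<in> cell D l j'" for t using that by (intro Vlow) (auto simp: cell_def)
        thus ?thesis using True by (intro exI[of _ 0]) (simp add: v_def)
      next
        case 3
        have "\<beta> \<le> node D l (j' - 1)" unfolding \<beta>_def using 3 j' True by (intro node_le l) auto
        hence "V t = poly p \<beta>" if "t \<in> cell D l j'" for t using that by (intro Vhigh) (auto simp: cell_def)
        thus ?thesis using True by (intro exI[of _ "[:poly p \<beta>:]"]) (simp add: v_def)
      qed
    qed
  qed
  have v0: "\<forall>i<N. v 0 i = 0" using sub Vlow by (simp add: v_def)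
  have eq: "integral {0..T} (\<lambda>t. \<Sum>i<N. deriv (\<lambda>s. v s i) t * \<Phi> t i) =
        integral {0..T} (\<lambda>t. \<Sum>i<N. (\<Sum>k<N. Jac f piu U t i k * v t k) * \<Phi> t i) + Lfun D \<psi> g v"
    using dual v v0 by (simp add: mcG_dual_solution_def)
  have "integral {0..T} (\<lambda>t. \<Sum>i<N. deriv (\<lambda>s. v s i) t * \<Phi> t i) = integral {\<alpha>..\<beta>} (\<lambda>t. poly w t * poly r t)"
  proof -
    have dV: "deriv V t = (if t < \<alpha> then 0 else if t < \<beta> then poly w t else 0)" if "t \<notin> {\<alpha>, \<beta>}" for t
    proof -
      have "t < \<alpha> \<or> t \<in> {\<alpha><..<\<beta>} \<or> t > \<beta>" using that by auto
      then consider "t < \<alpha>" | "t \<in> {\<alpha><..<\<beta>}" | "t > \<beta>" by blast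
      thus ?thesis
      proof cases
        case 1
        have "(V has_real_derivative 0) (at t)"
          by (rule has_field_derivative_transform_within_open[OF DERIV_const, of "{..<\<alpha>}"]) (use 1 Vlow in auto)
        thus ?thesis using 1 by (simp add: DERIV_imp_deriv)
      next
        case 2
        have "(V has_real_derivative poly (pderiv p) t) (at t)"
          by (rule has_field_derivative_transform_within_open[OF poly_DERIV, where S = "{\<alpha><..<\<beta>}"]) (use 2 Vmid in auto)
        thus ?thesis using 2 by (simp add: DERIV_imp_deriv p)
      next
        case 3
        have "(V has_real_derivative 0) (at t)"
          by (rule has_field_derivative_transform_within_open[OF DERIV_const, of "{\<beta><..}"]) (use 3 Vhigh in auto)
        thus ?thesis using 3 ab by (simp add: DERIV_imp_deriv)
      qed
    qed
    have "(\<Sum>i<N. deriv (\<lambda>s. v s i) t * \<Phi> t i) = deriv V t * \<Phi> t l" for t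
    proof -
      have "(\<Sum>i<N. deriv (\<lambda>s. v s i) t * \<Phi> t i) = (\<Sum>i<N. if i = l then deriv V t * \<Phi> t l else 0)"
        by (intro sum.cong) (auto simp: v_def)
      thus ?thesis using l by simp
    qed
    hence "integral {0..T} (\<lambda>t. \<Sum>i<N. deriv (\<lambda>s. v s i) t * \<Phi> t i) =
        integral {0..T} (\<lambda>t. if t \<in> cell D l j then poly w t * poly r t else 0)"
      by (intro integral_spike[of "{\<alpha>, \<beta>}"]) (auto simp: dV cell_eq r[unfolded cell_eq])
    thus ?thesis by (simp add: integral_cell[OF l j] \<alpha>_def \<beta>_def)
  qed
  moreover have "integral {0..T} (\<lambda>t. \<Sum>i<N. (\<Sum>k<N. Jac f piu U t i k * v t k) * \<Phi> t i) + Lfun D \<psi> g v =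
      poly p \<beta> * \<psi> l + integral {0..T} (\<lambda>t. V t * F t l)"
  proof -
    have "(\<Sum>i<N. (\<Sum>k<N. Jac f piu U t i k * v t k) * \<Phi> t i) = V t * (\<Sum>i<N. Jac f piu U t i l * \<Phi> t i)" for t
    proof -
      have "(\<Sum>k<N. Jac f piu U t i k * v t k) = Jac f piu U t i l * V t" for i
      proof -
        have "(\<Sum>k<N. Jac f piu U t i k * v t k) = (\<Sum>k<N. if k = l then Jac f piu U t i l * V t else 0)"
          by (intro sum.cong) (auto simp: v_def)
        thus ?thesis using l by simp
      qed
      thus ?thesis by (simp add: sum_distrib_left mult_ac)
    qed
    moreover have "(\<Sum>i<N. v t i * h i) = V t * h l" for t h
    proof -
      have "(\<Sum>i<N. v t i * h i) = (\<Sum>i<N. if i = l then V t * h l else 0)"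
        by (intro sum.cong) (auto simp: v_def)
      thus ?thesis using l by simp
    qed
    moreover have "integral {0..T} (\<lambda>t. V t * (\<Sum>i<N. Jac f piu U t i l * \<Phi> t i)) + integral {0..T} (\<lambda>t. V t * g t l) =
        integral {0..T} (\<lambda>t. V t * F t l)"
      by (subst integral_add[symmetric]) (auto simp: F_def distrib_left intro!: times_F_integrable(1,2) l Vc)
    ultimately show ?thesis using sub Vhigh[of T] by (simp add: Lfun_def)
  qed
  moreover have "integral {0..T} (\<lambda>t. V t * F t l) =
      integral {\<alpha>..\<beta>} (\<lambda>t. poly p t * F t l) + poly p \<beta> * integral {\<beta>..T} (\<lambda>t. F t l)"
  proof -
    have VF: "(\<lambda>t. V t * F t l) integrable_on {0..T}" by (rule times_F_integrable(3)[OF l Vc])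
    have "integral {0..T} (\<lambda>t. V t * F t l) =
        integral {0..\<alpha>} (\<lambda>t. V t * F t l) + integral {\<alpha>..T} (\<lambda>t. V t * F t l)"
      using sub ab by (intro Henstock_Kurzweil_Integration.integral_combine[symmetric] VF) auto
    also have "integral {\<alpha>..T} (\<lambda>t. V t * F t l) = integral {\<alpha>..\<beta>} (\<lambda>t. V t * F t l) + integral {\<beta>..T} (\<lambda>t. V t * F t l)"
      using sub ab by (intro Henstock_Kurzweil_Integration.integral_combine[symmetric] integrable_on_subinterval[OF VF]) auto
    also have "integral {0..\<alpha>} (\<lambda>t. V t * F t l) = integral {0..\<alpha>} (\<lambda>t. 0)" by (rule integral_cong) (simp add: Vlow)
    also have "integral {\<alpha>..\<beta>} (\<lambda>t. V t * F t l) = integral {\<alpha>..\<beta>} (\<lambda>t. poly p t * F t l)" by (rule integral_cong) (simp add: Vmid)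
    also have "integral {\<beta>..T} (\<lambda>t. V t * F t l) = integral {\<beta>..T} (\<lambda>t. poly p \<beta> * F t l)" by (rule integral_cong) (simp add: Vhigh)
    finally show ?thesis by simp
  qed
  ultimately have main: "integral {\<alpha>..\<beta>} (\<lambda>t. poly w t * poly r t) =
      integral {\<alpha>..\<beta>} (\<lambda>t. poly p t * F t l) + poly p \<beta> * \<Theta> \<beta> l"
    using eq by (simp add: \<Theta>_def algebra_simps)
  have \<Theta>c: "continuous_on {\<alpha>..\<beta>} (\<lambda>t. \<Theta> t l)"
    by (rule continuous_on_subset[OF \<Theta>_cont[OF l]]) (use sub in auto)
  \<comment> \<open>The contribution of \<open>(\<beta>, T)\<close> and \<open>\<psi>\<close> has been collected in \<open>\<Theta> \<beta>\<close>; integration by parts on the cell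
    turns the remaining terms into the integral of \<open>w * \<Theta>\<close>.\<close>
  have parts: "((\<lambda>t. poly w t * \<Theta> t l - poly p t * F t l) has_integral poly p \<beta> * \<Theta> \<beta> l - poly p \<alpha> * \<Theta> \<alpha> l) {\<alpha>..\<beta>}"
  proof (rule fundamental_theorem_of_calculus_interior_strong[OF S])
    show "continuous_on {\<alpha>..\<beta>} (\<lambda>t. poly p t * \<Theta> t l)" by (intro continuous_on_mult continuous_on_poly_real \<Theta>c)
    fix t assume t: "t \<in> {\<alpha><..<\<beta>} - S"
    have "((\<lambda>t. \<Theta> t l) has_real_derivative - F t l) (at t)"
      using t sub c by (intro \<Theta>_deriv l) (auto simp: \<alpha>_def \<beta>_def)
    from DERIV_mult[OF poly_DERIV[of p t] this]
    show "((\<lambda>t. poly p t * \<Theta> t l) has_vector_derivative poly w t * \<Theta> t l - poly p t * F t l) (at t)"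
      by (simp add: has_real_derivative_iff_has_vector_derivative p algebra_simps)
  qed (use ab in simp)
  have i\<Theta>: "(\<lambda>t. poly w t * \<Theta> t l) integrable_on {\<alpha>..\<beta>}"
    by (intro integrable_continuous_real continuous_on_mult continuous_on_poly_real \<Theta>c)
  have iF: "(\<lambda>t. poly p t * F t l) integrable_on {\<alpha>..\<beta>}"
    by (rule integrable_on_subinterval[OF times_F_integrable(3)[OF l continuous_on_poly_real]]) (use sub in auto)
  have "integral {\<alpha>..\<beta>} (\<lambda>t. poly w t * \<Theta> t l) - integral {\<alpha>..\<beta>} (\<lambda>t. poly p t * F t l) = poly p \<beta> * \<Theta> \<beta> l"
    using integral_unique[OF parts] integral_diff[OF i\<Theta> iF] p(3) by simp
  with main have "integral {\<alpha>..\<beta>} (\<lambda>t. poly w t * poly r t) = integral {\<alpha>..\<beta>} (\<lambda>t. poly w t * \<Theta> t l)" by simp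
  moreover have ir: "(\<lambda>t. poly w t * poly r t) integrable_on {\<alpha>..\<beta>}"
    by (intro integrable_continuous_real continuous_on_mult continuous_on_poly_real)
  ultimately have "((\<lambda>t. poly w t * poly r t - poly w t * \<Theta> t l) has_integral 0) {\<alpha>..\<beta>}"
    using has_integral_diff[OF integrable_integral[OF ir] integrable_integral[OF i\<Theta>]] by simp
  thus ?thesis by (simp add: \<alpha>_def \<beta>_def algebra_simps)
qed

subsection \<open>Time slabs\<close>

lemma level_less: "n \<in> {1..nslabs D} \<Longrightarrow> level D (n - 1) < level D n"
  and level_0: "level D 0 = 0" and level_T: "level D (nslabs D) = T"
  and level_node: "n \<le> nslabs D \<Longrightarrow> i < N \<Longrightarrow> \<exists>j\<le>ncells D i. node D i j = level D n"
  using mesh by (auto simp: is_mesh_def)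

lemma level_le: "n \<le> n' \<Longrightarrow> n' \<le> nslabs D \<Longrightarrow> level D n \<le> level D n'"
  by (rule increasing_sequence_le[of "nslabs D"]) (blast intro: level_less)+

lemma level_bounds: "n \<le> nslabs D \<Longrightarrow> level D n \<in> {0..T}"
  using level_le[of 0 n] level_le[of n "nslabs D"] level_0 level_T by auto

lemma slab_subset: "n \<in> {1..nslabs D} \<Longrightarrow> slab D n \<subseteq> {0<..T}"
  using level_bounds[of n] level_bounds[of "n - 1"] by (fastforce simp: slab_def le_diff_conv)

lemma slab_at_unique:
  assumes "t \<in> {0<..T}"
  shows "\<exists>!n. n \<in> {1..nslabs D} \<and> t \<in> slab D n"
  unfolding slab_def
  using partition_index[of "nslabs D" "level D" t] level_less level_0 level_T assms by simp

lemma slab_at: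
  assumes "t \<in> {0<..T}"
  shows "slab_at D t \<in> {1..nslabs D}" "t \<in> slab D (slab_at D t)"
  using theI'[OF slab_at_unique[OF assms]] unfolding slab_at_def by auto

lemma slab_at_eq:
  assumes "n \<in> {1..nslabs D}" "t \<in> slab D n"
  shows "slab_at D t = n"
proof -
  have "t \<in> {0<..T}" using slab_subset assms by blast
  thus ?thesis unfolding slab_at_def by (intro the1_equality slab_at_unique) (use assms in auto)
qed

text \<open>The levels are nodes of every component, so that no cell crosses a level.\<close>

lemma cell_in_slab:
  assumes n: "n \<in> {1..nslabs D}" and t: "t \<in> slab D n" and i: "i < N"
  shows "(i, cell_at D i t) \<in> slab_cells D n"
proof -
  have tT: "t \<in> {0<..T}" using slab_subset n t by blast
  define j where "j = cell_at D i t"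
  have j: "j \<in> {1..ncells D i}" "node D i (j - 1) < t" "t \<le> node D i j"
    using cell_at[OF i tT] by (auto simp: j_def cell_def)
  have "n - 1 \<le> nslabs D" using n by auto
  from level_node[OF this i] obtain j1 where j1: "j1 \<le> ncells D i" "node D i j1 = level D (n - 1)" by blast
  obtain j2 where j2: "j2 \<le> ncells D i" "node D i j2 = level D n" using level_node[of n i] n i by auto
  have tl: "level D (n - 1) < t" "t \<le> level D n" using t by (auto simp: slab_def)
  have "j1 \<le> j - 1"
  proof (rule ccontr)
    assume "\<not> j1 \<le> j - 1"
    hence "node D i j \<le> node D i j1" using j1 j by (intro node_le i) auto
    thus False using tl j1 j by simp
  qed
  hence "level D (n - 1) \<le> node D i (j - 1)" unfolding j1(2)[symmetric] using j by (intro node_le i) auto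
  moreover have "j \<le> j2"
  proof (rule ccontr)
    assume "\<not> j \<le> j2"
    hence "node D i j2 \<le> node D i (j - 1)" using j2 j by (intro node_le i) auto
    thus False using tl j2 j by simp
  qed
  hence "node D i j \<le> level D n" unfolding j2(2)[symmetric] using j2 by (intro node_le i) auto
  ultimately show ?thesis using i j by (simp add: slab_cells_def j_def[symmetric])
qed

lemma slab_of_cell:
  assumes i: "i < N" and j: "j \<in> {1..ncells D i}"
  obtains n where "n \<in> {1..nslabs D}" "(i, j) \<in> slab_cells D n"
proof -
  have c: "node D i j \<in> cell D i j" using node_less[OF i j] by (simp add: cell_def)
  hence "node D i j \<in> {0<..T}" using cell_subset[OF i j] by blast
  from slab_at[OF this] have "slab_at D (node D i j) \<in> {1..nslabs D}" "node D i j \<in> slab D (slab_at D (node D i j))" .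
  from cell_in_slab[OF this i] cell_at_eq[OF i j c] this(1) that show ?thesis by auto
qed

lemma \<Phi>_le_slab_sup:
  assumes n: "n \<in> {1..nslabs D}" and t: "t \<in> slab D n" and i: "i < N"
  shows "\<bar>\<Phi> t i\<bar> \<le> slab_sup D \<Phi> n"
proof -
  obtain B where B: "B \<ge> 0" "\<And>i t. i < N \<Longrightarrow> t \<in> {0<..T} \<Longrightarrow> \<bar>\<Phi> t i\<bar> \<le> B" using \<Phi>_bounded by blast
  have "\<bar>\<Phi> t i\<bar> \<le> linf N (\<Phi> t)" by (rule linf_upper[OF i])
  also have "\<dots> \<le> slab_sup D \<Phi> n"
    unfolding slab_sup_def
  proof (rule cSUP_upper[OF t])
    show "bdd_above ((\<lambda>t. linf N (\<Phi> t)) ` slab D n)"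
      using slab_subset[OF n] B N_pos by (intro bdd_aboveI2[of _ _ B]) (auto simp: linf_le_iff)
  qed
  finally show ?thesis .
qed

lemma slab_sup_nonneg: "n \<in> {1..nslabs D} \<Longrightarrow> slab_sup D \<Phi> n \<ge> 0"
proof -
  assume n: "n \<in> {1..nslabs D}"
  have "level D n \<in> slab D n" using level_less[OF n] by (simp add: slab_def)
  from \<Phi>_le_slab_sup[OF n this, of 0] N_pos show ?thesis by fastforce
qed

end

section \<open>The second estimate\<close>

lemma slab_constant_mono:
  assumes "slab_constant N f q a b A C" "C \<le> C'" "N \<ge> 1"
  shows "slab_constant N f q a b A C'"
  unfolding slab_constant_def
proof (intro conjI allI impI ballI)
  fix i assume "i < N"
  hence "Dpnorm N (q + 1) (\<lambda>x t. f x t i) a b A \<le> ereal C" using assms(1) by (simp add: slab_constant_def)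
  thus "Dpnorm N (q + 1) (\<lambda>x t. f x t i) a b A \<le> ereal C'" by (rule order.trans) (use assms(2) in simp)
next
  fix x S Cx p t
  assume h: "p \<le> q \<and> 0 < Cx \<and> (\<forall>i<N. piecewise_Ck p a b S (\<lambda>t. x t i)) \<and>
    (\<forall>n\<in>{1..p}. \<forall>t\<in>{a<..<b} - S. linf N (\<lambda>i. (deriv ^^ n) (\<lambda>s. x s i) t) \<le> Cx ^ n)"
  {
    assume "t \<in> {a<..<b} - S"
    hence "linf_op N (\<lambda>i l. (deriv ^^ p) (DfT f x i l) t) \<le> C * Cx ^ p"
      using assms(1) h unfolding slab_constant_def by blast
    also have "\<dots> \<le> C' * Cx ^ p" using assms(2) h by (intro mult_right_mono) auto
    finally show "linf_op N (\<lambda>i l. (deriv ^^ p) (DfT f x i l) t) \<le> C' * Cx ^ p" .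
  }
  {
    assume "p < q" "t \<in> {a<..<b}"
    hence "linf_op N (\<lambda>i l. jump ((deriv ^^ p) (DfT f x i l)) t) \<le>
        C * (\<Sum>n\<le>p. Cx ^ (p - n) * linf N (\<lambda>i. jump ((deriv ^^ n) (\<lambda>s. x s i)) t))"
      using assms(1) h unfolding slab_constant_def by blast
    also have "\<dots> \<le> C' * (\<Sum>n\<le>p. Cx ^ (p - n) * linf N (\<lambda>i. jump ((deriv ^^ n) (\<lambda>s. x s i)) t))"
    proof (intro mult_right_mono assms(2) sum_nonneg mult_nonneg_nonneg)
      fix n
      have "0 \<le> \<bar>jump ((deriv ^^ n) (\<lambda>s. x s 0)) t\<bar>" by simp
      also have "\<dots> \<le> linf N (\<lambda>i. jump ((deriv ^^ n) (\<lambda>s. x s i)) t)"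
        using assms(3) by (intro linf_upper[where v = "\<lambda>i. jump ((deriv ^^ n) (\<lambda>s. x s i)) t"]) auto
      finally show "0 \<le> linf N (\<lambda>i. jump ((deriv ^^ n) (\<lambda>s. x s i)) t)" .
      show "0 \<le> Cx ^ (p - n)" using h by simp
    qed
    finally show "linf_op N (\<lambda>i l. jump ((deriv ^^ p) (DfT f x i l)) t) \<le>
        C' * (\<Sum>n\<le>p. Cx ^ (p - n) * linf N (\<lambda>i. jump ((deriv ^^ n) (\<lambda>s. x s i)) t))" .
  }
qed

text \<open>
  The constants of the induction. Every projection on the way from \<open>f(U)\<close> to \<open>G\<close> consumes one unit of
  the initial radius of the window. At order \<open>r\<close>, \<open>derivB\<close> belongs to the velocities of \<open>u\<close> and \<open>U\<close>
  in units of \<open>Cf\<close>, and \<open>dualB\<close> to \<open>\<Phi>\<close> in units of its maximum in the slab, where \<open>projB\<close> accounts for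
  the passage through \<open>\<Theta>\<close>. Finally \<open>curveB\<close> belongs to the curves \<open>u\<close>, \<open>U\<close>, \<open>piu\<close>, and \<open>gradB\<close> to \<open>G\<close>.
\<close>

definition radius :: "nat \<Rightarrow> real" where "radius q = 2 * real q + 4"

definition projC :: "nat \<Rightarrow> real" where "projC q = 1 + polyC (q - 1)"

fun derivB :: "real \<Rightarrow> nat \<Rightarrow> nat \<Rightarrow> real" where
  "derivB c q 0 = projC q"
| "derivB c q (Suc r) = projC q * smooth_slab.rhsC c (radius q) (window.lowerC c (radius q) r * derivB c q r) (Suc r)"

definition curveB :: "real \<Rightarrow> nat \<Rightarrow> real" where
  "curveB c q = window.lowerC c (radius q) q * (interpC q * (derivB c q (q - 1) * window.H c (radius q)))"

definition projB :: "real \<Rightarrow> real \<Rightarrow> nat \<Rightarrow> nat \<Rightarrow> real \<Rightarrow> real" where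
  "projB c cg q r B = projC q * (smooth_slab.jacC c (radius q) r (curveB c q) * B * window.prodC c (radius q) r +
     cg * window.H c (radius q) ^ r) * window.H c (radius q)"

fun dualB :: "real \<Rightarrow> real \<Rightarrow> nat \<Rightarrow> nat \<Rightarrow> real" where
  "dualB c cg q 0 = 1"
| "dualB c cg q (Suc r) = 1 + (1 + window.lowerC c (radius q) (Suc r)) * projB c cg q r (dualB c cg q r)"

definition gradB :: "real \<Rightarrow> real \<Rightarrow> nat \<Rightarrow> real" where
  "gradB c cg q = smooth_slab.jacC c (radius q) (q - 1) (curveB c q) * dualB c cg q (q - 1) * window.prodC c (radius q) (q - 1)"

locale galerkin_smooth = galerkin +
  fixes qbar :: "nat \<Rightarrow> nat" and Cf :: "nat \<Rightarrow> real" and \<alpha> ck cg :: real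
  assumes \<alpha>: "\<alpha> \<in> {0<..<1}" and ck: "ck > 0" and cg: "cg \<ge> 0"
    and slabs: "slab_assumptions D f u U piu qbar Cf \<alpha> ck"
    and source: "source_bound D g \<Phi> qbar Cf cg"
begin

lemma slab_props:
  assumes n: "n \<in> {1..nslabs D}"
  shows deg_slab: "\<And>i j. (i, j) \<in> slab_cells D n \<Longrightarrow> deg D i j = qbar n"
    and quasi_uniform: "\<And>i j i' j'. (i, j) \<in> slab_cells D n \<Longrightarrow> (i', j') \<in> slab_cells D n \<Longrightarrow> step D i j > \<alpha> * step D i' j'"
    and stationary: "\<And>i x t. i < N \<Longrightarrow> t \<in> slab D n \<Longrightarrow> ((\<lambda>s. f x s i) has_real_derivative 0) (at t within slab D n)"
    and f_Ck: "\<And>i t. i < N \<Longrightarrow> t \<in> slab D n \<Longrightarrow> Ck_space N (qbar n + 1) (\<lambda>x. f x t i)"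
    and slab_const: "slab_constant N f (qbar n) (level D (n - 1)) (level D n) (args u U piu) (Cf n)"
    and step_Cf: "\<And>i j. (i, j) \<in> slab_cells D n \<Longrightarrow> step D i j * Cf n \<le> ck"
proof -
  note s = bspec[OF slabs[unfolded slab_assumptions_def] n]
  from s have 1: "\<forall>(i, j)\<in>slab_cells D n. deg D i j = qbar n"
    and 2: "\<forall>(i, j)\<in>slab_cells D n. \<forall>(i', j')\<in>slab_cells D n. step D i j > \<alpha> * step D i' j'"
    and 3: "\<forall>i<N. \<forall>x. \<forall>t\<in>slab D n. ((\<lambda>s. f x s i) has_real_derivative 0) (at t within slab D n)"
    and 4: "\<forall>i<N. \<forall>t\<in>slab D n. Ck_space N (qbar n + 1) (\<lambda>x. f x t i)"
    and 5: "slab_constant N f (qbar n) (level D (n - 1)) (level D n) (args u U piu) (Cf n)"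
    and 6: "\<forall>(i, j)\<in>slab_cells D n. step D i j * Cf n \<le> ck"
    by blast+
  show "\<And>i j. (i, j) \<in> slab_cells D n \<Longrightarrow> deg D i j = qbar n" using 1 by blast
  show "\<And>i j i' j'. (i, j) \<in> slab_cells D n \<Longrightarrow> (i', j') \<in> slab_cells D n \<Longrightarrow> step D i j > \<alpha> * step D i' j'"
    using 2 by blast
  show "\<And>i x t. i < N \<Longrightarrow> t \<in> slab D n \<Longrightarrow> ((\<lambda>s. f x s i) has_real_derivative 0) (at t within slab D n)" using 3 by blast
  show "\<And>i t. i < N \<Longrightarrow> t \<in> slab D n \<Longrightarrow> Ck_space N (qbar n + 1) (\<lambda>x. f x t i)" using 4 by blast
  show "slab_constant N f (qbar n) (level D (n - 1)) (level D n) (args u U piu) (Cf n)" by (rule 5)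
  show "\<And>i j. (i, j) \<in> slab_cells D n \<Longrightarrow> step D i j * Cf n \<le> ck" using 6 by blast
qed

lemma level_in_slab: "n \<in> {1..nslabs D} \<Longrightarrow> level D n \<in> slab D n"
  using level_less by (simp add: slab_def)

lemma f_autonomous:
  assumes n: "n \<in> {1..nslabs D}" and i: "i < N" and t: "t \<in> slab D n"
  shows "f x t i = f x (level D n) i"
proof -
  have "convex (slab D n)" by (simp add: slab_def)
  from has_field_derivative_zero_constant[OF this stationary[OF n i]]
  obtain c where "\<forall>t\<in>slab D n. f x t i = c" by blast
  thus ?thesis using t level_in_slab[OF n] by simp
qed

lemma args_u: "u t \<in> args u U piu t" and args_U: "U t \<in> args u U piu t"
proof -
  have "(\<lambda>i. 0 * piu t i + (1 - 0) * u t i) \<in> args u U piu t"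
    "(\<lambda>i. 0 * piu t i + (1 - 0) * U t i) \<in> args u U piu t"
    unfolding args_def by (rule UN_I[of 0]; simp)+
  thus "u t \<in> args u U piu t" "U t \<in> args u U piu t" by simp_all
qed

lemma Cf_nonneg: assumes n: "n \<in> {1..nslabs D}" shows "Cf n \<ge> 0"
proof -
  have "Dpnorm N (qbar n + 1) (\<lambda>x t. f x t 0) (level D (n - 1)) (level D n) (args u U piu) \<le> ereal (Cf n)"
    using slab_const[OF n] N_pos by (simp add: slab_constant_def)
  from Dpnorm_bound[OF this _ level_in_slab[OF n, unfolded slab_def] args_u N_pos, of 0]
  have "\<bar>Dform N 0 (\<lambda>y. f y (level D n) 0) (u (level D n)) undefined\<bar> \<le> Cf n" by simp
  thus ?thesis by linarith
qed

lemma qbar_ge1: assumes n: "n \<in> {1..nslabs D}" shows "qbar n \<ge> 1"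
proof -
  have "(0, cell_at D 0 (level D n)) \<in> slab_cells D n"
    using N_pos by (intro cell_in_slab n level_in_slab) auto
  thus ?thesis using deg_slab[OF n] deg_ge1 unfolding slab_cells_def by fastforce
qed

end

text \<open>
  The window is centred at the middle of one local interval \<open>(i0, j0)\<close>. Divided by \<open>\<alpha>\<close>, its length
  exceeds all steps in the slab. The number \<open>C\<close> replaces the constant of the slab, which may vanish.
\<close>

locale galerkin_cell = galerkin_smooth +
  fixes n i0 j0 :: nat and C :: real
  assumes n: "n \<in> {1..nslabs D}" and ij: "(i0, j0) \<in> slab_cells D n"
    and C: "C > 0" "Cf n \<le> C" "step D i0 j0 * C \<le> 2 * ck"
begin

abbreviation "q \<equiv> qbar n"
definition a :: real where "a = level D (n - 1)"
definition b :: real where "b = level D n"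
definition mid :: real where "mid = (node D i0 (j0 - 1) + node D i0 j0) / 2"
abbreviation "Sn \<equiv> slab_sup D \<Phi> n"
abbreviation "c \<equiv> 2 * ck / \<alpha>"

lemma ij': "i0 < N" "j0 \<in> {1..ncells D i0}" "a \<le> node D i0 (j0 - 1)" "node D i0 j0 \<le> b"
  using ij by (auto simp: slab_cells_def a_def b_def)

lemma slab_eq: "slab D n = {a<..b}" by (simp add: slab_def a_def b_def)

lemma k0_pos: "step D i0 j0 > 0" using step_pos ij' by blast

sublocale sl: smooth_slab a b mid "step D i0 j0 / \<alpha>" C c "radius q" nodes N q f "args u U piu"
proof
  have lt: "node D i0 (j0 - 1) < node D i0 j0" using node_less ij' by blast
  have mean: "x < (x + y) / 2" "(x + y) / 2 < y" if "x < y" for x y :: real using that by auto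
  show "a < mid" unfolding mid_def by (rule le_less_trans[OF ij'(3) mean(1)[OF lt]])
  show "mid < b" unfolding mid_def by (rule less_le_trans[OF mean(2)[OF lt] ij'(4)])
  show "0 < step D i0 j0 / \<alpha>" using k0_pos \<alpha> by simp
  show "C > 0" by (rule C)
  have "step D i0 j0 * C / \<alpha> \<le> c" using C(3) \<alpha> by (intro divide_right_mono) auto
  thus "step D i0 j0 / \<alpha> * C \<le> c" by (simp only: times_divide_eq_left)
  show "1 \<le> radius q" by (simp add: radius_def)
  show "finite nodes" by (rule finite_nodes)
  show "1 \<le> N" by (rule N_pos)
  show "depends_on_first N (\<lambda>x. f x b i)" if "i < N" for i
    unfolding b_def using f_depends[OF mesh ivp refl refl that] level_in_slab[OF n] slab_subset[OF n] by blast
  show "Ck_space N (q + 1) (\<lambda>x. f x b i)" if "i < N" for i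
    unfolding b_def using f_Ck[OF n that level_in_slab[OF n]] .
  show "f x t i = f x b i" if "i < N" "t \<in> {a<..b}" for i x t
    unfolding b_def using f_autonomous[OF n that(1)] that(2) unfolding slab_eq .
  show "slab_constant N f q a b (args u U piu) C"
    unfolding a_def b_def by (rule slab_constant_mono[OF slab_const[OF n] C(2) N_pos])
qed

lemma q_ge1: "q \<ge> 1" using qbar_ge1[OF n] .

lemma open_slab_subset: "{a<..<b} \<subseteq> {0<..<T}"
proof -
  have "n - 1 \<le> nslabs D" "n \<le> nslabs D" using n by auto
  hence "a \<ge> 0" "b \<le> T" unfolding a_def b_def using level_bounds[of "n - 1"] level_bounds[of n] by auto
  thus ?thesis by auto
qed

lemma window_cell:
  assumes t: "t \<in> {a<..<b} - nodes" and l: "l < N"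
  defines "j \<equiv> cell_at D l t"
  shows "j \<in> {1..ncells D l}" "node D l (j - 1) < t" "t < node D l j" "a \<le> node D l (j - 1)"
    "node D l j \<le> b" "node D l j - node D l (j - 1) \<le> step D i0 j0 / \<alpha>" "deg D l j = q"
proof -
  have t': "t \<in> {0<..<T} - nodes" using t open_slab_subset by blast
  from cell_interior[OF l t' refl] show "j \<in> {1..ncells D l}" "node D l (j - 1) < t" "t < node D l j"
    by (auto simp: j_def)
  have "(l, j) \<in> slab_cells D n" unfolding j_def using t by (intro cell_in_slab n l) (auto simp: slab_eq)
  thus "a \<le> node D l (j - 1)" "node D l j \<le> b" "deg D l j = q"
    using deg_slab[OF n] by (auto simp: slab_cells_def a_def b_def)
  have "\<alpha> * step D l j < step D i0 j0" using quasi_uniform[OF n ij \<open>(l, j) \<in> slab_cells D n\<close>] by simp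
  thus "node D l j - node D l (j - 1) \<le> step D i0 j0 / \<alpha>"
    unfolding step_def[of D l j] using \<alpha> by (simp add: pos_le_divide_eq mult.commute)
qed

lemma W_cell: "t \<in> sl.W \<rho> \<Longrightarrow> t \<in> {a<..<b} - nodes" by (auto simp: sl.W_def)

lemma projC_ge1: "projC q \<ge> 1" using polyC_pos[of "q - 1"] by (simp add: projC_def)

text \<open>If the velocity is near a polynomial of order \<open>r\<close>, then \<open>f\<close> along the curve is so of order \<open>r + 1\<close>,
  and with it the velocity, which equals \<open>f\<close> (for \<open>u\<close>) or a projection of it (for \<open>U\<close>).\<close>

lemma curve_derivative_near_poly:
  assumes yA: "\<And>t. t \<in> {a<..<b} \<Longrightarrow> y t \<in> args u U piu t"
    and yc: "\<And>l. l < N \<Longrightarrow> continuous_on {a<..<b} (\<lambda>t. y t l)"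
    and y': "\<And>l t. l < N \<Longrightarrow> t \<in> {a<..<b} - nodes \<Longrightarrow> ((\<lambda>t. y t l) has_real_derivative y' t l) (at t)"
    and proj: "\<And>l r \<rho> B. l < N \<Longrightarrow> r \<le> q \<Longrightarrow> sl.near_poly r (\<rho> + 1) B (\<lambda>t. f (y t) t l) \<Longrightarrow> sl.near_poly r \<rho> (projC q * B) (\<lambda>t. y' t l)"
    and r: "r \<le> q" and l: "l < N"
  shows "sl.near_poly r (radius q - 1 - real r) (derivB c q r * C) (\<lambda>t. y' t l)"
  using r l
proof (induction r arbitrary: l)
  case 0
  have "sl.near_poly 0 (radius q) (C * sl.rhsC 0 0) (\<lambda>t. f (y t) t l)"
    by (rule sl.f_along_near_poly[OF yA yc y']) (use 0 in auto)
  hence "sl.near_poly 0 (radius q - 1 + 1) C (\<lambda>t. f (y t) t l)" by (simp add: sl.rhsC.simps)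
  from proj[OF 0(2) _ this] show ?case by simp
next
  case (Suc r)
  let ?B = "sl.lowerC r * derivB c q r"
  have IH: "sl.near_poly r (radius q - 1 - real r) (derivB c q r * C) (\<lambda>t. y' t l)" if "l < N" for l
    using Suc that by auto
  have B0: "?B \<ge> 0"
    using sl.near_poly_nonneg[OF IH[OF Suc.prems(2)]] C(1) sl.lowerC_ge1[of r] by (simp add: zero_le_mult_iff)
  have "sl.near_poly (Suc r) (radius q - 1 - real r) (C * sl.rhsC ?B (Suc r)) (\<lambda>t. f (y t) t l)"
  proof (rule sl.f_along_near_poly[OF yA yc y' _ B0])
    fix s l assume s: "s < Suc r" and l: "l < N"
    have "sl.near_poly s (radius q - 1 - real r) (sl.lowerC r * (derivB c q r * C)) (\<lambda>t. y' t l)"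
      using s by (intro sl.near_poly_lower IH l) auto
    thus "sl.near_poly s (radius q - 1 - real r) (?B * C) (\<lambda>t. y' t l)" by (simp add: mult.assoc)
  qed (use Suc.prems in auto)
  hence "sl.near_poly (Suc r) (radius q - 1 - real (Suc r) + 1) (C * sl.rhsC ?B (Suc r)) (\<lambda>t. f (y t) t l)"
    by (simp add: algebra_simps)
  from proj[OF Suc.prems(2,1) this] show ?case by (simp add: mult_ac)
qed

abbreviation "XB \<equiv> derivB c q (q - 1) * sl.H"

lemma curve_near_poly:
  assumes yA: "\<And>t. t \<in> {a<..<b} \<Longrightarrow> y t \<in> args u U piu t"
    and yc: "\<And>l. l < N \<Longrightarrow> continuous_on {a<..<b} (\<lambda>t. y t l)"
    and y': "\<And>l t. l < N \<Longrightarrow> t \<in> {a<..<b} - nodes \<Longrightarrow> ((\<lambda>t. y t l) has_real_derivative y' t l) (at t)"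
    and proj: "\<And>l r \<rho> B. l < N \<Longrightarrow> r \<le> q \<Longrightarrow> sl.near_poly r (\<rho> + 1) B (\<lambda>t. f (y t) t l) \<Longrightarrow> sl.near_poly r \<rho> (projC q * B) (\<lambda>t. y' t l)"
    and l: "l < N"
  shows "sl.near_poly q (radius q - real q) XB (\<lambda>t. y t l - y mid l)"
proof -
  have "sl.near_poly (q - 1) (radius q - 1 - real (q - 1)) (derivB c q (q - 1) * C) (\<lambda>t. y' t l)"
    by (rule curve_derivative_near_poly[OF yA yc y' proj _ l]) auto
  hence "sl.near_poly (Suc (q - 1)) (radius q - 1 - real (q - 1)) XB (\<lambda>t. y t l - y mid l)"
    by (rule sl.near_poly_integrate) (auto intro!: yc y' l)
  thus ?thesis using q_ge1 by (simp add: of_nat_diff algebra_simps)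
qed

lemma open_slab_continuous:
  assumes "continuous_on {0..T} h" shows "continuous_on {a<..<b} h"
  by (rule continuous_on_subset[OF assms]) (use open_slab_subset in auto)

lemma U_near_poly:
  assumes l: "l < N" shows "sl.near_poly q (radius q - real q) XB (\<lambda>t. U t l - U mid l)"
proof (rule curve_near_poly[OF args_U open_slab_continuous[OF U_cont] _ _ l])
  fix l t assume l: "l < N" and t: "t \<in> {a<..<b} - nodes"
  note c = window_cell[OF t l]
  have "\<exists>p. ((\<lambda>s. U s l) has_real_derivative poly (pderiv p) t) (at t)"
    using deriv_trial[OF U_trial l c(1)] c(2,3) by fastforce
  thus "((\<lambda>s. U s l) has_real_derivative (\<lambda>t l. deriv (\<lambda>s. U s l) t) t l) (at t)"
    using DERIV_imp_deriv by fastforce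
next
  fix l r \<rho> B assume l: "l < N" and r: "r \<le> q" and g: "sl.near_poly r (\<rho> + 1) B (\<lambda>t. f (U t) t l)"
  show "sl.near_poly r \<rho> (projC q * B) (\<lambda>t. deriv (\<lambda>s. U s l) t)"
    unfolding projC_def
  proof (rule sl.near_poly_projection[OF g])
    show "r \<le> q - 1 + 1" using r q_ge1 by simp
    fix t assume "t \<in> sl.W \<rho>"
    from W_cell[OF this] have t: "t \<in> {a<..<b} - nodes" .
    define j where "j = cell_at D l t"
    note c = window_cell[OF t l, folded j_def]
    obtain p where p: "degree p \<le> deg D l j"
      "\<forall>t\<in>{node D l (j - 1)<..<node D l j}. deriv (\<lambda>s. U s l) t = poly (pderiv p) t"
      using deriv_trial[OF U_trial l c(1)] by blast
    show "\<exists>\<alpha>' \<beta> (Y :: real poly). \<alpha>' < t \<and> t < \<beta> \<and> a \<le> \<alpha>' \<and> \<beta> \<le> b \<and> \<beta> - \<alpha>' \<le> step D i0 j0 / \<alpha> \<and>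
      degree Y \<le> q - 1 \<and> deriv (\<lambda>s. U s l) t = poly Y t \<and>
      (\<forall>w. degree w \<le> q - 1 \<longrightarrow> ((\<lambda>s. (poly Y s - f (U s) s l) * poly w s) has_integral 0) {\<alpha>'..\<beta>})"
    proof (intro exI conjI allI impI)
      show "node D l (j - 1) < t" "t < node D l j" "a \<le> node D l (j - 1)" "node D l j \<le> b"
        "node D l j - node D l (j - 1) \<le> step D i0 j0 / \<alpha>" using c by auto
      show "degree (pderiv p) \<le> q - 1" using p(1) c(7) by (simp add: degree_pderiv)
      show "deriv (\<lambda>s. U s l) t = poly (pderiv p) t" using p(2) c by simp
      fix w :: "real poly" assume "degree w \<le> q - 1"
      thus "((\<lambda>s. (poly (pderiv p) s - f (U s) s l) * poly w s) has_integral 0) {node D l (j - 1)..node D l j}"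
        using p(2) c by (intro U_projection[OF l c(1)]) auto
    qed
  qed
qed

lemma u_near_poly:
  assumes l: "l < N" shows "sl.near_poly q (radius q - real q) XB (\<lambda>t. u t l - u mid l)"
proof (rule curve_near_poly[OF args_u open_slab_continuous[OF u_cont] _ _ l])
  fix l t assume l: "l < N" and t: "t \<in> {a<..<b} - nodes"
  thus "((\<lambda>s. u s l) has_real_derivative (\<lambda>t l. f (u t) t l) t l) (at t)"
    using u_deriv[OF l, of t] open_slab_subset by blast
next
  fix l r \<rho> B assume l: "l < N" and r: "r \<le> q" and g: "sl.near_poly r (\<rho> + 1) B (\<lambda>t. f (u t) t l)"
  have "B \<le> projC q * B" using sl.near_poly_nonneg[OF g] projC_ge1 by (simp add: mult_le_cancel_right1)
  thus "sl.near_poly r \<rho> (projC q * B) (\<lambda>t. f (u t) t l)" by (intro sl.near_poly_mono[OF g]) auto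
qed

lemma piu_near_poly:
  assumes l: "l < N" shows "sl.near_poly q (radius q - real q - 1) (interpC q * XB) (\<lambda>t. piu t l - u mid l)"
proof (rule sl.near_poly_interp)
  show "sl.near_poly q (radius q - real q - 1 + 1) XB (\<lambda>t. u t l - u mid l)" using u_near_poly[OF l] by simp
  fix t assume "t \<in> sl.W (radius q - real q - 1)"
  from W_cell[OF this] have t: "t \<in> {a<..<b} - nodes" .
  define j where "j = cell_at D l t"
  note c = window_cell[OF t l, folded j_def]
  have "cG_interp q (node D l (j - 1)) (node D l j) (\<lambda>t. u t l) (\<lambda>t. piu t l)"
    using piu_interp[OF l c(1)] c(7) by simp
  moreover have "continuous_on {node D l (j - 1)..node D l j} (\<lambda>t. u t l)"
    by (rule continuous_on_subset[OF u_cont[OF l] cell_closed_subset[OF l c(1)]])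
  ultimately show "\<exists>\<alpha>' \<beta>. \<alpha>' < t \<and> t < \<beta> \<and> a \<le> \<alpha>' \<and> \<beta> \<le> b \<and> \<beta> - \<alpha>' \<le> step D i0 j0 / \<alpha> \<and>
      cG_interp q \<alpha>' \<beta> (\<lambda>t. u t l) (\<lambda>t. piu t l) \<and> continuous_on {\<alpha>'..\<beta>} (\<lambda>t. u t l)"
    using c by blast
qed simp

lemma curves_near_poly:
  assumes l: "l < N" and r: "r \<le> q"
  shows "sl.near_poly r (radius q - real q - 1) (curveB c q) (\<lambda>t. U t l - U mid l)"
    "sl.near_poly r (radius q - real q - 1) (curveB c q) (\<lambda>t. u t l - u mid l)"
    "sl.near_poly r (radius q - real q - 1) (curveB c q) (\<lambda>t. piu t l - u mid l)"
proof -
  have XB0: "XB \<ge> 0" using sl.near_poly_nonneg[OF u_near_poly[OF l]] .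
  have "1 \<le> interpC q" using polyC_pos[of q] by (simp add: interpC_def)
  hence le: "XB \<le> interpC q * XB" using XB0 by (simp add: mult_le_cancel_right1)
  have rq: "radius q - real q - 1 \<le> radius q" "radius q - real q - 1 \<le> radius q - real q" by auto
  show "sl.near_poly r (radius q - real q - 1) (curveB c q) (\<lambda>t. U t l - U mid l)"
    unfolding curveB_def using le rq by (intro sl.near_poly_lower sl.near_poly_mono[OF U_near_poly[OF l]] r) auto
  show "sl.near_poly r (radius q - real q - 1) (curveB c q) (\<lambda>t. u t l - u mid l)"
    unfolding curveB_def using le rq by (intro sl.near_poly_lower sl.near_poly_mono[OF u_near_poly[OF l]] r) auto
  show "sl.near_poly r (radius q - real q - 1) (curveB c q) (\<lambda>t. piu t l - u mid l)"
    unfolding curveB_def using rq by (intro sl.near_poly_lower[OF piu_near_poly[OF l]] r) auto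
qed

lemma Sn_nonneg: "Sn \<ge> 0" using slab_sup_nonneg[OF n] .

lemma \<Phi>_le_Sn: "t \<in> {a<..<b} \<Longrightarrow> l < N \<Longrightarrow> \<bar>\<Phi> t l\<bar> \<le> Sn"
  by (intro \<Phi>_le_slab_sup n) (auto simp: slab_eq)

lemma source_slab:
  assumes "l < N" "r + 2 \<le> q"
  shows "Ck_on r {a<..<b} (\<lambda>t. g t l)"
    "s \<in> {a<..<b} \<Longrightarrow> \<bar>(deriv ^^ r) (\<lambda>t. g t l) s\<bar> \<le> cg * Cf n ^ (r + 1) * Sn"
  using source n assms unfolding source_bound_def a_def b_def by blast+

lemma F_isCont:
  assumes l: "l < N" and t: "t \<in> {a<..<b} - nodes" and q2: "2 \<le> q"
  shows "isCont (\<lambda>t. F t l) t"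
proof -
  have op: "open {a<..<b}" by simp
  have "isCont (\<lambda>t. \<Phi> t i) t" if i: "i < N" for i
  proof -
    define j where "j = cell_at D i t"
    note c = window_cell[OF t i, folded j_def]
    obtain p where p: "\<And>t. t \<in> cell D i j \<Longrightarrow> \<Phi> t i = poly p t" using \<Phi>_poly[OF i c(1)] by blast
    have "eventually (\<lambda>s. poly p s = \<Phi> s i) (nhds t)"
      unfolding eventually_nhds using c p
      by (intro exI[of _ "{node D i (j - 1)<..<node D i j}"]) (auto simp: cell_def)
    from isCont_cong[OF this] show ?thesis using poly_isCont[where p = p and x = t] by (rule iffD1)
  qed
  moreover have "isCont (\<lambda>t. Jac f piu U t i l) t" if i: "i < N" for i
    using sl.Jac_continuous[OF open_slab_continuous[OF piu_cont] open_slab_continuous[OF U_cont] l i] t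
    by (simp add: continuous_on_eq_continuous_at)
  moreover have "isCont (\<lambda>t. g t l) t"
  proof -
    have "Ck_on 0 {a<..<b} (\<lambda>t. g t l)" using source_slab(1)[OF l, of 0] q2 by simp
    thus ?thesis using t by (simp add: Ck_on_def continuous_on_eq_continuous_at)
  qed
  ultimately show ?thesis unfolding F_def by (intro continuous_intros) auto
qed

lemma g_near_poly:
  assumes l: "l < N" and r: "r + 2 \<le> q" and \<rho>: "\<rho> \<le> radius q"
  shows "sl.near_poly r \<rho> (cg * C * Sn * sl.H ^ r) (\<lambda>t. g t l)"
proof (rule sl.near_poly_taylor[OF _ _ \<rho>])
  fix m s assume m: "m < r" and s: "s \<in> {a<..<b}"
  have "Ck_on r {a<..<b} (\<lambda>t. g t l)" using source_slab(1)[OF l r] .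
  thus "((deriv ^^ m) (\<lambda>t. g t l)) differentiable (at s)" using m s by (simp add: Ck_on_def)
next
  fix m s assume m: "m \<le> r" and s: "s \<in> {a<..<b}"
  have "\<bar>(deriv ^^ m) (\<lambda>t. g t l) s\<bar> \<le> cg * Cf n ^ (m + 1) * Sn"
    using source_slab(2)[OF l _ s, of m] m r by simp
  also have "\<dots> \<le> cg * C ^ (m + 1) * Sn"
    using cg Sn_nonneg C(2) Cf_nonneg[OF n] by (intro mult_right_mono mult_left_mono power_mono) auto
  finally show "\<bar>(deriv ^^ m) (\<lambda>t. g t l) s\<bar> \<le> cg * C * Sn * C ^ m" by (simp add: mult_ac)
qed

lemma W_nonempty: assumes "\<rho> > 0" shows "\<exists>t. t \<in> sl.W \<rho>"
proof -
  define x y where "x = max a (mid - \<rho> * (step D i0 j0 / \<alpha>))" and "y = min b (mid + \<rho> * (step D i0 j0 / \<alpha>))"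
  have "\<rho> * (step D i0 j0 / \<alpha>) > 0" by (rule mult_pos_pos[OF assms sl.\<kappa>])
  hence "x < y" using sl.t0 by (auto simp: x_def y_def)
  hence "infinite ({x<..<y} - nodes)" using finite_nodes by (simp add: Diff_infinite_finite)
  hence "{x<..<y} - nodes \<noteq> {}" by (metis finite.emptyI)
  then obtain t where "t \<in> {x<..<y} - nodes" by blast
  hence "t \<in> sl.W \<rho>" by (auto simp: sl.W_def x_def y_def)
  thus ?thesis ..
qed

lemma J_near_poly:
  assumes r: "r \<le> q" and \<rho>: "\<rho> \<le> radius q - real q - 1" and i: "i < N" and B: "B \<ge> 0"
    and \<Phi>: "\<And>l. l < N \<Longrightarrow> sl.near_poly r \<rho> B (\<lambda>t. \<Phi> t l)"
  shows "sl.near_poly r \<rho> (C * sl.jacC r (curveB c q) * B * sl.prodC r) (\<lambda>t. \<Sum>l<N. Jac f piu U t l i * \<Phi> t l)"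
    "sl.near_poly r \<rho> (C * sl.jacC r (curveB c q) * B * sl.prodC r) (\<lambda>t. \<Sum>l<N. Jac f piu u t l i * \<Phi> t l)"
proof -
  have \<rho>': "\<rho> \<le> radius q" using \<rho> by simp
  have x: "sl.near_poly r \<rho> (curveB c q) (\<lambda>t. piu t m - u mid m)"
    and y: "sl.near_poly r \<rho> (curveB c q) (\<lambda>t. U t m - U mid m)"
    and z: "sl.near_poly r \<rho> (curveB c q) (\<lambda>t. u t m - u mid m)" if "m < N" for m
    using sl.near_poly_mono[OF curves_near_poly(3)[OF that r] order.refl \<rho>] sl.near_poly_mono[OF curves_near_poly(1)[OF that r] order.refl \<rho>]
      sl.near_poly_mono[OF curves_near_poly(2)[OF that r] order.refl \<rho>] by auto
  show "sl.near_poly r \<rho> (C * sl.jacC r (curveB c q) * B * sl.prodC r) (\<lambda>t. \<Sum>l<N. Jac f piu U t l i * \<Phi> t l)"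
    by (rule sl.Jac_near_poly[OF x y \<Phi> B r q_ge1 \<rho>' i])
  show "sl.near_poly r \<rho> (C * sl.jacC r (curveB c q) * B * sl.prodC r) (\<lambda>t. \<Sum>l<N. Jac f piu u t l i * \<Phi> t l)"
    by (rule sl.Jac_near_poly[OF x z \<Phi> B r q_ge1 \<rho>' i])
qed

text \<open>If \<open>\<Phi>\<close> is near a polynomial of order \<open>r\<close>, so is \<open>F\<close>, hence \<open>\<Theta> - \<Theta>(mid)\<close> of order \<open>r + 1\<close>, and with it
  the projection \<open>\<Phi> - \<Theta>(mid)\<close>. The number \<open>\<Theta>(mid)\<close> is bounded by comparison with \<open>\<Phi>\<close> at a point of the
  window. Orders up to \<open>q - 1\<close> can be reached, as \<open>q - 2\<close> derivatives of \<open>g\<close> are controlled.\<close>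

lemma \<Phi>_near_poly:
  assumes r: "r \<le> q - 1" and l: "l < N"
  shows "dualB c cg q r \<ge> 0 \<and> sl.near_poly r (radius q - real q - 1 - real r) (dualB c cg q r * Sn) (\<lambda>t. \<Phi> t l)"
  using r l
proof (induction r arbitrary: l)
  case 0
  thus ?case using Sn_nonneg \<Phi>_le_Sn W_cell by (auto simp: sl.near_poly_0_iff)
next
  case (Suc r)
  define \<rho> where "\<rho> = radius q - real q - 1 - real r"
  define B where "B = dualB c cg q r"
  have \<rho>: "\<rho> \<le> radius q - real q - 1" "\<rho> \<le> radius q" by (auto simp: \<rho>_def)
  have r2: "r + 2 \<le> q" and q2: "2 \<le> q" using Suc.prems(1) by auto
  have B0: "B \<ge> 0" and \<Phi>: "sl.near_poly r \<rho> (B * Sn) (\<lambda>t. \<Phi> t l)" if "l < N" for l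
    using Suc.IH[of l] Suc.prems that by (auto simp: B_def \<rho>_def)
  have B0: "B \<ge> 0" using B0 Suc.prems(2) by blast
  \<comment> \<open>The constant of \<open>F\<close> in units of \<open>C * Sn\<close>: the first summand is that of the Jacobian term, the
    second that of \<open>g\<close>.\<close>
  define E where "E = sl.jacC r (curveB c q) * B * sl.prodC r + cg * sl.H ^ r"
  have F: "sl.near_poly r \<rho> ((E * Sn) * C) (\<lambda>t. - F t l)" if l: "l < N" for l
  proof -
    have "sl.near_poly r \<rho> (C * sl.jacC r (curveB c q) * (B * Sn) * sl.prodC r) (\<lambda>t. \<Sum>i<N. Jac f piu U t i l * \<Phi> t i)"
      using r2 B0 Sn_nonneg by (intro J_near_poly(1) \<rho> \<Phi> l) auto
    from sl.near_poly_add[OF this g_near_poly[OF l r2 \<rho>(2)]]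
    have "sl.near_poly r \<rho> (C * sl.jacC r (curveB c q) * (B * Sn) * sl.prodC r + cg * C * Sn * sl.H ^ r) (\<lambda>t. F t l)"
      unfolding F_def .
    from sl.near_poly_cmult[OF this, of "-1"]
    have "sl.near_poly r \<rho> (C * sl.jacC r (curveB c q) * (B * Sn) * sl.prodC r + cg * C * Sn * sl.H ^ r) (\<lambda>t. - F t l)" by simp
    moreover have "C * sl.jacC r (curveB c q) * (B * Sn) * sl.prodC r + cg * C * Sn * sl.H ^ r = (E * Sn) * C"
      by (simp add: E_def algebra_simps)
    ultimately show ?thesis by (simp only:)
  qed
  have \<Theta>: "sl.near_poly (Suc r) \<rho> (E * Sn * sl.H) (\<lambda>t. \<Theta> t l - \<Theta> mid l)" if l: "l < N" for l
  proof (rule sl.near_poly_integrate[OF F[OF l] \<rho>(2) open_slab_continuous[OF \<Theta>_cont[OF l]]])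
    fix t assume t: "t \<in> {a<..<b} - nodes"
    show "((\<lambda>t. \<Theta> t l) has_real_derivative - F t l) (at t)"
      using t open_slab_subset by (intro \<Theta>_deriv l F_isCont q2) auto
  qed
  define K where "K = projB c cg q r B"
  have K: "K * Sn = projC q * (E * Sn * sl.H)" by (simp add: K_def projB_def E_def mult_ac)
  have \<rho>1: "radius q - real q - 1 - real (Suc r) = \<rho> - 1" by (simp add: \<rho>_def)
  have P: "sl.near_poly (Suc r) (\<rho> - 1) (K * Sn) (\<lambda>t. \<Phi> t l - \<Theta> mid l)" if l: "l < N" for l
    unfolding K projC_def
  proof (rule sl.near_poly_projection)
    show "sl.near_poly (Suc r) (\<rho> - 1 + 1) (E * Sn * sl.H) (\<lambda>t. \<Theta> t l - \<Theta> mid l)" using \<Theta>[OF l] by simp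
    show "Suc r \<le> q - 1 + 1" using r2 by simp
    fix t assume "t \<in> sl.W (\<rho> - 1)"
    from W_cell[OF this] have t: "t \<in> {a<..<b} - nodes" .
    define j where "j = cell_at D l t"
    note c = window_cell[OF t l, folded j_def]
    obtain p where p: "degree p \<le> deg D l j - 1" "\<And>t. t \<in> cell D l j \<Longrightarrow> \<Phi> t l = poly p t"
      using \<Phi>_poly[OF l c(1)] by blast
    show "\<exists>\<alpha>' \<beta> (Y :: real poly). \<alpha>' < t \<and> t < \<beta> \<and> a \<le> \<alpha>' \<and> \<beta> \<le> b \<and> \<beta> - \<alpha>' \<le> step D i0 j0 / \<alpha> \<and>
      degree Y \<le> q - 1 \<and> \<Phi> t l - \<Theta> mid l = poly Y t \<and>
      (\<forall>w. degree w \<le> q - 1 \<longrightarrow> ((\<lambda>s. (poly Y s - (\<Theta> s l - \<Theta> mid l)) * poly w s) has_integral 0) {\<alpha>'..\<beta>})"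
    proof (intro exI conjI allI impI)
      show "node D l (j - 1) < t" "t < node D l j" "a \<le> node D l (j - 1)" "node D l j \<le> b"
        "node D l j - node D l (j - 1) \<le> step D i0 j0 / \<alpha>" using c by auto
      show "degree (p - [:\<Theta> mid l:]) \<le> q - 1" using p(1) c(7) by (intro degree_diff_le) auto
      show "\<Phi> t l - \<Theta> mid l = poly (p - [:\<Theta> mid l:]) t" using p(2)[of t] c by (simp add: cell_def)
      fix w :: "real poly" assume w: "degree w \<le> q - 1"
      have "((\<lambda>s. (poly p s - \<Theta> s l) * poly w s) has_integral 0) {node D l (j - 1)..node D l j}"
      proof (rule dual_projection[OF l c(1) finite_nodes _ p(2)])
        show "degree w \<le> deg D l j - 1" using w c(7) by simp
        fix s assume "s \<in> {node D l (j - 1)<..<node D l j} - nodes"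
        thus "isCont (\<lambda>t. F t l) s" using c(4,5) by (intro F_isCont l q2) auto
      qed
      thus "((\<lambda>s. (poly (p - [:\<Theta> mid l:]) s - (\<Theta> s l - \<Theta> mid l)) * poly w s) has_integral 0)
          {node D l (j - 1)..node D l j}" by simp
    qed
  qed
  have KS: "K * Sn \<ge> 0" using sl.near_poly_nonneg[OF P[OF Suc.prems(2)]] .
  \<comment> \<open>This does not follow from the sign of \<open>K * Sn\<close>, because \<open>Sn\<close> may vanish.\<close>
  have "0 \<le> K"
  proof -
    have "E \<ge> 0"
    proof -
      have "sl.jacC r (curveB c q) \<ge> 0"
      proof -
        have "sl.near_poly r (radius q - real q - 1) (curveB c q) (\<lambda>t. u t l - u mid l)"
          using curves_near_poly(2)[OF Suc.prems(2), of r] r2 by simp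
        from sl.near_poly_nonneg[OF this] show ?thesis
          using sl.H_ge by (simp add: sl.jacC_def sl.curveC_def)
      qed
      thus ?thesis unfolding E_def using B0 cg sl.prodC_ge1[of r] sl.H_ge by simp
    qed
    thus ?thesis using projC_ge1 sl.H_ge unfolding K_def projB_def E_def by simp
  qed
  have "\<bar>\<Theta> mid l\<bar> \<le> Sn + sl.lowerC (Suc r) * (K * Sn)"
  proof -
    have "\<rho> - 1 > 0" using r2 by (simp add: \<rho>_def radius_def)
    then obtain t where t: "t \<in> sl.W (\<rho> - 1)" using W_nonempty by blast
    have "sl.near_poly 0 (\<rho> - 1) (sl.lowerC (Suc r) * (K * Sn)) (\<lambda>t. \<Phi> t l - \<Theta> mid l)"
      using \<rho> by (intro sl.near_poly_lower P Suc.prems) auto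
    hence "\<bar>\<Phi> t l - \<Theta> mid l\<bar> \<le> sl.lowerC (Suc r) * (K * Sn)" using t by (simp add: sl.near_poly_0_iff)
    moreover have "\<bar>\<Phi> t l\<bar> \<le> Sn" using W_cell[OF t] by (intro \<Phi>_le_Sn Suc.prems) auto
    ultimately show ?thesis by linarith
  qed
  hence "sl.near_poly (Suc r) (\<rho> - 1) (Sn + sl.lowerC (Suc r) * (K * Sn)) (\<lambda>_. \<Theta> mid l)" by (rule sl.near_poly_const)
  from sl.near_poly_add[OF P[OF Suc.prems(2)] this]
  have "sl.near_poly (Suc r) (\<rho> - 1) (K * Sn + (Sn + sl.lowerC (Suc r) * (K * Sn))) (\<lambda>t. \<Phi> t l)" by simp
  moreover have "K * Sn + (Sn + sl.lowerC (Suc r) * (K * Sn)) = dualB c cg q (Suc r) * Sn"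
    by (simp add: K_def B_def algebra_simps)
  moreover have "dualB c cg q (Suc r) \<ge> 0" using \<open>0 \<le> K\<close> sl.lowerC_ge1[of "Suc r"] by (simp add: K_def[symmetric] B_def[symmetric])
  ultimately show ?case unfolding \<rho>1 by (simp only:)
qed

lemma G_near_poly: "l < N \<Longrightarrow> sl.near_poly (q - 1) 4 (gradB c cg q * C * Sn) (\<lambda>t. G t l)"
proof -
  assume l: "l < N"
  have \<rho>: "radius q - real q - 1 - real (q - 1) = 4"
    using q_ge1 by (simp add: radius_def of_nat_diff)
  have "sl.near_poly (q - 1) 4 (C * sl.jacC (q - 1) (curveB c q) * (dualB c cg q (q - 1) * Sn) * sl.prodC (q - 1)) (\<lambda>t. G t l)"
    unfolding G_def
  proof (rule J_near_poly(2))
    show "4 \<le> radius q - real q - 1" using q_ge1 by (simp add: radius_def)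
    show "dualB c cg q (q - 1) * Sn \<ge> 0" using \<Phi>_near_poly[OF order.refl l] Sn_nonneg by simp
    show "sl.near_poly (q - 1) 4 (dualB c cg q (q - 1) * Sn) (\<lambda>t. \<Phi> t l)" if "l < N" for l
      using \<Phi>_near_poly[OF order.refl that] unfolding \<rho> by blast
  qed (use l in auto)
  thus ?thesis by (simp add: gradB_def mult_ac)
qed

end

lemma (in galerkin) times_G_integrable:
  assumes l: "l < N" and h: "continuous_on {0..T} h"
  shows "(\<lambda>t. h t * G t l) integrable_on {0..T}"
proof -
  obtain L where L: "\<And>l t. l < N \<Longrightarrow> t \<in> {0<..T} \<Longrightarrow> \<bar>G t l\<bar> \<le> L" using G_bounded by blast
  show ?thesis
    by (rule continuous_times_bounded_measurable_integrable[OF T_pos h G_measurable[OF l] L[OF l]])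
qed

definition cellC :: "real \<Rightarrow> real \<Rightarrow> real \<Rightarrow> nat \<Rightarrow> real" where
  "cellC \<alpha> ck cg q = interpC q * (gradB (2 * ck / \<alpha>) cg q / \<alpha> ^ (q - 1))"

context galerkin_cell
begin

text \<open>
  The interpolation error is orthogonal to the polynomial of degree at most \<open>q - 2\<close> near \<open>G\<close>, which
  may therefore be subtracted from \<open>G\<close>; this gains \<open>q - 1\<close> powers of the step.
\<close>

lemma cell_estimate:
  "\<bar>integral {node D i0 (j0 - 1)..node D i0 j0} (\<lambda>t. (piu t i0 - u t i0) * G t i0)\<bar> \<le>
     cellC \<alpha> ck cg q * (step D i0 j0 ^ (2 * q + 1) * C ^ q * Sn * cell_deriv_sup D u i0 j0)"
proof -
  define x y where "x = node D i0 (j0 - 1)" and "y = node D i0 j0"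
  define k where "k = step D i0 j0"
  define M where "M = cell_deriv_sup D u i0 j0"
  have xy: "x < y" "k = y - x" "k > 0" using node_less[OF ij'(1,2)] by (auto simp: x_def y_def k_def step_def)
  have M0: "M \<ge> 0" unfolding M_def by (rule cell_deriv_sup_nonneg[OF ij'(1,2)])
  have degq: "deg D i0 j0 = q" using deg_slab[OF n ij] .
  have sub: "{x..y} \<subseteq> {0..T}" using cell_closed_subset[OF ij'(1,2)] by (simp add: x_def y_def)
  let ?e = "\<lambda>t. piu t i0 - u t i0"
  have ec: "continuous_on {0..T} ?e" by (intro continuous_intros piu_cont u_cont ij'(1))
  obtain P where P: "\<And>m. m \<ge> q - 1 \<Longrightarrow> coeff P m = 0"
    "\<And>t. t \<in> sl.W 4 \<Longrightarrow> \<bar>G t i0 - poly P (t - mid)\<bar> \<le> gradB c cg q * C * Sn * (k / \<alpha> * C) ^ (q - 1)"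
    by (rule sl.near_polyE[OF G_near_poly[OF ij'(1)]]) (auto simp: k_def)
  define w where "w = pcompose P [:- mid, 1:]"
  have w: "poly w t = poly P (t - mid)" for t by (simp add: w_def poly_pcompose)
  have ew: "((\<lambda>t. ?e t * poly w t) has_integral 0) {x..y}"
  proof (cases "P = 0")
    case True
    thus ?thesis by (simp add: w)
  next
    case False
    hence "coeff P (degree P) \<noteq> 0" by simp
    hence "degree P < q - 1" using P(1) by (meson not_le)
    moreover have "degree w \<le> degree P" unfolding w_def using degree_pcompose_le[of P "[:- mid, 1:]"] by simp
    ultimately have "degree w + 2 \<le> q" by linarith
    moreover have "cG_interp q x y (\<lambda>t. u t i0) (\<lambda>t. piu t i0)"
      using piu_interp[OF ij'(1,2)] by (simp add: degq x_def y_def)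
    ultimately have "integral {x..y} (\<lambda>t. (u t i0 - piu t i0) * poly w t) = 0" unfolding cG_interp_def by blast
    hence "integral {x..y} (\<lambda>t. - ((u t i0 - piu t i0) * poly w t)) = 0" by simp
    moreover have "(\<lambda>t. - ((u t i0 - piu t i0) * poly w t)) = (\<lambda>t. ?e t * poly w t)" by (simp add: algebra_simps)
    moreover have "((\<lambda>t. ?e t * poly w t) has_integral integral {x..y} (\<lambda>t. ?e t * poly w t)) {x..y}"
      by (intro integrable_integral integrable_continuous_real continuous_on_mult continuous_on_poly_real
          continuous_on_subset[OF ec sub])
    ultimately show ?thesis by simp
  qed
  have eG: "((\<lambda>t. ?e t * G t i0) has_integral integral {x..y} (\<lambda>t. ?e t * G t i0)) {x..y}"
    by (intro integrable_integral integrable_on_subinterval[OF times_G_integrable[OF ij'(1) ec] sub])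
  have I: "((\<lambda>t. ?e t * G t i0 - ?e t * poly w t) has_integral integral {x..y} (\<lambda>t. ?e t * G t i0)) {x..y}"
    using has_integral_diff[OF eG ew] by simp
  \<comment> \<open>The pointwise bound: interpolation error times distance of \<open>G\<close> from the polynomial.\<close>
  define B where "B = (interpC q * (k ^ (q + 1) * M)) * (gradB c cg q * C * Sn * (k / \<alpha> * C) ^ (q - 1))"
  have bnd: "\<bar>?e t * G t i0 - ?e t * poly w t\<bar> \<le> B" if t: "t \<in> {x..y} - (nodes \<union> {x, y})" for t
  proof -
    have "mid = (x + y) / 2" by (simp add: mid_def x_def y_def)
    hence "\<bar>t - mid\<bar> \<le> k" using t xy by (auto simp: abs_le_iff field_simps)
    also have "k \<le> k / \<alpha>" using xy(3) \<alpha> by (simp add: pos_le_divide_eq mult_le_cancel_left1)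
    also have "\<dots> \<le> 4 * (k / \<alpha>)"
    proof -
      have "k / \<alpha> > 0" using xy(3) \<alpha> by simp
      thus ?thesis by linarith
    qed
    finally have "\<bar>t - mid\<bar> \<le> 4 * (step D i0 j0 / \<alpha>)" by (simp only: k_def)
    hence W: "t \<in> sl.W 4" using t ij'(3,4) by (auto simp: sl.W_def x_def y_def)
    have "\<bar>?e t\<bar> \<le> interpC q * (k ^ (q + 1) * M)"
      using cell_interp_error[OF ij'(1,2), of t] t by (simp add: degq x_def y_def k_def M_def)
    hence "\<bar>?e t\<bar> * \<bar>G t i0 - poly w t\<bar> \<le> B"
      unfolding B_def w using P(2)[OF W] by (intro mult_mono) auto
    thus ?thesis by (simp add: abs_mult[symmetric] right_diff_distrib)
  qed
  have "infinite ({x<..<y} - (nodes \<union> {x, y}))" using xy finite_nodes by (simp add: Diff_infinite_finite)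
  hence "{x<..<y} - (nodes \<union> {x, y}) \<noteq> {}" by (metis finite.emptyI)
  then obtain t where "t \<in> {x<..<y} - (nodes \<union> {x, y})" by blast
  hence "0 \<le> B" using bnd[of t] by fastforce
  from has_integral_bound_real[OF this _ I, of "nodes \<union> {x, y}"] bnd finite_nodes xy
  have "\<bar>integral {x..y} (\<lambda>t. ?e t * G t i0)\<bar> \<le> B * k" by simp
  also have "B * k = cellC \<alpha> ck cg q * (k ^ (2 * q + 1) * C ^ q * Sn * M)"
  proof -
    obtain r where r: "q = Suc r" using q_ge1 by (cases q) auto
    show ?thesis unfolding B_def cellC_def r
      by (simp add: power_mult_distrib power_divide power_add power_mult power2_eq_square mult_ac)
  qed
  finally show ?thesis by (simp add: x_def y_def k_def M_def)
qed

end

context galerkin_smooth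
begin

text \<open>The bound is continuous in \<open>C\<close>, so that \<open>C\<close> may tend to the constant of the slab, even if that is \<open>0\<close>.\<close>

lemma slab_cell_estimate:
  assumes n: "n \<in> {1..nslabs D}" and ij: "(i, j) \<in> slab_cells D n"
  shows "\<bar>integral {node D i (j - 1)..node D i j} (\<lambda>t. (piu t i - u t i) * G t i)\<bar> \<le>
     cellC \<alpha> ck cg (qbar n) * (step D i j ^ (2 * qbar n + 1) * Cf n ^ qbar n * slab_sup D \<Phi> n * cell_deriv_sup D u i j)"
proof -
  define h where "h C = cellC \<alpha> ck cg (qbar n) * (step D i j ^ (2 * qbar n + 1) * C ^ qbar n * slab_sup D \<Phi> n * cell_deriv_sup D u i j)" for C
  have k: "step D i j > 0" using ij by (intro step_pos) (auto simp: slab_cells_def)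
  have "isCont h (Cf n)" unfolding h_def by (intro continuous_intros)
  hence "(h \<longlongrightarrow> h (Cf n)) (at_right (Cf n))" by (simp add: continuous_at filterlim_at_split)
  moreover have "eventually (\<lambda>C. \<bar>integral {node D i (j - 1)..node D i j} (\<lambda>t. (piu t i - u t i) * G t i)\<bar> \<le> h C) (at_right (Cf n))"
    unfolding eventually_at_right_field
  \<comment> \<open>As long as \<open>C\<close> exceeds the constant of the slab by at most \<open>ck\<close> divided by the step, the product
    of the step and \<open>C\<close> is at most \<open>2 * ck\<close>; this is the origin of the factor 2.\<close>
  proof (intro exI[of _ "Cf n + ck / step D i j"] conjI allI impI)
    show "Cf n < Cf n + ck / step D i j" using k ck by simp
    fix C assume C: "Cf n < C" "C < Cf n + ck / step D i j"
    have "step D i j * C \<le> step D i j * (Cf n + ck / step D i j)" using C k by (intro mult_left_mono) auto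
    also have "\<dots> = step D i j * Cf n + ck" using k by (simp add: distrib_left)
    also have "\<dots> \<le> 2 * ck" using step_Cf[OF n ij] by simp
    finally have 1: "step D i j * C \<le> 2 * ck" .
    interpret galerkin_cell D f u0 \<psi> u U piu g \<Phi> qbar Cf \<alpha> ck cg n i j C
      by unfold_locales (use n ij C 1 Cf_nonneg[OF n] in auto)
    show "\<bar>integral {node D i (j - 1)..node D i j} (\<lambda>t. (piu t i - u t i) * G t i)\<bar> \<le> h C"
      unfolding h_def by (rule cell_estimate)
  qed
  ultimately have "\<bar>integral {node D i (j - 1)..node D i j} (\<lambda>t. (piu t i - u t i) * G t i)\<bar> \<le> h (Cf n)"
    by (rule tendsto_lowerbound) simp
  thus ?thesis by (simp add: h_def)
qed

definition weight :: "real \<Rightarrow> real" where "weight t = Cf (slab_at D t) * slab_sup D \<Phi> (slab_at D t)"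

lemma weight_nonneg: "t \<in> {0<..T} \<Longrightarrow> weight t \<ge> 0"
  unfolding weight_def using slab_at by (intro mult_nonneg_nonneg Cf_nonneg slab_sup_nonneg) auto

lemma weight_integral:
  "(weight has_integral (\<Sum>n=1..nslabs D. (level D n - level D (n - 1)) * Cf n * slab_sup D \<Phi> n)) {0..T}"
proof -
  have "(weight has_integral (\<Sum>n=1..nslabs D. (level D n - level D (n - 1)) * Cf n * slab_sup D \<Phi> n))
      {level D 0..level D (nslabs D)}"
  proof (rule has_integral_partition')
    show "level D (n - 1) < level D n" if "n \<in> {1..nslabs D}" for n using level_less[OF that] .
    fix n assume n: "n \<in> {1..nslabs D}"
    have "((\<lambda>_. Cf n * slab_sup D \<Phi> n) has_integral (level D n - level D (n - 1)) * Cf n * slab_sup D \<Phi> n)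
        {level D (n - 1)..level D n}"
      using has_integral_const_real[of "Cf n * slab_sup D \<Phi> n" "level D (n - 1)" "level D n"] level_less[OF n]
      by (simp add: mult.assoc)
    thus "(weight has_integral (level D n - level D (n - 1)) * Cf n * slab_sup D \<Phi> n) {level D (n - 1)..level D n}"
    proof (rule has_integral_spike_finite[where S = "{level D (n - 1)}", rotated 2])
      fix t assume "t \<in> {level D (n - 1)..level D n} - {level D (n - 1)}"
      hence "t \<in> slab D n" by (auto simp: slab_def)
      thus "weight t = Cf n * slab_sup D \<Phi> n" by (simp add: weight_def slab_at_eq[OF n])
    qed simp
  qed
  thus ?thesis by (simp add: level_0 level_T)
qed

lemma stab_factor2_eq:
  "stab_factor2 D Cf \<Phi> = (\<Sum>n=1..nslabs D. (level D n - level D (n - 1)) * Cf n * slab_sup D \<Phi> n)"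
  using integral_unique[OF weight_integral] by (simp add: stab_factor2_def weight_def[abs_def])

theorem second_estimate:
  assumes deg: "\<And>i j. i < N \<Longrightarrow> j \<in> {1..ncells D i} \<Longrightarrow> deg D i j \<le> qmax"
  shows "\<bar>Lfun D \<psi> g err\<bar> \<le> (1 + (\<Sum>q\<le>qmax. \<bar>cellC \<alpha> ck cg q\<bar>)) * stab_factor2 D Cf \<Phi> *
         (SUP t\<in>{0<..T}. l1 N (ubarbar D Cf u t))"
proof -
  \<comment> \<open>A bound for the constants of all degrees that may occur; the degree differs from slab to slab.\<close>
  define K where "K = 1 + (\<Sum>q\<le>qmax. \<bar>cellC \<alpha> ck cg q\<bar>)"
  have K0: "K \<ge> 0" unfolding K_def by (intro add_nonneg_nonneg sum_nonneg) auto
  have Kq: "cellC \<alpha> ck cg q \<le> K" if "q \<le> qmax" for q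
  proof -
    have "\<bar>cellC \<alpha> ck cg q\<bar> \<le> (\<Sum>q\<le>qmax. \<bar>cellC \<alpha> ck cg q\<bar>)"
      using that by (intro member_le_sum[of q "{..qmax}" "\<lambda>q. \<bar>cellC \<alpha> ck cg q\<bar>"]) auto
    thus ?thesis by (simp add: K_def)
  qed
  define M where "M = (SUP t\<in>{0<..T}. l1 N (ubarbar D Cf u t))"
  have ub0: "ubarbar D Cf u t i \<ge> 0" if i: "i < N" and t: "t \<in> {0<..T}" for i t
    unfolding ubarbar_def Let_def
    using cell_at(1)[OF i t] slab_at(1)[OF t] i step_pos Cf_nonneg cell_deriv_sup_nonneg
    by (intro mult_nonneg_nonneg zero_le_power) (auto intro: less_imp_le)
  have bdd: "bdd_above ((\<lambda>t. l1 N (ubarbar D Cf u t)) ` {0<..T})"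
  proof (rule cellwise_bdd_above[where A = "{1..nslabs D}" and K = "slab_at D"])
    fix t
    show "l1 N (ubarbar D Cf u t) \<le> (\<Sum>i<N. \<bar>(\<lambda>i j n. step D i j ^ (2 * deg D i j) * Cf n ^ (deg D i j - 1) *
        cell_deriv_sup D u i j) i (cell_at D i t) (slab_at D t)\<bar>)"
      by (simp add: l1_def ubarbar_def Let_def)
  qed (use slab_at(1) in auto)
  have comp: "(\<lambda>t. ubarbar D Cf u t i * weight t) integrable_on {0..T} \<and>
      \<bar>integral {0..T} (\<lambda>t. (piu t i - u t i) * G t i)\<bar> \<le> K * integral {0..T} (\<lambda>t. ubarbar D Cf u t i * weight t)"
    if i: "i < N" for i
  proof -
    have ec: "continuous_on {0..T} (\<lambda>t. piu t i - u t i)" by (intro continuous_intros piu_cont u_cont i)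
    have eG: "(\<lambda>t. (piu t i - u t i) * G t i) integrable_on {node D i (j - 1)..node D i j}" if j: "j \<in> {1..ncells D i}" for j
      by (rule integrable_on_subinterval[OF times_G_integrable[OF i ec] cell_closed_subset[OF i j]])
    have ex: "\<exists>v. ((\<lambda>t. ubarbar D Cf u t i * weight t) has_integral v) {node D i (j - 1)..node D i j} \<and>
        \<bar>integral {node D i (j - 1)..node D i j} (\<lambda>t. (piu t i - u t i) * G t i)\<bar> \<le> K * v"
      if j: "j \<in> {1..ncells D i}" for j
    proof -
      obtain n where n: "n \<in> {1..nslabs D}" "(i, j) \<in> slab_cells D n" using slab_of_cell[OF i j] by blast
      have q: "deg D i j = qbar n" by (rule deg_slab[OF n])
      \<comment> \<open>The powers of the step and of \<open>Cf\<close> are split between \<open>ubarbar\<close>, the weight, and the length of the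
        cell.\<close>
      obtain r where r: "qbar n = Suc r" using qbar_ge1[OF n(1)] by (cases "qbar n") auto
      define z where "z = step D i j ^ (2 * qbar n) * Cf n ^ (qbar n - 1) * cell_deriv_sup D u i j * (Cf n * slab_sup D \<Phi> n)"
      have z0: "z \<ge> 0"
        unfolding z_def using step_pos[OF i j] Cf_nonneg[OF n(1)] cell_deriv_sup_nonneg[OF i j] slab_sup_nonneg[OF n(1)]
        by (intro mult_nonneg_nonneg) auto
      have "((\<lambda>_. z) has_integral step D i j * z) {node D i (j - 1)..node D i j}"
        using has_integral_const_real[of z "node D i (j - 1)" "node D i j"] node_less[OF i j] by (simp add: step_def)
      hence 1: "((\<lambda>t. ubarbar D Cf u t i * weight t) has_integral step D i j * z) {node D i (j - 1)..node D i j}"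
      proof (rule has_integral_spike_finite[where S = "{node D i (j - 1)}", rotated 2])
        fix t assume "t \<in> {node D i (j - 1)..node D i j} - {node D i (j - 1)}"
        hence t: "t \<in> cell D i j" by (auto simp: cell_def)
        have "t \<in> slab D n" using t n(2) by (auto simp: cell_def slab_def slab_cells_def)
        thus "ubarbar D Cf u t i * weight t = z"
          using cell_at_eq[OF i j t] slab_at_eq[OF n(1)]
          by (simp add: ubarbar_def Let_def weight_def z_def q)
      qed simp
      have "\<bar>integral {node D i (j - 1)..node D i j} (\<lambda>t. (piu t i - u t i) * G t i)\<bar> \<le>
          cellC \<alpha> ck cg (qbar n) * (step D i j ^ (2 * qbar n + 1) * Cf n ^ qbar n * slab_sup D \<Phi> n * cell_deriv_sup D u i j)"
        by (rule slab_cell_estimate[OF n])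
      also have "step D i j ^ (2 * qbar n + 1) * Cf n ^ qbar n * slab_sup D \<Phi> n * cell_deriv_sup D u i j = step D i j * z"
        by (simp add: z_def r mult_ac)
      also have "cellC \<alpha> ck cg (qbar n) * (step D i j * z) \<le> K * (step D i j * z)"
        using z0 step_pos[OF i j] deg[OF i j] q by (intro mult_right_mono Kq) auto
      finally show ?thesis using 1 by blast
    qed
    define v where "v j = integral {node D i (j - 1)..node D i j} (\<lambda>t. ubarbar D Cf u t i * weight t)" for j
    have v: "((\<lambda>t. ubarbar D Cf u t i * weight t) has_integral v j) {node D i (j - 1)..node D i j}"
      "\<bar>integral {node D i (j - 1)..node D i j} (\<lambda>t. (piu t i - u t i) * G t i)\<bar> \<le> K * v j"
      if j: "j \<in> {1..ncells D i}" for j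
    proof -
      from ex[OF j] obtain v' where v': "((\<lambda>t. ubarbar D Cf u t i * weight t) has_integral v') {node D i (j - 1)..node D i j}"
        "\<bar>integral {node D i (j - 1)..node D i j} (\<lambda>t. (piu t i - u t i) * G t i)\<bar> \<le> K * v'" by blast
      have "v j = v'" unfolding v_def by (rule integral_unique[OF v'(1)])
      thus "((\<lambda>t. ubarbar D Cf u t i * weight t) has_integral v j) {node D i (j - 1)..node D i j}"
        "\<bar>integral {node D i (j - 1)..node D i j} (\<lambda>t. (piu t i - u t i) * G t i)\<bar> \<le> K * v j"
        using v' by (simp_all only:)
    qed
    have uw: "((\<lambda>t. ubarbar D Cf u t i * weight t) has_integral (\<Sum>j=1..ncells D i. v j)) {0..T}"
      by (rule has_integral_cells[OF i v(1)])
    have "\<bar>integral {0..T} (\<lambda>t. (piu t i - u t i) * G t i)\<bar> =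
        \<bar>\<Sum>j=1..ncells D i. integral {node D i (j - 1)..node D i j} (\<lambda>t. (piu t i - u t i) * G t i)\<bar>"
      by (subst integrable_cells(2)[OF i eG]) auto
    also have "\<dots> \<le> (\<Sum>j=1..ncells D i. K * v j)" by (rule order.trans[OF sum_abs sum_mono]) (rule v(2))
    also have "\<dots> = K * integral {0..T} (\<lambda>t. ubarbar D Cf u t i * weight t)"
      by (simp add: integral_unique[OF uw] sum_distrib_left)
    finally show ?thesis using uw by blast
  qed
  have L: "Lfun D \<psi> g err = (\<Sum>i<N. integral {0..T} (\<lambda>t. (piu t i - u t i) * G t i))"
    unfolding error_representation(2)
  proof (rule integral_sum)
    fix i assume "i \<in> {..<N}"
    thus "(\<lambda>t. (piu t i - u t i) * G t i) integrable_on {0..T}"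
      by (intro times_G_integrable continuous_on_diff piu_cont u_cont) auto
  qed simp
  have "\<bar>Lfun D \<psi> g err\<bar> \<le> (\<Sum>i<N. K * integral {0..T} (\<lambda>t. ubarbar D Cf u t i * weight t))"
    unfolding L by (rule order.trans[OF sum_abs sum_mono]) (use comp in blast)
  also have "\<dots> = K * integral {0..T} (\<lambda>t. \<Sum>i<N. ubarbar D Cf u t i * weight t)"
    using comp by (subst integral_sum) (auto simp: sum_distrib_left)
  also have "\<dots> \<le> K * integral {0..T} (\<lambda>t. M * weight t)"
  proof -
    have "integral {0<..T} (\<lambda>t. \<Sum>i<N. ubarbar D Cf u t i * weight t) \<le> integral {0<..T} (\<lambda>t. M * weight t)"
    proof (rule integral_le)
      have eq: "insert 0 {0<..T} = {0..T}" using T_pos by auto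
      have "(\<lambda>t. \<Sum>i<N. ubarbar D Cf u t i * weight t) integrable_on {0..T}"
        using comp by (intro integrable_sum) auto
      thus "(\<lambda>t. \<Sum>i<N. ubarbar D Cf u t i * weight t) integrable_on {0<..T}"
        unfolding eq[symmetric] integrable_on_insert_iff .
      have "(\<lambda>t. M *\<^sub>R weight t) integrable_on {0..T}" using weight_integral by (intro integrable_cmul) blast
      thus "(\<lambda>t. M * weight t) integrable_on {0<..T}"
        unfolding eq[symmetric] integrable_on_insert_iff by simp
      fix t assume t: "t \<in> {0<..T}"
      have "(\<Sum>i<N. ubarbar D Cf u t i * weight t) = l1 N (ubarbar D Cf u t) * weight t"
        using ub0 t by (simp add: l1_def sum_distrib_right)
      also have "\<dots> \<le> M * weight t"
        unfolding M_def by (intro mult_right_mono cSUP_upper bdd weight_nonneg t)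
      finally show "(\<Sum>i<N. ubarbar D Cf u t i * weight t) \<le> M * weight t" .
    qed
    from mult_left_mono[OF this K0] show ?thesis by (simp only: integral_0T)
  qed
  also have "integral {0..T} (\<lambda>t. M * weight t) = M * stab_factor2 D Cf \<Phi>"
    unfolding stab_factor2_def weight_def by simp
  finally show ?thesis by (simp add: K_def M_def mult_ac)
qed

end

theorem theorem6p5:
  fixes qmax :: nat
  shows
    "(\<exists>C>0. \<forall>D f u0 u U piu \<psi> g \<Phi>.
       mcG_setup D f u0 u U piu \<psi> g \<Phi> \<and>
       (\<forall>i<ncomp D. \<forall>j\<in>{1..ncells D i}. deg D i j \<le> qmax) \<longrightarrow>
       \<bar>Lfun D \<psi> g (\<lambda>t i. U t i - piu t i)\<bar> \<le>
         C * stab_factor D f piu u \<Phi> *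
         (SUP t\<in>{0<..horizon D}. L2_set (ubar D u t) {..<ncomp D})) \<and>
     (\<forall>\<alpha>\<in>{0<..<1}. \<forall>ck>0. \<forall>cg\<ge>0. \<exists>C>0. \<forall>D f u0 u U piu \<psi> g \<Phi> qbar Cf.
       mcG_setup D f u0 u U piu \<psi> g \<Phi> \<and>
       (\<forall>i<ncomp D. \<forall>j\<in>{1..ncells D i}. deg D i j \<le> qmax) \<and>
       slab_assumptions D f u U piu qbar Cf \<alpha> ck \<and>
       source_bound D g \<Phi> qbar Cf cg \<longrightarrow>
       \<bar>Lfun D \<psi> g (\<lambda>t i. U t i - piu t i)\<bar> \<le>
         C * stab_factor2 D Cf \<Phi> *
         (SUP t\<in>{0<..horizon D}. l1 (ncomp D) (ubarbar D Cf u t)) \<and>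
       stab_factor2 D Cf \<Phi> =
         (\<Sum>n=1..nslabs D. (level D n - level D (n - 1)) * Cf n * slab_sup D \<Phi> n))"
proof (intro conjI ballI allI impI)
  have pos: "(\<Sum>q\<le>qmax. interpC q) > 0" by (intro sum_pos interpC_pos) auto
  show "\<exists>C>0. \<forall>D f u0 u U piu \<psi> g \<Phi>.
       mcG_setup D f u0 u U piu \<psi> g \<Phi> \<and>
       (\<forall>i<ncomp D. \<forall>j\<in>{1..ncells D i}. deg D i j \<le> qmax) \<longrightarrow>
       \<bar>Lfun D \<psi> g (\<lambda>t i. U t i - piu t i)\<bar> \<le>
         C * stab_factor D f piu u \<Phi> *
         (SUP t\<in>{0<..horizon D}. L2_set (ubar D u t) {..<ncomp D})"
  proof (intro exI[of _ "\<Sum>q\<le>qmax. interpC q"] conjI pos allI impI, elim conjE)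
    fix D f u0 u U piu \<psi> g \<Phi>
    assume s: "mcG_setup D f u0 u U piu \<psi> g \<Phi>"
      and d: "\<forall>i<ncomp D. \<forall>j\<in>{1..ncells D i}. deg D i j \<le> qmax"
    interpret galerkin D f u0 \<psi> u U piu g \<Phi> by unfold_locales (rule s)
    show "\<bar>Lfun D \<psi> g (\<lambda>t i. U t i - piu t i)\<bar> \<le>
         (\<Sum>q\<le>qmax. interpC q) * stab_factor D f piu u \<Phi> *
         (SUP t\<in>{0<..horizon D}. L2_set (ubar D u t) {..<ncomp D})"
      using first_estimate[of qmax] d unfolding err_def[abs_def] by blast
  qed
next
  fix \<alpha> ck cg :: real
  assume \<alpha>: "\<alpha> \<in> {0<..<1}" and ck: "ck > 0" and cg: "cg \<ge> 0"
  define C where "C = 1 + (\<Sum>q\<le>qmax. \<bar>cellC \<alpha> ck cg q\<bar>)"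
  have pos: "C > 0" unfolding C_def by (intro add_pos_nonneg sum_nonneg) auto
  show "\<exists>C>0. \<forall>D f u0 u U piu \<psi> g \<Phi> qbar Cf.
       mcG_setup D f u0 u U piu \<psi> g \<Phi> \<and>
       (\<forall>i<ncomp D. \<forall>j\<in>{1..ncells D i}. deg D i j \<le> qmax) \<and>
       slab_assumptions D f u U piu qbar Cf \<alpha> ck \<and>
       source_bound D g \<Phi> qbar Cf cg \<longrightarrow>
       \<bar>Lfun D \<psi> g (\<lambda>t i. U t i - piu t i)\<bar> \<le>
         C * stab_factor2 D Cf \<Phi> *
         (SUP t\<in>{0<..horizon D}. l1 (ncomp D) (ubarbar D Cf u t)) \<and>
       stab_factor2 D Cf \<Phi> =
         (\<Sum>n=1..nslabs D. (level D n - level D (n - 1)) * Cf n * slab_sup D \<Phi> n)"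
  proof (intro exI[of _ C] conjI[OF pos] allI impI, elim conjE)
    fix D f u0 u U piu \<psi> g \<Phi> qbar Cf
    assume s: "mcG_setup D f u0 u U piu \<psi> g \<Phi>"
      and d: "\<forall>i<ncomp D. \<forall>j\<in>{1..ncells D i}. deg D i j \<le> qmax"
      and a: "slab_assumptions D f u U piu qbar Cf \<alpha> ck" and b: "source_bound D g \<Phi> qbar Cf cg"
    interpret galerkin_smooth D f u0 \<psi> u U piu g \<Phi> qbar Cf \<alpha> ck cg
      by unfold_locales (rule s \<alpha> ck cg a b)+
    show "\<bar>Lfun D \<psi> g (\<lambda>t i. U t i - piu t i)\<bar> \<le>
         C * stab_factor2 D Cf \<Phi> *
         (SUP t\<in>{0<..horizon D}. l1 (ncomp D) (ubarbar D Cf u t)) \<and>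
       stab_factor2 D Cf \<Phi> =
         (\<Sum>n=1..nslabs D. (level D n - level D (n - 1)) * Cf n * slab_sup D \<Phi> n)"
      using second_estimate[of qmax] d stab_factor2_eq unfolding err_def[abs_def] C_def by blast
  qed
qed

end
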